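(* Let $R$ be a unital ring, $I$ a cofiltered category, $G_\bullet=\{G_i,\phi^G_{ij}\colon G_i\to G_j\}$ an $I$-diagram of finite discrete groups and surjective homomorphisms, and $X_\bullet=\{X_i,\phi_{ij}\colon X_i\to X_j\}$ an $I$-diagram of finite discrete spaces and surjective maps, with each $X_i$ a $G_i$-space and $\phi_{ij}(gx)=\phi^G_{ij}(g)\phi_{ij}(x)$ for all $g\in G_i$, $x\in X_i$. Let $G=\lim_iG_i$ and $X=\lim_iX_i$. There is an adjunction whose left adjoint $$\operatorname{colim}_i(\bar p_i)^*\colon \{G_\bullet\text{-sheaves of }R\text{-modules over }X_\bullet\}\longrightarrow\{G\text{-sheaves of }R\text{-modules over }X\}$$ sends $D_\bullet$ to $\operatorname{colim}_i(\bar p_i)^*D_i$, and whose right adjoint $\bar p_\bullet$ sends $E$ to $\{(\bar p_i)_*E\}_i$. The counit of this adjunction is an isomorphism. This adjunction restricts to an equivalence of categories between the category of $G$-sheaves of $R$-modules over $X$ and the full subcategory of the category of $G_\bullet$-sheaves of $R$-modules over $X_\bullet$ on those $D_\bullet$ whose adjoint structure maps $$\bar\alpha_{ij}\colon D_j\longrightarrow(\bar\phi_{ij})_*D_i$$ are isomorphisms for all $i\to j$ in $I$.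
   Context: For a topological group $\Gamma$ and a $\Gamma$-space $X$, a $\Gamma$-sheaf of $R$-modules over $X$ is a $\Gamma$-equivariant local homeomorphism $p\colon E\to X$, with $E$ a space with continuous $\Gamma$-action, such that each stalk $E_x=p^{-1}(x)$ is an $R$-module, the fibrewise subtraction $E\times_XE\to E$ and each map $e\mapsto re$ ($r\in R$) are continuous, and each map $g\colon E_x\to E_{gx}$ is $R$-linear. Morphisms are continuous $\Gamma$-equivariant maps over $X$ that are $R$-linear on stalks. $E(U)$ denotes all continuous sections over $U$, and $g\in\Gamma$ acts by $g\ast s=g\circ s\circ g^{-1}\colon gU\to E$. Change of space and group: let $\pi\colon\Gamma\to\Gamma'$ be a surjective homomorphism of profinite groups with open kernel $N$, and let $q\colon X\to Y$ be a continuous surjection from a $\Gamma$-space to a $\Gamma'$-space with $q(gx)=\pi(g)q(x)$. For a $\Gamma'$-sheaf $D$ over $Y$, $\bar q^*D$ is the pull back sheaf $X\times_YD\to X$ with $g(x,d)=(gx,\pi(g)d)$. For a $\Gamma$-sheaf $E$ over $X$, $\bar q_*E$ is the $\Gamma'$-sheaf over $Y$ with sections $(\bar q_*E)(V)=E(q^{-1}V)^N$ and the induced $\Gamma'\cong\Gamma/N$-action. The functor $\bar q^*$ is left adjoint to $\bar q_*$. This is applied to the projections $p_i\colon X\to X_i$ (with $p_i^G\colon G\to G_i$, kernel $N_i$) giving $(\bar p_i)^*,(\bar p_i)_*$, and to $\phi_{ij}$ (with $\phi_{ij}^G$, kernel $N_j/N_i$) giving $(\bar\phi_{ij})^*,(\bar\phi_{ij})_*$.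 Here $G$ acts on $X$ as the limit of the actions of the $G_i$ on the $X_i$. A $G_\bullet$-sheaf of $R$-modules over $X_\bullet$, $D_\bullet$, consists of a $G_i$-sheaf of $R$-modules $D_i$ over $X_i$ for each $i\in I$ and, for each $i\to j$ in $I$, a map of $G_i$-sheaves of $R$-modules over $X_i$, $\alpha_{ij}\colon(\bar\phi_{ij})^*D_j\to D_i$, compatible with identities and composition in $I$. A morphism $f_\bullet\colon D_\bullet\to D'_\bullet$ consists of maps $f_i\colon D_i\to D'_i$ of $G_i$-sheaves of $R$-modules with $f_i\circ\alpha_{ij}=\alpha'_{ij}\circ(\bar\phi_{ij})^*f_j$. The map $\bar\alpha_{ij}\colon D_j\to(\bar\phi_{ij})_*D_i$ is the adjoint of $\alpha_{ij}$. The colimit $\operatorname{colim}_i(\bar p_i)^*D_i$ is taken in $G$-sheaves of $R$-modules over $X$, along the maps $(\bar p_j)^*D_j=(\bar p_i)^*(\bar\phi_{ij})^*D_j\to(\bar p_i)^*D_i$ given by $(\bar p_i)^*\alpha_{ij}$ for $i\to j$ in $I$. For a $G$-sheaf $E$ over $X$, the structure maps of $\bar p_\bullet E=\{(\bar p_i)_*E\}_i$ are the adjoints of the equalities $(\bar p_j)_*E=(\bar\phi_{ij})_*(\bar p_i)_*E$. *)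

theory Defs
  imports "HOL-Analysis.Analysis" "HOL-Algebra.Module" "HOL-Algebra.Group_Action"
    "HOL-Library.Equipollence"
begin

section \<open>Categories, functors and adjunctions\<close>

text \<open>Hom-sets are indexed by pairs of objects and need not be disjoint, so composition and the
  action of a functor on arrows take the objects involved as arguments.
  \<open>Cmp C a b c g f\<close> is \<open>g \<circ> f\<close> for \<open>f : a \<rightarrow> b\<close> and \<open>g : b \<rightarrow> c\<close>.\<close>

record ('o, 'm) cat =
  Obj :: "'o set"
  Hom :: "'o \<Rightarrow> 'o \<Rightarrow> 'm set"
  Cmp :: "'o \<Rightarrow> 'o \<Rightarrow> 'o \<Rightarrow> 'm \<Rightarrow> 'm \<Rightarrow> 'm"
  Idn :: "'o \<Rightarrow> 'm"

definition category :: "('o, 'm) cat \<Rightarrow> bool" where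
  "category C \<longleftrightarrow>
     (\<forall>a\<in>Obj C. Idn C a \<in> Hom C a a) \<and>
     (\<forall>a\<in>Obj C. \<forall>b\<in>Obj C. \<forall>c\<in>Obj C. \<forall>f\<in>Hom C a b. \<forall>g\<in>Hom C b c. Cmp C a b c g f \<in> Hom C a c) \<and>
     (\<forall>a\<in>Obj C. \<forall>b\<in>Obj C. \<forall>f\<in>Hom C a b.
        Cmp C a a b f (Idn C a) = f \<and> Cmp C a b b (Idn C b) f = f) \<and>
     (\<forall>a\<in>Obj C. \<forall>b\<in>Obj C. \<forall>c\<in>Obj C. \<forall>d\<in>Obj C.
        \<forall>f\<in>Hom C a b. \<forall>g\<in>Hom C b c. \<forall>h\<in>Hom C c d.
          Cmp C a c d h (Cmp C a b c g f) = Cmp C a b d (Cmp C b c d h g) f)"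

definition cofiltered :: "('o, 'm) cat \<Rightarrow> bool" where
  "cofiltered C \<longleftrightarrow> category C \<and> Obj C \<noteq> {} \<and>
     (\<forall>a\<in>Obj C. \<forall>b\<in>Obj C. \<exists>c\<in>Obj C. Hom C c a \<noteq> {} \<and> Hom C c b \<noteq> {}) \<and>
     (\<forall>a\<in>Obj C. \<forall>b\<in>Obj C. \<forall>f\<in>Hom C a b. \<forall>g\<in>Hom C a b.
        \<exists>c\<in>Obj C. \<exists>h\<in>Hom C c a. Cmp C c a b f h = Cmp C c a b g h)"

definition full_subcategory :: "('o, 'm) cat \<Rightarrow> ('o \<Rightarrow> bool) \<Rightarrow> ('o, 'm) cat" where
  "full_subcategory C P = C\<lparr>Obj := {a \<in> Obj C. P a}\<rparr>"

definition iso_in :: "('o, 'm) cat \<Rightarrow> 'o \<Rightarrow> 'o \<Rightarrow> 'm \<Rightarrow> bool" where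
  "iso_in C a b f \<longleftrightarrow> f \<in> Hom C a b \<and>
     (\<exists>g\<in>Hom C b a. Cmp C a b a g f = Idn C a \<and> Cmp C b a b f g = Idn C b)"

record ('o, 'm, 'p, 'n) fctr =
  onObj :: "'o \<Rightarrow> 'p"
  onHom :: "'o \<Rightarrow> 'o \<Rightarrow> 'm \<Rightarrow> 'n"

definition functor_between ::
  "('o, 'm) cat \<Rightarrow> ('p, 'n) cat \<Rightarrow> ('o, 'm, 'p, 'n) fctr \<Rightarrow> bool" where
  "functor_between C D F \<longleftrightarrow> category C \<and> category D \<and>
     (\<forall>a\<in>Obj C. onObj F a \<in> Obj D) \<and>
     (\<forall>a\<in>Obj C. \<forall>b\<in>Obj C. \<forall>f\<in>Hom C a b. onHom F a b f \<in> Hom D (onObj F a) (onObj F b)) \<and>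
     (\<forall>a\<in>Obj C. onHom F a a (Idn C a) = Idn D (onObj F a)) \<and>
     (\<forall>a\<in>Obj C. \<forall>b\<in>Obj C. \<forall>c\<in>Obj C. \<forall>f\<in>Hom C a b. \<forall>g\<in>Hom C b c.
        onHom F a c (Cmp C a b c g f) =
          Cmp D (onObj F a) (onObj F b) (onObj F c) (onHom F b c g) (onHom F a b f))"

definition id_functor :: "('o, 'm, 'o, 'm) fctr" where
  "id_functor = \<lparr>onObj = (\<lambda>a. a), onHom = (\<lambda>a b f. f)\<rparr>"

definition comp_functor ::
  "('p, 'n, 'q, 'k) fctr \<Rightarrow> ('o, 'm, 'p, 'n) fctr \<Rightarrow> ('o, 'm, 'q, 'k) fctr" where
  "comp_functor G F =
     \<lparr>onObj = (\<lambda>a. onObj G (onObj F a)),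
      onHom = (\<lambda>a b f. onHom G (onObj F a) (onObj F b) (onHom F a b f))\<rparr>"

definition nat_transf :: "('o, 'm) cat \<Rightarrow> ('p, 'n) cat \<Rightarrow> ('o, 'm, 'p, 'n) fctr \<Rightarrow>
    ('o, 'm, 'p, 'n) fctr \<Rightarrow> ('o \<Rightarrow> 'n) \<Rightarrow> bool" where
  "nat_transf C D F G \<tau> \<longleftrightarrow>
     (\<forall>a\<in>Obj C. \<tau> a \<in> Hom D (onObj F a) (onObj G a)) \<and>
     (\<forall>a\<in>Obj C. \<forall>b\<in>Obj C. \<forall>f\<in>Hom C a b.
        Cmp D (onObj F a) (onObj G a) (onObj G b) (onHom G a b f) (\<tau> a) =
        Cmp D (onObj F a) (onObj F b) (onObj G b) (\<tau> b) (onHom F a b f))"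

text \<open>\<open>F : C \<rightarrow> D\<close> is left adjoint to \<open>G : D \<rightarrow> C\<close> with unit \<open>\<eta>\<close> and counit \<open>\<epsilon>\<close>.\<close>

definition adjunction :: "('o, 'm) cat \<Rightarrow> ('p, 'n) cat \<Rightarrow> ('o, 'm, 'p, 'n) fctr \<Rightarrow>
    ('p, 'n, 'o, 'm) fctr \<Rightarrow> ('o \<Rightarrow> 'm) \<Rightarrow> ('p \<Rightarrow> 'n) \<Rightarrow> bool" where
  "adjunction C D F G \<eta> \<epsilon> \<longleftrightarrow>
     functor_between C D F \<and> functor_between D C G \<and>
     nat_transf C C id_functor (comp_functor G F) \<eta> \<and>
     nat_transf D D (comp_functor F G) id_functor \<epsilon> \<and>
     (\<forall>a\<in>Obj C. let Fa = onObj F a; GFa = onObj G Fa in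
        Cmp D Fa (onObj F GFa) Fa (\<epsilon> Fa) (onHom F a GFa (\<eta> a)) = Idn D Fa) \<and>
     (\<forall>b\<in>Obj D. let Gb = onObj G b; FGb = onObj F Gb in
        Cmp C Gb (onObj G FGb) Gb (onHom G FGb b (\<epsilon> b)) (\<eta> Gb) = Idn C Gb)"

definition adjoint_equivalence :: "('o, 'm) cat \<Rightarrow> ('p, 'n) cat \<Rightarrow> ('o, 'm, 'p, 'n) fctr \<Rightarrow>
    ('p, 'n, 'o, 'm) fctr \<Rightarrow> ('o \<Rightarrow> 'm) \<Rightarrow> ('p \<Rightarrow> 'n) \<Rightarrow> bool" where
  "adjoint_equivalence C D F G \<eta> \<epsilon> \<longleftrightarrow> adjunction C D F G \<eta> \<epsilon> \<and>
     (\<forall>a\<in>Obj C. iso_in C a (onObj G (onObj F a)) (\<eta> a)) \<and>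
     (\<forall>b\<in>Obj D. iso_in D (onObj F (onObj G b)) b (\<epsilon> b))"


section \<open>Topological groups and their spaces\<close>

definition topological_group :: "'g monoid \<Rightarrow> 'g topology \<Rightarrow> bool" where
  "topological_group G T \<longleftrightarrow> group G \<and> topspace T = carrier G \<and>
     continuous_map (prod_topology T T) T (\<lambda>(a, b). a \<otimes>\<^bsub>G\<^esub> b) \<and>
     continuous_map T T (\<lambda>a. inv\<^bsub>G\<^esub> a)"

definition continuous_action ::
  "'g monoid \<Rightarrow> 'g topology \<Rightarrow> 'x topology \<Rightarrow> ('g \<Rightarrow> 'x \<Rightarrow> 'x) \<Rightarrow> bool" where
  "continuous_action G T X act \<longleftrightarrow> group_action G (topspace X) act \<and>
     continuous_map (prod_topology T X) X (\<lambda>(g, x). act g x)"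

record ('g, 'x) gspace =
  grp :: "'g monoid"
  gtop :: "'g topology"
  pts :: "'x topology"
  mov :: "'g \<Rightarrow> 'x \<Rightarrow> 'x"

definition is_gspace :: "('g, 'x) gspace \<Rightarrow> bool" where
  "is_gspace B \<longleftrightarrow> topological_group (grp B) (gtop B) \<and>
     continuous_action (grp B) (gtop B) (pts B) (mov B)"


section \<open>Equivariant sheaves of modules\<close>

text \<open>The library locale \<open>module\<close> requires a commutative ring of scalars.\<close>

locale left_module = R?: ring R + M?: abelian_group M for R (structure) and M (structure) +
  assumes smult_closed:
      "\<lbrakk>a \<in> carrier R; x \<in> carrier M\<rbrakk> \<Longrightarrow> a \<odot>\<^bsub>M\<^esub> x \<in> carrier M"
    and smult_l_distr:
      "\<lbrakk>a \<in> carrier R; b \<in> carrier R; x \<in> carrier M\<rbrakk> \<Longrightarrow>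
        (a \<oplus> b) \<odot>\<^bsub>M\<^esub> x = a \<odot>\<^bsub>M\<^esub> x \<oplus>\<^bsub>M\<^esub> b \<odot>\<^bsub>M\<^esub> x"
    and smult_r_distr:
      "\<lbrakk>a \<in> carrier R; x \<in> carrier M; y \<in> carrier M\<rbrakk> \<Longrightarrow>
        a \<odot>\<^bsub>M\<^esub> (x \<oplus>\<^bsub>M\<^esub> y) = a \<odot>\<^bsub>M\<^esub> x \<oplus>\<^bsub>M\<^esub> a \<odot>\<^bsub>M\<^esub> y"
    and smult_assoc1:
      "\<lbrakk>a \<in> carrier R; b \<in> carrier R; x \<in> carrier M\<rbrakk> \<Longrightarrow>
        (a \<otimes> b) \<odot>\<^bsub>M\<^esub> x = a \<odot>\<^bsub>M\<^esub> (b \<odot>\<^bsub>M\<^esub> x)"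
    and smult_one:
      "x \<in> carrier M \<Longrightarrow> \<one> \<odot>\<^bsub>M\<^esub> x = x"

definition left_linear ::
  "('r, 's) ring_scheme \<Rightarrow> ('r, 'a) module \<Rightarrow> ('r, 'b) module \<Rightarrow> ('a \<Rightarrow> 'b) \<Rightarrow> bool" where
  "left_linear R M N f \<longleftrightarrow> f \<in> carrier M \<rightarrow> carrier N \<and>
     (\<forall>a\<in>carrier M. \<forall>b\<in>carrier M. f (a \<oplus>\<^bsub>M\<^esub> b) = f a \<oplus>\<^bsub>N\<^esub> f b) \<and>
     (\<forall>r\<in>carrier R. \<forall>a\<in>carrier M. f (r \<odot>\<^bsub>M\<^esub> a) = r \<odot>\<^bsub>N\<^esub> f a)"

definition local_homeomorphism :: "'e topology \<Rightarrow> 'x topology \<Rightarrow> ('e \<Rightarrow> 'x) \<Rightarrow> bool" where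
  "local_homeomorphism E X p \<longleftrightarrow> continuous_map E X p \<and>
     (\<forall>e\<in>topspace E. \<exists>U. openin E U \<and> e \<in> U \<and> openin X (p ` U) \<and>
        homeomorphic_map (subtopology E U) (subtopology X (p ` U)) p)"

text \<open>The operations of all stalks are collected in single functions: \<open>esum\<close> is only meaningful on
  pairs of points of the same stalk, and \<open>ezero\<close> picks the zero of the stalk over a point.\<close>

record ('g, 'x, 'r, 'e) sheaf =
  tot :: "'e topology"
  prj :: "'e \<Rightarrow> 'x"
  emov :: "'g \<Rightarrow> 'e \<Rightarrow> 'e"
  ezero :: "'x \<Rightarrow> 'e"
  esum :: "'e \<Rightarrow> 'e \<Rightarrow> 'e"
  escal :: "'r \<Rightarrow> 'e \<Rightarrow> 'e"

definition stalk :: "('g, 'x, 'r, 'e) sheaf \<Rightarrow> 'x \<Rightarrow> ('r, 'e) module" where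
  "stalk E x = \<lparr>carrier = {e \<in> topspace (tot E). prj E e = x},
     mult = (\<lambda>_ _. undefined), one = undefined,
     zero = ezero E x, add = esum E, smult = escal E\<rparr>"

definition is_sheaf ::
  "('r, 's) ring_scheme \<Rightarrow> ('g, 'x) gspace \<Rightarrow> ('g, 'x, 'r, 'e) sheaf \<Rightarrow> bool" where
  "is_sheaf R B E \<longleftrightarrow>
     continuous_action (grp B) (gtop B) (tot E) (emov E) \<and>
     local_homeomorphism (tot E) (pts B) (prj E) \<and>
     (\<forall>g\<in>carrier (grp B). \<forall>e\<in>topspace (tot E). prj E (emov E g e) = mov B g (prj E e)) \<and>
     (\<forall>x\<in>topspace (pts B). left_module R (stalk E x)) \<and>
     continuous_map
       (subtopology (prod_topology (tot E) (tot E)) {(a, b). prj E a = prj E b}) (tot E)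
       (\<lambda>(a, b). a \<ominus>\<^bsub>stalk E (prj E a)\<^esub> b) \<and>
     (\<forall>r\<in>carrier R. continuous_map (tot E) (tot E) (escal E r)) \<and>
     (\<forall>g\<in>carrier (grp B). \<forall>x\<in>topspace (pts B).
        left_linear R (stalk E x) (stalk E (mov B g x)) (emov E g))"

text \<open>Maps are extensional on the total space, so that equal maps are equal as HOL functions. The
  total spaces of the two sheaves may have different types.\<close>

definition sheaf_hom :: "('r, 's) ring_scheme \<Rightarrow> ('g, 'x) gspace \<Rightarrow>
    ('g, 'x, 'r, 'e) sheaf \<Rightarrow> ('g, 'x, 'r, 'f) sheaf \<Rightarrow> ('e \<Rightarrow> 'f) set" where
  "sheaf_hom R B E F = {f \<in> extensional (topspace (tot E)).
     continuous_map (tot E) (tot F) f \<and>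
     (\<forall>g\<in>carrier (grp B). \<forall>e\<in>topspace (tot E). f (emov E g e) = emov F g (f e)) \<and>
     (\<forall>e\<in>topspace (tot E). prj F (f e) = prj E e) \<and>
     (\<forall>x\<in>topspace (pts B). left_linear R (stalk E x) (stalk F x) f)}"

definition sheaf_id :: "('g, 'x, 'r, 'e) sheaf \<Rightarrow> 'e \<Rightarrow> 'e" where
  "sheaf_id E = restrict (\<lambda>e. e) (topspace (tot E))"

definition sheaf_iso :: "('r, 's) ring_scheme \<Rightarrow> ('g, 'x) gspace \<Rightarrow>
    ('g, 'x, 'r, 'e) sheaf \<Rightarrow> ('g, 'x, 'r, 'f) sheaf \<Rightarrow> ('e \<Rightarrow> 'f) \<Rightarrow> bool" where
  "sheaf_iso R B E F f \<longleftrightarrow> f \<in> sheaf_hom R B E F \<and>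
     (\<exists>g\<in>sheaf_hom R B F E.
        compose (topspace (tot E)) g f = sheaf_id E \<and> compose (topspace (tot F)) f g = sheaf_id F)"

text \<open>The category of \<open>\<Gamma>\<close>-sheaves of \<open>R\<close>-modules over \<open>X\<close> whose total spaces are subsets of the
  type \<open>'e\<close>, which plays the role of a universe.\<close>

definition Sheaves ::
  "('r, 's) ring_scheme \<Rightarrow> ('g, 'x) gspace \<Rightarrow> (('g, 'x, 'r, 'e) sheaf, 'e \<Rightarrow> 'e) cat" where
  "Sheaves R B = \<lparr>Obj = {E. is_sheaf R B E}, Hom = sheaf_hom R B,
     Cmp = (\<lambda>E F G g f. compose (topspace (tot E)) g f), Idn = sheaf_id\<rparr>"

definition sections_over ::
  "('g, 'x) gspace \<Rightarrow> ('g, 'x, 'r, 'e) sheaf \<Rightarrow> 'x set \<Rightarrow> ('x \<Rightarrow> 'e) set" where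
  "sections_over B E U = {s \<in> extensional U.
     continuous_map (subtopology (pts B) U) (tot E) s \<and> (\<forall>x\<in>U. prj E (s x) = x)}"

text \<open>For a section \<open>s\<close> over \<open>U\<close>, this is the section \<open>g \<circ> s \<circ> g\<^sup>-\<^sup>1\<close> over \<open>gU\<close>.\<close>

definition section_mov :: "('g, 'x) gspace \<Rightarrow> ('g, 'x, 'r, 'e) sheaf \<Rightarrow>
    'g \<Rightarrow> 'x set \<Rightarrow> ('x \<Rightarrow> 'e) \<Rightarrow> ('x \<Rightarrow> 'e)" where
  "section_mov B E g U s =
     restrict (\<lambda>x. emov E g (s (mov B (inv\<^bsub>grp B\<^esub> g) x))) (mov B g ` U)"


section \<open>Change of space and group\<close>

text \<open>The data of a homomorphism \<open>\<pi> = grp_map\<close> and a \<open>\<pi>\<close>-equivariant map \<open>q = pt_map\<close>.\<close>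

record ('g, 'x, 'h, 'y) change =
  src :: "('g, 'x) gspace"
  tgt :: "('h, 'y) gspace"
  grp_map :: "'g \<Rightarrow> 'h"
  pt_map :: "'x \<Rightarrow> 'y"

definition pre :: "('g, 'x, 'h, 'y) change \<Rightarrow> 'y set \<Rightarrow> 'x set" where
  "pre C V = {x \<in> topspace (pts (src C)). pt_map C x \<in> V}"

definition pull_top ::
  "('g, 'x, 'h, 'y) change \<Rightarrow> ('h, 'y, 'r, 'd) sheaf \<Rightarrow> ('x \<times> 'd) topology" where
  "pull_top C D =
     subtopology (prod_topology (pts (src C)) (tot D)) {(x, d). pt_map C x = prj D d}"

definition pull ::
  "('g, 'x, 'h, 'y) change \<Rightarrow> ('h, 'y, 'r, 'd) sheaf \<Rightarrow> ('g, 'x, 'r, 'x \<times> 'd) sheaf" where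
  "pull C D =
     \<lparr>tot = pull_top C D,
      prj = fst,
      emov = (\<lambda>g. restrict (\<lambda>(x, d). (mov (src C) g x, emov D (grp_map C g) d))
                     (topspace (pull_top C D))),
      ezero = (\<lambda>x. (x, ezero D (pt_map C x))),
      esum = (\<lambda>(x, d) (x', d'). (x, esum D d d')),
      escal = (\<lambda>r (x, d). (x, escal D r d))\<rparr>"

definition pull_map :: "('g, 'x, 'h, 'y) change \<Rightarrow> ('h, 'y, 'r, 'd) sheaf \<Rightarrow>
    ('d \<Rightarrow> 'c) \<Rightarrow> ('x \<times> 'd \<Rightarrow> 'x \<times> 'c)" where
  "pull_map C D f = restrict (\<lambda>(x, d). (x, f d)) (topspace (tot (pull C D)))"

text \<open>The module \<open>E(q\<^sup>-\<^sup>1V)\<^sup>N\<close>, where \<open>N\<close> is the kernel of \<open>\<pi>\<close>.\<close>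

definition inv_sections ::
  "('g, 'x, 'h, 'y) change \<Rightarrow> ('g, 'x, 'r, 'e) sheaf \<Rightarrow> 'y set \<Rightarrow> ('x \<Rightarrow> 'e) set" where
  "inv_sections C E V = {s \<in> sections_over (src C) E (pre C V).
     \<forall>n\<in>kernel (grp (src C)) (grp (tgt C)) (grp_map C). section_mov (src C) E n (pre C V) s = s}"

text \<open>The direct image is the etale space of the sheaf \<open>V \<mapsto> E(q\<^sup>-\<^sup>1V)\<^sup>N\<close>: its points over \<open>y\<close> are the
  germs at \<open>y\<close>, a germ being the set of all pairs \<open>(W, t)\<close> with \<open>t\<close> in \<open>E(q\<^sup>-\<^sup>1W)\<^sup>N\<close> representing it.\<close>

type_synonym ('x, 'y, 'e) germ = "'y \<times> ('y set \<times> ('x \<Rightarrow> 'e)) set"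

definition germ :: "('g, 'x, 'h, 'y) change \<Rightarrow> ('g, 'x, 'r, 'e) sheaf \<Rightarrow>
    'y \<Rightarrow> 'y set \<Rightarrow> ('x \<Rightarrow> 'e) \<Rightarrow> ('x, 'y, 'e) germ" where
  "germ C E y V s = (y, {(W, t). openin (pts (tgt C)) W \<and> y \<in> W \<and> t \<in> inv_sections C E W \<and>
     (\<exists>U. openin (pts (tgt C)) U \<and> y \<in> U \<and> U \<subseteq> V \<inter> W \<and> (\<forall>x\<in>pre C U. s x = t x))})"

definition germ_rep :: "('x, 'y, 'e) germ \<Rightarrow> 'y set \<times> ('x \<Rightarrow> 'e)" where
  "germ_rep z = (SOME r. r \<in> snd z)"

definition push_top :: "('g, 'x, 'h, 'y) change \<Rightarrow> ('g, 'x, 'r, 'e) sheaf \<Rightarrow>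
    ('x, 'y, 'e) germ topology" where
  "push_top C E = topology_generated_by
     {(\<lambda>y. germ C E y V s) ` V |V s. openin (pts (tgt C)) V \<and> s \<in> inv_sections C E V}"

definition push :: "('g, 'x, 'h, 'y) change \<Rightarrow> ('g, 'x, 'r, 'e) sheaf \<Rightarrow>
    ('h, 'y, 'r, ('x, 'y, 'e) germ) sheaf" where
  "push C E =
     \<lparr>tot = push_top C E,
      prj = fst,
      emov = (\<lambda>h. restrict (\<lambda>z.
        let (V, s) = germ_rep z; g = (SOME g. g \<in> carrier (grp (src C)) \<and> grp_map C g = h)
        in germ C E (mov (tgt C) h (fst z)) (mov (tgt C) h ` V)
             (section_mov (src C) E g (pre C V) s))
        (topspace (push_top C E))),
      ezero = (\<lambda>y. germ C E y (topspace (pts (tgt C)))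
        (restrict (ezero E) (topspace (pts (src C))))),
      esum = (\<lambda>z z'. let (V, s) = germ_rep z; (W, t) = germ_rep z'
        in germ C E (fst z) (V \<inter> W) (restrict (\<lambda>x. esum E (s x) (t x)) (pre C (V \<inter> W)))),
      escal = (\<lambda>r z. let (V, s) = germ_rep z
        in germ C E (fst z) V (restrict (\<lambda>x. escal E r (s x)) (pre C V)))\<rparr>"

definition push_map :: "('g, 'x, 'h, 'y) change \<Rightarrow> ('g, 'x, 'r, 'e) sheaf \<Rightarrow>
    ('g, 'x, 'r, 'f) sheaf \<Rightarrow> ('e \<Rightarrow> 'f) \<Rightarrow> ('x, 'y, 'e) germ \<Rightarrow> ('x, 'y, 'f) germ" where
  "push_map C E F f = restrict (\<lambda>z. let (V, s) = germ_rep z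
     in germ C F (fst z) V (restrict (\<lambda>x. f (s x)) (pre C V))) (topspace (tot (push C E)))"

text \<open>The two directions of the bijection between maps \<open>q\<^sup>*D \<rightarrow> E\<close> and maps \<open>D \<rightarrow> q\<^sub>*E\<close>: the adjoint
  of \<open>a\<close> sends a section \<open>t\<close> of \<open>D\<close> over \<open>V\<close> to the section \<open>x \<mapsto> a (x, t (q x))\<close> of \<open>E\<close> over
  \<open>q\<^sup>-\<^sup>1V\<close>, and the adjoint of \<open>b\<close> sends \<open>(x, d)\<close> to the value at \<open>x\<close> of the germ \<open>b d\<close>.\<close>

definition adjoint_right :: "('g, 'x, 'h, 'y) change \<Rightarrow> ('h, 'y, 'r, 'd) sheaf \<Rightarrow>
    ('g, 'x, 'r, 'e) sheaf \<Rightarrow> ('x \<times> 'd \<Rightarrow> 'e) \<Rightarrow> 'd \<Rightarrow> ('x, 'y, 'e) germ" where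
  "adjoint_right C D E a = restrict (\<lambda>d.
     let (V, t) = (SOME (V, t). openin (pts (tgt C)) V \<and> prj D d \<in> V \<and>
                                t \<in> sections_over (tgt C) D V \<and> t (prj D d) = d)
     in germ C E (prj D d) V (restrict (\<lambda>x. a (x, t (pt_map C x))) (pre C V))) (topspace (tot D))"

definition adjoint_left :: "('g, 'x, 'h, 'y) change \<Rightarrow> ('h, 'y, 'r, 'd) sheaf \<Rightarrow>
    ('d \<Rightarrow> ('x, 'y, 'e) germ) \<Rightarrow> 'x \<times> 'd \<Rightarrow> 'e" where
  "adjoint_left C D b = restrict (\<lambda>(x, d). snd (germ_rep (b d)) x) (topspace (tot (pull C D)))"


section \<open>Diagrams of finite groups and spaces, and their limits\<close>

text \<open>\<open>trG i j f : G\<^sub>i \<rightarrow> G\<^sub>j\<close> and \<open>trX i j f : X\<^sub>i \<rightarrow> X\<^sub>j\<close> are the maps induced by an arrow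
  \<open>f : i \<rightarrow> j\<close> of the index category.\<close>

record ('o, 'm, 'g, 'x) diagram =
  idx :: "('o, 'm) cat"
  lvl :: "'o \<Rightarrow> ('g, 'x) gspace"
  trG :: "'o \<Rightarrow> 'o \<Rightarrow> 'm \<Rightarrow> 'g \<Rightarrow> 'g"
  trX :: "'o \<Rightarrow> 'o \<Rightarrow> 'm \<Rightarrow> 'x \<Rightarrow> 'x"

definition finite_discrete_gspace :: "('g, 'x) gspace \<Rightarrow> bool" where
  "finite_discrete_gspace B \<longleftrightarrow> is_gspace B \<and>
     finite (carrier (grp B)) \<and> gtop B = discrete_topology (carrier (grp B)) \<and>
     finite (topspace (pts B)) \<and> pts B = discrete_topology (topspace (pts B))"

definition surjective_equivariant_diagram :: "('o, 'm, 'g, 'x) diagram \<Rightarrow> bool" where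
  "surjective_equivariant_diagram S \<longleftrightarrow>
     (\<forall>i\<in>Obj (idx S). \<forall>j\<in>Obj (idx S). \<forall>f\<in>Hom (idx S) i j.
        trG S i j f \<in> hom (grp (lvl S i)) (grp (lvl S j)) \<and>
        trG S i j f ` carrier (grp (lvl S i)) = carrier (grp (lvl S j)) \<and>
        trX S i j f ` topspace (pts (lvl S i)) = topspace (pts (lvl S j)) \<and>
        (\<forall>g\<in>carrier (grp (lvl S i)). \<forall>x\<in>topspace (pts (lvl S i)).
           trX S i j f (mov (lvl S i) g x) = mov (lvl S j) (trG S i j f g) (trX S i j f x))) \<and>
     (\<forall>i\<in>Obj (idx S).
        (\<forall>g\<in>carrier (grp (lvl S i)). trG S i i (Idn (idx S) i) g = g) \<and>
        (\<forall>x\<in>topspace (pts (lvl S i)). trX S i i (Idn (idx S) i) x = x)) \<and>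
     (\<forall>i\<in>Obj (idx S). \<forall>j\<in>Obj (idx S). \<forall>k\<in>Obj (idx S).
        \<forall>f\<in>Hom (idx S) i j. \<forall>f'\<in>Hom (idx S) j k.
          (\<forall>g\<in>carrier (grp (lvl S i)).
             trG S i k (Cmp (idx S) i j k f' f) g = trG S j k f' (trG S i j f g)) \<and>
          (\<forall>x\<in>topspace (pts (lvl S i)).
             trX S i k (Cmp (idx S) i j k f' f) x = trX S j k f' (trX S i j f x)))"

definition transition :: "('o, 'm, 'g, 'x) diagram \<Rightarrow> 'o \<Rightarrow> 'o \<Rightarrow> 'm \<Rightarrow> ('g, 'x, 'g, 'x) change" where
  "transition S i j f = \<lparr>src = lvl S i, tgt = lvl S j, grp_map = trG S i j f, pt_map = trX S i j f\<rparr>"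

definition lim_carrier :: "('o, 'm, 'g, 'x) diagram \<Rightarrow> ('o \<Rightarrow> 'g) set" where
  "lim_carrier S = {g \<in> (\<Pi>\<^sub>E i\<in>Obj (idx S). carrier (grp (lvl S i))).
     \<forall>i\<in>Obj (idx S). \<forall>j\<in>Obj (idx S). \<forall>f\<in>Hom (idx S) i j. trG S i j f (g i) = g j}"

definition lim_points :: "('o, 'm, 'g, 'x) diagram \<Rightarrow> ('o \<Rightarrow> 'x) set" where
  "lim_points S = {x \<in> (\<Pi>\<^sub>E i\<in>Obj (idx S). topspace (pts (lvl S i))).
     \<forall>i\<in>Obj (idx S). \<forall>j\<in>Obj (idx S). \<forall>f\<in>Hom (idx S) i j. trX S i j f (x i) = x j}"

definition lim_gspace :: "('o, 'm, 'g, 'x) diagram \<Rightarrow> ('o \<Rightarrow> 'g, 'o \<Rightarrow> 'x) gspace" where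
  "lim_gspace S =
     \<lparr>grp = \<lparr>carrier = lim_carrier S,
             mult = (\<lambda>g h. \<lambda>i\<in>Obj (idx S). g i \<otimes>\<^bsub>grp (lvl S i)\<^esub> h i),
             one = (\<lambda>i\<in>Obj (idx S). \<one>\<^bsub>grp (lvl S i)\<^esub>)\<rparr>,
      gtop = subtopology (product_topology (\<lambda>i. gtop (lvl S i)) (Obj (idx S))) (lim_carrier S),
      pts = subtopology (product_topology (\<lambda>i. pts (lvl S i)) (Obj (idx S))) (lim_points S),
      mov = (\<lambda>g. restrict (\<lambda>x. \<lambda>i\<in>Obj (idx S). mov (lvl S i) (g i) (x i)) (lim_points S))\<rparr>"

definition lim_proj ::
  "('o, 'm, 'g, 'x) diagram \<Rightarrow> 'o \<Rightarrow> ('o \<Rightarrow> 'g, 'o \<Rightarrow> 'x, 'g, 'x) change" where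
  "lim_proj S i =
     \<lparr>src = lim_gspace S, tgt = lvl S i, grp_map = (\<lambda>g. g i), pt_map = (\<lambda>x. x i)\<rparr>"


section \<open>Sheaves over a diagram\<close>

text \<open>\<open>str i j f\<close> is the structure map \<open>\<alpha>\<^sub>i\<^sub>j : \<phi>\<^sub>i\<^sub>j\<^sup>* D\<^sub>j \<rightarrow> D\<^sub>i\<close> of the arrow \<open>f : i \<rightarrow> j\<close>.\<close>

record ('o, 'm, 'g, 'x, 'r, 'e) dsheaf =
  dsh :: "'o \<Rightarrow> ('g, 'x, 'r, 'e) sheaf"
  str :: "'o \<Rightarrow> 'o \<Rightarrow> 'm \<Rightarrow> 'x \<times> 'e \<Rightarrow> 'e"

text \<open>In the composition law, \<open>(x, d)\<close> ranges over \<open>(\<phi>\<^sub>j\<^sub>k \<phi>\<^sub>i\<^sub>j)\<^sup>* D\<^sub>k\<close>, which is identified with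
  \<open>\<phi>\<^sub>i\<^sub>j\<^sup>* \<phi>\<^sub>j\<^sub>k\<^sup>* D\<^sub>k\<close> by \<open>(x, d) \<mapsto> (x, (\<phi>\<^sub>i\<^sub>j x, d))\<close>.\<close>

definition is_dsheaf :: "('r, 's) ring_scheme \<Rightarrow> ('o, 'm, 'g, 'x) diagram \<Rightarrow>
    ('o, 'm, 'g, 'x, 'r, 'e) dsheaf \<Rightarrow> bool" where
  "is_dsheaf R S D \<longleftrightarrow>
     (\<forall>i\<in>Obj (idx S). is_sheaf R (lvl S i) (dsh D i)) \<and>
     (\<forall>i\<in>Obj (idx S). \<forall>j\<in>Obj (idx S). \<forall>f\<in>Hom (idx S) i j.
        str D i j f \<in> sheaf_hom R (lvl S i) (pull (transition S i j f) (dsh D j)) (dsh D i)) \<and>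
     (\<forall>i\<in>Obj (idx S). let f = Idn (idx S) i in
        \<forall>(x, d)\<in>topspace (tot (pull (transition S i i f) (dsh D i))). str D i i f (x, d) = d) \<and>
     (\<forall>i\<in>Obj (idx S). \<forall>j\<in>Obj (idx S). \<forall>k\<in>Obj (idx S).
        \<forall>f\<in>Hom (idx S) i j. \<forall>f'\<in>Hom (idx S) j k. let h = Cmp (idx S) i j k f' f in
          \<forall>(x, d)\<in>topspace (tot (pull (transition S i k h) (dsh D k))).
            str D i k h (x, d) = str D i j f (x, str D j k f' (trX S i j f x, d)))"

definition dsheaf_hom :: "('r, 's) ring_scheme \<Rightarrow> ('o, 'm, 'g, 'x) diagram \<Rightarrow>
    ('o, 'm, 'g, 'x, 'r, 'e) dsheaf \<Rightarrow> ('o, 'm, 'g, 'x, 'r, 'c) dsheaf \<Rightarrow>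
    ('o \<Rightarrow> 'e \<Rightarrow> 'c) set" where
  "dsheaf_hom R S D D' = {u \<in> (\<Pi>\<^sub>E i\<in>Obj (idx S). sheaf_hom R (lvl S i) (dsh D i) (dsh D' i)).
     \<forall>i\<in>Obj (idx S). \<forall>j\<in>Obj (idx S). \<forall>f\<in>Hom (idx S) i j.
       let P = pull (transition S i j f) (dsh D j) in
       compose (topspace (tot P)) (u i) (str D i j f) =
       compose (topspace (tot P)) (str D' i j f) (pull_map (transition S i j f) (dsh D j) (u j))}"

definition dsheaf_comp :: "('o, 'm, 'g, 'x) diagram \<Rightarrow> ('o, 'm, 'g, 'x, 'r, 'e) dsheaf \<Rightarrow>
    ('o \<Rightarrow> 'c \<Rightarrow> 'd) \<Rightarrow> ('o \<Rightarrow> 'e \<Rightarrow> 'c) \<Rightarrow> 'o \<Rightarrow> 'e \<Rightarrow> 'd" where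
  "dsheaf_comp S D v u = (\<lambda>i\<in>Obj (idx S). compose (topspace (tot (dsh D i))) (v i) (u i))"

definition dsheaf_id :: "('o, 'm, 'g, 'x) diagram \<Rightarrow> ('o, 'm, 'g, 'x, 'r, 'e) dsheaf \<Rightarrow>
    'o \<Rightarrow> 'e \<Rightarrow> 'e" where
  "dsheaf_id S D = (\<lambda>i\<in>Obj (idx S). sheaf_id (dsh D i))"

definition dsheaf_iso :: "('r, 's) ring_scheme \<Rightarrow> ('o, 'm, 'g, 'x) diagram \<Rightarrow>
    ('o, 'm, 'g, 'x, 'r, 'e) dsheaf \<Rightarrow> ('o, 'm, 'g, 'x, 'r, 'c) dsheaf \<Rightarrow>
    ('o \<Rightarrow> 'e \<Rightarrow> 'c) \<Rightarrow> bool" where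
  "dsheaf_iso R S D D' u \<longleftrightarrow> u \<in> dsheaf_hom R S D D' \<and>
     (\<exists>v\<in>dsheaf_hom R S D' D.
        dsheaf_comp S D v u = dsheaf_id S D \<and> dsheaf_comp S D' u v = dsheaf_id S D')"

definition DSheaves :: "('r, 's) ring_scheme \<Rightarrow> ('o, 'm, 'g, 'x) diagram \<Rightarrow>
    (('o, 'm, 'g, 'x, 'r, 'e) dsheaf, 'o \<Rightarrow> 'e \<Rightarrow> 'e) cat" where
  "DSheaves R S = \<lparr>Obj = {D. is_dsheaf R S D}, Hom = dsheaf_hom R S,
     Cmp = (\<lambda>D D' D'' v u. dsheaf_comp S D v u), Idn = dsheaf_id S\<rparr>"

definition adjoint_structure_isos :: "('r, 's) ring_scheme \<Rightarrow> ('o, 'm, 'g, 'x) diagram \<Rightarrow>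
    ('o, 'm, 'g, 'x, 'r, 'e) dsheaf \<Rightarrow> bool" where
  "adjoint_structure_isos R S D \<longleftrightarrow>
     (\<forall>i\<in>Obj (idx S). \<forall>j\<in>Obj (idx S). \<forall>f\<in>Hom (idx S) i j.
        sheaf_iso R (lvl S j) (dsh D j) (push (transition S i j f) (dsh D i))
          (adjoint_right (transition S i j f) (dsh D j) (dsh D i) (str D i j f)))"


section \<open>The two functors\<close>

text \<open>The equality \<open>(p\<^sub>j)\<^sub>* E = (\<phi>\<^sub>i\<^sub>j)\<^sub>* (p\<^sub>i)\<^sub>* E\<close> of sheaves of sections, on germs: a section
  \<open>s\<close> over the preimage of \<open>V\<close> in \<open>X\<close> is regarded as a section of \<open>(p\<^sub>i)\<^sub>* E\<close> over the preimage
  of \<open>V\<close> in \<open>X\<^sub>i\<close>.\<close>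

definition push_trans :: "('o, 'm, 'g, 'x) diagram \<Rightarrow> 'o \<Rightarrow> 'o \<Rightarrow> 'm \<Rightarrow>
    ('o \<Rightarrow> 'g, 'o \<Rightarrow> 'x, 'r, 'e) sheaf \<Rightarrow>
    ('o \<Rightarrow> 'x, 'x, 'e) germ \<Rightarrow> ('x, 'x, ('o \<Rightarrow> 'x, 'x, 'e) germ) germ" where
  "push_trans S i j f E = restrict (\<lambda>z. let (V, s) = germ_rep z; W = pre (transition S i j f) V
     in germ (transition S i j f) (push (lim_proj S i) E) (fst z) V
          (\<lambda>x\<in>W. germ (lim_proj S i) E x W s))
     (topspace (tot (push (lim_proj S j) E)))"

definition p_bullet :: "('o, 'm, 'g, 'x) diagram \<Rightarrow> ('o \<Rightarrow> 'g, 'o \<Rightarrow> 'x, 'r, 'e) sheaf \<Rightarrow>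
    ('o, 'm, 'g, 'x, 'r, ('o \<Rightarrow> 'x, 'x, 'e) germ) dsheaf" where
  "p_bullet S E =
     \<lparr>dsh = (\<lambda>i. push (lim_proj S i) E),
      str = (\<lambda>i j f. adjoint_left (transition S i j f) (push (lim_proj S j) E) (push_trans S i j f E))\<rparr>"

definition p_bullet_map :: "('o, 'm, 'g, 'x) diagram \<Rightarrow> ('o \<Rightarrow> 'g, 'o \<Rightarrow> 'x, 'r, 'e) sheaf \<Rightarrow>
    ('o \<Rightarrow> 'g, 'o \<Rightarrow> 'x, 'r, 'c) sheaf \<Rightarrow> ('e \<Rightarrow> 'c) \<Rightarrow>
    'o \<Rightarrow> ('o \<Rightarrow> 'x, 'x, 'e) germ \<Rightarrow> ('o \<Rightarrow> 'x, 'x, 'c) germ" where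
  "p_bullet_map S E F f = (\<lambda>i\<in>Obj (idx S). push_map (lim_proj S i) E F f)"

text \<open>The map \<open>p\<^sub>j\<^sup>* D\<^sub>j = p\<^sub>i\<^sup>* \<phi>\<^sub>i\<^sub>j\<^sup>* D\<^sub>j \<rightarrow> p\<^sub>i\<^sup>* D\<^sub>i\<close>; the equality is \<open>(x, d) \<mapsto> (x, (x\<^sub>i, d))\<close>.\<close>

definition pull_trans :: "('o, 'm, 'g, 'x) diagram \<Rightarrow> ('o, 'm, 'g, 'x, 'r, 'e) dsheaf \<Rightarrow>
    'o \<Rightarrow> 'o \<Rightarrow> 'm \<Rightarrow> ('o \<Rightarrow> 'x) \<times> 'e \<Rightarrow> ('o \<Rightarrow> 'x) \<times> 'e" where
  "pull_trans S D i j f = compose (topspace (tot (pull (lim_proj S j) (dsh D j))))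
     (pull_map (lim_proj S i) (pull (transition S i j f) (dsh D j)) (str D i j f))
     (\<lambda>(x, d). (x, (x i, d)))"

text \<open>\<open>K\<close> with legs \<open>\<iota> i : F\<^sub>i \<rightarrow> K\<close> is a cocone under, respectively a colimit of, a diagram of
  sheaves with maps \<open>t i j f : F\<^sub>j \<rightarrow> F\<^sub>i\<close>. The universal property is that of the category of
  sheaves with total spaces in \<open>'u\<close>; the \<open>F\<^sub>i\<close> may live in another type.\<close>

definition sheaf_cocone :: "('r, 's) ring_scheme \<Rightarrow> ('g, 'x) gspace \<Rightarrow> ('o, 'm) cat \<Rightarrow>
    ('o \<Rightarrow> ('g, 'x, 'r, 'e) sheaf) \<Rightarrow> ('o \<Rightarrow> 'o \<Rightarrow> 'm \<Rightarrow> 'e \<Rightarrow> 'e) \<Rightarrow>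
    ('g, 'x, 'r, 'u) sheaf \<Rightarrow> ('o \<Rightarrow> 'e \<Rightarrow> 'u) \<Rightarrow> bool" where
  "sheaf_cocone R B I F t K \<iota> \<longleftrightarrow> is_sheaf R B K \<and>
     (\<forall>i\<in>Obj I. \<iota> i \<in> sheaf_hom R B (F i) K) \<and>
     (\<forall>i\<in>Obj I. \<forall>j\<in>Obj I. \<forall>f\<in>Hom I i j.
        compose (topspace (tot (F j))) (\<iota> i) (t i j f) = \<iota> j)"

definition sheaf_colimit :: "('r, 's) ring_scheme \<Rightarrow> ('g, 'x) gspace \<Rightarrow> ('o, 'm) cat \<Rightarrow>
    ('o \<Rightarrow> ('g, 'x, 'r, 'e) sheaf) \<Rightarrow> ('o \<Rightarrow> 'o \<Rightarrow> 'm \<Rightarrow> 'e \<Rightarrow> 'e) \<Rightarrow>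
    ('g, 'x, 'r, 'u) sheaf \<Rightarrow> ('o \<Rightarrow> 'e \<Rightarrow> 'u) \<Rightarrow> bool" where
  "sheaf_colimit R B I F t K \<iota> \<longleftrightarrow> sheaf_cocone R B I F t K \<iota> \<and>
     (\<forall>(K' :: ('g, 'x, 'r, 'u) sheaf) \<kappa>. sheaf_cocone R B I F t K' \<kappa> \<longrightarrow>
        (\<exists>!h. h \<in> sheaf_hom R B K K' \<and>
           (\<forall>i\<in>Obj I. compose (topspace (tot (F i))) h (\<iota> i) = \<kappa> i)))"

text \<open>\<open>L\<close> is the functor \<open>colim\<^sub>i p\<^sub>i\<^sup>*\<close>: its values are colimits, with legs \<open>\<iota> D\<close>, and its effect
  on maps is the one induced by the universal property.\<close>

definition is_colim_functor :: "('r, 's) ring_scheme \<Rightarrow> ('o, 'm, 'g, 'x) diagram \<Rightarrow>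
    (('o, 'm, 'g, 'x, 'r, 'u) dsheaf, 'o \<Rightarrow> 'u \<Rightarrow> 'u,
     ('o \<Rightarrow> 'g, 'o \<Rightarrow> 'x, 'r, 'u) sheaf, 'u \<Rightarrow> 'u) fctr \<Rightarrow>
    (('o, 'm, 'g, 'x, 'r, 'u) dsheaf \<Rightarrow> 'o \<Rightarrow> ('o \<Rightarrow> 'x) \<times> 'u \<Rightarrow> 'u) \<Rightarrow> bool" where
  "is_colim_functor R S L \<iota> \<longleftrightarrow>
     (\<forall>D\<in>Obj (DSheaves R S). sheaf_colimit R (lim_gspace S) (idx S)
        (\<lambda>i. pull (lim_proj S i) (dsh D i)) (pull_trans S D) (onObj L D) (\<iota> D)) \<and>
     (\<forall>D\<in>Obj (DSheaves R S). \<forall>D'\<in>Obj (DSheaves R S). \<forall>u\<in>Hom (DSheaves R S) D D'.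
        \<forall>i\<in>Obj (idx S). let P = topspace (tot (pull (lim_proj S i) (dsh D i))) in
          compose P (onHom L D D' u) (\<iota> D i) =
          compose P (\<iota> D' i) (pull_map (lim_proj S i) (dsh D i) (u i)))"

text \<open>\<open>Q\<close> is the functor \<open>E \<mapsto> {(p\<^sub>i)\<^sub>* E}\<close>. The total spaces of \<open>(p\<^sub>i)\<^sub>* E\<close> consist of germs and have
  to be copied into the type \<open>'u\<close>, so \<open>Q\<close> agrees with \<open>p_bullet\<close> via a natural isomorphism \<open>\<theta>\<close>.\<close>

definition is_p_bullet_functor :: "('r, 's) ring_scheme \<Rightarrow> ('o, 'm, 'g, 'x) diagram \<Rightarrow>
    (('o \<Rightarrow> 'g, 'o \<Rightarrow> 'x, 'r, 'u) sheaf, 'u \<Rightarrow> 'u,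
     ('o, 'm, 'g, 'x, 'r, 'u) dsheaf, 'o \<Rightarrow> 'u \<Rightarrow> 'u) fctr \<Rightarrow>
    (('o \<Rightarrow> 'g, 'o \<Rightarrow> 'x, 'r, 'u) sheaf \<Rightarrow> 'o \<Rightarrow> 'u \<Rightarrow> ('o \<Rightarrow> 'x, 'x, 'u) germ) \<Rightarrow> bool" where
  "is_p_bullet_functor R S Q \<theta> \<longleftrightarrow>
     (\<forall>E\<in>Obj (Sheaves R (lim_gspace S)).
        is_dsheaf R S (p_bullet S E) \<and> dsheaf_iso R S (onObj Q E) (p_bullet S E) (\<theta> E)) \<and>
     (\<forall>E\<in>Obj (Sheaves R (lim_gspace S)). \<forall>F\<in>Obj (Sheaves R (lim_gspace S)).
        \<forall>f\<in>Hom (Sheaves R (lim_gspace S)) E F.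
          dsheaf_comp S (onObj Q E) (p_bullet_map S E F f) (\<theta> E) =
          dsheaf_comp S (onObj Q E) (\<theta> F) (onHom Q E F f))"


section \<open>Universes for total spaces\<close>

text \<open>The type \<open>'u\<close> is large enough to contain, up to bijection, the total spaces of the direct images
  and of the colimits formed from sheaves with total spaces in \<open>'u\<close>.\<close>

definition universe_for :: "('o, 'm, 'g, 'x) diagram \<Rightarrow> 'u itself \<Rightarrow> bool" where
  "universe_for S U \<longleftrightarrow>
     (UNIV :: (('o \<times> ('o \<Rightarrow> 'x)) \<times> (('o \<Rightarrow> 'x) \<Rightarrow> 'u)) set) \<lesssim> (UNIV :: 'u set)"

text \<open>Every type \<open>'w\<close> embeds into such a universe.\<close>

datatype ('k, 'p, 'w) univ = Atom 'w | Family 'k "'p \<Rightarrow> ('k, 'p, 'w) univ"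

lemma universe_for_univ:
  fixes S :: "('o, 'm, 'g, 'x) diagram"
  shows "universe_for S TYPE(('o \<times> ('o \<Rightarrow> 'x), 'o \<Rightarrow> 'x, 'w) univ)"
  unfolding universe_for_def lepoll_def
  by (rule exI[of _ "\<lambda>(k, s). Family k s"]) (auto simp: inj_on_def)

lemma inj_Atom: "inj Atom"
  by (simp add: inj_on_def)

end

theory Submission
  imports Defs
begin

text \<open>A cocone from a system \<open>D\<close> to a sheaf \<open>E\<close> is a compatible family of morphisms
  \<open>(p\<^sub>i)\<^sup>* D\<^sub>i \<rightarrow> E\<close>. Cocones form a profunctor, which is represented on one side by the colimit
  (stalkwise a filtered colimit, topologised by the images of the basic sections of the pull backs)
  and on the other side by the system of sheaves of \<open>N\<^sub>i\<close>-invariant sections; this is the adjunction.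
  The counit is bijective on stalks because, by compactness of the group, every germ extends to a section
  over some fibre of \<open>X \<rightarrow> X\<^sub>i\<close> that is invariant under \<open>N\<^sub>i\<close>. If all adjoint structure maps are
  isomorphisms, the unit is injective because elements identified in the colimit are already
  identified in some \<open>D\<^sub>i\<close>, and surjective because an invariant section over a fibre of \<open>X \<rightarrow> X\<^sub>j\<close>,
  which is compact, comes from a single level \<open>i\<close>.\<close>

section \<open>Cofiltered limits of finite sets\<close>

text \<open>The obstacle is that the sheaves involved live in many different types and that direct
  images consist of germs. Direct images are therefore handled through the interface
  \<open>section_model\<close>: a sheaf over a discrete base together with an evaluation that
  identifies its stalk at \<open>y\<close> with the invariant sections over the fibre of
  \<open>y\<close>. A point of a discrete space is open, so a germ there is nothing but a section
  over a fibre. The germ sheaves and their copies inside the universe \<open>'u\<close> are both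
  models, and the arguments about unit and counit use only the evaluation. Unit and counit are never
  computed: each is the unique map satisfying an equation between cocones, and its bijectivity is
  read off from that equation. Both surjectivity assumptions on the diagram return as surjectivity
  of the limit projections: for the spaces it turns statements about limit points into statements
  about a finite level, for the groups it lets an element of \<open>G_i\<close> act through a lift
  to the limit.\<close>

lemma cofiltered_category: "cofiltered I \<Longrightarrow> category I"
  by (simp add: cofiltered_def)

lemma category_comp:
  "\<lbrakk>category C; a \<in> Obj C; b \<in> Obj C; c \<in> Obj C; f \<in> Hom C a b; g \<in> Hom C b c\<rbrakk>
    \<Longrightarrow> Cmp C a b c g f \<in> Hom C a c"
  unfolding category_def by blast

lemma category_assoc:
  "\<lbrakk>category C; a \<in> Obj C; b \<in> Obj C; c \<in> Obj C; d \<in> Obj C;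
    f \<in> Hom C a b; g \<in> Hom C b c; h \<in> Hom C c d\<rbrakk>
    \<Longrightarrow> Cmp C a c d h (Cmp C a b c g f) = Cmp C a b d (Cmp C b c d h g) f"
  unfolding category_def by blast

lemma category_id:
  "\<lbrakk>category C; a \<in> Obj C\<rbrakk> \<Longrightarrow> Idn C a \<in> Hom C a a"
  unfolding category_def by blast

lemma cofiltered_two:
  assumes "cofiltered I" "a \<in> Obj I" "b \<in> Obj I"
  obtains c f g where "c \<in> Obj I" "f \<in> Hom I c a" "g \<in> Hom I c b"
  using assms unfolding cofiltered_def by blast

lemma cofiltered_equalize:
  assumes "cofiltered I" "a \<in> Obj I" "b \<in> Obj I" "f \<in> Hom I a b" "g \<in> Hom I a b"
  obtains c h where "c \<in> Obj I" "h \<in> Hom I c a" "Cmp I c a b f h = Cmp I c a b g h"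
  using assms unfolding cofiltered_def by blast

text \<open>Two moves suffice: an object over both sources, then an equalizer of the two resulting
  arrows to \<open>j\<close>. Transitivity of the relation defining the colimit rests on
  this.\<close>

lemma cofiltered_square:
  assumes I: "cofiltered I" and o: "a \<in> Obj I" "b \<in> Obj I" "j \<in> Obj I"
    and f: "f \<in> Hom I a j" and g: "g \<in> Hom I b j"
  obtains c u v where "c \<in> Obj I" "u \<in> Hom I c a" "v \<in> Hom I c b"
    "Cmp I c a j f u = Cmp I c b j g v"
proof -
  note cat = cofiltered_category[OF I]
  obtain c u v where c: "c \<in> Obj I" "u \<in> Hom I c a" "v \<in> Hom I c b"
    using cofiltered_two[OF I o(1,2)] .
  have "Cmp I c a j f u \<in> Hom I c j" "Cmp I c b j g v \<in> Hom I c j"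
    using c f g o category_comp[OF cat] by auto
  then obtain d h where d: "d \<in> Obj I" "h \<in> Hom I d c"
    "Cmp I d c j (Cmp I c a j f u) h = Cmp I d c j (Cmp I c b j g v) h"
    using cofiltered_equalize[OF I c(1) o(3)] by metis
  show thesis
  proof (rule that[OF d(1)])
    show "Cmp I d c a u h \<in> Hom I d a" "Cmp I d c b v h \<in> Hom I d b"
      using c d o category_comp[OF cat] by auto
    show "Cmp I d a j f (Cmp I d c a u h) = Cmp I d b j g (Cmp I d c b v h)"
      using category_assoc[OF cat d(1) c(1) o(1) o(3) d(2) c(2) f]
        category_assoc[OF cat d(1) c(1) o(2) o(3) d(2) c(3) g] d(3) by simp
  qed
qed

lemma cofiltered_cone_objects:
  assumes I: "cofiltered I" and A: "finite A" "A \<subseteq> Obj I"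
  shows "\<exists>c\<in>Obj I. \<forall>k\<in>A. Hom I c k \<noteq> {}"
  using A
proof (induction A rule: finite_induct)
  case empty
  then show ?case using I by (auto simp: cofiltered_def)
next
  case (insert a A)
  then obtain c where c: "c \<in> Obj I" "\<forall>k\<in>A. Hom I c k \<noteq> {}" by auto
  obtain d f g where d: "d \<in> Obj I" "f \<in> Hom I d c" "g \<in> Hom I d a"
    using cofiltered_two[OF I c(1)] insert.prems by blast
  have "Hom I d k \<noteq> {}" if k: "k \<in> A" for k
  proof -
    obtain u where "u \<in> Hom I c k" using c k by blast
    then have "Cmp I d c k u f \<in> Hom I d k"
      using category_comp[OF cofiltered_category[OF I] d(1) c(1) _ d(2)] insert.prems k by blast
    then show ?thesis by blast
  qed
  then show ?case using d by blast
qed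

text \<open>The induction adds one arrow at a time: each costs one equalizer, and precomposing with
  it keeps the equations already obtained. Cones over finite subdiagrams are what compactness
  arguments reduce to.\<close>

lemma cofiltered_cone:
  assumes I: "cofiltered I" and A: "finite A" "A \<subseteq> Obj I"
    and F: "finite F" "\<And>i j f. (i, j, f) \<in> F \<Longrightarrow> i \<in> A \<and> j \<in> A \<and> f \<in> Hom I i j"
  shows "\<exists>c\<in>Obj I. \<exists>a. (\<forall>k\<in>A. a k \<in> Hom I c k) \<and> (\<forall>(i, j, f)\<in>F. Cmp I c i j f (a i) = a j)"
  using F
proof (induction F rule: finite_induct)
  case empty
  obtain c where c: "c \<in> Obj I" "\<forall>k\<in>A. Hom I c k \<noteq> {}"
    using cofiltered_cone_objects[OF I A] by blast
  then have "\<forall>k\<in>A. (SOME u. u \<in> Hom I c k) \<in> Hom I c k"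
    by (auto simp: some_in_eq)
  then show ?case by (intro bexI[OF _ c(1)] exI[of _ "\<lambda>k. SOME u. u \<in> Hom I c k"]) simp
next
  case (insert t F)
  note cat = cofiltered_category[OF I]
  obtain i j f where t: "t = (i, j, f)" by (cases t)
  have ij: "i \<in> A" "j \<in> A" "f \<in> Hom I i j" "i \<in> Obj I" "j \<in> Obj I"
    using insert.prems[of i j f] t A by auto
  obtain c a where c: "c \<in> Obj I" "\<And>k. k \<in> A \<Longrightarrow> a k \<in> Hom I c k"
    and cF: "\<And>i j f. (i, j, f) \<in> F \<Longrightarrow> Cmp I c i j f (a i) = a j"
  proof -
    have "\<And>i j f. (i, j, f) \<in> F \<Longrightarrow> i \<in> A \<and> j \<in> A \<and> f \<in> Hom I i j"
      using insert.prems by blast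
    from insert.IH[OF this] show thesis using that by (auto simp: Ball_def)
  qed
  have "Cmp I c i j f (a i) \<in> Hom I c j"
    using category_comp[OF cat c(1)] c(2) ij by blast
  then obtain d h where d: "d \<in> Obj I" "h \<in> Hom I d c"
    "Cmp I d c j (Cmp I c i j f (a i)) h = Cmp I d c j (a j) h"
    using cofiltered_equalize[OF I c(1) ij(5)] c(2)[OF ij(2)] by metis
  have 1: "\<forall>k\<in>A. Cmp I d c k (a k) h \<in> Hom I d k"
    using category_comp[OF cat d(1) c(1)] c(2) d(2) A by blast
  have 2: "Cmp I d k l g (Cmp I d c k (a k) h) = Cmp I d c l (a l) h"
    if "(k, l, g) \<in> insert t F" for k l g
  proof -
    have k: "k \<in> A" "l \<in> A" "g \<in> Hom I k l" "k \<in> Obj I" "l \<in> Obj I"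
      using insert.prems[OF that] A by auto
    have "Cmp I d k l g (Cmp I d c k (a k) h) = Cmp I d c l (Cmp I c k l g (a k)) h"
      using category_assoc[OF cat d(1) c(1) k(4,5) d(2) c(2)[OF k(1)] k(3)] .
    also have "\<dots> = Cmp I d c l (a l) h"
      using that cF[of k l g] d(3) t by auto
    finally show ?thesis .
  qed
  show ?case
    by (rule bexI[OF _ d(1)], rule exI[of _ "\<lambda>k. Cmp I d c k (a k) h"]) (use 1 2 in auto)
qed

section \<open>Inverse systems of finite discrete spaces along surjections\<close>

locale inverse_system =
  fixes I :: "('o, 'm) cat" and T :: "'o \<Rightarrow> 't topology" and tr :: "'o \<Rightarrow> 'o \<Rightarrow> 'm \<Rightarrow> 't \<Rightarrow> 't"
  assumes cof: "cofiltered I"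
    and disc: "i \<in> Obj I \<Longrightarrow> T i = discrete_topology (topspace (T i))"
    and fin: "i \<in> Obj I \<Longrightarrow> finite (topspace (T i))"
    and surj: "\<lbrakk>i \<in> Obj I; j \<in> Obj I; f \<in> Hom I i j\<rbrakk> \<Longrightarrow> tr i j f ` topspace (T i) = topspace (T j)"
    and comp: "\<lbrakk>i \<in> Obj I; j \<in> Obj I; k \<in> Obj I; f \<in> Hom I i j; f' \<in> Hom I j k; x \<in> topspace (T i)\<rbrakk>
      \<Longrightarrow> tr i k (Cmp I i j k f' f) x = tr j k f' (tr i j f x)"
begin

definition lim :: "('o \<Rightarrow> 't) set" where
  "lim = {x \<in> (\<Pi>\<^sub>E i\<in>Obj I. topspace (T i)).
     \<forall>i\<in>Obj I. \<forall>j\<in>Obj I. \<forall>f\<in>Hom I i j. tr i j f (x i) = x j}"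

abbreviation limtop :: "('o \<Rightarrow> 't) topology" where
  "limtop \<equiv> subtopology (product_topology T (Obj I)) lim"

lemma topspace_limtop: "topspace limtop = lim"
  by (auto simp: lim_def)

lemma tr_closed: "\<lbrakk>i \<in> Obj I; j \<in> Obj I; f \<in> Hom I i j; x \<in> topspace (T i)\<rbrakk> \<Longrightarrow> tr i j f x \<in> topspace (T j)"
  using surj by blast

lemma lim_coord: "\<lbrakk>x \<in> lim; i \<in> Obj I\<rbrakk> \<Longrightarrow> x i \<in> topspace (T i)"
  by (auto simp: lim_def)

lemma lim_tr: "\<lbrakk>x \<in> lim; i \<in> Obj I; j \<in> Obj I; f \<in> Hom I i j\<rbrakk> \<Longrightarrow> tr i j f (x i) = x j"
  by (auto simp: lim_def)

lemma cont_coord: "i \<in> Obj I \<Longrightarrow> continuous_map limtop (T i) (\<lambda>x. x i)"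
  by (simp add: continuous_map_from_subtopology)

text \<open>The locus where two continuous maps into a Hausdorff space agree is closed; discreteness
  of the levels supplies both continuity and the Hausdorff property.\<close>

lemma closedin_arrow_equation:
  assumes "i \<in> Obj I" "j \<in> Obj I" "f \<in> Hom I i j"
  shows "closedin (product_topology T (Obj I))
    {x \<in> topspace (product_topology T (Obj I)). tr i j f (x i) = x j}"
proof (rule closedin_continuous_maps_eq[where Y = "T j"])
  show "Hausdorff_space (T j)"
    by (subst disc[OF assms(2)]) (rule Hausdorff_space_discrete_topology)
  have "continuous_map (T i) (T j) (tr i j f)"
    by (subst disc[OF assms(1)]) (use surj[OF assms] in auto)
  then show "continuous_map (product_topology T (Obj I)) (T j) (\<lambda>x. tr i j f (x i))"
    using continuous_map_compose[OF continuous_map_product_projection[OF assms(1)]]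
    by (force simp: o_def)
  show "continuous_map (product_topology T (Obj I)) (T j) (\<lambda>x. x j)"
    using assms by simp
qed

definition arrows :: "('o \<times> 'o \<times> 'm) set" where
  "arrows = {(i, j, f). i \<in> Obj I \<and> j \<in> Obj I \<and> f \<in> Hom I i j}"

text \<open>One closed subset of the product per arrow, so that the limit is the intersection of a
  family to which the finite intersection property applies.\<close>

definition solutions :: "'o \<times> 'o \<times> 'm \<Rightarrow> ('o \<Rightarrow> 't) set" where
  "solutions = (\<lambda>(i, j, f). {x \<in> topspace (product_topology T (Obj I)). tr i j f (x i) = x j})"

lemma closedin_solutions: "a \<in> arrows \<Longrightarrow> closedin (product_topology T (Obj I)) (solutions a)"
  by (cases a) (use closedin_arrow_equation in \<open>auto simp: arrows_def solutions_def\<close>)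

lemma lim_eq_solutions: "lim = topspace (product_topology T (Obj I)) \<inter> (\<Inter>a\<in>arrows. solutions a)"
  by (force simp: lim_def arrows_def solutions_def)

lemma compact_product: "compact_space (product_topology T (Obj I))"
  unfolding compact_space_product_topology
proof (intro disjI2 ballI)
  fix i assume i: "i \<in> Obj I"
  show "compact_space (T i)"
    by (subst disc[OF i]) (simp add: compact_space_discrete_topology fin[OF i])
qed

lemma closedin_lim: "closedin (product_topology T (Obj I)) lim"
proof (cases "arrows = {}")
  case True
  then show ?thesis by (simp add: lim_eq_solutions del: topspace_product_topology)
next
  case False
  then show ?thesis
    unfolding lim_eq_solutions
    by (intro closedin_Int closedin_topspace closedin_INT closedin_solutions) auto
qed

lemma compact_limtop: "compact_space limtop"
  using closedin_compact_space[OF compact_product closedin_lim] compact_space_subtopology by blast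

text \<open>By compactness it is enough to meet finitely many arrow equations together with the
  condition at \<open>i\<close>. A cone with vertex \<open>c\<close> over the finitely many objects
  involved reduces this to level \<open>c\<close>: lift \<open>y\<close> along the surjection to
  \<open>i\<close> and push the lift down along the cone.\<close>

lemma proj_surj:
  assumes i: "i \<in> Obj I" and y: "y \<in> topspace (T i)"
  obtains x where "x \<in> lim" "x i = y"
proof -
  \<comment> \<open>Provides the default values of the partial solution: an object over
    \<open>i\<close> and \<open>k\<close> has a point over \<open>y\<close>, and its image at
    \<open>k\<close> is a point.\<close>
  have ne: "topspace (T k) \<noteq> {}" if k: "k \<in> Obj I" for k
  proof -
    obtain c f g where "c \<in> Obj I" "f \<in> Hom I c i" "g \<in> Hom I c k"
      using cofiltered_two[OF cof i k] .
    then show ?thesis using surj i k y by (metis empty_iff image_is_empty)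
  qed
  let ?P = "product_topology T (Obj I)"
  let ?C = "{x \<in> topspace ?P. x i \<in> {y}}"
  have C: "closedin ?P ?C"
    by (rule closedin_continuous_map_preimage[where Y = "T i"])
      (use i y in \<open>simp, metis disc closedin_discrete_topology empty_subsetI insert_subset\<close>)
  have "\<Inter> (insert ?C (solutions ` arrows)) \<noteq> {}"
  proof (rule compact_product[unfolded compact_space_fip, rule_format], intro conjI allI impI ballI)
    fix B assume "B \<in> insert ?C (solutions ` arrows)"
    then show "closedin ?P B" using C closedin_solutions by auto
  next
    fix F assume F: "finite F \<and> F \<subseteq> insert ?C (solutions ` arrows)"
    then have "finite (F - {?C})" "F - {?C} \<subseteq> solutions ` arrows" by auto
    then obtain A where A: "finite A" "A \<subseteq> arrows" "F - {?C} = solutions ` A"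
      by (meson finite_subset_image)
    \<comment> \<open>The cone must also reach \<open>i\<close> itself, since the solution starts
      from a lift of \<open>y\<close> to the vertex.\<close>
    define O' where "O' = insert i (fst ` A \<union> (fst \<circ> snd) ` A)"
    have O': "finite O'" "O' \<subseteq> Obj I"
      using A i by (auto simp: O'_def arrows_def)
    have A': "k \<in> O' \<and> l \<in> O' \<and> f \<in> Hom I k l" if "(k, l, f) \<in> A" for k l f
      using that A(2) by (force simp: O'_def arrows_def)
    obtain c a where c: "c \<in> Obj I" "\<And>k. k \<in> O' \<Longrightarrow> a k \<in> Hom I c k"
      and ca: "\<And>k l f. (k, l, f) \<in> A \<Longrightarrow> Cmp I c k l f (a k) = a l"
      using cofiltered_cone[OF cof O' A(1) A'] by (auto simp: Ball_def)
    obtain z where z: "z \<in> topspace (T c)" "tr c i (a i) z = y"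
      using surj[OF c(1) i c(2)] y by (force simp: O'_def)
    \<comment> \<open>Objects outside \<open>O'\<close> occur in none of the equations considered
      and get an arbitrary point.\<close>
    define x where "x = (\<lambda>k\<in>Obj I. if k \<in> O' then tr c k (a k) z else (SOME t. t \<in> topspace (T k)))"
    have x: "x \<in> topspace ?P"
      using ne O' c z tr_closed by (auto simp: x_def some_in_eq subset_iff)
    have "x i = y" using i z by (simp add: x_def O'_def)
    moreover have "x \<in> solutions t" if t: "t \<in> A" for t
    proof -
      obtain k l f where [simp]: "t = (k, l, f)" by (cases t)
      have *: "k \<in> O'" "l \<in> O'" "f \<in> Hom I k l" "k \<in> Obj I" "l \<in> Obj I"
        using A' t O' by auto
      have "tr k l f (tr c k (a k) z) = tr c l (a l) z"
        using comp[OF c(1) *(4,5) c(2)[OF *(1)] *(3) z(1)] ca t by simp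
      then show ?thesis using x * by (simp add: solutions_def x_def)
    qed
    ultimately have "x \<in> \<Inter> F" using A(3) x by blast
    then show "\<Inter> F \<noteq> {}" by blast
  qed
  then obtain x where "x \<in> \<Inter> (insert ?C (solutions ` arrows))" by blast
  then have "x \<in> lim \<and> x i = y" by (auto simp: lim_eq_solutions)
  then show thesis using that by blast
qed

lemma openin_fibre: "i \<in> Obj I \<Longrightarrow> openin limtop {x \<in> lim. x i = y}"
proof -
  assume i: "i \<in> Obj I"
  \<comment> \<open>Intersecting with \<open>topspace (T i)\<close> covers a \<open>y\<close> that
    is not a point of level \<open>i\<close>; the fibre is then empty.\<close>
  have "openin limtop {x \<in> topspace limtop. x i \<in> {y} \<inter> topspace (T i)}"
    by (rule openin_continuous_map_preimage[OF cont_coord[OF i]])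
      (metis disc i inf_le2 openin_discrete_topology)
  also have "{x \<in> topspace limtop. x i \<in> {y} \<inter> topspace (T i)} = {x \<in> lim. x i = y}"
    unfolding topspace_limtop using lim_coord[OF _ i] by auto
  finally show ?thesis .
qed

lemma closedin_fibre: "i \<in> Obj I \<Longrightarrow> closedin limtop {x \<in> lim. x i = y}"
proof -
  assume i: "i \<in> Obj I"
  have "closedin limtop {x \<in> topspace limtop. x i \<in> {y} \<inter> topspace (T i)}"
    by (rule closedin_continuous_map_preimage[OF cont_coord[OF i]])
      (metis disc i inf_le2 closedin_discrete_topology)
  also have "{x \<in> topspace limtop. x i \<in> {y} \<inter> topspace (T i)} = {x \<in> lim. x i = y}"
    unfolding topspace_limtop using lim_coord[OF _ i] by auto
  finally show ?thesis .
qed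

text \<open>A basic open set of the product constrains finitely many coordinates, and all of them
  are determined by the coordinate at an object mapping to them. So the fibres of single projections
  form a neighbourhood basis.\<close>

lemma neighbourhood_fibre:
  assumes U: "openin limtop U" "x \<in> U"
  obtains i where "i \<in> Obj I" "{x' \<in> lim. x' i = x i} \<subseteq> U"
proof -
  obtain W where W: "openin (product_topology T (Obj I)) W" "U = W \<inter> lim"
    using U(1) by (auto simp: openin_subtopology)
  obtain V where V: "finite {i \<in> Obj I. V i \<noteq> topspace (T i)}" "x \<in> Pi\<^sub>E (Obj I) V" "Pi\<^sub>E (Obj I) V \<subseteq> W"
    using W U(2) unfolding openin_product_topology_alt by blast
  obtain c where c: "c \<in> Obj I" "\<forall>k\<in>{i \<in> Obj I. V i \<noteq> topspace (T i)}. Hom I c k \<noteq> {}"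
    using cofiltered_cone_objects[OF cof V(1)] by blast
  have xl: "x \<in> lim" using U W by auto
  have "x' \<in> W" if x': "x' \<in> lim" "x' c = x c" for x'
  proof -
    have "x' k \<in> V k" if k: "k \<in> Obj I" for k
    proof (cases "V k = topspace (T k)")
      case True
      then show ?thesis using lim_coord[OF x'(1) k] by simp
    next
      case False
      then obtain f where f: "f \<in> Hom I c k" using c k by blast
      have "x' k = x k"
        using lim_tr[OF x'(1) c(1) k f] lim_tr[OF xl c(1) k f] x'(2) by simp
      then show ?thesis using V(2) k by auto
    qed
    then have "x' \<in> Pi\<^sub>E (Obj I) V" using x'(1) by (auto simp: lim_def PiE_iff)
    then show ?thesis using V(3) by blast
  qed
  then show thesis using that[OF c(1)] W(2) by blast
qed

text \<open>Compactness of the fibre over \<open>y\<close> leaves finitely many chosen arrows to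
  \<open>j\<close>; a cone over them makes their composites one arrow, along which
  \<open>refine\<close> transports every local instance of \<open>P\<close>. As every point of a
  level lifts to the limit, the result holds at all points of that level over
  \<open>y\<close>.\<close>

lemma uniform_level:
  assumes j: "j \<in> Obj I"
    and local: "\<And>x. \<lbrakk>x \<in> lim; x j = y\<rbrakk> \<Longrightarrow> \<exists>i\<in>Obj I. \<exists>f\<in>Hom I i j. P i f (x i)"
    and refine: "\<And>i f k g x. \<lbrakk>i \<in> Obj I; k \<in> Obj I; f \<in> Hom I i j; g \<in> Hom I k i;
       x \<in> topspace (T k); tr i j f (tr k i g x) = y; P i f (tr k i g x)\<rbrakk> \<Longrightarrow> P k (Cmp I k i j f g) x"
  obtains i f where "i \<in> Obj I" "f \<in> Hom I i j"
    "\<And>x. \<lbrakk>x \<in> topspace (T i); tr i j f x = y\<rbrakk> \<Longrightarrow> P i f x"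
proof -
  let ?Y = "{x \<in> lim. x j = y}"
  define good where "good x p \<longleftrightarrow> fst p \<in> Obj I \<and> snd p \<in> Hom I (fst p) j \<and> P (fst p) (snd p) (x (fst p))"
    for x p
  have "\<forall>x\<in>?Y. \<exists>p. good x p"
  proof
    fix x assume "x \<in> ?Y"
    then obtain i f where "i \<in> Obj I" "f \<in> Hom I i j" "P i f (x i)" using local by blast
    then have "good x (i, f)" by (simp add: good_def)
    then show "\<exists>p. good x p" ..
  qed
  from bchoice[OF this] obtain t where t': "\<forall>x\<in>?Y. good x (t x)" ..
  have t: "fst (t x) \<in> Obj I \<and> snd (t x) \<in> Hom I (fst (t x)) j \<and> P (fst (t x)) (snd (t x)) (x (fst (t x)))"
    if "x \<in> ?Y" for x
    using bspec[OF t' that] unfolding good_def .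
  define N where "N x = {x' \<in> lim. x' (fst (t x)) = x (fst (t x))}" for x
  have cpt: "compactin limtop ?Y"
    using closedin_compact_space[OF compact_limtop closedin_fibre[OF j]] .
  have "openin limtop U" if U: "U \<in> N ` ?Y" for U
  proof -
    obtain x where "x \<in> ?Y" "U = N x" using U by blast
    then show ?thesis using t[of x] openin_fibre[of "fst (t x)"] by (simp add: N_def)
  qed
  moreover have "?Y \<subseteq> \<Union> (N ` ?Y)" by (auto simp: N_def)
  ultimately have "\<exists>F. finite F \<and> F \<subseteq> N ` ?Y \<and> ?Y \<subseteq> \<Union> F"
    by (rule compactinD[OF cpt])
  then obtain F where F: "finite F" "F \<subseteq> N ` ?Y" and YF: "?Y \<subseteq> \<Union> F"
    by (elim exE conjE) (rule that)
  obtain A where A: "A \<subseteq> ?Y" "finite A" "F = N ` A"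
    using finite_subset_image[OF F] by blast
  have YA: "?Y \<subseteq> (\<Union>x\<in>A. N x)" using YF unfolding A(3) .
  define O' where "O' = insert j ((fst \<circ> t) ` A)"
  \<comment> \<open>The arrows chosen for the finite subcover all end at \<open>j\<close>; the cone
    equations force their composites with the cone to be the single arrow
    \<open>a j\<close>.\<close>
  define F where "F = (\<lambda>x. (fst (t x), j, snd (t x))) ` A"
  have O': "finite O'" using A(2) by (simp add: O'_def)
  have O'': "O' \<subseteq> Obj I" using A(1) t j by (force simp: O'_def)
  have F: "finite F" using A(2) by (simp add: F_def)
  have F': "k \<in> O' \<and> l \<in> O' \<and> f \<in> Hom I k l" if "(k, l, f) \<in> F" for k l f
    using that A(1) t by (force simp: O'_def F_def)
  obtain c a where c: "c \<in> Obj I" "\<And>k. k \<in> O' \<Longrightarrow> a k \<in> Hom I c k"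
      and ca: "\<And>k l f. (k, l, f) \<in> F \<Longrightarrow> Cmp I c k l f (a k) = a l"
    using cofiltered_cone[OF cof O' O'' F F'] by (auto simp: Ball_def)
  have aj: "a j \<in> Hom I c j" using c by (simp add: O'_def)
  have "P c (a j) z" if z: "z \<in> topspace (T c)" "tr c j (a j) z = y" for z
  proof -
    obtain x' where x': "x' \<in> lim" "x' c = z" using proj_surj[OF c(1) z(1)] .
    have "x' j = y" using lim_tr[OF x'(1) c(1) j aj] x' z by simp
    then obtain x where x: "x \<in> A" "x' \<in> N x" using YA x'(1) by blast
    let ?i = "fst (t x)"
    have tx: "?i \<in> Obj I" "snd (t x) \<in> Hom I ?i j" "P ?i (snd (t x)) (x ?i)"
      using t[of x] x(1) A(1) by blast+
    have ai: "a ?i \<in> Hom I c ?i" using c(2) x(1) by (auto simp: O'_def)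
    have e: "tr c ?i (a ?i) z = x ?i"
      using lim_tr[OF x'(1) c(1) tx(1) ai] x' x(2) by (simp add: N_def)
    have "tr ?i j (snd (t x)) (x ?i) = y"
      using lim_tr[of x ?i j "snd (t x)"] tx x(1) A(1) j by blast
    then have "P c (Cmp I c ?i j (snd (t x)) (a ?i)) z"
      using refine[OF tx(1) c(1) tx(2) ai z(1)] e tx(3) by simp
    then show ?thesis using ca[of ?i j "snd (t x)"] x(1) by (auto simp: F_def)
  qed
  then show thesis using that[OF c(1) aj] by blast
qed

end

section \<open>Group actions\<close>

text \<open>The library notion is a homomorphism into the group of extensional bijections;
  bijectivity of each translation is witnessed by the translation by the inverse element.\<close>

lemma group_actionI:
  assumes G: "group G"
    and ext: "\<And>g. g \<in> carrier G \<Longrightarrow> \<phi> g \<in> extensional E"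
    and cl: "\<And>g x. g \<in> carrier G \<Longrightarrow> x \<in> E \<Longrightarrow> \<phi> g x \<in> E"
    and one: "\<And>x. x \<in> E \<Longrightarrow> \<phi> \<one>\<^bsub>G\<^esub> x = x"
    and mult: "\<And>g h x. g \<in> carrier G \<Longrightarrow> h \<in> carrier G \<Longrightarrow> x \<in> E \<Longrightarrow> \<phi> (g \<otimes>\<^bsub>G\<^esub> h) x = \<phi> g (\<phi> h x)"
  shows "group_action G E \<phi>"
proof -
  interpret group G by (rule G)
  have inv: "\<phi> (inv\<^bsub>G\<^esub> g) (\<phi> g x) = x" "\<phi> g (\<phi> (inv\<^bsub>G\<^esub> g) x) = x" if "g \<in> carrier G" "x \<in> E" for g x
    using that mult[of "inv\<^bsub>G\<^esub> g" g x] mult[of g "inv\<^bsub>G\<^esub> g" x] one by auto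
  have Bij: "\<phi> g \<in> Bij E" if "g \<in> carrier G" for g
    unfolding Bij_def
    using that ext cl inv inv_closed
    by (auto intro!: bij_betw_byWitness[where f' = "\<phi> (inv\<^bsub>G\<^esub> g)"])
  show ?thesis
    unfolding group_action_def group_hom_def group_hom_axioms_def
  proof (intro conjI homI)
    show "\<phi> (g \<otimes>\<^bsub>G\<^esub> h) = \<phi> g \<otimes>\<^bsub>BijGroup E\<^esub> \<phi> h" if "g \<in> carrier G" "h \<in> carrier G" for g h
    proof
      fix x
      show "\<phi> (g \<otimes>\<^bsub>G\<^esub> h) x = (\<phi> g \<otimes>\<^bsub>BijGroup E\<^esub> \<phi> h) x"
        using that Bij mult ext[of "g \<otimes>\<^bsub>G\<^esub> h"]
        by (cases "x \<in> E") (auto simp: BijGroup_def compose_def extensional_def)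
    qed
  qed (use G Bij group_BijGroup in \<open>auto simp: BijGroup_def\<close>)
qed

lemma group_action_group: "group_action G E \<phi> \<Longrightarrow> group G"
  by (simp add: group_action_def group_hom_def)

lemma group_action_closed: "\<lbrakk>group_action G E \<phi>; g \<in> carrier G; x \<in> E\<rbrakk> \<Longrightarrow> \<phi> g x \<in> E"
  using group_action.element_image by metis

lemma group_action_one: "\<lbrakk>group_action G E \<phi>; x \<in> E\<rbrakk> \<Longrightarrow> \<phi> \<one>\<^bsub>G\<^esub> x = x"
  using group_action.id_eq_one by (metis restrict_apply')

lemma group_action_mult:
  "\<lbrakk>group_action G E \<phi>; g \<in> carrier G; h \<in> carrier G; x \<in> E\<rbrakk> \<Longrightarrow> \<phi> (g \<otimes>\<^bsub>G\<^esub> h) x = \<phi> g (\<phi> h x)"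
  using group_action.composition_rule by metis

lemma group_action_inv:
  assumes "group_action G E \<phi>" "g \<in> carrier G" "x \<in> E"
  shows "\<phi> (inv\<^bsub>G\<^esub> g) (\<phi> g x) = x" "\<phi> g (\<phi> (inv\<^bsub>G\<^esub> g) x) = x"
proof -
  interpret group G using group_action_group[OF assms(1)] .
  show "\<phi> (inv\<^bsub>G\<^esub> g) (\<phi> g x) = x" "\<phi> g (\<phi> (inv\<^bsub>G\<^esub> g) x) = x"
    using group_action_mult[OF assms(1) inv_closed assms(2,3), OF assms(2)]
      group_action_mult[OF assms(1,2) inv_closed assms(3), OF assms(2)]
      group_action_one[OF assms(1,3)] assms(2) by simp_all
qed

section \<open>Adjunctions from birepresentable profunctors\<close>

text \<open>\<open>H\<close> plays the role of a set of morphisms from objects of \<open>C\<close>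
  to objects of \<open>D\<close>, with \<open>post\<close> and \<open>prec\<close> composing on
  either side. \<open>r a\<close> and \<open>s b\<close> are universal elements: the first makes
  \<open>L0 a\<close> represent \<open>H a\<close>, the second makes \<open>Q0 b\<close> represent
  \<open>H\<close> in its first argument. Two representations of one profunctor amount to an
  adjunction, and the functors are obtained on morphisms from the universal properties.\<close>

locale birepresentable =
  fixes C :: "('o, 'm) cat" and D :: "('p, 'n) cat" and H :: "'o \<Rightarrow> 'p \<Rightarrow> 'h set"
    and post :: "'o \<Rightarrow> 'n \<Rightarrow> 'h \<Rightarrow> 'h" and prec :: "'o \<Rightarrow> 'h \<Rightarrow> 'm \<Rightarrow> 'h"
    and L0 :: "'o \<Rightarrow> 'p" and Q0 :: "'p \<Rightarrow> 'o" and r :: "'o \<Rightarrow> 'h" and s :: "'p \<Rightarrow> 'h"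
  assumes C: "category C" and D: "category D"
    and post_closed: "\<lbrakk>a \<in> Obj C; b \<in> Obj D; b' \<in> Obj D; h \<in> Hom D b b'; k \<in> H a b\<rbrakk> \<Longrightarrow> post a h k \<in> H a b'"
    and post_comp: "\<lbrakk>a \<in> Obj C; b \<in> Obj D; b' \<in> Obj D; b'' \<in> Obj D; h \<in> Hom D b b'; h' \<in> Hom D b' b'';
        k \<in> H a b\<rbrakk> \<Longrightarrow> post a (Cmp D b b' b'' h' h) k = post a h' (post a h k)"
    and post_id: "\<lbrakk>a \<in> Obj C; b \<in> Obj D; k \<in> H a b\<rbrakk> \<Longrightarrow> post a (Idn D b) k = k"
    and prec_closed: "\<lbrakk>a \<in> Obj C; a' \<in> Obj C; b \<in> Obj D; u \<in> Hom C a a'; k \<in> H a' b\<rbrakk> \<Longrightarrow> prec a k u \<in> H a b"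
    and prec_comp: "\<lbrakk>a \<in> Obj C; a' \<in> Obj C; a'' \<in> Obj C; b \<in> Obj D; u \<in> Hom C a a'; u' \<in> Hom C a' a'';
        k \<in> H a'' b\<rbrakk> \<Longrightarrow> prec a k (Cmp C a a' a'' u' u) = prec a (prec a' k u') u"
    and prec_id: "\<lbrakk>a \<in> Obj C; b \<in> Obj D; k \<in> H a b\<rbrakk> \<Longrightarrow> prec a k (Idn C a) = k"
    and post_prec: "\<lbrakk>a \<in> Obj C; a' \<in> Obj C; b \<in> Obj D; b' \<in> Obj D; u \<in> Hom C a a'; h \<in> Hom D b b';
        k \<in> H a' b\<rbrakk> \<Longrightarrow> post a h (prec a k u) = prec a (post a' h k) u"
    and L0: "a \<in> Obj C \<Longrightarrow> L0 a \<in> Obj D" and Q0: "b \<in> Obj D \<Longrightarrow> Q0 b \<in> Obj C"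
    and r: "a \<in> Obj C \<Longrightarrow> r a \<in> H a (L0 a)" and s: "b \<in> Obj D \<Longrightarrow> s b \<in> H (Q0 b) b"
    and r_univ: "\<lbrakk>a \<in> Obj C; b \<in> Obj D; k \<in> H a b\<rbrakk> \<Longrightarrow> \<exists>!h. h \<in> Hom D (L0 a) b \<and> post a h (r a) = k"
    and s_univ: "\<lbrakk>a \<in> Obj C; b \<in> Obj D; k \<in> H a b\<rbrakk> \<Longrightarrow> \<exists>!u. u \<in> Hom C a (Q0 b) \<and> prec a (s b) u = k"
begin

definition left :: "'o \<Rightarrow> 'p \<Rightarrow> 'h \<Rightarrow> 'n" where
  "left a b k = (THE h. h \<in> Hom D (L0 a) b \<and> post a h (r a) = k)"

definition right :: "'o \<Rightarrow> 'p \<Rightarrow> 'h \<Rightarrow> 'm" where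
  "right a b k = (THE u. u \<in> Hom C a (Q0 b) \<and> prec a (s b) u = k)"

lemma left: "\<lbrakk>a \<in> Obj C; b \<in> Obj D; k \<in> H a b\<rbrakk> \<Longrightarrow> left a b k \<in> Hom D (L0 a) b \<and> post a (left a b k) (r a) = k"
  unfolding left_def by (rule theI'[OF r_univ])

lemma right: "\<lbrakk>a \<in> Obj C; b \<in> Obj D; k \<in> H a b\<rbrakk> \<Longrightarrow> right a b k \<in> Hom C a (Q0 b) \<and> prec a (s b) (right a b k) = k"
  unfolding right_def by (rule theI'[OF s_univ])

text \<open>Uniqueness in the universal property: a morphism out of \<open>L0 a\<close> is known by
  its effect on \<open>r a\<close>. Equations between such morphisms are tested in this way below,
  and dually with \<open>right_eqI\<close>.\<close>

lemma left_eqI: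
  "\<lbrakk>a \<in> Obj C; b \<in> Obj D; h \<in> Hom D (L0 a) b; h' \<in> Hom D (L0 a) b; post a h (r a) = post a h' (r a)\<rbrakk> \<Longrightarrow> h = h'"
  using r_univ[of a b "post a h' (r a)"] post_closed[of a "L0 a" b h' "r a"] L0 r by auto

lemma right_eqI:
  "\<lbrakk>a \<in> Obj C; b \<in> Obj D; u \<in> Hom C a (Q0 b); u' \<in> Hom C a (Q0 b); prec a (s b) u = prec a (s b) u'\<rbrakk> \<Longrightarrow> u = u'"
  using s_univ[of a b "prec a (s b) u'"] prec_closed[of a "Q0 b" b u' "s b"] Q0 s by auto

definition L :: "('o, 'm, 'p, 'n) fctr" where
  "L = \<lparr>onObj = L0, onHom = (\<lambda>a a' u. left a (L0 a') (prec a (r a') u))\<rparr>"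

definition Q :: "('p, 'n, 'o, 'm) fctr" where
  "Q = \<lparr>onObj = Q0, onHom = (\<lambda>b b' h. right (Q0 b) b' (post (Q0 b) h (s b)))\<rparr>"

text \<open>The unit is the universal element \<open>r a\<close> read through the other
  representation; the counit does the same with \<open>s b\<close>.\<close>

definition \<eta> :: "'o \<Rightarrow> 'm" where "\<eta> a = right a (L0 a) (r a)"

definition \<epsilon> :: "'p \<Rightarrow> 'n" where "\<epsilon> b = left (Q0 b) b (s b)"

lemma onObj: "onObj L = L0" "onObj Q = Q0"
  by (simp_all add: L_def Q_def)

lemma L_hom: "\<lbrakk>a \<in> Obj C; a' \<in> Obj C; u \<in> Hom C a a'\<rbrakk> \<Longrightarrow>
    onHom L a a' u \<in> Hom D (L0 a) (L0 a') \<and> post a (onHom L a a' u) (r a) = prec a (r a') u"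
  unfolding L_def using left[of a "L0 a'"] L0 prec_closed r by simp

lemma Q_hom: "\<lbrakk>b \<in> Obj D; b' \<in> Obj D; h \<in> Hom D b b'\<rbrakk> \<Longrightarrow>
    onHom Q b b' h \<in> Hom C (Q0 b) (Q0 b') \<and> prec (Q0 b) (s b') (onHom Q b b' h) = post (Q0 b) h (s b)"
  unfolding Q_def using right[of "Q0 b" b'] Q0 post_closed s by simp

lemma eta: "a \<in> Obj C \<Longrightarrow> \<eta> a \<in> Hom C a (Q0 (L0 a)) \<and> prec a (s (L0 a)) (\<eta> a) = r a"
  unfolding \<eta>_def using right L0 r by simp

lemma eps: "b \<in> Obj D \<Longrightarrow> \<epsilon> b \<in> Hom D (L0 (Q0 b)) b \<and> post (Q0 b) (\<epsilon> b) (r (Q0 b)) = s b"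
  unfolding \<epsilon>_def using left Q0 s by simp

lemmas closed = L0 Q0 r s post_closed prec_closed category_comp[OF C] category_comp[OF D]
  category_id[OF C] category_id[OF D]

lemma functor_L: "functor_between C D L"
  unfolding functor_between_def onObj
proof (intro conjI ballI)
  fix a assume a: "a \<in> Obj C"
  show "onHom L a a (Idn C a) = Idn D (L0 a)"
    using a L_hom[OF a a] closed
    by (intro left_eqI[of a "L0 a"]) (auto simp: post_id[OF a L0 r] prec_id[OF a L0 r])
next
  fix a b c f g assume abc: "a \<in> Obj C" "b \<in> Obj C" "c \<in> Obj C" and fg: "f \<in> Hom C a b" "g \<in> Hom C b c"
  note h = L_hom[OF abc(1,2) fg(1)] L_hom[OF abc(2,3) fg(2)]
    L_hom[OF abc(1,3) category_comp[OF C abc fg]]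
  note ra = r[OF abc(1)] and rb = r[OF abc(2)] and rc = r[OF abc(3)]
  note La = L0[OF abc(1)] and Lb = L0[OF abc(2)] and Lc = L0[OF abc(3)]
  have "post a (onHom L a c (Cmp C a b c g f)) (r a) = prec a (prec b (r c) g) f"
    using h prec_comp[OF abc Lc fg rc] by simp
  also have "\<dots> = prec a (post b (onHom L b c g) (r b)) f" using h by simp
  also have "\<dots> = post a (onHom L b c g) (prec a (r b) f)"
    using post_prec[OF abc(1,2) Lb Lc fg(1) _ rb] h by simp
  also have "\<dots> = post a (onHom L b c g) (post a (onHom L a b f) (r a))" using h by simp
  also have "\<dots> = post a (Cmp D (L0 a) (L0 b) (L0 c) (onHom L b c g) (onHom L a b f)) (r a)"
    using post_comp[OF abc(1) La Lb Lc _ _ ra] h by simp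
  finally show "onHom L a c (Cmp C a b c g f) = Cmp D (L0 a) (L0 b) (L0 c) (onHom L b c g) (onHom L a b f)"
    using h category_comp[OF D La Lb Lc] by (intro left_eqI[OF abc(1) Lc]) auto
qed (use C D L0 L_hom in auto)

lemma functor_Q: "functor_between D C Q"
  unfolding functor_between_def onObj
proof (intro conjI ballI)
  fix b assume b: "b \<in> Obj D"
  show "onHom Q b b (Idn D b) = Idn C (Q0 b)"
    using b Q_hom[OF b b] closed
    by (intro right_eqI[of "Q0 b" b]) (auto simp: post_id[OF Q0 b s] prec_id[OF Q0 b s])
next
  fix a b c f g assume abc: "a \<in> Obj D" "b \<in> Obj D" "c \<in> Obj D" and fg: "f \<in> Hom D a b" "g \<in> Hom D b c"
  note h = Q_hom[OF abc(1,2) fg(1)] Q_hom[OF abc(2,3) fg(2)]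
    Q_hom[OF abc(1,3) category_comp[OF D abc fg]]
  note sa = s[OF abc(1)] and sb = s[OF abc(2)] and sc = s[OF abc(3)]
  note Qa = Q0[OF abc(1)] and Qb = Q0[OF abc(2)] and Qc = Q0[OF abc(3)]
  have "prec (Q0 a) (s c) (onHom Q a c (Cmp D a b c g f)) = post (Q0 a) g (post (Q0 a) f (s a))"
    using h post_comp[OF Qa abc fg sa] by simp
  also have "\<dots> = post (Q0 a) g (prec (Q0 a) (s b) (onHom Q a b f))" using h by simp
  also have "\<dots> = prec (Q0 a) (post (Q0 b) g (s b)) (onHom Q a b f)"
    using post_prec[OF Qa Qb abc(2,3) conjunct1[OF h(1)] fg(2) sb] .
  also have "\<dots> = prec (Q0 a) (prec (Q0 b) (s c) (onHom Q b c g)) (onHom Q a b f)" using h by simp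
  also have "\<dots> = prec (Q0 a) (s c) (Cmp C (Q0 a) (Q0 b) (Q0 c) (onHom Q b c g) (onHom Q a b f))"
    using prec_comp[OF Qa Qb Qc abc(3) _ _ sc] h by simp
  finally show "onHom Q a c (Cmp D a b c g f) = Cmp C (Q0 a) (Q0 b) (Q0 c) (onHom Q b c g) (onHom Q a b f)"
    using h category_comp[OF C Qa Qb Qc] by (intro right_eqI[OF Qa abc(3)]) auto
qed (use C D Q0 Q_hom in auto)

text \<open>Naturality and the triangle identities become equations between elements of
  \<open>H\<close> once both sides are applied to a universal element; there they follow from the
  defining equations of \<open>\<eta>\<close>, \<open>\<epsilon>\<close> and the two functors
  together with the laws of the two actions.\<close>

lemma adjunction: "adjunction C D L Q \<eta> \<epsilon>"
  unfolding adjunction_def nat_transf_def Let_def comp_functor_def id_functor_def fctr.simps onObj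
proof (intro conjI ballI functor_L functor_Q)
  fix a b f assume ab: "a \<in> Obj C" "b \<in> Obj C" and f: "f \<in> Hom C a b"
  note La = L0[OF ab(1)] and Lb = L0[OF ab(2)]
  note Qa = Q0[OF La] and Qb = Q0[OF Lb]
  note ea = eta[OF ab(1)] and eb = eta[OF ab(2)] and Lf = L_hom[OF ab f]
  note QLf = Q_hom[OF La Lb conjunct1[OF Lf]]
  have "prec a (s (L0 b)) (Cmp C a (Q0 (L0 a)) (Q0 (L0 b)) (onHom Q (L0 a) (L0 b) (onHom L a b f)) (\<eta> a))
      = prec a (post (Q0 (L0 a)) (onHom L a b f) (s (L0 a))) (\<eta> a)"
    using prec_comp[OF ab(1) Qa Qb Lb _ _ s[OF Lb]] ea QLf by simp
  also have "\<dots> = post a (onHom L a b f) (r a)"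
    using post_prec[OF ab(1) Qa La Lb conjunct1[OF ea] conjunct1[OF Lf] s[OF La]] ea by simp
  also have "\<dots> = prec a (prec b (s (L0 b)) (\<eta> b)) f" using Lf eb by simp
  also have "\<dots> = prec a (s (L0 b)) (Cmp C a b (Q0 (L0 b)) (\<eta> b) f)"
    using prec_comp[OF ab Qb Lb f _ s[OF Lb]] eb by simp
  finally show "Cmp C a (Q0 (L0 a)) (Q0 (L0 b)) (onHom Q (L0 a) (L0 b) (onHom L a b f)) (\<eta> a)
      = Cmp C a b (Q0 (L0 b)) (\<eta> b) f"
    using ea eb QLf f ab Qa Qb category_comp[OF C] by (intro right_eqI[OF ab(1) Lb]) auto
next
  fix a b f assume ab: "a \<in> Obj D" "b \<in> Obj D" and f: "f \<in> Hom D a b"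
  note Qa = Q0[OF ab(1)] and Qb = Q0[OF ab(2)]
  note La = L0[OF Qa] and Lb = L0[OF Qb]
  note ea = eps[OF ab(1)] and eb = eps[OF ab(2)] and Qf = Q_hom[OF ab f]
  note LQf = L_hom[OF Qa Qb conjunct1[OF Qf]]
  have "post (Q0 a) (Cmp D (L0 (Q0 a)) (L0 (Q0 b)) b (\<epsilon> b) (onHom L (Q0 a) (Q0 b) (onHom Q a b f))) (r (Q0 a))
      = post (Q0 a) (\<epsilon> b) (prec (Q0 a) (r (Q0 b)) (onHom Q a b f))"
    using post_comp[OF Qa La Lb ab(2) _ _ r[OF Qa]] eb LQf by simp
  also have "\<dots> = prec (Q0 a) (s b) (onHom Q a b f)"
    using post_prec[OF Qa Qb Lb ab(2) _ _ r[OF Qb]] eb Qf by simp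
  also have "\<dots> = post (Q0 a) f (post (Q0 a) (\<epsilon> a) (r (Q0 a)))" using Qf ea by simp
  also have "\<dots> = post (Q0 a) (Cmp D (L0 (Q0 a)) a b f (\<epsilon> a)) (r (Q0 a))"
    using post_comp[OF Qa La ab _ f r[OF Qa]] ea by simp
  finally show "Cmp D (L0 (Q0 a)) a b f (\<epsilon> a) =
      Cmp D (L0 (Q0 a)) (L0 (Q0 b)) b (\<epsilon> b) (onHom L (Q0 a) (Q0 b) (onHom Q a b f))"
    using ea eb LQf f ab La Lb category_comp[OF D] by (intro left_eqI[OF Qa ab(2)]) auto
next
  fix a assume a: "a \<in> Obj C"
  note La = L0[OF a] note Qa = Q0[OF La] note LQ = L0[OF Qa]
  note ea = eta[OF a] and ee = eps[OF La]
  note Lf = L_hom[OF a Qa conjunct1[OF ea]]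
  have "post a (Cmp D (L0 a) (L0 (Q0 (L0 a))) (L0 a) (\<epsilon> (L0 a)) (onHom L a (Q0 (L0 a)) (\<eta> a))) (r a)
      = post a (\<epsilon> (L0 a)) (prec a (r (Q0 (L0 a))) (\<eta> a))"
    using post_comp[OF a La LQ La _ _ r[OF a]] Lf ee by simp
  also have "\<dots> = r a"
    using post_prec[OF a Qa LQ La conjunct1[OF ea] conjunct1[OF ee] r[OF Qa]] ea ee by simp
  also have "\<dots> = post a (Idn D (L0 a)) (r a)" using post_id[OF a La r[OF a]] by simp
  finally show "Cmp D (L0 a) (L0 (Q0 (L0 a))) (L0 a) (\<epsilon> (L0 a)) (onHom L a (Q0 (L0 a)) (\<eta> a)) = Idn D (L0 a)"
    using ee Lf La LQ category_comp[OF D] category_id[OF D] by (intro left_eqI[OF a La]) auto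
next
  fix b assume b: "b \<in> Obj D"
  note Qb = Q0[OF b] note LQ = L0[OF Qb] note QLQ = Q0[OF LQ]
  note ee = eps[OF b] and ea = eta[OF Qb]
  note Qf = Q_hom[OF LQ b conjunct1[OF ee]]
  have "prec (Q0 b) (s b) (Cmp C (Q0 b) (Q0 (L0 (Q0 b))) (Q0 b) (onHom Q (L0 (Q0 b)) b (\<epsilon> b)) (\<eta> (Q0 b)))
      = prec (Q0 b) (post (Q0 (L0 (Q0 b))) (\<epsilon> b) (s (L0 (Q0 b)))) (\<eta> (Q0 b))"
    using prec_comp[OF Qb QLQ Qb b _ _ s[OF b]] Qf ea by simp
  also have "\<dots> = s b"
    using post_prec[OF Qb QLQ LQ b conjunct1[OF ea] conjunct1[OF ee] s[OF LQ]] ea ee by simp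
  also have "\<dots> = prec (Q0 b) (s b) (Idn C (Q0 b))" using prec_id[OF Qb b s[OF b]] by simp
  finally show "Cmp C (Q0 b) (Q0 (L0 (Q0 b))) (Q0 b) (onHom Q (L0 (Q0 b)) b (\<epsilon> b)) (\<eta> (Q0 b)) = Idn C (Q0 b)"
    using ea Qf Qb QLQ category_comp[OF C] category_id[OF C] by (intro right_eqI[OF Qb b]) auto
qed (use eta eps in auto)

end

section \<open>Restricting an adjunction to a full subcategory\<close>

lemma full_subcategory_simps:
  "Obj (full_subcategory C P) = {a \<in> Obj C. P a}" "Hom (full_subcategory C P) = Hom C"
  "Cmp (full_subcategory C P) = Cmp C" "Idn (full_subcategory C P) = Idn C"
  by (simp_all add: full_subcategory_def)

lemma category_full_subcategory: "category C \<Longrightarrow> category (full_subcategory C P)"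
  unfolding category_def full_subcategory_simps by blast

text \<open>Functors, unit and counit stay the same. Fullness keeps all morphisms available, so the
  only point to secure is that \<open>G\<close> lands in the subcategory.\<close>

lemma adjunction_full_subcategory:
  assumes adj: "adjunction C D F G \<eta> \<epsilon>" and P: "\<And>b. b \<in> Obj D \<Longrightarrow> P (onObj G b)"
  shows "adjunction (full_subcategory C P) D F G \<eta> \<epsilon>"
proof -
  have F: "functor_between C D F" and G: "functor_between D C G"
    using adj by (auto simp: adjunction_def)
  then have cat: "category (full_subcategory C P)"
    by (auto simp: functor_between_def intro: category_full_subcategory)
  have "functor_between (full_subcategory C P) D F"
    using F cat unfolding functor_between_def full_subcategory_simps by simp
  moreover have "functor_between D (full_subcategory C P) G"
    using G cat P unfolding functor_between_def full_subcategory_simps by simp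
  moreover have "nat_transf (full_subcategory C P) (full_subcategory C P) id_functor (comp_functor G F) \<eta>"
    using adj unfolding adjunction_def nat_transf_def full_subcategory_simps by simp
  ultimately show ?thesis
    using adj unfolding adjunction_def full_subcategory_simps by simp
qed

section \<open>Local homeomorphisms\<close>

lemma continuous_map_local:
  assumes "\<And>x. x \<in> topspace X \<Longrightarrow> \<exists>U. openin X U \<and> x \<in> U \<and> continuous_map (subtopology X U) Y f"
  shows "continuous_map X Y f"
  unfolding continuous_map_def
proof (intro conjI allI impI)
  show "f \<in> topspace X \<rightarrow> topspace Y"
  proof
    fix x assume "x \<in> topspace X"
    from assms[OF this] obtain U where "openin X U" "x \<in> U" "continuous_map (subtopology X U) Y f" by blast
    then show "f x \<in> topspace Y"
      using openin_subset by (fastforce simp: continuous_map_def)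
  qed
  fix V assume V: "openin Y V"
  show "openin X {x \<in> topspace X. f x \<in> V}"
  proof (subst openin_subopen, intro ballI)
    fix x assume x: "x \<in> {x \<in> topspace X. f x \<in> V}"
    then obtain U where U: "openin X U" "x \<in> U" "continuous_map (subtopology X U) Y f"
      using assms[of x] by blast
    have "openin (subtopology X U) {x \<in> topspace (subtopology X U). f x \<in> V}"
      using openin_continuous_map_preimage[OF U(3) V] .
    then have "openin X {x \<in> topspace (subtopology X U). f x \<in> V}"
      using openin_trans_full[OF _ U(1)] by blast
    then show "\<exists>W. openin X W \<and> x \<in> W \<and> W \<subseteq> {x \<in> topspace X. f x \<in> V}"
      using x U by (intro exI[of _ "{x \<in> topspace (subtopology X U). f x \<in> V}"]) auto
  qed
qed

lemma local_homeomorphism_inj: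
  assumes p: "local_homeomorphism E X p" and e: "e \<in> topspace E"
  obtains V where "openin E V" "e \<in> V" "inj_on p V"
proof -
  obtain V where V: "openin E V" "e \<in> V" "openin X (p ` V)"
    "homeomorphic_map (subtopology E V) (subtopology X (p ` V)) p"
    using p e unfolding local_homeomorphism_def by blast
  have "inj_on p (topspace (subtopology E V))" using homeomorphic_imp_injective_map[OF V(4)] .
  moreover have "topspace (subtopology E V) = V" using openin_subset[OF V(1)] by auto
  ultimately show thesis using that V by simp
qed

text \<open>On an open set where it is injective, a continuous open map restricts to a homeomorphism
  onto its image.\<close>

lemma local_homeomorphismI:
  assumes cont: "continuous_map E X p" and op: "\<And>U. openin E U \<Longrightarrow> openin X (p ` U)"
    and inj: "\<And>e. e \<in> topspace E \<Longrightarrow> \<exists>U. openin E U \<and> e \<in> U \<and> inj_on p U"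
  shows "local_homeomorphism E X p"
  unfolding local_homeomorphism_def
proof (intro conjI cont ballI)
  fix e assume "e \<in> topspace E"
  then obtain U where U: "openin E U" "e \<in> U" "inj_on p U" using inj by blast
  have t: "topspace (subtopology E U) = U" using openin_subset[OF U(1)] by auto
  have "homeomorphic_map (subtopology E U) (subtopology X (p ` U)) p"
  proof (rule bijective_open_imp_homeomorphic_map)
    show "continuous_map (subtopology E U) (subtopology X (p ` U)) p"
      using cont by (auto simp: continuous_map_in_subtopology continuous_map_from_subtopology)
    show "open_map (subtopology E U) (subtopology X (p ` U)) p"
      unfolding open_map_def
    proof (intro allI impI)
      fix W assume W: "openin (subtopology E U) W"
      then have "openin E W" "W \<subseteq> U" using openin_trans_full[OF _ U(1)] openin_subset[OF W] t by auto
      then have "openin X (p ` W)" "p ` W \<subseteq> p ` U" using op by auto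
      then show "openin (subtopology X (p ` U)) (p ` W)" by (auto simp: openin_subtopology)
    qed
    show "p ` topspace (subtopology E U) = topspace (subtopology X (p ` U))"
      using t openin_subset[OF op[OF U(1)]] by auto
  qed (use t U in simp)
  then show "\<exists>U. openin E U \<and> e \<in> U \<and> openin X (p ` U) \<and>
      homeomorphic_map (subtopology E U) (subtopology X (p ` U)) p"
    using U op by blast
qed

lemma local_section:
  assumes p: "local_homeomorphism E X p" and e: "e \<in> topspace E"
  obtains U s where "openin X U" "p e \<in> U" "continuous_map (subtopology X U) E s"
    "\<And>x. x \<in> U \<Longrightarrow> p (s x) = x" "s (p e) = e"
proof -
  obtain V where V: "openin E V" "e \<in> V" "openin X (p ` V)"
    "homeomorphic_map (subtopology E V) (subtopology X (p ` V)) p"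
    using p e unfolding local_homeomorphism_def by blast
  obtain s where s: "homeomorphic_maps (subtopology E V) (subtopology X (p ` V)) p s"
    using V(4) by (auto simp: homeomorphic_map_maps)
  have tE: "topspace (subtopology E V) = V" and tX: "topspace (subtopology X (p ` V)) = p ` V"
    using openin_subset[OF V(1)] openin_subset[OF V(3)] by auto
  show thesis
  proof (rule that[OF V(3), of s])
    show "continuous_map (subtopology X (p ` V)) E s"
      using s by (auto simp: homeomorphic_maps_def continuous_map_in_subtopology)
    show "p (s x) = x" if "x \<in> p ` V" for x
      using s that tX by (auto simp: homeomorphic_maps_def)
    show "s (p e) = e" using s V(2) tE by (auto simp: homeomorphic_maps_def)
  qed (use V(2) in blast)
qed

text \<open>Two lifts of one map that meet at \<open>t\<close> stay in a common sheet
  \<open>V\<close> near \<open>t\<close>, where \<open>p\<close> is injective, and so coincide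
  there. This is the source of the later statements that sections with a common value agree
  nearby.\<close>

lemma openin_equalizer:
  assumes p: "local_homeomorphism E X p" and f: "continuous_map T E f" and g: "continuous_map T E g"
    and eq: "\<And>t. t \<in> topspace T \<Longrightarrow> p (f t) = p (g t)"
  shows "openin T {t \<in> topspace T. f t = g t}"
proof (subst openin_subopen, intro ballI)
  fix t assume t: "t \<in> {t \<in> topspace T. f t = g t}"
  then have "f t \<in> topspace E" using continuous_map_image_subset_topspace[OF f] by blast
  then obtain V where V: "openin E V" "f t \<in> V" "inj_on p V"
    using local_homeomorphism_inj[OF p] by blast
  let ?W = "{t \<in> topspace T. f t \<in> V} \<inter> {t \<in> topspace T. g t \<in> V}"
  have "openin T ?W" using openin_continuous_map_preimage[OF f V(1)] openin_continuous_map_preimage[OF g V(1)] by blast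
  moreover have "?W \<subseteq> {t \<in> topspace T. f t = g t}"
    using eq V(3) by (auto dest: inj_onD)
  moreover have "t \<in> ?W"
  proof -
    have "t \<in> topspace T" "g t \<in> V" using t V(2) by auto
    then show ?thesis using V(2) by blast
  qed
  ultimately show "\<exists>W. openin T W \<and> t \<in> W \<and> W \<subseteq> {t \<in> topspace T. f t = g t}"
    by blast
qed

section \<open>Equivariant sheaves\<close>

abbreviation tspace :: "('g, 'x, 'r, 'e) sheaf \<Rightarrow> 'e set" where
  "tspace E \<equiv> topspace (tot E)"

abbreviation base :: "('g, 'x) gspace \<Rightarrow> 'x set" where
  "base B \<equiv> topspace (pts B)"

lemma stalk_simps [simp]:
  "carrier (stalk E x) = {e \<in> tspace E. prj E e = x}" "zero (stalk E x) = ezero E x"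
  "add (stalk E x) = esum E" "smult (stalk E x) = escal E"
  by (simp_all add: stalk_def)

lemma sheaf_lh: "is_sheaf R B E \<Longrightarrow> local_homeomorphism (tot E) (pts B) (prj E)"
  by (simp add: is_sheaf_def)

lemma sheaf_prj_cont: "is_sheaf R B E \<Longrightarrow> continuous_map (tot E) (pts B) (prj E)"
  by (simp add: is_sheaf_def local_homeomorphism_def)

lemma sheaf_prj: "\<lbrakk>is_sheaf R B E; e \<in> tspace E\<rbrakk> \<Longrightarrow> prj E e \<in> base B"
  using sheaf_prj_cont by (fastforce simp: continuous_map_def)

lemma sheaf_act: "is_sheaf R B E \<Longrightarrow> group_action (grp B) (tspace E) (emov E)"
  by (simp add: is_sheaf_def continuous_action_def)

lemma sheaf_mov_closed: "\<lbrakk>is_sheaf R B E; g \<in> carrier (grp B); e \<in> tspace E\<rbrakk> \<Longrightarrow> emov E g e \<in> tspace E"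
  using group_action_closed[of "grp B" "tspace E" "emov E" g e] sheaf_act[of R B E] by blast

lemma sheaf_prj_mov:
  "\<lbrakk>is_sheaf R B E; g \<in> carrier (grp B); e \<in> tspace E\<rbrakk> \<Longrightarrow> prj E (emov E g e) = mov B g (prj E e)"
  by (simp add: is_sheaf_def)

lemma sheaf_module: "\<lbrakk>is_sheaf R B E; x \<in> base B\<rbrakk> \<Longrightarrow> left_module R (stalk E x)"
  by (simp add: is_sheaf_def)

lemma left_module_abelian_group: "left_module R M \<Longrightarrow> abelian_group M"
  by (simp add: left_module_def)

lemma sheaf_zero: "\<lbrakk>is_sheaf R B E; x \<in> base B\<rbrakk> \<Longrightarrow> ezero E x \<in> tspace E \<and> prj E (ezero E x) = x"
  using abelian_groupE(2)[OF left_module_abelian_group[OF sheaf_module]] by fastforce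

lemma sheaf_add:
  assumes E: "is_sheaf R B E" and ab: "a \<in> tspace E" "b \<in> tspace E" "prj E a = prj E b"
  shows "esum E a b \<in> tspace E \<and> prj E (esum E a b) = prj E b"
  using abelian_groupE(1)[OF left_module_abelian_group[OF sheaf_module[OF E sheaf_prj[OF E ab(2)]]], of a b] ab
  by simp

lemma sheaf_scal:
  assumes E: "is_sheaf R B E" and r: "r \<in> carrier R" and a: "a \<in> tspace E"
  shows "escal E r a \<in> tspace E \<and> prj E (escal E r a) = prj E a"
  using left_module.smult_closed[OF sheaf_module[OF E sheaf_prj[OF E a]] r, of a] a
  unfolding stalk_simps by blast

lemma sheaf_sub:
  assumes E: "is_sheaf R B E" and ab: "a \<in> tspace E" "b \<in> tspace E" "prj E a = x" "prj E b = x"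
  shows "a \<ominus>\<^bsub>stalk E x\<^esub> b \<in> tspace E \<and> prj E (a \<ominus>\<^bsub>stalk E x\<^esub> b) = x"
proof -
  have x: "x \<in> base B" using sheaf_prj[OF E ab(1)] ab(3) by simp
  interpret abelian_group "stalk E x"
    by (rule left_module_abelian_group[OF sheaf_module[OF E x]])
  show ?thesis using minus_closed[of a b] ab by simp
qed

lemma sheaf_mov_linear:
  "\<lbrakk>is_sheaf R B E; g \<in> carrier (grp B); x \<in> base B\<rbrakk>
    \<Longrightarrow> left_linear R (stalk E x) (stalk E (mov B g x)) (emov E g)"
  by (simp add: is_sheaf_def)

lemma sheaf_mov_add:
  "\<lbrakk>is_sheaf R B E; g \<in> carrier (grp B); a \<in> tspace E; b \<in> tspace E; prj E a = prj E b\<rbrakk>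
    \<Longrightarrow> emov E g (esum E a b) = esum E (emov E g a) (emov E g b)"
  using sheaf_mov_linear[of R B E g "prj E b"] sheaf_prj[of R B E b] by (simp add: left_linear_def)

lemma sheaf_mov_scal:
  "\<lbrakk>is_sheaf R B E; g \<in> carrier (grp B); r \<in> carrier R; a \<in> tspace E\<rbrakk>
    \<Longrightarrow> emov E g (escal E r a) = escal E r (emov E g a)"
  using sheaf_mov_linear[of R B E g "prj E a"] sheaf_prj[of R B E a] by (simp add: left_linear_def)

lemma sheaf_sub_cont:
  assumes E: "is_sheaf R B E" and f: "continuous_map T (tot E) f" and g: "continuous_map T (tot E) g"
    and eq: "\<And>t. t \<in> topspace T \<Longrightarrow> prj E (f t) = prj E (g t)"
  shows "continuous_map T (tot E) (\<lambda>t. f t \<ominus>\<^bsub>stalk E (prj E (f t))\<^esub> g t)"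
proof -
  have "continuous_map T (prod_topology (tot E) (tot E)) (\<lambda>t. (f t, g t))"
    using f g by (rule continuous_map_pairedI)
  then have "continuous_map T
      (subtopology (prod_topology (tot E) (tot E)) {(a, b). prj E a = prj E b}) (\<lambda>t. (f t, g t))"
    using eq by (auto simp: continuous_map_in_subtopology)
  moreover have "continuous_map
       (subtopology (prod_topology (tot E) (tot E)) {(a, b). prj E a = prj E b}) (tot E)
       (\<lambda>(a, b). a \<ominus>\<^bsub>stalk E (prj E a)\<^esub> b)"
    using E by (simp add: is_sheaf_def)
  ultimately show ?thesis
    using continuous_map_compose by (fastforce simp: o_def)
qed

text \<open>Locally the zero section is \<open>s\<close> minus itself for any local section
  \<open>s\<close>, and subtraction is continuous.\<close>

lemma sheaf_zero_cont:
  assumes E: "is_sheaf R B E"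
  shows "continuous_map (pts B) (tot E) (ezero E)"
proof (rule continuous_map_local)
  fix x assume x: "x \<in> base B"
  note z = sheaf_zero[OF E x]
  obtain U s where U: "openin (pts B) U" "prj E (ezero E x) \<in> U"
    "continuous_map (subtopology (pts B) U) (tot E) s" "\<And>x. x \<in> U \<Longrightarrow> prj E (s x) = x"
    using local_section[OF sheaf_lh[OF E] conjunct1[OF z]] by metis
  have tU: "topspace (subtopology (pts B) U) = U" using openin_subset[OF U(1)] by auto
  have "continuous_map (subtopology (pts B) U) (tot E) (\<lambda>t. s t \<ominus>\<^bsub>stalk E (prj E (s t))\<^esub> s t)"
    using sheaf_sub_cont[OF E U(3,3)] by blast
  moreover have "s t \<ominus>\<^bsub>stalk E (prj E (s t))\<^esub> s t = ezero E t" if t: "t \<in> U" for t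
  proof -
    have "t \<in> base B" using openin_subset[OF U(1)] t by blast
    then interpret abelian_group "stalk E t"
      using left_module_abelian_group[OF sheaf_module[OF E]] by blast
    have "s t \<in> carrier (stalk E t)" using U(3) U(4)[OF t] t tU by (auto simp: continuous_map_def)
    then show ?thesis using U(4)[OF t] r_neg[of "s t"] by (simp add: a_minus_def)
  qed
  ultimately have "continuous_map (subtopology (pts B) U) (tot E) (ezero E)"
    by (rule continuous_map_eq) (simp add: tU)
  then show "\<exists>U. openin (pts B) U \<and> x \<in> U \<and> continuous_map (subtopology (pts B) U) (tot E) (ezero E)"
    using U(1) U(2)[unfolded conjunct2[OF z]] by (intro exI[of _ U] conjI)
qed

text \<open>It is subtraction that is continuous by definition, so the sum is rewritten as
  \<open>f - (0 - g)\<close>.\<close>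

lemma sheaf_add_cont:
  assumes E: "is_sheaf R B E" and f: "continuous_map T (tot E) f" and g: "continuous_map T (tot E) g"
    and eq: "\<And>t. t \<in> topspace T \<Longrightarrow> prj E (f t) = prj E (g t)"
  shows "continuous_map T (tot E) (\<lambda>t. esum E (f t) (g t))"
proof -
  have gt: "g t \<in> tspace E" "f t \<in> tspace E" if "t \<in> topspace T" for t
    using f g that by (auto simp: continuous_map_def)
  define z where "z t = ezero E (prj E (g t))" for t
  have z: "continuous_map T (tot E) z"
    unfolding z_def
    using continuous_map_compose[OF continuous_map_compose[OF g sheaf_prj_cont[OF E]] sheaf_zero_cont[OF E]]
    by (simp add: o_def)
  have zt: "z t \<in> tspace E \<and> prj E (z t) = prj E (g t)" if "t \<in> topspace T" for t
    using sheaf_zero[OF E sheaf_prj[OF E gt(1)[OF that]]] by (simp add: z_def)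
  define n where "n t = z t \<ominus>\<^bsub>stalk E (prj E (z t))\<^esub> g t" for t
  have n: "continuous_map T (tot E) n"
    unfolding n_def by (rule sheaf_sub_cont[OF E z g]) (use zt in auto)
  have nt: "n t \<in> tspace E \<and> prj E (n t) = prj E (g t)" if "t \<in> topspace T" for t
    using sheaf_sub[OF E, of "z t" "g t"] zt[OF that] gt[OF that] by (simp add: n_def)
  have "continuous_map T (tot E) (\<lambda>t. f t \<ominus>\<^bsub>stalk E (prj E (f t))\<^esub> n t)"
    by (rule sheaf_sub_cont[OF E f n]) (use nt eq in auto)
  moreover have "f t \<ominus>\<^bsub>stalk E (prj E (f t))\<^esub> n t = esum E (f t) (g t)" if t: "t \<in> topspace T" for t
  proof -
    interpret abelian_group "stalk E (prj E (g t))"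
      using left_module_abelian_group[OF sheaf_module[OF E sheaf_prj[OF E gt(1)[OF t]]]] .
    have c: "f t \<in> carrier (stalk E (prj E (g t)))" "g t \<in> carrier (stalk E (prj E (g t)))"
      using gt[OF t] eq[OF t] by auto
    have "f t \<ominus>\<^bsub>stalk E (prj E (g t))\<^esub> (\<zero>\<^bsub>stalk E (prj E (g t))\<^esub> \<ominus>\<^bsub>stalk E (prj E (g t))\<^esub> g t)
        = f t \<oplus>\<^bsub>stalk E (prj E (g t))\<^esub> g t"
      using c minus_minus[of "g t"] a_inv_closed[OF c(2)] l_zero[of "\<ominus>\<^bsub>stalk E (prj E (g t))\<^esub> g t"]
      unfolding a_minus_def by presburger
    then show ?thesis using zt[OF t] eq[OF t] by (simp add: n_def z_def)
  qed
  ultimately show ?thesis by (rule continuous_map_eq)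
qed

lemma sheaf_scal_cont:
  assumes E: "is_sheaf R B E" and f: "continuous_map T (tot E) f" and r: "r \<in> carrier R"
  shows "continuous_map T (tot E) (\<lambda>t. escal E r (f t))"
proof -
  have "continuous_map (tot E) (tot E) (escal E r)" using E r by (simp add: is_sheaf_def)
  then show ?thesis using continuous_map_compose[OF f] by (fastforce simp: o_def)
qed

lemma sheaf_mov_cont:
  assumes E: "is_sheaf R B E" and f: "continuous_map T (tot E) f" and g: "continuous_map T (gtop B) g"
  shows "continuous_map T (tot E) (\<lambda>t. emov E (g t) (f t))"
proof -
  have "continuous_map (prod_topology (gtop B) (tot E)) (tot E) (\<lambda>(g, x). emov E g x)"
    using E by (simp add: is_sheaf_def continuous_action_def)
  then show ?thesis
    using continuous_map_compose[OF continuous_map_pairedI[OF g f]] by (fastforce simp: o_def)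
qed

subsection \<open>Morphisms\<close>

lemma sheaf_homI:
  assumes "f \<in> extensional (tspace E)" "continuous_map (tot E) (tot F) f"
    and "\<And>g e. \<lbrakk>g \<in> carrier (grp B); e \<in> tspace E\<rbrakk> \<Longrightarrow> f (emov E g e) = emov F g (f e)"
    and "\<And>e. e \<in> tspace E \<Longrightarrow> prj F (f e) = prj E e"
    and "\<And>a b. \<lbrakk>a \<in> tspace E; b \<in> tspace E; prj E a = prj E b; prj E b \<in> base B\<rbrakk>
      \<Longrightarrow> f (esum E a b) = esum F (f a) (f b)"
    and "\<And>r a. \<lbrakk>r \<in> carrier R; a \<in> tspace E; prj E a \<in> base B\<rbrakk> \<Longrightarrow> f (escal E r a) = escal F r (f a)"
  shows "f \<in> sheaf_hom R B E F"
  using assms continuous_map_image_subset_topspace[OF assms(2)]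
  unfolding sheaf_hom_def left_linear_def stalk_simps
  by (intro CollectI conjI ballI funcsetI) (auto simp only: mem_Collect_eq image_subset_iff)

lemma hom_ext: "f \<in> sheaf_hom R B E F \<Longrightarrow> f \<in> extensional (tspace E)"
  by (simp add: sheaf_hom_def)

lemma hom_cont: "f \<in> sheaf_hom R B E F \<Longrightarrow> continuous_map (tot E) (tot F) f"
  by (simp add: sheaf_hom_def)

lemma hom_closed: "\<lbrakk>f \<in> sheaf_hom R B E F; e \<in> tspace E\<rbrakk> \<Longrightarrow> f e \<in> tspace F"
  by (auto simp: sheaf_hom_def continuous_map_def)

lemma hom_prj: "\<lbrakk>f \<in> sheaf_hom R B E F; e \<in> tspace E\<rbrakk> \<Longrightarrow> prj F (f e) = prj E e"
  by (simp add: sheaf_hom_def)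

lemma hom_mov: "\<lbrakk>f \<in> sheaf_hom R B E F; g \<in> carrier (grp B); e \<in> tspace E\<rbrakk> \<Longrightarrow> f (emov E g e) = emov F g (f e)"
  by (simp add: sheaf_hom_def)

lemma hom_add: "\<lbrakk>f \<in> sheaf_hom R B E F; a \<in> tspace E; b \<in> tspace E; prj E a = prj E b; prj E b \<in> base B\<rbrakk>
    \<Longrightarrow> f (esum E a b) = esum F (f a) (f b)"
  by (auto simp: sheaf_hom_def left_linear_def)

lemma hom_scal: "\<lbrakk>f \<in> sheaf_hom R B E F; r \<in> carrier R; a \<in> tspace E; prj E a \<in> base B\<rbrakk>
    \<Longrightarrow> f (escal E r a) = escal F r (f a)"
  by (auto simp: sheaf_hom_def left_linear_def)

lemma hom_eqI:
  assumes f: "f \<in> sheaf_hom R B E F" and f': "f' \<in> sheaf_hom R B E F"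
    and eq: "\<And>e. e \<in> tspace E \<Longrightarrow> f e = f' e"
  shows "f = f'"
  using hom_ext[OF f] hom_ext[OF f'] eq by (rule extensionalityI)

text \<open>The closure properties of the source on which identities and composites of morphisms
  rely. Inverse images enter the later arguments through this condition.\<close>

definition ops_closed :: "('r, 's) ring_scheme \<Rightarrow> ('g, 'x) gspace \<Rightarrow> ('g, 'x, 'r, 'e) sheaf \<Rightarrow> bool" where
  "ops_closed R B E \<longleftrightarrow>
     (\<forall>g\<in>carrier (grp B). \<forall>e\<in>tspace E. emov E g e \<in> tspace E) \<and>
     (\<forall>a\<in>tspace E. \<forall>b\<in>tspace E. prj E a = prj E b \<longrightarrow> esum E a b \<in> tspace E) \<and>
     (\<forall>r\<in>carrier R. \<forall>a\<in>tspace E. escal E r a \<in> tspace E)"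

lemma sheaf_ops_closed: "is_sheaf R B E \<Longrightarrow> ops_closed R B E"
  unfolding ops_closed_def by (simp add: sheaf_mov_closed sheaf_add sheaf_scal)

lemma sheaf_id_hom:
  assumes "ops_closed R B E"
  shows "sheaf_id E \<in> sheaf_hom R B E E"
proof (rule sheaf_homI)
  show "continuous_map (tot E) (tot E) (sheaf_id E)"
    by (rule continuous_map_eq[OF continuous_map_id]) (simp add: sheaf_id_def)
qed (use assms in \<open>simp_all add: sheaf_id_def ops_closed_def\<close>)

lemma compose_hom:
  assumes E: "ops_closed R B E" and f: "f \<in> sheaf_hom R B E F" and g: "g \<in> sheaf_hom R B F H"
  shows "compose (tspace E) g f \<in> sheaf_hom R B E H"
proof (rule sheaf_homI)
  show "continuous_map (tot E) (tot H) (compose (tspace E) g f)"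
    using continuous_map_compose[OF hom_cont[OF f] hom_cont[OF g]]
    by (rule continuous_map_eq) (simp add: compose_def)
qed (use E hom_closed[OF f] hom_prj[OF f] hom_prj[OF g] hom_mov[OF f] hom_mov[OF g] hom_add[OF f]
    hom_add[OF g] hom_scal[OF f] hom_scal[OF g] in \<open>simp_all add: compose_def ops_closed_def\<close>)

lemma compose_sheaf_id_right: "f \<in> sheaf_hom R B E F \<Longrightarrow> compose (tspace E) f (sheaf_id E) = f"
  by (rule extensionalityI[OF compose_extensional hom_ext]) (simp_all add: compose_def sheaf_id_def)

lemma compose_sheaf_id_left: "f \<in> sheaf_hom R B E F \<Longrightarrow> compose (tspace E) (sheaf_id F) f = f"
  by (rule extensionalityI[OF compose_extensional hom_ext])
    (simp_all add: compose_def sheaf_id_def hom_closed)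

lemma compose_hom_assoc:
  "f \<in> sheaf_hom R B E F \<Longrightarrow>
    compose (tspace E) h (compose (tspace E) g f) = compose (tspace E) (compose (tspace F) h g) f"
  by (rule extensionalityI[OF compose_extensional compose_extensional])
    (simp add: compose_def hom_closed)

lemma category_Sheaves: "category (Sheaves R B)"
  unfolding category_def Sheaves_def
  by (auto intro: sheaf_id_hom compose_hom sheaf_ops_closed compose_sheaf_id_left compose_sheaf_id_right
      compose_hom_assoc)

text \<open>The point at issue is continuity of the inverse. Near \<open>y\<close> a local section
  \<open>s\<close> through the preimage of \<open>y\<close> gives the candidate \<open>s\<close>
  after \<open>prj F\<close>, and it is the inverse wherever applying \<open>f\<close> to it gives
  the identity.\<close>

lemma bijective_hom_iso:
  assumes E: "is_sheaf R B E" and F: "is_sheaf R B F" and f: "f \<in> sheaf_hom R B E F"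
    and bij: "bij_betw f (tspace E) (tspace F)"
  shows "sheaf_iso R B E F f"
proof -
  define g where "g = restrict (inv_into (tspace E) f) (tspace F)"
  have gf: "g (f e) = e" if "e \<in> tspace E" for e
    using that bij hom_closed[OF f] by (simp add: g_def bij_betw_def)
  have fg: "f (g y) = y" and g_closed: "g y \<in> tspace E" if "y \<in> tspace F" for y
    using that bij by (auto simp: g_def bij_betw_inv_into_right bij_betw_def intro: inv_into_into f_inv_into_f)
  have prj_g: "prj E (g y) = prj F y" if "y \<in> tspace F" for y
    using hom_prj[OF f g_closed[OF that]] fg[OF that] by simp
  have g: "g \<in> sheaf_hom R B F E"
  proof (rule sheaf_homI)
    show "g \<in> extensional (tspace F)" by (simp add: g_def)
    show "continuous_map (tot F) (tot E) g"
    proof (rule continuous_map_local)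
      fix y assume y: "y \<in> tspace F"
      obtain U s where U: "openin (pts B) U" "prj E (g y) \<in> U"
        "continuous_map (subtopology (pts B) U) (tot E) s" "\<And>x. x \<in> U \<Longrightarrow> prj E (s x) = x"
        "s (prj E (g y)) = g y"
        using local_section[OF sheaf_lh[OF E] g_closed[OF y]] by metis
      have tU: "topspace (subtopology (pts B) U) = U" using openin_subset[OF U(1)] by auto
      let ?V = "{y \<in> tspace F. prj F y \<in> U}"
      have V: "openin (tot F) ?V" using openin_continuous_map_preimage[OF sheaf_prj_cont[OF F] U(1)] .
      have "continuous_map (subtopology (tot F) ?V) (subtopology (pts B) U) (prj F)"
        using sheaf_prj_cont[OF F] by (auto simp: continuous_map_in_subtopology continuous_map_from_subtopology)
      then have sp: "continuous_map (subtopology (tot F) ?V) (tot E) (\<lambda>y. s (prj F y))"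
        using continuous_map_compose[OF _ U(3)] by (fastforce simp: o_def)
      then have fsp: "continuous_map (subtopology (tot F) ?V) (tot F) (\<lambda>y. f (s (prj F y)))"
        using continuous_map_compose[OF _ hom_cont[OF f]] by (fastforce simp: o_def)
      have s_closed: "s x \<in> tspace E" if "x \<in> U" for x
        using U(3) tU that by (auto simp: continuous_map_def)
      \<comment> \<open>Openness of this locus holds because \<open>f\<close> after the candidate
        and the identity are two lifts of \<open>prj F\<close>.\<close>
      let ?O = "{y' \<in> topspace (subtopology (tot F) ?V). f (s (prj F y')) = y'}"
      have "openin (subtopology (tot F) ?V) ?O"
        by (rule openin_equalizer[OF sheaf_lh[OF F] fsp])
          (use hom_prj[OF f s_closed] U(4) in \<open>auto simp: continuous_map_from_subtopology\<close>)
      then have O: "openin (tot F) ?O" using openin_trans_full[OF _ V] by blast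
      have "y \<in> ?O" using y U(2,5) prj_g fg by auto
      moreover have "continuous_map (subtopology (tot F) ?O) (tot E) g"
      proof (rule continuous_map_eq)
        show "continuous_map (subtopology (tot F) ?O) (tot E) (\<lambda>y. s (prj F y))"
          using continuous_map_from_subtopology_mono[OF sp, of ?O] by auto
        show "s (prj F y') = g y'" if y': "y' \<in> topspace (subtopology (tot F) ?O)" for y'
        proof -
          have "prj F y' \<in> U" "f (s (prj F y')) = y'" using y' by auto
          then show ?thesis using gf[OF s_closed] by metis
        qed
      qed
      ultimately show "\<exists>O'. openin (tot F) O' \<and> y \<in> O' \<and> continuous_map (subtopology (tot F) O') (tot E) g"
        using O by blast
    qed
    show "g (emov F h y) = emov E h (g y)" if "h \<in> carrier (grp B)" "y \<in> tspace F" for h y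
      using that gf[OF sheaf_mov_closed[OF E that(1) g_closed[OF that(2)]]] hom_mov[OF f that(1) g_closed] fg by simp
    show "prj E (g e) = prj F e" if "e \<in> tspace F" for e using prj_g that .
    show "g (esum F a b) = esum E (g a) (g b)"
      if *: "a \<in> tspace F" "b \<in> tspace F" "prj F a = prj F b" "prj F b \<in> base B" for a b
    proof -
      have p: "prj E (g a) = prj E (g b)" "prj E (g b) \<in> base B" using * prj_g by auto
      have "f (esum E (g a) (g b)) = esum F a b"
        using hom_add[OF f g_closed[OF *(1)] g_closed[OF *(2)] p] fg * by simp
      then show ?thesis using gf sheaf_add[OF E g_closed[OF *(1)] g_closed[OF *(2)] p(1)] by metis
    qed
    show "g (escal F r a) = escal E r (g a)"
      if *: "r \<in> carrier R" "a \<in> tspace F" "prj F a \<in> base B" for r a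
    proof -
      have "f (escal E r (g a)) = escal F r a"
        using hom_scal[OF f *(1) g_closed[OF *(2)]] prj_g fg * by simp
      then show ?thesis using gf sheaf_scal[OF E *(1) g_closed[OF *(2)]] by metis
    qed
  qed
  show ?thesis
    unfolding sheaf_iso_def
    by (intro conjI f bexI[OF _ g]) (auto simp: compose_def sheaf_id_def gf fg)
qed

lemma sheaf_iso_bij:
  assumes "sheaf_iso R B E F f"
  shows "bij_betw f (tspace E) (tspace F)"
proof -
  obtain g where f: "f \<in> sheaf_hom R B E F" and g: "g \<in> sheaf_hom R B F E"
    and gf: "compose (tspace E) g f = sheaf_id E" and fg: "compose (tspace F) f g = sheaf_id F"
    using assms unfolding sheaf_iso_def by blast
  have "g (f e) = e" if "e \<in> tspace E" for e
    using fun_cong[OF gf, of e] that by (simp add: compose_def sheaf_id_def)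
  moreover have "f (g e) = e" if "e \<in> tspace F" for e
    using fun_cong[OF fg, of e] that by (simp add: compose_def sheaf_id_def)
  ultimately show ?thesis
    using hom_closed[OF f] hom_closed[OF g] by (intro bij_betw_byWitness[where f' = g]) auto
qed

subsection \<open>Sheaves over discrete spaces\<close>

text \<open>A singleton is cut out of a sheet of \<open>prj E\<close> by the preimage of the open
  point below it.\<close>

lemma sheaf_discrete:
  assumes E: "is_sheaf R B E" and B: "pts B = discrete_topology (base B)"
  shows "tot E = discrete_topology (tspace E)"
proof -
  have "openin (tot E) {e}" if e: "e \<in> tspace E" for e
  proof -
    obtain V where V: "openin (tot E) V" "e \<in> V" "inj_on (prj E) V"
      using local_homeomorphism_inj[OF sheaf_lh[OF E] e] .
    have "openin (pts B) {prj E e}"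
      using sheaf_prj[OF E e] by (subst B) simp
    then have "openin (tot E) (V \<inter> {e' \<in> tspace E. prj E e' \<in> {prj E e}})"
      using openin_continuous_map_preimage[OF sheaf_prj_cont[OF E]] V(1) by blast
    moreover have "V \<inter> {e' \<in> tspace E. prj E e' \<in> {prj E e}} = {e}"
      using V e by (auto dest: inj_onD)
    ultimately show ?thesis by simp
  qed
  then show ?thesis by (metis discrete_topology_unique)
qed

text \<open>Over a discrete group and a discrete space all continuity conditions hold automatically,
  which leaves the algebraic part of the definition.\<close>

lemma is_sheaf_discreteI:
  assumes B: "pts B = discrete_topology (base B)" and G: "gtop B = discrete_topology (carrier (grp B))"
    and E: "tot E = discrete_topology (tspace E)"
    and act: "group_action (grp B) (tspace E) (emov E)"
    and prj: "\<And>e. e \<in> tspace E \<Longrightarrow> prj E e \<in> base B"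
    and prj_mov: "\<And>g e. \<lbrakk>g \<in> carrier (grp B); e \<in> tspace E\<rbrakk> \<Longrightarrow> prj E (emov E g e) = mov B g (prj E e)"
    and mod: "\<And>x. x \<in> base B \<Longrightarrow> left_module R (stalk E x)"
    and lin: "\<And>g x. \<lbrakk>g \<in> carrier (grp B); x \<in> base B\<rbrakk> \<Longrightarrow> left_linear R (stalk E x) (stalk E (mov B g x)) (emov E g)"
  shows "is_sheaf R B E"
proof -
  have cont: "continuous_map (tot E) Y f \<longleftrightarrow> f \<in> tspace E \<rightarrow> topspace Y" for Y :: "'y topology" and f
    by (subst E) (auto)
  have "local_homeomorphism (tot E) (pts B) (prj E)"
  proof (rule local_homeomorphismI)
    show "openin (pts B) (prj E ` U)" if "openin (tot E) U" for U
      using openin_subset[OF that] prj by (subst B) auto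
    show "\<exists>U. openin (tot E) U \<and> e \<in> U \<and> inj_on (prj E) U" if "e \<in> tspace E" for e
      using that by (intro exI[of _ "{e}"]) (subst E, auto)
  qed (use prj in \<open>simp add: cont\<close>)
  moreover have "continuous_action (grp B) (gtop B) (tot E) (emov E)"
  proof -
    have "prod_topology (gtop B) (tot E) = discrete_topology (carrier (grp B) \<times> tspace E)"
      by (metis E G prod_topology_discrete_topology)
    then show ?thesis
      using act group_action_closed[OF act] by (auto simp: continuous_action_def)
  qed
  moreover have "continuous_map (subtopology (prod_topology (tot E) (tot E)) {(a, b). prj E a = prj E b}) (tot E)
       (\<lambda>(a, b). a \<ominus>\<^bsub>stalk E (prj E a)\<^esub> b)"
  proof -
    have "prod_topology (tot E) (tot E) = discrete_topology (tspace E \<times> tspace E)"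
      by (metis E prod_topology_discrete_topology)
    moreover have "a \<ominus>\<^bsub>stalk E (prj E a)\<^esub> b \<in> tspace E"
      if *: "a \<in> tspace E" "b \<in> tspace E" "prj E a = prj E b" for a b
    proof -
      interpret abelian_group "stalk E (prj E a)"
        using left_module_abelian_group[OF mod[OF prj[OF *(1)]]] .
      show ?thesis using minus_closed[of a b] * by simp
    qed
    ultimately show ?thesis by (auto simp: subtopology_discrete_topology)
  qed
  moreover have "continuous_map (tot E) (tot E) (escal E r)" if r: "r \<in> carrier R" for r
  proof -
    have "escal E r a \<in> tspace E" if "a \<in> tspace E" for a
      using left_module.smult_closed[OF mod[OF prj[OF that]] r, of a] that by simp
    then show ?thesis by (simp add: cont)
  qed
  ultimately show ?thesis
    unfolding is_sheaf_def using prj_mov mod lin by blast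
qed

section \<open>Direct images along maps to discrete spaces\<close>

lemma group_idem_one:
  assumes "group G" "a \<in> carrier G" "a \<otimes>\<^bsub>G\<^esub> a = a"
  shows "a = \<one>\<^bsub>G\<^esub>"
  using assms group.l_cancel_one by metis

text \<open>Gives that additive maps between stalks preserve zero; it is applied to translations, to
  structure maps and to multiplication by the zero scalar.\<close>

lemma abelian_group_idem_zero:
  assumes "abelian_group M" "a \<in> carrier M" "a \<oplus>\<^bsub>M\<^esub> a = a"
  shows "a = \<zero>\<^bsub>M\<^esub>"
proof -
  interpret abelian_group M by fact
  show ?thesis using group_idem_one[OF a_group, of a] assms by simp
qed

lemma (in left_module) smult_zero_left:
  assumes x: "x \<in> carrier M"
  shows "\<zero>\<^bsub>R\<^esub> \<odot>\<^bsub>M\<^esub> x = \<zero>\<^bsub>M\<^esub>"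
proof (rule abelian_group_idem_zero[OF M.abelian_group_axioms])
  show "\<zero>\<^bsub>R\<^esub> \<odot>\<^bsub>M\<^esub> x \<oplus>\<^bsub>M\<^esub> \<zero>\<^bsub>R\<^esub> \<odot>\<^bsub>M\<^esub> x = \<zero>\<^bsub>R\<^esub> \<odot>\<^bsub>M\<^esub> x"
    using smult_l_distr[OF R.zero_closed R.zero_closed x] by simp
qed (use x smult_closed in simp)

text \<open>Yields negatives as scalar multiples, so that a model of a direct image has to provide
  sum, zero and scalar product but no separate negation.\<close>

lemma (in left_module) add_smult_minus_one:
  assumes x: "x \<in> carrier M"
  shows "(\<ominus>\<^bsub>R\<^esub> \<one>\<^bsub>R\<^esub>) \<odot>\<^bsub>M\<^esub> x \<oplus>\<^bsub>M\<^esub> x = \<zero>\<^bsub>M\<^esub>"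
proof -
  have "(\<ominus>\<^bsub>R\<^esub> \<one>\<^bsub>R\<^esub>) \<odot>\<^bsub>M\<^esub> x \<oplus>\<^bsub>M\<^esub> \<one>\<^bsub>R\<^esub> \<odot>\<^bsub>M\<^esub> x = \<zero>\<^bsub>R\<^esub> \<odot>\<^bsub>M\<^esub> x"
    using smult_l_distr[of "\<ominus>\<^bsub>R\<^esub> \<one>\<^bsub>R\<^esub>" "\<one>\<^bsub>R\<^esub>" x] x by (simp add: R.l_neg)
  then show ?thesis using smult_one[OF x] smult_zero_left[OF x] by simp
qed

lemma sheaf_mov_zero:
  assumes E: "is_sheaf R B E" and g: "g \<in> carrier (grp B)" and x: "x \<in> base B" "mov B g x \<in> base B"
  shows "emov E g (ezero E x) = ezero E (mov B g x)"
proof -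
  note z = sheaf_zero[OF E x(1)]
  have ab: "abelian_group (stalk E y)" if "y \<in> base B" for y
    using left_module_abelian_group[OF sheaf_module[OF E that]] .
  have "esum E (ezero E x) (ezero E x) = ezero E x"
    using abelian_groupE(5)[OF ab[OF x(1)], of "ezero E x"] z by simp
  then have "esum E (emov E g (ezero E x)) (emov E g (ezero E x)) = emov E g (ezero E x)"
    using sheaf_mov_add[OF E g, of "ezero E x" "ezero E x"] z by simp
  then show ?thesis
    using abelian_group_idem_zero[OF ab[OF x(2)], of "emov E g (ezero E x)"]
      sheaf_mov_closed[OF E g] sheaf_prj_mov[OF E g] z by simp
qed

text \<open>Invariant sections without extensionality, with the fixed point condition in the
  pointwise form \<open>s (n x) = n (s x)\<close>. Formulas such as
  \<open>x \<mapsto> a (x, d)\<close> can then be used directly, and \<open>inv_sections_iff\<close>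
  returns to the official notion.\<close>

definition inv_on ::
  "('g, 'x, 'h, 'y) change \<Rightarrow> ('g, 'x, 'r, 'e) sheaf \<Rightarrow> 'y set \<Rightarrow> ('x \<Rightarrow> 'e) \<Rightarrow> bool" where
  "inv_on C E V s \<longleftrightarrow> continuous_map (subtopology (pts (src C)) (pre C V)) (tot E) s \<and>
     (\<forall>x\<in>pre C V. prj E (s x) = x) \<and>
     (\<forall>n\<in>kernel (grp (src C)) (grp (tgt C)) (grp_map C). \<forall>x\<in>pre C V.
        s (mov (src C) n x) = emov E n (s x))"

lemma mem_pre: "x \<in> pre C V \<longleftrightarrow> x \<in> base (src C) \<and> pt_map C x \<in> V"
  by (simp add: pre_def)

lemma topspace_pre: "topspace (subtopology (pts (src C)) (pre C V)) = pre C V"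
  by (auto simp: pre_def)

lemma inv_on_closed: "\<lbrakk>inv_on C E V s; x \<in> pre C V\<rbrakk> \<Longrightarrow> s x \<in> tspace E"
  unfolding inv_on_def using continuous_map_image_subset_topspace topspace_pre by (metis image_subset_iff)

lemma inv_on_prj: "\<lbrakk>inv_on C E V s; x \<in> pre C V\<rbrakk> \<Longrightarrow> prj E (s x) = x"
  by (simp add: inv_on_def)

lemma inv_on_cont: "inv_on C E V s \<Longrightarrow> continuous_map (subtopology (pts (src C)) (pre C V)) (tot E) s"
  by (simp add: inv_on_def)

lemma inv_on_mov:
  "\<lbrakk>inv_on C E V s; n \<in> carrier (grp (src C)); grp_map C n = \<one>\<^bsub>grp (tgt C)\<^esub>; x \<in> pre C V\<rbrakk>
    \<Longrightarrow> s (mov (src C) n x) = emov E n (s x)"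
  by (simp add: inv_on_def kernel_def)

lemma inv_onI:
  assumes "continuous_map (subtopology (pts (src C)) (pre C V)) (tot E) s"
    and "\<And>x. x \<in> pre C V \<Longrightarrow> prj E (s x) = x"
    and "\<And>n x. \<lbrakk>n \<in> carrier (grp (src C)); grp_map C n = \<one>\<^bsub>grp (tgt C)\<^esub>; x \<in> pre C V\<rbrakk>
      \<Longrightarrow> s (mov (src C) n x) = emov E n (s x)"
  shows "inv_on C E V s"
  using assms by (simp add: inv_on_def kernel_def)

lemma inv_on_mono:
  assumes s: "inv_on C E V s" and "W \<subseteq> V"
  shows "inv_on C E W s"
proof -
  have "pre C W \<subseteq> pre C V" using assms by (auto simp: pre_def)
  then show ?thesis
    using s continuous_map_from_subtopology_mono unfolding inv_on_def by blast
qed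

text \<open>Transport of structure along \<open>c\<close> into another type. Giving the image the
  discrete topology is faithful because the sheaves copied lie over discrete spaces.\<close>

definition copy_sheaf :: "('e \<Rightarrow> 'f) \<Rightarrow> ('g, 'x, 'r, 'e) sheaf \<Rightarrow> ('g, 'x, 'r, 'f) sheaf" where
  "copy_sheaf c F = (let d = inv_into (tspace F) c in
     \<lparr>tot = discrete_topology (c ` tspace F),
      prj = (\<lambda>z. prj F (d z)),
      emov = (\<lambda>h. restrict (\<lambda>z. c (emov F h (d z))) (c ` tspace F)),
      ezero = (\<lambda>y. c (ezero F y)),
      esum = (\<lambda>a b. c (esum F (d a) (d b))),
      escal = (\<lambda>r a. c (escal F r (d a)))\<rparr>)"

lemma tspace_pull:
  "tspace (pull C D) = {(x, d). x \<in> base (src C) \<and> d \<in> tspace D \<and> pt_map C x = prj D d}"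
  by (auto simp: pull_def pull_top_def)

lemma mem_pull: "(x, d) \<in> tspace (pull C D) \<longleftrightarrow> d \<in> tspace D \<and> x \<in> pre C {prj D d}"
  by (auto simp: tspace_pull pre_def)

lemma pull_simps [simp]:
  "prj (pull C D) (x, d) = x"
  "esum (pull C D) (x, d) (x', d') = (x, esum D d d')"
  "escal (pull C D) r (x, d) = (x, escal D r d)"
  "ezero (pull C D) x = (x, ezero D (pt_map C x))"
  by (simp_all add: pull_def)

lemma emov_pull:
  "\<lbrakk>d \<in> tspace D; x \<in> pre C {prj D d}\<rbrakk> \<Longrightarrow> emov (pull C D) g (x, d) = (mov (src C) g x, emov D (grp_map C g) d)"
  using mem_pull[of x d C D] by (simp add: pull_def)

text \<open>Common setting of the projections from the limit, whose source is profinite, and of the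
  transition maps between finite levels. The target is discrete in both cases; of the source little
  more is recorded than an action by continuous maps.\<close>

locale discrete_change =
  fixes C :: "('g, 'x, 'h, 'y) change"
  assumes src_act: "group_action (grp (src C)) (base (src C)) (mov (src C))"
    and tgt_act: "group_action (grp (tgt C)) (base (tgt C)) (mov (tgt C))"
    and tgt_disc: "pts (tgt C) = discrete_topology (base (tgt C))"
    and tgt_gdisc: "gtop (tgt C) = discrete_topology (carrier (grp (tgt C)))"
    and grp_hom: "grp_map C \<in> hom (grp (src C)) (grp (tgt C))"
    and grp_surj: "grp_map C ` carrier (grp (src C)) = carrier (grp (tgt C))"
    and pt_cont: "continuous_map (pts (src C)) (pts (tgt C)) (pt_map C)"
    and equivariant: "\<lbrakk>g \<in> carrier (grp (src C)); x \<in> base (src C)\<rbrakk>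
      \<Longrightarrow> pt_map C (mov (src C) g x) = mov (tgt C) (grp_map C g) (pt_map C x)"
    and src_gtop: "topspace (gtop (src C)) = carrier (grp (src C))"
    and src_mov_cont: "g \<in> carrier (grp (src C)) \<Longrightarrow> continuous_map (pts (src C)) (pts (src C)) (mov (src C) g)"
begin

lemma openin_tgt: "openin (pts (tgt C)) V \<longleftrightarrow> V \<subseteq> base (tgt C)"
  by (subst tgt_disc) simp

lemma src_group: "group (grp (src C))" and tgt_group: "group (grp (tgt C))"
  using group_action_group src_act tgt_act by blast+

lemma grp_map_closed: "g \<in> carrier (grp (src C)) \<Longrightarrow> grp_map C g \<in> carrier (grp (tgt C))"
  using grp_surj by blast

lemma grp_map_one: "grp_map C \<one>\<^bsub>grp (src C)\<^esub> = \<one>\<^bsub>grp (tgt C)\<^esub>"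
  using hom_one[OF grp_hom src_group tgt_group] .

lemma grp_map_mult:
  "\<lbrakk>g \<in> carrier (grp (src C)); h \<in> carrier (grp (src C))\<rbrakk>
    \<Longrightarrow> grp_map C (g \<otimes>\<^bsub>grp (src C)\<^esub> h) = grp_map C g \<otimes>\<^bsub>grp (tgt C)\<^esub> grp_map C h"
  using hom_mult[OF grp_hom] .

lemma grp_map_inv:
  assumes g: "g \<in> carrier (grp (src C))"
  shows "grp_map C (inv\<^bsub>grp (src C)\<^esub> g) = inv\<^bsub>grp (tgt C)\<^esub> (grp_map C g)"
proof -
  interpret group_hom "grp (src C)" "grp (tgt C)" "grp_map C"
    using src_group tgt_group grp_hom by (simp add: group_hom_def group_hom_axioms_def)
  show ?thesis using hom_inv[OF g] .
qed

lemma pt_map_closed: "x \<in> base (src C) \<Longrightarrow> pt_map C x \<in> base (tgt C)"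
  using continuous_map_image_subset_topspace[OF pt_cont] by blast

lemma openin_pre: "openin (pts (src C)) (pre C V)"
proof -
  have "openin (pts (src C)) {x \<in> base (src C). pt_map C x \<in> V \<inter> base (tgt C)}"
    by (rule openin_continuous_map_preimage[OF pt_cont]) (simp add: openin_tgt)
  also have "{x \<in> base (src C). pt_map C x \<in> V \<inter> base (tgt C)} = pre C V"
    using pt_map_closed by (auto simp: pre_def)
  finally show ?thesis .
qed

lemma mov_pre:
  assumes "g \<in> carrier (grp (src C))" "x \<in> pre C {y}"
  shows "mov (src C) g x \<in> pre C {mov (tgt C) (grp_map C g) y}"
  using assms equivariant group_action_closed[OF src_act] by (auto simp: mem_pre)

lemma mov_kernel_pre:
  assumes n: "n \<in> carrier (grp (src C))" "grp_map C n = \<one>\<^bsub>grp (tgt C)\<^esub>" and x: "x \<in> pre C V"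
  shows "mov (src C) n x \<in> pre C V"
  using assms equivariant[OF n(1)] group_action_closed[OF src_act n(1)]
    group_action_one[OF tgt_act pt_map_closed] by (simp add: mem_pre)

lemma kernel_inv:
  assumes n: "n \<in> carrier (grp (src C))" "grp_map C n = \<one>\<^bsub>grp (tgt C)\<^esub>"
  shows "inv\<^bsub>grp (src C)\<^esub> n \<in> carrier (grp (src C))" "grp_map C (inv\<^bsub>grp (src C)\<^esub> n) = \<one>\<^bsub>grp (tgt C)\<^esub>"
  using group.inv_closed[OF src_group n(1)] grp_map_inv[OF n(1)] n(2) monoid.inv_one[OF group.is_monoid[OF tgt_group]] by simp_all

lemma pre_mov_inv:
  assumes g: "g \<in> carrier (grp (src C))" and y: "y \<in> base (tgt C)" and x: "x \<in> pre C {mov (tgt C) (grp_map C g) y}"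
  obtains x' where "x' \<in> pre C {y}" "x = mov (src C) g x'"
proof (rule that)
  have xb: "x \<in> base (src C)" using x by (simp add: mem_pre)
  have ig: "inv\<^bsub>grp (src C)\<^esub> g \<in> carrier (grp (src C))" using group.inv_closed[OF src_group g] .
  show "x = mov (src C) g (mov (src C) (inv\<^bsub>grp (src C)\<^esub> g) x)"
    using group_action_inv(2)[OF src_act g xb] by simp
  have "pt_map C (mov (src C) (inv\<^bsub>grp (src C)\<^esub> g) x) = y"
    using equivariant[OF ig xb] x grp_map_inv[OF g] group_action_inv(1)[OF tgt_act grp_map_closed[OF g] y]
    by (simp add: mem_pre)
  then show "mov (src C) (inv\<^bsub>grp (src C)\<^esub> g) x \<in> pre C {y}"
    using group_action_closed[OF src_act ig xb] by (simp add: mem_pre)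
qed

text \<open>A kernel element maps \<open>pre C V\<close> onto itself, so the translated section has
  the same domain as \<open>s\<close>; substituting \<open>n x\<close> for \<open>x\<close> turns
  the fixed point equation into the pointwise one.\<close>

lemma inv_sections_iff:
  assumes E: "is_sheaf R (src C) E"
  shows "s \<in> inv_sections C E V \<longleftrightarrow> s \<in> extensional (pre C V) \<and> inv_on C E V s"
proof -
  have fixed: "section_mov (src C) E n (pre C V) s = s \<longleftrightarrow> (\<forall>x\<in>pre C V. s (mov (src C) n x) = emov E n (s x))"
    if s: "s \<in> extensional (pre C V)" and n: "n \<in> carrier (grp (src C))" "grp_map C n = \<one>\<^bsub>grp (tgt C)\<^esub>" for n
  proof -
    have mv: "mov (src C) n x \<in> pre C V" "mov (src C) (inv\<^bsub>grp (src C)\<^esub> n) x \<in> pre C V"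
      "mov (src C) n (mov (src C) (inv\<^bsub>grp (src C)\<^esub> n) x) = x"
      "mov (src C) (inv\<^bsub>grp (src C)\<^esub> n) (mov (src C) n x) = x" if "x \<in> pre C V" for x
      using mov_kernel_pre[OF n that] mov_kernel_pre[OF kernel_inv[OF n] that]
        group_action_inv[OF src_act n(1), of x] that by (auto simp: mem_pre)
    have "mov (src C) n ` pre C V = pre C V"
      using mv by (auto simp: image_iff) metis
    then have *: "section_mov (src C) E n (pre C V) s =
        restrict (\<lambda>x. emov E n (s (mov (src C) (inv\<^bsub>grp (src C)\<^esub> n) x))) (pre C V)"
      by (simp add: section_mov_def)
    show ?thesis
    proof
      assume sm: "section_mov (src C) E n (pre C V) s = s"
      then have eq: "emov E n (s (mov (src C) (inv\<^bsub>grp (src C)\<^esub> n) x)) = s x" if "x \<in> pre C V" for x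
        using fun_cong[OF sm[unfolded *], of x] that by simp
      show "\<forall>x\<in>pre C V. s (mov (src C) n x) = emov E n (s x)"
      proof
        fix x assume x: "x \<in> pre C V"
        show "s (mov (src C) n x) = emov E n (s x)"
          using eq[OF mv(1)[OF x]] mv(4)[OF x] by simp
      qed
    next
      assume eq: "\<forall>x\<in>pre C V. s (mov (src C) n x) = emov E n (s x)"
      show "section_mov (src C) E n (pre C V) s = s"
        unfolding *
      proof (rule extensionalityI[OF restrict_extensional s])
        fix x assume x: "x \<in> pre C V"
        show "restrict (\<lambda>x. emov E n (s (mov (src C) (inv\<^bsub>grp (src C)\<^esub> n) x))) (pre C V) x = s x"
          using bspec[OF eq mv(2)[OF x]] mv(3)[OF x] x by simp
      qed
    qed
  qed
  have "s \<in> inv_sections C E V \<longleftrightarrow> s \<in> extensional (pre C V) \<and>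
      continuous_map (subtopology (pts (src C)) (pre C V)) (tot E) s \<and> (\<forall>x\<in>pre C V. prj E (s x) = x) \<and>
      (\<forall>n\<in>kernel (grp (src C)) (grp (tgt C)) (grp_map C). section_mov (src C) E n (pre C V) s = s)"
    by (simp add: inv_sections_def sections_over_def)
  also have "\<dots> \<longleftrightarrow> s \<in> extensional (pre C V) \<and> inv_on C E V s"
    unfolding inv_on_def
    by (intro conj_cong refl ball_cong fixed) (simp_all add: kernel_def)
  finally show ?thesis .
qed

lemma restrict_inv_sections:
  assumes E: "is_sheaf R (src C) E" and s: "inv_on C E V s"
  shows "restrict s (pre C V) \<in> inv_sections C E V"
proof -
  have "inv_on C E V (restrict s (pre C V))"
  proof (rule inv_onI)
    show "continuous_map (subtopology (pts (src C)) (pre C V)) (tot E) (restrict s (pre C V))"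
      by (rule continuous_map_eq[OF inv_on_cont[OF s]]) (simp add: topspace_pre)
  qed (simp_all add: inv_on_prj[OF s] inv_on_mov[OF s] mov_kernel_pre)
  then show ?thesis by (simp add: inv_sections_iff[OF E])
qed

subsection \<open>Inverse images\<close>

lemma pull_ops_closed:
  assumes D: "is_sheaf R (tgt C) D"
  shows "ops_closed R (src C) (pull C D)"
  unfolding ops_closed_def
proof (intro conjI ballI impI)
  fix g e assume g: "g \<in> carrier (grp (src C))" and e: "e \<in> tspace (pull C D)"
  obtain x d where [simp]: "e = (x, d)" by (cases e)
  have xd: "d \<in> tspace D" "x \<in> pre C {prj D d}" using e by (simp_all add: mem_pull)
  show "emov (pull C D) g e \<in> tspace (pull C D)"
    using mov_pre[OF g xd(2)] sheaf_mov_closed[OF D grp_map_closed[OF g] xd(1)]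
      sheaf_prj_mov[OF D grp_map_closed[OF g] xd(1)] by (simp add: emov_pull[OF xd] mem_pull)
next
  fix a b assume "a \<in> tspace (pull C D)" "b \<in> tspace (pull C D)" "prj (pull C D) a = prj (pull C D) b"
  then obtain x d d' where "a = (x, d)" "b = (x, d')" "x \<in> base (src C)" "d \<in> tspace D" "d' \<in> tspace D"
    "pt_map C x = prj D d" "pt_map C x = prj D d'"
    by (cases a; cases b) (auto simp: tspace_pull)
  then show "esum (pull C D) a b \<in> tspace (pull C D)"
    using sheaf_add[OF D, of d d'] by (simp add: tspace_pull)
next
  fix r a assume r: "r \<in> carrier R" and "a \<in> tspace (pull C D)"
  then show "escal (pull C D) r a \<in> tspace (pull C D)"
    using sheaf_scal[OF D r] by (cases a) (auto simp: tspace_pull)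
qed

text \<open>The total space of \<open>D\<close> is discrete, so the inverse image is a disjoint
  union of open pieces, one copy of \<open>pre C {prj D d}\<close> for each \<open>d\<close>.
  Continuity may be checked on each piece with \<open>d\<close> held fixed.\<close>

lemma pull_homI:
  assumes D: "is_sheaf R (tgt C) D"
    and ext: "a \<in> extensional (tspace (pull C D))"
    and cont: "\<And>d. d \<in> tspace D \<Longrightarrow>
      continuous_map (subtopology (pts (src C)) (pre C {prj D d})) (tot E) (\<lambda>x. a (x, d))"
    and mov: "\<And>g x d. \<lbrakk>g \<in> carrier (grp (src C)); d \<in> tspace D; x \<in> pre C {prj D d}\<rbrakk> \<Longrightarrow>
      a (mov (src C) g x, emov D (grp_map C g) d) = emov E g (a (x, d))"
    and prj: "\<And>x d. \<lbrakk>d \<in> tspace D; x \<in> pre C {prj D d}\<rbrakk> \<Longrightarrow> prj E (a (x, d)) = x"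
    and add: "\<And>x d d'. \<lbrakk>d \<in> tspace D; d' \<in> tspace D; prj D d = prj D d'; x \<in> pre C {prj D d'}\<rbrakk> \<Longrightarrow>
      a (x, esum D d d') = esum E (a (x, d)) (a (x, d'))"
    and scal: "\<And>r x d. \<lbrakk>r \<in> carrier R; d \<in> tspace D; x \<in> pre C {prj D d}\<rbrakk> \<Longrightarrow>
      a (x, escal D r d) = escal E r (a (x, d))"
  shows "a \<in> sheaf_hom R (src C) (pull C D) E"
proof (rule sheaf_homI[OF ext])
  show "continuous_map (tot (pull C D)) (tot E) a"
    unfolding continuous_map_def
  proof (intro conjI allI impI)
    have "a (x, d) \<in> tspace E" if "d \<in> tspace D" "x \<in> pre C {prj D d}" for x d
      using continuous_map_image_subset_topspace[OF cont[OF that(1)], unfolded topspace_pre] that(2)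
      by (simp add: image_subset_iff)
    then show "a \<in> tspace (pull C D) \<rightarrow> tspace E" by (auto simp: tspace_pull pre_def)
    fix U assume U: "openin (tot E) U"
    let ?W = "\<lambda>d. {x \<in> pre C {prj D d}. a (x, d) \<in> U}"
    have W: "openin (pts (src C)) (?W d)" if d: "d \<in> tspace D" for d
    proof -
      have "openin (subtopology (pts (src C)) (pre C {prj D d})) (?W d)"
        using openin_continuous_map_preimage[OF cont[OF d] U] unfolding topspace_pre .
      then show ?thesis using openin_trans_full[OF _ openin_pre] by blast
    qed
    have "openin (prod_topology (pts (src C)) (tot D)) (\<Union>d\<in>tspace D. ?W d \<times> {d})"
    proof (intro openin_Union)
      fix S assume "S \<in> (\<lambda>d. ?W d \<times> {d}) ` tspace D"
      then obtain d where "d \<in> tspace D" "S = ?W d \<times> {d}" by blast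
      moreover from this have "openin (tot D) {d}"
        by (subst sheaf_discrete[OF D tgt_disc]) simp
      ultimately show "openin (prod_topology (pts (src C)) (tot D)) S"
        using W by (simp add: openin_prod_Times_iff)
    qed
    moreover have "{e \<in> tspace (pull C D). a e \<in> U} = (\<Union>d\<in>tspace D. ?W d \<times> {d}) \<inter> {(x, d). pt_map C x = prj D d}"
      by (auto simp: tspace_pull pre_def)
    ultimately show "openin (tot (pull C D)) {e \<in> tspace (pull C D). a e \<in> U}"
      by (auto simp: pull_def pull_top_def openin_subtopology)
  qed
next
  fix g e assume g: "g \<in> carrier (grp (src C))" and e: "e \<in> tspace (pull C D)"
  obtain x d where [simp]: "e = (x, d)" by (cases e)
  have xd: "d \<in> tspace D" "x \<in> pre C {prj D d}" using e by (simp_all add: mem_pull)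
  show "a (emov (pull C D) g e) = emov E g (a e)"
    using mov[OF g xd] by (simp add: emov_pull[OF xd])
next
  fix e assume "e \<in> tspace (pull C D)"
  then show "prj E (a e) = prj (pull C D) e" by (cases e) (simp add: mem_pull prj)
next
  fix e e' assume "e \<in> tspace (pull C D)" "e' \<in> tspace (pull C D)" "prj (pull C D) e = prj (pull C D) e'"
  then obtain x d d' where "e = (x, d)" "e' = (x, d')" "x \<in> base (src C)" "d \<in> tspace D" "d' \<in> tspace D"
    "pt_map C x = prj D d" "pt_map C x = prj D d'"
    by (cases e; cases e') (auto simp: tspace_pull)
  then show "a (esum (pull C D) e e') = esum E (a e) (a e')"
    using add[of d d' x] by (simp add: mem_pre)
next
  fix r e assume "r \<in> carrier R" "e \<in> tspace (pull C D)"
  then show "a (escal (pull C D) r e) = escal E r (a e)"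
    by (cases e) (simp add: mem_pull scal)
qed

context
  fixes R :: "('r, 's) ring_scheme" and D :: "('h, 'y, 'r, 'd) sheaf" and E :: "('g, 'x, 'r, 'e) sheaf" and a
  assumes D: "is_sheaf R (tgt C) D" and a: "a \<in> sheaf_hom R (src C) (pull C D) E"
begin

lemma pull_hom_prj: "\<lbrakk>d \<in> tspace D; x \<in> pre C {prj D d}\<rbrakk> \<Longrightarrow> prj E (a (x, d)) = x"
  using hom_prj[OF a, of "(x, d)"] by (simp add: mem_pull)

lemma pull_hom_mov: "\<lbrakk>g \<in> carrier (grp (src C)); d \<in> tspace D; x \<in> pre C {prj D d}\<rbrakk> \<Longrightarrow>
      a (mov (src C) g x, emov D (grp_map C g) d) = emov E g (a (x, d))"
  using hom_mov[OF a, of g "(x, d)"] by (simp add: mem_pull emov_pull)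

lemma pull_hom_add: "\<lbrakk>d \<in> tspace D; d' \<in> tspace D; prj D d = prj D d'; x \<in> pre C {prj D d'}\<rbrakk> \<Longrightarrow>
      a (x, esum D d d') = esum E (a (x, d)) (a (x, d'))"
  using hom_add[OF a, of "(x, d)" "(x, d')"] by (simp add: mem_pull mem_pre)

lemma pull_hom_scal: "\<lbrakk>r \<in> carrier R; d \<in> tspace D; x \<in> pre C {prj D d}\<rbrakk> \<Longrightarrow>
      a (x, escal D r d) = escal E r (a (x, d))"
  using hom_scal[OF a, of r "(x, d)"] by (simp add: mem_pull mem_pre)

lemma pull_hom_cont:
  assumes d: "d \<in> tspace D"
  shows "continuous_map (subtopology (pts (src C)) (pre C {prj D d})) (tot E) (\<lambda>x. a (x, d))"
proof -
  have "continuous_map (subtopology (pts (src C)) (pre C {prj D d})) (tot (pull C D)) (\<lambda>x. (x, d))"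
    unfolding pull_def pull_top_def
    using d by (auto simp: continuous_map_in_subtopology continuous_map_pairedI continuous_map_from_subtopology mem_pre)
  then show ?thesis
    using continuous_map_compose[OF _ hom_cont[OF a]] by (fastforce simp: o_def)
qed

text \<open>This section is what the adjoint of \<open>a\<close> assigns to \<open>d\<close>. It is
  invariant because the kernel acts trivially on \<open>D\<close>.\<close>

lemma pull_hom_inv_on:
  assumes d: "d \<in> tspace D"
  shows "inv_on C E {prj D d} (\<lambda>x. a (x, d))"
proof (rule inv_onI[OF pull_hom_cont[OF d]])
  fix n x assume n: "n \<in> carrier (grp (src C))" "grp_map C n = \<one>\<^bsub>grp (tgt C)\<^esub>" and x: "x \<in> pre C {prj D d}"
  show "a (mov (src C) n x, d) = emov E n (a (x, d))"
    using pull_hom_mov[OF n(1) d x] n(2) group_action_one[OF sheaf_act[OF D] d] by simp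
qed (use d in \<open>simp add: pull_hom_prj\<close>)

end

lemma pull_map_hom:
  assumes D: "is_sheaf R (tgt C) D" and D': "is_sheaf R (tgt C) D'" and u: "u \<in> sheaf_hom R (tgt C) D D'"
  shows "pull_map C D u \<in> sheaf_hom R (src C) (pull C D) (pull C D')"
proof (rule pull_homI[OF D])
  have pm: "pull_map C D u (x, d) = (x, u d)" if "d \<in> tspace D" "x \<in> pre C {prj D d}" for x d
    using that by (simp add: pull_map_def mem_pull)
  have ud: "u d \<in> tspace D'" "prj D' (u d) = prj D d" if "d \<in> tspace D" for d
    using that hom_closed[OF u] hom_prj[OF u] by auto
  have pb: "prj D d \<in> base (tgt C)" if "d \<in> tspace D" for d using sheaf_prj[OF D that] .
  show "pull_map C D u \<in> extensional (tspace (pull C D))" by (simp add: pull_map_def)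
  show "continuous_map (subtopology (pts (src C)) (pre C {prj D d})) (tot (pull C D')) (\<lambda>x. pull_map C D u (x, d))"
    if d: "d \<in> tspace D" for d
  proof (rule continuous_map_eq)
    show "continuous_map (subtopology (pts (src C)) (pre C {prj D d})) (tot (pull C D')) (\<lambda>x. (x, u d))"
      unfolding pull_def pull_top_def
      using ud[OF d] by (auto simp: continuous_map_in_subtopology continuous_map_pairedI continuous_map_from_subtopology mem_pre)
  qed (simp add: topspace_pre pm[OF d])
  show "pull_map C D u (mov (src C) g x, emov D (grp_map C g) d) = emov (pull C D') g (pull_map C D u (x, d))"
    if *: "g \<in> carrier (grp (src C))" "d \<in> tspace D" "x \<in> pre C {prj D d}" for g x d
    using pm[OF *(2,3)] ud[OF *(2)] *(3) hom_mov[OF u grp_map_closed[OF *(1)] *(2)]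
      emov_pull[of "u d" D' x C g] mov_pre[OF *(1,3)] sheaf_prj_mov[OF D grp_map_closed[OF *(1)] *(2)]
      sheaf_mov_closed[OF D grp_map_closed[OF *(1)] *(2)] by (simp add: pm)
  show "prj (pull C D') (pull_map C D u (x, d)) = x" if "d \<in> tspace D" "x \<in> pre C {prj D d}" for x d
    using pm[OF that] by simp
  show "pull_map C D u (x, esum D d d') = esum (pull C D') (pull_map C D u (x, d)) (pull_map C D u (x, d'))"
    if *: "d \<in> tspace D" "d' \<in> tspace D" "prj D d = prj D d'" "x \<in> pre C {prj D d'}" for x d d'
    using * sheaf_add[OF D *(1-3)] hom_add[OF u *(1-3) pb[OF *(2)]] by (simp add: pm)
  show "pull_map C D u (x, escal D r d) = escal (pull C D') r (pull_map C D u (x, d))"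
    if *: "r \<in> carrier R" "d \<in> tspace D" "x \<in> pre C {prj D d}" for r x d
    using * sheaf_scal[OF D *(1,2)] hom_scal[OF u *(1,2) pb[OF *(2)]] by (simp add: pm)
qed

end

subsection \<open>Sheaves of invariant sections\<close>

text \<open>An abstract presentation of the direct image of \<open>E\<close>: \<open>ev z x\<close>
  is the value at \<open>x\<close> of the section represented by \<open>z\<close>, meaningful for
  \<open>x\<close> over \<open>prj F z\<close>. \<open>ev_eqI\<close> and \<open>ev_surj\<close>
  identify the stalk at \<open>y\<close> with the invariant sections over the fibre of
  \<open>y\<close>, and the operations are pointwise. Germs are one model and their copies in
  another type are others; the locale treats them at once.\<close>

locale section_model = discrete_change C
  for C :: "('g, 'x, 'h, 'y) change" +
  fixes R :: "('r, 's) ring_scheme" and E :: "('g, 'x, 'r, 'e) sheaf" and F :: "('h, 'y, 'r, 'f) sheaf"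
    and ev :: "'f \<Rightarrow> 'x \<Rightarrow> 'e"
  assumes ring: "ring R" and E: "is_sheaf R (src C) E"
    and tot_discrete: "tot F = discrete_topology (tspace F)"
    and prj_closed: "z \<in> tspace F \<Longrightarrow> prj F z \<in> base (tgt C)"
    and ev_inv_on: "z \<in> tspace F \<Longrightarrow> inv_on C E {prj F z} (ev z)"
    and ev_eqI: "\<lbrakk>z \<in> tspace F; z' \<in> tspace F; prj F z = prj F z';
      \<And>x. x \<in> pre C {prj F z'} \<Longrightarrow> ev z x = ev z' x\<rbrakk> \<Longrightarrow> z = z'"
    and ev_surj: "\<lbrakk>y \<in> base (tgt C); inv_on C E {y} s\<rbrakk> \<Longrightarrow>
      \<exists>z. z \<in> tspace F \<and> prj F z = y \<and> (\<forall>x\<in>pre C {y}. ev z x = s x)"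
    and zero: "y \<in> base (tgt C) \<Longrightarrow>
      ezero F y \<in> tspace F \<and> prj F (ezero F y) = y \<and> (\<forall>x\<in>pre C {y}. ev (ezero F y) x = ezero E x)"
    and add: "\<lbrakk>a \<in> tspace F; b \<in> tspace F; prj F a = prj F b\<rbrakk> \<Longrightarrow> esum F a b \<in> tspace F \<and>
      prj F (esum F a b) = prj F b \<and> (\<forall>x\<in>pre C {prj F b}. ev (esum F a b) x = esum E (ev a x) (ev b x))"
    and scal: "\<lbrakk>r \<in> carrier R; a \<in> tspace F\<rbrakk> \<Longrightarrow> escal F r a \<in> tspace F \<and>
      prj F (escal F r a) = prj F a \<and> (\<forall>x\<in>pre C {prj F a}. ev (escal F r a) x = escal E r (ev a x))"
    and emov_ext: "h \<in> carrier (grp (tgt C)) \<Longrightarrow> emov F h \<in> extensional (tspace F)"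
    and emov: "\<lbrakk>g \<in> carrier (grp (src C)); a \<in> tspace F\<rbrakk> \<Longrightarrow> emov F (grp_map C g) a \<in> tspace F \<and>
      prj F (emov F (grp_map C g) a) = mov (tgt C) (grp_map C g) (prj F a) \<and>
      (\<forall>x\<in>pre C {prj F a}. ev (emov F (grp_map C g) a) (mov (src C) g x) = emov E g (ev a x))"
begin

lemma ev_carrier: "\<lbrakk>z \<in> tspace F; x \<in> pre C {prj F z}\<rbrakk> \<Longrightarrow> ev z x \<in> tspace E \<and> prj E (ev z x) = x"
  using inv_on_closed[OF ev_inv_on] inv_on_prj[OF ev_inv_on] by blast

text \<open>Translation in \<open>F\<close> is described by values at points \<open>g x\<close>. As
  the fibre over \<open>g y\<close> consists of such points with \<open>x\<close> over
  \<open>y\<close>, comparing values there is enough.\<close>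

lemma ev_eq_translateI:
  assumes z: "z \<in> tspace F" "z' \<in> tspace F" and y: "y \<in> base (tgt C)" and g: "g \<in> carrier (grp (src C))"
    and p: "prj F z = mov (tgt C) (grp_map C g) y" "prj F z' = mov (tgt C) (grp_map C g) y"
    and ev: "\<And>x. x \<in> pre C {y} \<Longrightarrow> ev z (mov (src C) g x) = ev z' (mov (src C) g x)"
  shows "z = z'"
proof (rule ev_eqI[OF z])
  show "prj F z = prj F z'" using p by simp
  fix x assume "x \<in> pre C {prj F z'}"
  then have "x \<in> pre C {mov (tgt C) (grp_map C g) y}" using p by simp
  then show "ev z x = ev z' x" using pre_mov_inv[OF g y] ev by metis
qed

text \<open>Each module law is the corresponding law in the stalks of \<open>E\<close>, evaluated at
  every point of the fibre.\<close>

lemma stalk_module: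
  assumes y: "y \<in> base (tgt C)"
  shows "left_module R (stalk F y)"
proof -
  have mod: "left_module R (stalk E x)" if "x \<in> pre C {y}" for x
    using sheaf_module[OF E] that by (simp add: mem_pre)
  have ab: "abelian_group (stalk E x)" if "x \<in> pre C {y}" for x
    using left_module_abelian_group[OF mod[OF that]] .
  have ev: "ev z x \<in> carrier (stalk E x)" if "z \<in> tspace F" "prj F z = y" "x \<in> pre C {y}" for z x
    using ev_carrier[of z x] that by simp
  note eqI = ev_eqI
  interpret R: ring R by (rule ring)
  have "abelian_group (stalk F y)"
  proof (rule abelian_groupI, unfold stalk_simps mem_Collect_eq, goal_cases)
    case (1 a b) then show ?case using add[of a b] by simp
  next
    case 2 then show ?case using zero[OF y] by simp
  next
    case (3 a b c)
    then show ?case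
      using abelian_groupE(3)[OF ab ev[of a] ev[of b] ev[of c]]
      by (intro eqI) (simp_all add: add)
  next
    case (4 a b)
    then show ?case
      using abelian_groupE(4)[OF ab ev[of a] ev[of b]]
      by (intro eqI) (simp_all add: add)
  next
    case (5 a)
    then show ?case
      using abelian_groupE(5)[OF ab ev[of a]] zero[OF y]
      by (intro eqI) (simp_all add: add)
  next
    case (6 a)
    have s: "escal F (\<ominus>\<^bsub>R\<^esub> \<one>\<^bsub>R\<^esub>) a \<in> tspace F \<and> prj F (escal F (\<ominus>\<^bsub>R\<^esub> \<one>\<^bsub>R\<^esub>) a) = y \<and>
        (\<forall>x\<in>pre C {y}. ev (escal F (\<ominus>\<^bsub>R\<^esub> \<one>\<^bsub>R\<^esub>) a) x = escal E (\<ominus>\<^bsub>R\<^esub> \<one>\<^bsub>R\<^esub>) (ev a x))"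
      using scal[of "\<ominus>\<^bsub>R\<^esub> \<one>\<^bsub>R\<^esub>" a] 6 by simp
    have "esum F (escal F (\<ominus>\<^bsub>R\<^esub> \<one>\<^bsub>R\<^esub>) a) a = ezero F y"
      using 6 s zero[OF y] left_module.add_smult_minus_one[OF mod ev[of a]]
      by (intro eqI) (simp_all add: add)
    then show ?case using s by blast
  qed
  then show ?thesis
  proof (rule left_module.intro[OF ring], intro left_module_axioms.intro, unfold stalk_simps mem_Collect_eq, goal_cases)
    case (1 r a) then show ?case using scal[of r a] by simp
  next
    case (2 r r' a)
    then show ?case
      using left_module.smult_l_distr[OF mod 2(2,3) ev[of a]]
      by (intro eqI) (simp_all add: add scal)
  next
    case (3 r a b)
    then show ?case
      using left_module.smult_r_distr[OF mod 3(2) ev[of a] ev[of b]]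
      by (intro eqI) (simp_all add: add scal)
  next
    case (4 r r' a)
    then show ?case
      using left_module.smult_assoc1[OF mod 4(2,3) ev[of a]]
      by (intro eqI) (simp_all add: add scal)
  next
    case (5 a)
    then show ?case
      using left_module.smult_one[OF mod ev[of a]]
      by (intro eqI) (simp_all add: add scal)
  qed
qed

lemma is_sheaf: "is_sheaf R (tgt C) F"
proof (rule is_sheaf_discreteI[OF tgt_disc tgt_gdisc tot_discrete])
  have surj: "\<exists>g. g \<in> carrier (grp (src C)) \<and> h = grp_map C g" if "h \<in> carrier (grp (tgt C))" for h
    using that grp_surj by blast
  have one: "\<one>\<^bsub>grp (src C)\<^esub> \<in> carrier (grp (src C))"
    using group.is_monoid[OF src_group] by (rule monoid.one_closed)
  have act_mult: "mov (tgt C) (grp_map C (g \<otimes>\<^bsub>grp (src C)\<^esub> g')) y = mov (tgt C) (grp_map C g) (mov (tgt C) (grp_map C g') y)"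
    if "g \<in> carrier (grp (src C))" "g' \<in> carrier (grp (src C))" "y \<in> base (tgt C)" for g g' y
    using group_action_mult[OF tgt_act grp_map_closed grp_map_closed, OF that] grp_map_mult that by simp
  show "group_action (grp (tgt C)) (tspace F) (emov F)"
  proof (rule group_actionI[OF tgt_group emov_ext])
    show "emov F h a \<in> tspace F" if "h \<in> carrier (grp (tgt C))" "a \<in> tspace F" for h a
      using surj[OF that(1)] emov that(2) by blast
    fix a assume a: "a \<in> tspace F"
    note ma = emov[OF one a, unfolded grp_map_one]
    show "emov F \<one>\<^bsub>grp (tgt C)\<^esub> a = a"
    proof (rule ev_eqI[OF _ a])
      show "emov F \<one>\<^bsub>grp (tgt C)\<^esub> a \<in> tspace F" using ma by blast
      show "prj F (emov F \<one>\<^bsub>grp (tgt C)\<^esub> a) = prj F a"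
        using ma group_action_one[OF tgt_act prj_closed[OF a]] by simp
      fix x assume x: "x \<in> pre C {prj F a}"
      then have "x \<in> base (src C)" by (simp add: mem_pre)
      then show "ev (emov F \<one>\<^bsub>grp (tgt C)\<^esub> a) x = ev a x"
        using bspec[OF conjunct2[OF conjunct2[OF ma]] x] group_action_one[OF src_act, of x]
          group_action_one[OF sheaf_act[OF E]] ev_carrier[OF a x] by simp
    qed
  next
    fix h h' a assume h: "h \<in> carrier (grp (tgt C))" "h' \<in> carrier (grp (tgt C))" and a: "a \<in> tspace F"
    \<comment> \<open>The formula for translation concerns images \<open>grp_map C g\<close>, so the
      elements are lifted through the surjection of groups.\<close>
    obtain g g' where g: "g \<in> carrier (grp (src C))" "h = grp_map C g" "g' \<in> carrier (grp (src C))" "h' = grp_map C g'"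
      using surj h by metis
    have gg: "g \<otimes>\<^bsub>grp (src C)\<^esub> g' \<in> carrier (grp (src C))"
      using monoid.m_closed[OF group.is_monoid[OF src_group] g(1,3)] .
    note m = emov[OF gg a] and m' = emov[OF g(3) a]
    note m'' = emov[OF g(1) conjunct1[OF m']]
    have "emov F (grp_map C (g \<otimes>\<^bsub>grp (src C)\<^esub> g')) a = emov F (grp_map C g) (emov F (grp_map C g') a)"
    proof (rule ev_eq_translateI[OF _ _ prj_closed[OF a] gg])
      show "prj F (emov F (grp_map C g) (emov F (grp_map C g') a)) = mov (tgt C) (grp_map C (g \<otimes>\<^bsub>grp (src C)\<^esub> g')) (prj F a)"
        using m' m'' act_mult[OF g(1,3) prj_closed[OF a]] by simp
      fix x assume x: "x \<in> pre C {prj F a}"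
      then have xb: "x \<in> base (src C)" by (simp add: mem_pre)
      have gx: "mov (src C) (g \<otimes>\<^bsub>grp (src C)\<^esub> g') x = mov (src C) g (mov (src C) g' x)"
        using group_action_mult[OF src_act g(1,3) xb] .
      have "mov (src C) g' x \<in> pre C {prj F (emov F (grp_map C g') a)}"
        using mov_pre[OF g(3) x] m' by simp
      then have "ev (emov F (grp_map C g) (emov F (grp_map C g') a)) (mov (src C) g (mov (src C) g' x))
          = emov E g (emov E g' (ev a x))"
        using m'' m' x by simp
      moreover have "emov E (g \<otimes>\<^bsub>grp (src C)\<^esub> g') (ev a x) = emov E g (emov E g' (ev a x))"
        using group_action_mult[OF sheaf_act[OF E] g(1,3)] ev_carrier[OF a x] by blast
      ultimately show "ev (emov F (grp_map C (g \<otimes>\<^bsub>grp (src C)\<^esub> g')) a) (mov (src C) (g \<otimes>\<^bsub>grp (src C)\<^esub> g') x) =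
          ev (emov F (grp_map C g) (emov F (grp_map C g') a)) (mov (src C) (g \<otimes>\<^bsub>grp (src C)\<^esub> g') x)"
        using bspec[OF conjunct2[OF conjunct2[OF m]] x] gx by simp
    qed (use m m'' in blast)+
    then show "emov F (h \<otimes>\<^bsub>grp (tgt C)\<^esub> h') a = emov F h (emov F h' a)"
      using g grp_map_mult[OF g(1,3)] by simp
  qed
  show "prj F (emov F h e) = mov (tgt C) h (prj F e)" if "h \<in> carrier (grp (tgt C))" "e \<in> tspace F" for h e
    using surj[OF that(1)] emov[OF _ that(2)] by blast
  show "left_linear R (stalk F y) (stalk F (mov (tgt C) h y)) (emov F h)"
    if h: "h \<in> carrier (grp (tgt C))" and y: "y \<in> base (tgt C)" for h y
  proof -
    obtain g where g: "g \<in> carrier (grp (src C))" "h = grp_map C g" using surj[OF h] by blast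
    have "emov F (grp_map C g) (esum F a b) = esum F (emov F (grp_map C g) a) (emov F (grp_map C g) b)"
      if *: "a \<in> tspace F" "prj F a = y" "b \<in> tspace F" "prj F b = y" for a b
    proof (rule ev_eq_translateI[OF _ _ y g(1)])
      note ab = add[OF *(1,3)] and ga = emov[OF g(1) *(1)] and gb = emov[OF g(1) *(3)]
      have "esum F a b \<in> tspace F" using ab * by simp
      note gab = emov[OF g(1) this]
      note gagb = add[OF conjunct1[OF ga] conjunct1[OF gb]]
      show "emov F (grp_map C g) (esum F a b) \<in> tspace F" using gab by blast
      show "esum F (emov F (grp_map C g) a) (emov F (grp_map C g) b) \<in> tspace F"
        "prj F (esum F (emov F (grp_map C g) a) (emov F (grp_map C g) b)) = mov (tgt C) (grp_map C g) y"
        using gagb ga gb * by simp_all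
      show "prj F (emov F (grp_map C g) (esum F a b)) = mov (tgt C) (grp_map C g) y"
        using gab ab * by simp
      fix x assume x: "x \<in> pre C {y}"
      have "ev (emov F (grp_map C g) (esum F a b)) (mov (src C) g x) = emov E g (esum E (ev a x) (ev b x))"
        using gab ab * x by simp
      also have "\<dots> = esum E (emov E g (ev a x)) (emov E g (ev b x))"
        using sheaf_mov_add[OF E g(1), of "ev a x" "ev b x"] ev_carrier[OF *(1), of x] ev_carrier[OF *(3), of x] * x
        by simp
      also have "\<dots> = ev (esum F (emov F (grp_map C g) a) (emov F (grp_map C g) b)) (mov (src C) g x)"
        using gagb ga gb * x mov_pre[OF g(1) x] by simp
      finally show "ev (emov F (grp_map C g) (esum F a b)) (mov (src C) g x) =
        ev (esum F (emov F (grp_map C g) a) (emov F (grp_map C g) b)) (mov (src C) g x)" .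
    qed
    moreover have "emov F (grp_map C g) (escal F r a) = escal F r (emov F (grp_map C g) a)"
      if r: "r \<in> carrier R" and *: "a \<in> tspace F" "prj F a = y" for r a
    proof (rule ev_eq_translateI[OF _ _ y g(1)])
      note ra = scal[OF r *(1)] and ga = emov[OF g(1) *(1)]
      note gra = emov[OF g(1) conjunct1[OF ra]] and rga = scal[OF r conjunct1[OF ga]]
      show "emov F (grp_map C g) (escal F r a) \<in> tspace F" "escal F r (emov F (grp_map C g) a) \<in> tspace F"
        using gra rga by blast+
      show "prj F (emov F (grp_map C g) (escal F r a)) = mov (tgt C) (grp_map C g) y"
        "prj F (escal F r (emov F (grp_map C g) a)) = mov (tgt C) (grp_map C g) y"
        using gra ra rga ga * by simp_all
      fix x assume x: "x \<in> pre C {y}"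
      have "ev (emov F (grp_map C g) (escal F r a)) (mov (src C) g x) = emov E g (escal E r (ev a x))"
        using gra ra * x by simp
      also have "\<dots> = escal E r (emov E g (ev a x))"
        using sheaf_mov_scal[OF E g(1) r, of "ev a x"] ev_carrier[OF *(1), of x] * x by simp
      also have "\<dots> = ev (escal F r (emov F (grp_map C g) a)) (mov (src C) g x)"
        using rga ga * x mov_pre[OF g(1) x] by simp
      finally show "ev (emov F (grp_map C g) (escal F r a)) (mov (src C) g x) =
        ev (escal F r (emov F (grp_map C g) a)) (mov (src C) g x)" .
    qed
    ultimately show ?thesis
      unfolding left_linear_def g(2) stalk_simps using emov[OF g(1)] by auto
  qed
qed (use prj_closed stalk_module in auto)

text \<open>Evaluation separates points, so equivariance and linearity of \<open>u\<close> are
  inherited from those of \<open>a\<close> through \<open>ev (u d) x = a (x, d)\<close>; continuity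
  is automatic on a discrete space.\<close>

lemma mate_hom:
  fixes D :: "('h, 'y, 'r, 'd) sheaf"
  assumes D: "is_sheaf R (tgt C) D" and a: "a \<in> sheaf_hom R (src C) (pull C D) E"
    and ext: "u \<in> extensional (tspace D)"
    and u: "\<And>d. d \<in> tspace D \<Longrightarrow> u d \<in> tspace F \<and> prj F (u d) = prj D d"
    and ev: "\<And>d x. \<lbrakk>d \<in> tspace D; x \<in> pre C {prj D d}\<rbrakk> \<Longrightarrow> ev (u d) x = a (x, d)"
  shows "u \<in> sheaf_hom R (tgt C) D F"
proof (rule sheaf_homI[OF ext])
  show "continuous_map (tot D) (tot F) u"
    by (subst sheaf_discrete[OF D tgt_disc]) (use u in auto)
  show "prj F (u d) = prj D d" if "d \<in> tspace D" for d using u[OF that] by blast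
  fix h d assume h: "h \<in> carrier (grp (tgt C))" and d: "d \<in> tspace D"
  obtain g where g: "g \<in> carrier (grp (src C))" "h = grp_map C g" using h grp_surj by blast
  note hd = sheaf_mov_closed[OF D h d] and phd = sheaf_prj_mov[OF D h d]
  note ud = u[OF d] and uhd = u[OF hd]
  note gu = emov[OF g(1) conjunct1[OF ud]]
  show "u (emov D h d) = emov F h (u d)"
  proof (rule ev_eq_translateI[OF _ _ sheaf_prj[OF D d] g(1)])
    show "u (emov D h d) \<in> tspace F" "emov F h (u d) \<in> tspace F" using uhd gu g by auto
    show "prj F (u (emov D h d)) = mov (tgt C) (grp_map C g) (prj D d)" using uhd phd g by simp
    show "prj F (emov F h (u d)) = mov (tgt C) (grp_map C g) (prj D d)" using gu ud g by simp
    fix x assume x: "x \<in> pre C {prj D d}"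
    have "ev (u (emov D h d)) (mov (src C) g x) = a (mov (src C) g x, emov D h d)"
      using ev[OF hd] mov_pre[OF g(1) x] phd g by simp
    also have "\<dots> = emov E g (a (x, d))" using pull_hom_mov[OF D a g(1) d x] g by simp
    also have "\<dots> = ev (emov F h (u d)) (mov (src C) g x)" using gu g ud ev[OF d x] x by simp
    finally show "ev (u (emov D h d)) (mov (src C) g x) = ev (emov F h (u d)) (mov (src C) g x)" .
  qed
next
  fix d d' assume *: "d \<in> tspace D" "d' \<in> tspace D" "prj D d = prj D d'"
  note dd = sheaf_add[OF D *]
  note udd = add[OF conjunct1[OF u[OF *(1)]] conjunct1[OF u[OF *(2)]]]
  show "u (esum D d d') = esum F (u d) (u d')"
    by (rule ev_eqI) (use * dd udd u[OF *(1)] u[OF *(2)] u[OF conjunct1[OF dd]] ev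
      pull_hom_add[OF D a *] in simp_all)
next
  fix r d assume *: "r \<in> carrier R" "d \<in> tspace D"
  note dd = sheaf_scal[OF D *]
  note udd = scal[OF *(1) conjunct1[OF u[OF *(2)]]]
  show "u (escal D r d) = escal F r (u d)"
    by (rule ev_eqI) (use * dd udd u[OF *(2)] u[OF conjunct1[OF dd]] ev
      pull_hom_scal[OF D a *] in simp_all)
qed

text \<open>Transposition from inverse to direct image: \<open>u d\<close> is chosen to represent
  the invariant section \<open>x \<mapsto> a (x, d)\<close>.\<close>

lemma mate_exists:
  fixes D :: "('h, 'y, 'r, 'd) sheaf"
  assumes D: "is_sheaf R (tgt C) D" and a: "a \<in> sheaf_hom R (src C) (pull C D) E"
  obtains u where "u \<in> sheaf_hom R (tgt C) D F"
    "\<And>d x. \<lbrakk>d \<in> tspace D; x \<in> pre C {prj D d}\<rbrakk> \<Longrightarrow> ev (u d) x = a (x, d)"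
proof -
  have "\<forall>d\<in>tspace D. \<exists>z. z \<in> tspace F \<and> prj F z = prj D d \<and> (\<forall>x\<in>pre C {prj D d}. ev z x = a (x, d))"
    using ev_surj[OF sheaf_prj[OF D] pull_hom_inv_on[OF D a]] by blast
  from bchoice[OF this] obtain u where u:
    "\<forall>d\<in>tspace D. u d \<in> tspace F \<and> prj F (u d) = prj D d \<and> (\<forall>x\<in>pre C {prj D d}. ev (u d) x = a (x, d))" ..
  show thesis
  proof (rule that)
    show "restrict u (tspace D) \<in> sheaf_hom R (tgt C) D F"
      by (rule mate_hom[OF D a]) (use u in simp_all)
  qed (use u in simp)
qed

lemma copy_model:
  assumes c: "inj_on c (tspace F)"
  shows "section_model C R E (copy_sheaf c F) (\<lambda>z. ev (inv_into (tspace F) c z))"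
proof -
  have [simp]: "inv_into (tspace F) c (c z) = z" if "z \<in> tspace F" for z
    using c that by simp
  have simps [simp]: "tspace (copy_sheaf c F) = c ` tspace F"
      "prj (copy_sheaf c F) z = prj F (inv_into (tspace F) c z)"
      "ezero (copy_sheaf c F) y = c (ezero F y)"
      "esum (copy_sheaf c F) a b = c (esum F (inv_into (tspace F) c a) (inv_into (tspace F) c b))"
      "escal (copy_sheaf c F) r a = c (escal F r (inv_into (tspace F) c a))"
      "emov (copy_sheaf c F) h = restrict (\<lambda>z. c (emov F h (inv_into (tspace F) c z))) (c ` tspace F)"
      "tot (copy_sheaf c F) = discrete_topology (c ` tspace F)"
    for z y a b r h by (simp_all add: copy_sheaf_def Let_def)
  show ?thesis
  proof (intro section_model.intro[OF discrete_change_axioms] section_model_axioms.intro, unfold simps topspace_discrete_topology, goal_cases)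
    case 1 then show ?case by (rule ring)
  next
    case 2 then show ?case by (rule E)
  next
    case 3 then show ?case by simp
  next
    case (4 z) then show ?case using prj_closed by auto
  next
    case (5 z) then show ?case using ev_inv_on by auto
  next
    case (6 z z')
    then obtain a b where ab: "z = c a" "a \<in> tspace F" "z' = c b" "b \<in> tspace F" by blast
    have "a = b" using ev_eqI[OF ab(2,4)] 6(3,4) ab by simp
    then show ?case using ab by simp
  next
    case (7 y s)
    then obtain z where "z \<in> tspace F" "prj F z = y" "\<forall>x\<in>pre C {y}. ev z x = s x" using ev_surj by blast
    then show ?case by (intro exI[of _ "c z"]) simp
  next
    case (8 y) then show ?case using zero[of y] by simp
  next
    case (9 a b)
    then obtain a' b' where ab: "a = c a'" "a' \<in> tspace F" "b = c b'" "b' \<in> tspace F" by blast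
    then show ?case using add[OF ab(2,4)] 9(3) by simp
  next
    case (10 r a)
    then obtain a' where ab: "a = c a'" "a' \<in> tspace F" by blast
    then show ?case using scal[OF 10(1) ab(2)] by simp
  next
    case (11 h) then show ?case by simp
  next
    case (12 g a)
    then obtain a' where ab: "a = c a'" "a' \<in> tspace F" by blast
    then show ?case using emov[OF 12(1) ab(2)] by simp
  qed
qed

end

subsection \<open>Germs\<close>

text \<open>The value of the chosen representative. Away from the fibre over the base point of the
  germ it depends on that choice and carries no information.\<close>

definition germ_val :: "('x, 'y, 'e) germ \<Rightarrow> 'x \<Rightarrow> 'e" where
  "germ_val z = snd (germ_rep z)"

context discrete_change
begin

context
  fixes R :: "('r, 's) ring_scheme" and E :: "('g, 'x, 'r, 'e) sheaf"
  assumes E: "is_sheaf R (src C) E"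
begin

lemma inv_on_zero: "inv_on C E V (ezero E)"
proof (rule inv_onI)
  show "continuous_map (subtopology (pts (src C)) (pre C V)) (tot E) (ezero E)"
    using sheaf_zero_cont[OF E] by (rule continuous_map_from_subtopology)
  show "prj E (ezero E x) = x" if "x \<in> pre C V" for x
    using sheaf_zero[OF E, of x] that by (simp add: mem_pre)
  show "ezero E (mov (src C) n x) = emov E n (ezero E x)"
    if "n \<in> carrier (grp (src C))" "x \<in> pre C V" for n x
    using sheaf_mov_zero[OF E that(1), of x] group_action_closed[OF src_act that(1)] that(2)
    by (simp add: mem_pre)
qed

lemma inv_on_add:
  assumes s: "inv_on C E V s" and t: "inv_on C E V t"
  shows "inv_on C E V (\<lambda>x. esum E (s x) (t x))"
proof (rule inv_onI)
  show "continuous_map (subtopology (pts (src C)) (pre C V)) (tot E) (\<lambda>x. esum E (s x) (t x))"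
    by (rule sheaf_add_cont[OF E inv_on_cont[OF s] inv_on_cont[OF t]])
      (simp add: topspace_pre inv_on_prj[OF s] inv_on_prj[OF t])
  fix x assume x: "x \<in> pre C V"
  note c = inv_on_closed[OF s x] inv_on_closed[OF t x]
  have p: "prj E (s x) = prj E (t x)" using inv_on_prj[OF s x] inv_on_prj[OF t x] by simp
  show "prj E (esum E (s x) (t x)) = x"
    using sheaf_add[OF E c p] inv_on_prj[OF t x] by simp
  fix n assume n: "n \<in> carrier (grp (src C))" "grp_map C n = \<one>\<^bsub>grp (tgt C)\<^esub>"
  show "esum E (s (mov (src C) n x)) (t (mov (src C) n x)) = emov E n (esum E (s x) (t x))"
    using sheaf_mov_add[OF E n(1) c p] inv_on_mov[OF s n x] inv_on_mov[OF t n x] by simp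
qed

lemma inv_on_scal:
  assumes s: "inv_on C E V s" and r: "r \<in> carrier R"
  shows "inv_on C E V (\<lambda>x. escal E r (s x))"
proof (rule inv_onI)
  show "continuous_map (subtopology (pts (src C)) (pre C V)) (tot E) (\<lambda>x. escal E r (s x))"
    by (rule sheaf_scal_cont[OF E inv_on_cont[OF s] r])
  fix x assume x: "x \<in> pre C V"
  note c = inv_on_closed[OF s x]
  show "prj E (escal E r (s x)) = x"
    using sheaf_scal[OF E r c] inv_on_prj[OF s x] by simp
  fix n assume n: "n \<in> carrier (grp (src C))" "grp_map C n = \<one>\<^bsub>grp (tgt C)\<^esub>"
  show "escal E r (s (mov (src C) n x)) = emov E n (escal E r (s x))"
    using sheaf_mov_scal[OF E n(1) r c] inv_on_mov[OF s n x] by simp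
qed

lemma mov_inv_pre:
  assumes g: "g \<in> carrier (grp (src C))" and V: "V \<subseteq> base (tgt C)"
    and x: "x \<in> pre C (mov (tgt C) (grp_map C g) ` V)"
  shows "mov (src C) (inv\<^bsub>grp (src C)\<^esub> g) x \<in> pre C V"
proof -
  obtain y where y: "y \<in> V" "pt_map C x = mov (tgt C) (grp_map C g) y" "x \<in> base (src C)"
    using x by (auto simp: mem_pre)
  then have "y \<in> base (tgt C)" "x \<in> pre C {mov (tgt C) (grp_map C g) y}" using V by (auto simp: mem_pre)
  then obtain x' where x': "x' \<in> pre C {y}" "x = mov (src C) g x'" using pre_mov_inv[OF g] by blast
  then have "mov (src C) (inv\<^bsub>grp (src C)\<^esub> g) x = x'"
    using group_action_inv(1)[OF src_act g] by (simp add: mem_pre)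
  then show ?thesis using x'(1) y(1) by (simp add: mem_pre)
qed

text \<open>The kernel is normal: with \<open>m\<close> the conjugate of \<open>n\<close> by
  \<open>g\<close>, moving \<open>n\<close> past \<open>g\<close> reduces invariance of the
  translate under \<open>n\<close> to invariance of \<open>s\<close> under \<open>m\<close>.\<close>

lemma inv_on_translate:
  assumes s: "inv_on C E V s" and g: "g \<in> carrier (grp (src C))" and V: "V \<subseteq> base (tgt C)"
  shows "inv_on C E (mov (tgt C) (grp_map C g) ` V) (\<lambda>x. emov E g (s (mov (src C) (inv\<^bsub>grp (src C)\<^esub> g) x)))"
    (is "inv_on C E ?V' ?t")
proof (rule inv_onI)
  interpret G: group "grp (src C)" by (rule src_group)
  interpret H: group "grp (tgt C)" by (rule tgt_group)
  let ?i = "inv\<^bsub>grp (src C)\<^esub> g"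
  have i: "?i \<in> carrier (grp (src C))" using g by simp
  have "continuous_map (subtopology (pts (src C)) (pre C ?V')) (subtopology (pts (src C)) (pre C V)) (mov (src C) ?i)"
    using mov_inv_pre[OF g V] src_mov_cont[OF i]
    by (auto simp: continuous_map_in_subtopology continuous_map_from_subtopology)
  then have "continuous_map (subtopology (pts (src C)) (pre C ?V')) (tot E) (\<lambda>x. s (mov (src C) ?i x))"
    using continuous_map_compose[OF _ inv_on_cont[OF s]] by (fastforce simp: o_def)
  then show "continuous_map (subtopology (pts (src C)) (pre C ?V')) (tot E) ?t"
    by (rule sheaf_mov_cont[OF E]) (simp add: src_gtop g)
  fix x assume x: "x \<in> pre C ?V'"
  note x' = mov_inv_pre[OF g V x]
  note sx = inv_on_closed[OF s x'] and psx = inv_on_prj[OF s x']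
  have xb: "x \<in> base (src C)" using x by (simp add: mem_pre)
  show "prj E (?t x) = x"
    using sheaf_prj_mov[OF E g sx] psx group_action_inv(2)[OF src_act g xb] by simp
  fix n assume n: "n \<in> carrier (grp (src C))" "grp_map C n = \<one>\<^bsub>grp (tgt C)\<^esub>"
  let ?m = "?i \<otimes>\<^bsub>grp (src C)\<^esub> n \<otimes>\<^bsub>grp (src C)\<^esub> g"
  have m: "?m \<in> carrier (grp (src C))" "grp_map C ?m = \<one>\<^bsub>grp (tgt C)\<^esub>"
    using n g i grp_map_closed[OF g] by (simp_all add: grp_map_mult grp_map_inv)
  have "mov (src C) ?m (mov (src C) ?i x) = mov (src C) (?i \<otimes>\<^bsub>grp (src C)\<^esub> n) (mov (src C) g (mov (src C) ?i x))"
    using group_action_mult[OF src_act, of "?i \<otimes>\<^bsub>grp (src C)\<^esub> n" g "mov (src C) ?i x"] n g i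
      group_action_closed[OF src_act i xb] by simp
  also have "\<dots> = mov (src C) ?i (mov (src C) n x)"
    using group_action_inv(2)[OF src_act g xb] group_action_mult[OF src_act i n(1) xb] by simp
  finally have "s (mov (src C) ?i (mov (src C) n x)) = emov E ?m (s (mov (src C) ?i x))"
    using inv_on_mov[OF s m x'] by simp
  moreover have "emov E g (emov E ?m (s (mov (src C) ?i x))) = emov E n (emov E g (s (mov (src C) ?i x)))"
  proof -
    have "g \<otimes>\<^bsub>grp (src C)\<^esub> ?m = n \<otimes>\<^bsub>grp (src C)\<^esub> g"
      using n g i by (simp add: G.m_assoc[symmetric])
    then show ?thesis
      using group_action_mult[OF sheaf_act[OF E] g m(1) sx] group_action_mult[OF sheaf_act[OF E] n(1) g sx] by simp
  qed
  ultimately show "?t (mov (src C) n x) = emov E n (?t x)" by simp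
qed

text \<open>The one-point set of \<open>y\<close> is open, so two sections have the same germ at
  \<open>y\<close> exactly when they agree on the fibre over \<open>y\<close>. From here on germs
  are handled as sections over fibres.\<close>

lemma germ_eq:
  assumes y: "y \<in> V" "y \<in> base (tgt C)"
  shows "germ C E y V s = (y, {(W, t). W \<subseteq> base (tgt C) \<and> y \<in> W \<and> t \<in> inv_sections C E W \<and> (\<forall>x\<in>pre C {y}. s x = t x)})"
proof -
  have *: "(\<exists>U. U \<subseteq> base (tgt C) \<and> y \<in> U \<and> U \<subseteq> V \<inter> W \<and> (\<forall>x\<in>pre C U. s x = t x))
      \<longleftrightarrow> (\<forall>x\<in>pre C {y}. s x = t x)" if "y \<in> W" for W t
  proof
    assume "\<forall>x\<in>pre C {y}. s x = t x"
    then show "\<exists>U. U \<subseteq> base (tgt C) \<and> y \<in> U \<and> U \<subseteq> V \<inter> W \<and> (\<forall>x\<in>pre C U. s x = t x)"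
      using that y by (intro exI[of _ "{y}"]) simp
  qed (auto simp: mem_pre)
  show ?thesis
    unfolding germ_def openin_tgt prod.inject
    by (intro conjI refl arg_cong[of _ _ "\<lambda>f. Collect (case_prod f)"] ext) (simp only: * cong: conj_cong)
qed

lemma germ_cong:
  assumes "y \<in> V" "y \<in> V'" "y \<in> base (tgt C)" "\<And>x. x \<in> pre C {y} \<Longrightarrow> s x = s' x"
  shows "germ C E y V s = germ C E y V' s'"
  using assms by (simp add: germ_eq)

lemma tspace_push:
  "tspace (push C E) = {germ C E y V s |y V s. V \<subseteq> base (tgt C) \<and> y \<in> V \<and> s \<in> inv_sections C E V}"
  unfolding push_def push_top_def by (auto simp: topology_generated_by_topspace openin_tgt)

lemma push_rep:
  assumes "z \<in> tspace (push C E)"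
  obtains V s where "germ_rep z = (V, s)" "fst z \<in> V" "V \<subseteq> base (tgt C)" "s \<in> inv_sections C E V"
    "inv_on C E V s" "z = germ C E (fst z) V s" "germ_val z = s"
proof -
  obtain y W t where z: "z = germ C E y W t" "W \<subseteq> base (tgt C)" "y \<in> W" "t \<in> inv_sections C E W"
    using assms by (auto simp: tspace_push)
  have "(W, t) \<in> snd z" using z germ_eq[of y W t] by (auto simp: subset_iff)
  then have "germ_rep z \<in> snd z" unfolding germ_rep_def by (rule someI)
  moreover obtain V s where Vs: "germ_rep z = (V, s)" by (cases "germ_rep z")
  ultimately have V: "V \<subseteq> base (tgt C)" "y \<in> V" "s \<in> inv_sections C E V" "\<forall>x\<in>pre C {y}. t x = s x"
    using z germ_eq[of y W t] by (auto simp: subset_iff)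
  have y: "fst z = y" using z by (simp add: germ_def)
  have "z = germ C E y V s" unfolding z(1) by (rule germ_cong) (use z V in auto)
  then show thesis
    using that[OF Vs] V y inv_sections_iff[OF E] Vs by (simp add: germ_val_def)
qed

lemma germ_push:
  assumes y: "y \<in> V" and V: "V \<subseteq> base (tgt C)" and s: "inv_on C E V s"
  shows "germ C E y V s \<in> tspace (push C E)" "prj (push C E) (germ C E y V s) = y"
    "\<And>x. x \<in> pre C {y} \<Longrightarrow> germ_val (germ C E y V s) x = s x"
proof -
  have yb: "y \<in> base (tgt C)" using y V by blast
  have "germ C E y V s = germ C E y V (restrict s (pre C V))"
    by (rule germ_cong[OF y y yb]) (use y in \<open>simp add: mem_pre\<close>)
  then show m: "germ C E y V s \<in> tspace (push C E)"
    using restrict_inv_sections[OF E s] y V by (auto simp: tspace_push)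
  show p: "prj (push C E) (germ C E y V s) = y" by (simp add: push_def germ_def)
  show "germ_val (germ C E y V s) x = s x" if x: "x \<in> pre C {y}" for x
  proof -
    obtain W t where Wt: "germ_rep (germ C E y V s) = (W, t)" "y \<in> W"
      "germ C E y V s = germ C E y W t" "germ_val (germ C E y V s) = t" "t \<in> inv_sections C E W" "W \<subseteq> base (tgt C)"
      using push_rep[OF m] p by (metis (no_types, lifting) fst_conv germ_def)
    have "(W, t) \<in> snd (germ C E y W t)" using Wt germ_eq[of y W t] yb by auto
    then have "(W, t) \<in> snd (germ C E y V s)" using Wt by simp
    then show ?thesis using germ_eq[OF y yb] x Wt(4) by auto
  qed
qed

lemma push_eqI:
  assumes z: "z \<in> tspace (push C E)" "z' \<in> tspace (push C E)" "prj (push C E) z = prj (push C E) z'"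
    and ev: "\<And>x. x \<in> pre C {prj (push C E) z'} \<Longrightarrow> germ_val z x = germ_val z' x"
  shows "z = z'"
proof -
  have p: "prj (push C E) = fst" by (simp add: push_def)
  obtain V s where V: "fst z \<in> V" "V \<subseteq> base (tgt C)" "z = germ C E (fst z) V s" "germ_val z = s"
    using push_rep[OF z(1)] by metis
  obtain V' s' where V': "fst z' \<in> V'" "V' \<subseteq> base (tgt C)" "z' = germ C E (fst z') V' s'" "germ_val z' = s'"
    using push_rep[OF z(2)] by metis
  have "germ C E (fst z) V s = germ C E (fst z) V' s'"
    by (rule germ_cong) (use V V' z(3) ev p in auto)
  then show ?thesis using V(3) V'(3) z(3) p by simp
qed

text \<open>The singleton of a germ is the image of a section over an open one-point set, hence one
  of the generators of the topology.\<close>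

lemma push_tot_discrete: "tot (push C E) = discrete_topology (tspace (push C E))"
proof -
  have "openin (tot (push C E)) {z}" if z: "z \<in> tspace (push C E)" for z
  proof -
    obtain V s where V: "fst z \<in> V" "V \<subseteq> base (tgt C)" "inv_on C E V s" "z = germ C E (fst z) V s"
      using push_rep[OF z] by metis
    let ?y = "fst z"
    have yb: "?y \<in> base (tgt C)" using V by blast
    have "inv_on C E {?y} s" using inv_on_mono[OF V(3)] V(1) by simp
    from restrict_inv_sections[OF E this]
    have r: "restrict s (pre C {?y}) \<in> inv_sections C E {?y}" .
    have "z = germ C E ?y {?y} (restrict s (pre C {?y}))"
      by (subst V(4), rule germ_cong) (use V yb in auto)
    then have "(\<lambda>y. germ C E y {?y} (restrict s (pre C {?y}))) ` {?y} = {z}" by simp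
    moreover have "openin (tot (push C E)) ((\<lambda>y. germ C E y {?y} (restrict s (pre C {?y}))) ` {?y})"
      unfolding push_def push_top_def sheaf.simps
      by (rule topology_generated_by_Basis) (use r yb in \<open>auto simp: openin_tgt\<close>)
    ultimately show ?thesis by simp
  qed
  then show ?thesis by (metis discrete_topology_unique)
qed

lemma push_model:
  assumes ring: "ring R"
  shows "section_model C R E (push C E) germ_val"
proof (intro section_model.intro[OF discrete_change_axioms] section_model_axioms.intro)
  have p: "prj (push C E) = fst" by (simp add: push_def)
  show "ring R" "is_sheaf R (src C) E" using ring E .
  show "tot (push C E) = discrete_topology (tspace (push C E))" by (rule push_tot_discrete)
  show "prj (push C E) z \<in> base (tgt C)" if z: "z \<in> tspace (push C E)" for z
    using push_rep[OF z] p by (metis subsetD)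
  show "inv_on C E {prj (push C E) z} (germ_val z)" if z: "z \<in> tspace (push C E)" for z
    by (rule push_rep[OF z]) (use p inv_on_mono in \<open>metis empty_subsetI insert_subset\<close>)
  show "z = z'" if "z \<in> tspace (push C E)" "z' \<in> tspace (push C E)" "prj (push C E) z = prj (push C E) z'"
    "\<And>x. x \<in> pre C {prj (push C E) z'} \<Longrightarrow> germ_val z x = germ_val z' x" for z z'
    using push_eqI that by blast
  show "\<exists>z. z \<in> tspace (push C E) \<and> prj (push C E) z = y \<and> (\<forall>x\<in>pre C {y}. germ_val z x = s x)"
    if y: "y \<in> base (tgt C)" and s: "inv_on C E {y} s" for y s
    using germ_push[of y "{y}" s] y s by blast
  show "ezero (push C E) y \<in> tspace (push C E) \<and> prj (push C E) (ezero (push C E) y) = y \<and>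
      (\<forall>x\<in>pre C {y}. germ_val (ezero (push C E) y) x = ezero E x)" if y: "y \<in> base (tgt C)" for y
  proof -
    have "ezero (push C E) y = germ C E y (base (tgt C)) (restrict (ezero E) (base (src C)))"
      by (simp add: push_def)
    also have "\<dots> = germ C E y (base (tgt C)) (ezero E)"
      by (rule germ_cong) (use y in \<open>auto simp: mem_pre\<close>)
    finally show ?thesis using germ_push[OF y order.refl inv_on_zero] by simp
  qed
  show "esum (push C E) a b \<in> tspace (push C E) \<and> prj (push C E) (esum (push C E) a b) = prj (push C E) b \<and>
      (\<forall>x\<in>pre C {prj (push C E) b}. germ_val (esum (push C E) a b) x = esum E (germ_val a x) (germ_val b x))"
    if ab: "a \<in> tspace (push C E)" "b \<in> tspace (push C E)" "prj (push C E) a = prj (push C E) b" for a b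
  proof -
    have f: "fst a = fst b" using ab p by simp
    obtain V s where V: "germ_rep a = (V, s)" "fst b \<in> V" "V \<subseteq> base (tgt C)" "inv_on C E V s" "germ_val a = s"
      using push_rep[OF ab(1)] f by metis
    obtain W t where W: "germ_rep b = (W, t)" "fst b \<in> W" "inv_on C E W t" "germ_val b = t"
      using push_rep[OF ab(2)] by metis
    have st: "inv_on C E (V \<inter> W) (\<lambda>x. esum E (s x) (t x))"
      using inv_on_add inv_on_mono[OF V(4)] inv_on_mono[OF W(3)] by simp
    have "esum (push C E) a b = germ C E (fst b) (V \<inter> W) (restrict (\<lambda>x. esum E (s x) (t x)) (pre C (V \<inter> W)))"
      using V W f by (simp add: push_def)
    also have "\<dots> = germ C E (fst b) (V \<inter> W) (\<lambda>x. esum E (s x) (t x))"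
      by (rule germ_cong) (use V W in \<open>auto simp: mem_pre\<close>)
    finally have e: "esum (push C E) a b = germ C E (fst b) (V \<inter> W) (\<lambda>x. esum E (s x) (t x))" .
    have "fst b \<in> V \<inter> W" "V \<inter> W \<subseteq> base (tgt C)" using V W by auto
    from germ_push[OF this st] show ?thesis unfolding e V(5) W(4) p by simp
  qed
  show "escal (push C E) r a \<in> tspace (push C E) \<and> prj (push C E) (escal (push C E) r a) = prj (push C E) a \<and>
      (\<forall>x\<in>pre C {prj (push C E) a}. germ_val (escal (push C E) r a) x = escal E r (germ_val a x))"
    if r: "r \<in> carrier R" and a: "a \<in> tspace (push C E)" for r a
  proof -
    obtain V s where V: "germ_rep a = (V, s)" "fst a \<in> V" "V \<subseteq> base (tgt C)" "inv_on C E V s" "germ_val a = s"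
      using push_rep[OF a] by metis
    have "escal (push C E) r a = germ C E (fst a) V (restrict (\<lambda>x. escal E r (s x)) (pre C V))"
      using V by (simp add: push_def)
    also have "\<dots> = germ C E (fst a) V (\<lambda>x. escal E r (s x))"
      by (rule germ_cong) (use V in \<open>auto simp: mem_pre\<close>)
    finally have e: "escal (push C E) r a = germ C E (fst a) V (\<lambda>x. escal E r (s x))" .
    from germ_push[OF V(2,3) inv_on_scal[OF V(4) r]] show ?thesis unfolding e V(5) p by simp
  qed
  show "emov (push C E) h \<in> extensional (tspace (push C E))" for h
    by (simp add: push_def)
  show "emov (push C E) (grp_map C g) a \<in> tspace (push C E) \<and>
      prj (push C E) (emov (push C E) (grp_map C g) a) = mov (tgt C) (grp_map C g) (prj (push C E) a) \<and>
      (\<forall>x\<in>pre C {prj (push C E) a}. germ_val (emov (push C E) (grp_map C g) a) (mov (src C) g x) = emov E g (germ_val a x))"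
    if g: "g \<in> carrier (grp (src C))" and a: "a \<in> tspace (push C E)" for g a
  proof -
    interpret G: group "grp (src C)" by (rule src_group)
    interpret H: group "grp (tgt C)" by (rule tgt_group)
    obtain V s where V: "germ_rep a = (V, s)" "fst a \<in> V" "V \<subseteq> base (tgt C)" "inv_on C E V s" "germ_val a = s"
      using push_rep[OF a] by metis
    \<comment> \<open>The definition of \<open>push\<close> lifts the group element by choice, so
      the formula holds at first for this lift \<open>k\<close> and must be carried over to the
      given \<open>g\<close>.\<close>
    define k where "k = (SOME k. k \<in> carrier (grp (src C)) \<and> grp_map C k = grp_map C g)"
    have k: "k \<in> carrier (grp (src C))" "grp_map C k = grp_map C g"
      using someI[of "\<lambda>k. k \<in> carrier (grp (src C)) \<and> grp_map C k = grp_map C g" g] g by (simp_all add: k_def)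
    let ?V = "mov (tgt C) (grp_map C k) ` V" and ?y = "mov (tgt C) (grp_map C k) (fst a)"
    let ?t = "\<lambda>x. emov E k (s (mov (src C) (inv\<^bsub>grp (src C)\<^esub> k) x))"
    have yV: "?y \<in> ?V" "?V \<subseteq> base (tgt C)"
      using V(2,3) group_action_closed[OF tgt_act grp_map_closed[OF k(1)]] by auto
    have "emov (push C E) (grp_map C g) a = germ C E ?y ?V (section_mov (src C) E k (pre C V) s)"
      using V(1) a k by (simp add: push_def k_def)
    also have "\<dots> = germ C E ?y ?V ?t"
    proof (rule germ_cong)
      fix x assume x: "x \<in> pre C {?y}"
      then have xb: "x \<in> base (src C)" by (simp add: mem_pre)
      have "x \<in> pre C ?V" using x V(2) by (auto simp: mem_pre)
      then have "x \<in> mov (src C) k ` pre C V"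
        using mov_inv_pre[OF k(1) V(3)] group_action_inv(2)[OF src_act k(1) xb] by (metis image_eqI)
      then show "section_mov (src C) E k (pre C V) s x = ?t x" by (simp add: section_mov_def)
    qed (use yV in auto)
    finally have e: "emov (push C E) (grp_map C g) a = germ C E ?y ?V ?t" .
    note gp = germ_push[OF yV inv_on_translate[OF V(4) k(1) V(3)]]
    have "?t (mov (src C) g x) = emov E g (s x)" if x: "x \<in> pre C {fst a}" for x
    proof -
      \<comment> \<open>The two lifts differ by a kernel element, which \<open>s\<close> absorbs by
        invariance.\<close>
      let ?n = "inv\<^bsub>grp (src C)\<^esub> k \<otimes>\<^bsub>grp (src C)\<^esub> g"
      have n: "?n \<in> carrier (grp (src C))" "grp_map C ?n = \<one>\<^bsub>grp (tgt C)\<^esub>"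
        using k g grp_map_closed[OF g] by (simp_all add: grp_map_mult grp_map_inv)
      have xb: "x \<in> base (src C)" and xV: "x \<in> pre C V" using x V(2) by (simp_all add: mem_pre)
      have "mov (src C) (inv\<^bsub>grp (src C)\<^esub> k) (mov (src C) g x) = mov (src C) ?n x"
        using group_action_mult[OF src_act _ g xb] k by simp
      then have "?t (mov (src C) g x) = emov E k (emov E ?n (s x))"
        using inv_on_mov[OF V(4) n xV] by simp
      also have "\<dots> = emov E (k \<otimes>\<^bsub>grp (src C)\<^esub> ?n) (s x)"
        using group_action_mult[OF sheaf_act[OF E] k(1) n(1) inv_on_closed[OF V(4) xV]] by simp
      also have "k \<otimes>\<^bsub>grp (src C)\<^esub> ?n = g" using k(1) g by (simp add: G.m_assoc[symmetric])
      finally show ?thesis .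
    qed
    then show ?thesis
      using gp mov_pre[OF g] k(2) unfolding e V(5) p by simp
  qed
qed

lemma adjoint_right:
  fixes D :: "('h, 'y, 'r, 'd) sheaf"
  assumes ring: "ring R" and D: "is_sheaf R (tgt C) D" and a: "a \<in> sheaf_hom R (src C) (pull C D) E"
  shows "adjoint_right C D E a \<in> sheaf_hom R (tgt C) D (push C E)"
    "\<And>d x. \<lbrakk>d \<in> tspace D; x \<in> pre C {prj D d}\<rbrakk> \<Longrightarrow> germ_val (adjoint_right C D E a d) x = a (x, d)"
proof -
  interpret section_model C R E "push C E" germ_val by (rule push_model[OF ring])
  have *: "adjoint_right C D E a d \<in> tspace (push C E) \<and> prj (push C E) (adjoint_right C D E a d) = prj D d \<and>
      (\<forall>x\<in>pre C {prj D d}. germ_val (adjoint_right C D E a d) x = a (x, d))" if d: "d \<in> tspace D" for d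
  proof -
    let ?y = "prj D d"
    let ?P = "\<lambda>(V, t). openin (pts (tgt C)) V \<and> prj D d \<in> V \<and> t \<in> sections_over (tgt C) D V \<and> t (prj D d) = d"
    have yb: "?y \<in> base (tgt C)" using sheaf_prj[OF D d] .
    have "pts (tgt C) = discrete_topology (base (tgt C))" by (rule tgt_disc)
    then have st: "subtopology (pts (tgt C)) {?y} = discrete_topology {?y}"
      using yb by (metis Int_insert_right_if1 inf_bot_right subtopology_discrete_topology)
    \<comment> \<open>Witness for the choice of a local section through \<open>d\<close>: the
      constant one over the open point. Any other choice has the same value at
      \<open>prj D d\<close> and yields the same germ.\<close>
    have "?P ({?y}, \<lambda>y\<in>{?y}. d)"
      unfolding sections_over_def st using yb d by (simp add: openin_tgt)
    then have "?P (SOME p. ?P p)" by (rule someI)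
    moreover obtain V t where Vt: "(SOME p. ?P p) = (V, t)" by (cases "SOME p. ?P p")
    ultimately have V: "V \<subseteq> base (tgt C)" "?y \<in> V" "t ?y = d" by (simp_all add: openin_tgt)
    have "adjoint_right C D E a d = germ C E ?y V (restrict (\<lambda>x. a (x, t (pt_map C x))) (pre C V))"
      using d Vt by (simp add: adjoint_right_def)
    also have "\<dots> = germ C E ?y {?y} (\<lambda>x. a (x, d))"
      by (rule germ_cong) (use V yb in \<open>auto simp: mem_pre\<close>)
    finally show ?thesis
      using germ_push[OF _ _ pull_hom_inv_on[OF D a d]] yb by simp
  qed
  show "adjoint_right C D E a \<in> sheaf_hom R (tgt C) D (push C E)"
    by (rule mate_hom[OF D a]) (use * in \<open>simp_all add: adjoint_right_def\<close>)
  show "germ_val (adjoint_right C D E a d) x = a (x, d)" if "d \<in> tspace D" "x \<in> pre C {prj D d}" for d x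
    using * that by blast
qed

end

end

lemma inv_on_cong:
  assumes s: "inv_on C E V s" and eq: "\<And>x. x \<in> pre C V \<Longrightarrow> s x = s' x"
    and mv: "\<And>n x. \<lbrakk>n \<in> carrier (grp (src C)); grp_map C n = \<one>\<^bsub>grp (tgt C)\<^esub>; x \<in> pre C V\<rbrakk>
      \<Longrightarrow> mov (src C) n x \<in> pre C V"
  shows "inv_on C E V s'"
proof (rule inv_onI)
  show "continuous_map (subtopology (pts (src C)) (pre C V)) (tot E) s'"
    by (rule continuous_map_eq[OF inv_on_cont[OF s]]) (simp add: topspace_pre eq)
  show "prj E (s' x) = x" if "x \<in> pre C V" for x
    using inv_on_prj[OF s that] eq[OF that] by simp
  show "s' (mov (src C) n x) = emov E n (s' x)"
    if "n \<in> carrier (grp (src C))" "grp_map C n = \<one>\<^bsub>grp (tgt C)\<^esub>" "x \<in> pre C V" for n x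
    using inv_on_mov[OF s that] eq[OF mv[OF that]] eq[OF that(3)] by simp
qed

text \<open>The conditions of a model see \<open>ev\<close> only on the fibres, which allows
  evaluation to be replaced by an extensional map, as the components of a cocone must be.\<close>

lemma (in section_model) model_cong:
  assumes eq: "\<And>z x. \<lbrakk>z \<in> tspace F; x \<in> pre C {prj F z}\<rbrakk> \<Longrightarrow> ev z x = ev' z x"
  shows "section_model C R E F ev'"
proof (intro section_model.intro[OF discrete_change_axioms] section_model_axioms.intro)
  show "ring R" "is_sheaf R (src C) E" "tot F = discrete_topology (tspace F)"
    using ring E tot_discrete .
  show "prj F z \<in> base (tgt C)" if "z \<in> tspace F" for z using prj_closed that .
  show "inv_on C E {prj F z} (ev' z)" if z: "z \<in> tspace F" for z
    using ev_inv_on[OF z] eq[OF z] mov_kernel_pre by (rule inv_on_cong)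
  show "z = z'" if "z \<in> tspace F" "z' \<in> tspace F" "prj F z = prj F z'"
    "\<And>x. x \<in> pre C {prj F z'} \<Longrightarrow> ev' z x = ev' z' x" for z z'
    by (rule ev_eqI[OF that(1-3)]) (use that eq in simp)
  show "\<exists>z. z \<in> tspace F \<and> prj F z = y \<and> (\<forall>x\<in>pre C {y}. ev' z x = s x)"
    if "y \<in> base (tgt C)" "inv_on C E {y} s" for y s
    using ev_surj[OF that] eq by metis
  show "ezero F y \<in> tspace F \<and> prj F (ezero F y) = y \<and> (\<forall>x\<in>pre C {y}. ev' (ezero F y) x = ezero E x)"
    if "y \<in> base (tgt C)" for y
    using zero[OF that] eq[of "ezero F y"] by simp
  show "esum F a b \<in> tspace F \<and> prj F (esum F a b) = prj F b \<and>
      (\<forall>x\<in>pre C {prj F b}. ev' (esum F a b) x = esum E (ev' a x) (ev' b x))"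
    if "a \<in> tspace F" "b \<in> tspace F" "prj F a = prj F b" for a b
    using add[OF that] eq[of "esum F a b"] eq[OF that(1)] eq[OF that(2)] that(3) by simp
  show "escal F r a \<in> tspace F \<and> prj F (escal F r a) = prj F a \<and>
      (\<forall>x\<in>pre C {prj F a}. ev' (escal F r a) x = escal E r (ev' a x))"
    if "r \<in> carrier R" "a \<in> tspace F" for r a
    using scal[OF that] eq[of "escal F r a"] eq[OF that(2)] by simp
  show "emov F h \<in> extensional (tspace F)" if "h \<in> carrier (grp (tgt C))" for h using emov_ext that .
  show "emov F (grp_map C g) a \<in> tspace F \<and>
      prj F (emov F (grp_map C g) a) = mov (tgt C) (grp_map C g) (prj F a) \<and>
      (\<forall>x\<in>pre C {prj F a}. ev' (emov F (grp_map C g) a) (mov (src C) g x) = emov E g (ev' a x))"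
    if "g \<in> carrier (grp (src C))" "a \<in> tspace F" for g a
    using emov[OF that] eq[of "emov F (grp_map C g) a"] eq[OF that(2)] mov_pre[OF that(1)] by simp
qed

section \<open>Systems of finite discrete spaces\<close>

lemma lim_proj_simps [simp]:
  "src (lim_proj S i) = lim_gspace S" "tgt (lim_proj S i) = lvl S i"
  "grp_map (lim_proj S i) = (\<lambda>g. g i)" "pt_map (lim_proj S i) = (\<lambda>x. x i)"
  by (simp_all add: lim_proj_def)

lemma transition_simps [simp]:
  "src (transition S i j f) = lvl S i" "tgt (transition S i j f) = lvl S j"
  "grp_map (transition S i j f) = trG S i j f" "pt_map (transition S i j f) = trX S i j f"
  by (simp_all add: transition_def)

locale system =
  fixes R :: "('r, 's) ring_scheme" and S :: "('o, 'm, 'g, 'x) diagram"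
  assumes ring: "ring R" and cof: "cofiltered (idx S)"
    and fin: "i \<in> Obj (idx S) \<Longrightarrow> finite_discrete_gspace (lvl S i)"
    and diag: "surjective_equivariant_diagram S"
begin

abbreviation "I \<equiv> Obj (idx S)"
abbreviation "Ar \<equiv> Hom (idx S)"
abbreviation "L \<equiv> lim_gspace S"
abbreviation "p i \<equiv> lim_proj S i"
abbreviation "tn \<equiv> transition S"

lemma lvl_gspace: "i \<in> I \<Longrightarrow> is_gspace (lvl S i)"
  using fin by (simp add: finite_discrete_gspace_def)

lemma lvl_disc: "i \<in> I \<Longrightarrow> pts (lvl S i) = discrete_topology (base (lvl S i))"
  using fin by (simp add: finite_discrete_gspace_def)

lemma lvl_gdisc: "i \<in> I \<Longrightarrow> gtop (lvl S i) = discrete_topology (carrier (grp (lvl S i)))"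
  using fin by (simp add: finite_discrete_gspace_def)

lemma lvl_gtop: "i \<in> I \<Longrightarrow> topspace (gtop (lvl S i)) = carrier (grp (lvl S i))"
  by (simp add: lvl_gdisc)

lemma lvl_act: "i \<in> I \<Longrightarrow> group_action (grp (lvl S i)) (base (lvl S i)) (mov (lvl S i))"
  using lvl_gspace by (simp add: is_gspace_def continuous_action_def)

lemma lvl_mov_cont:
  "i \<in> I \<Longrightarrow> continuous_map (prod_topology (gtop (lvl S i)) (pts (lvl S i))) (pts (lvl S i)) (\<lambda>(g, x). mov (lvl S i) g x)"
  using lvl_gspace by (simp add: is_gspace_def continuous_action_def)

lemma lvl_group: "i \<in> I \<Longrightarrow> group (grp (lvl S i))"
  using group_action_group[OF lvl_act] .

context
  fixes i j f
  assumes ij: "i \<in> I" "j \<in> I" "f \<in> Ar i j"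
begin

lemma trG_hom: "trG S i j f \<in> hom (grp (lvl S i)) (grp (lvl S j))"
  and trG_surj: "trG S i j f ` carrier (grp (lvl S i)) = carrier (grp (lvl S j))"
  and trX_surj: "trX S i j f ` base (lvl S i) = base (lvl S j)"
  and tr_equiv: "\<lbrakk>g \<in> carrier (grp (lvl S i)); x \<in> base (lvl S i)\<rbrakk> \<Longrightarrow>
    trX S i j f (mov (lvl S i) g x) = mov (lvl S j) (trG S i j f g) (trX S i j f x)"
  using diag ij unfolding surjective_equivariant_diagram_def by blast+

lemma trX_closed: "x \<in> base (lvl S i) \<Longrightarrow> trX S i j f x \<in> base (lvl S j)"
  using trX_surj by blast

end

lemma trX_id: "\<lbrakk>i \<in> I; x \<in> base (lvl S i)\<rbrakk> \<Longrightarrow> trX S i i (Idn (idx S) i) x = x"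
  using diag unfolding surjective_equivariant_diagram_def by blast

lemma tr_comp:
  assumes "i \<in> I" "j \<in> I" "k \<in> I" "f \<in> Ar i j" "f' \<in> Ar j k"
  shows "g \<in> carrier (grp (lvl S i)) \<Longrightarrow> trG S i k (Cmp (idx S) i j k f' f) g = trG S j k f' (trG S i j f g)"
    and "x \<in> base (lvl S i) \<Longrightarrow> trX S i k (Cmp (idx S) i j k f' f) x = trX S j k f' (trX S i j f x)"
  using diag assms unfolding surjective_equivariant_diagram_def by blast+

lemma inverse_system_X: "inverse_system (idx S) (\<lambda>i. pts (lvl S i)) (trX S)"
  by unfold_locales (use cof fin lvl_disc trX_surj tr_comp in \<open>auto simp: finite_discrete_gspace_def\<close>)

lemma inverse_system_G: "inverse_system (idx S) (\<lambda>i. gtop (lvl S i)) (trG S)"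
proof
  show "gtop (lvl S i) = discrete_topology (topspace (gtop (lvl S i)))" if "i \<in> I" for i
    using lvl_gdisc[OF that] by simp
  show "finite (topspace (gtop (lvl S i)))" if "i \<in> I" for i
    using fin[OF that] lvl_gtop[OF that] by (simp add: finite_discrete_gspace_def)
qed (simp_all add: cof trG_surj tr_comp lvl_gtop)

sublocale X: inverse_system "idx S" "\<lambda>i. pts (lvl S i)" "trX S"
  by (rule inverse_system_X)

sublocale G: inverse_system "idx S" "\<lambda>i. gtop (lvl S i)" "trG S"
  by (rule inverse_system_G)

section \<open>The limit group and its action on the limit space\<close>

lemma lim_points_eq: "lim_points S = X.lim"
  by (simp add: lim_points_def X.lim_def)

lemma lim_carrier_eq: "lim_carrier S = G.lim"
proof -
  have "(\<Pi>\<^sub>E i\<in>I. carrier (grp (lvl S i))) = (\<Pi>\<^sub>E i\<in>I. topspace (gtop (lvl S i)))"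
    by (rule PiE_cong) (simp add: lvl_gtop)
  then show ?thesis by (simp add: lim_carrier_def G.lim_def)
qed

lemma L_top: "pts L = X.limtop" "gtop L = G.limtop"
  by (simp_all add: lim_gspace_def lim_points_eq lim_carrier_eq)

lemma L_simps: "carrier (grp L) = G.lim" "base L = X.lim" "topspace (gtop L) = G.lim"
  using X.topspace_limtop G.topspace_limtop unfolding L_top by (simp_all add: lim_gspace_def lim_carrier_eq)

lemma L_coord:
  "i \<in> I \<Longrightarrow> (g \<otimes>\<^bsub>grp L\<^esub> h) i = g i \<otimes>\<^bsub>grp (lvl S i)\<^esub> h i"
  "i \<in> I \<Longrightarrow> \<one>\<^bsub>grp L\<^esub> i = \<one>\<^bsub>grp (lvl S i)\<^esub>"
  "\<lbrakk>i \<in> I; x \<in> X.lim\<rbrakk> \<Longrightarrow> mov L g x i = mov (lvl S i) (g i) (x i)"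
  by (simp_all add: lim_gspace_def lim_points_eq)

lemma G_coord: "\<lbrakk>g \<in> G.lim; i \<in> I\<rbrakk> \<Longrightarrow> g i \<in> carrier (grp (lvl S i))"
  using G.lim_coord lvl_gtop by blast

lemma X_eqI: "\<lbrakk>x \<in> X.lim; x' \<in> X.lim; \<And>i. i \<in> I \<Longrightarrow> x i = x' i\<rbrakk> \<Longrightarrow> x = x'"
  unfolding X.lim_def by (blast intro: PiE_ext)

lemma G_eqI: "\<lbrakk>x \<in> G.lim; x' \<in> G.lim; \<And>i. i \<in> I \<Longrightarrow> x i = x' i\<rbrakk> \<Longrightarrow> x = x'"
  unfolding G.lim_def by (blast intro: PiE_ext)

lemma G_limI:
  assumes "\<And>i. i \<in> I \<Longrightarrow> g i \<in> carrier (grp (lvl S i))"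
    "\<And>i j f. \<lbrakk>i \<in> I; j \<in> I; f \<in> Ar i j\<rbrakk> \<Longrightarrow> trG S i j f (g i) = g j" "g \<in> extensional I"
  shows "g \<in> G.lim"
  using assms lvl_gtop by (simp add: G.lim_def PiE_iff)

lemma X_limI:
  assumes "\<And>i. i \<in> I \<Longrightarrow> x i \<in> base (lvl S i)"
    "\<And>i j f. \<lbrakk>i \<in> I; j \<in> I; f \<in> Ar i j\<rbrakk> \<Longrightarrow> trX S i j f (x i) = x j" "x \<in> extensional I"
  shows "x \<in> X.lim"
  using assms by (simp add: X.lim_def PiE_iff)

lemma mult_closed:
  assumes g: "g \<in> G.lim" "h \<in> G.lim"
  shows "g \<otimes>\<^bsub>grp L\<^esub> h \<in> G.lim"
proof (rule G_limI)
  show "(g \<otimes>\<^bsub>grp L\<^esub> h) i \<in> carrier (grp (lvl S i))" if i: "i \<in> I" for i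
    using monoid.m_closed[OF group.is_monoid[OF lvl_group[OF i]] G_coord[OF g(1) i] G_coord[OF g(2) i]]
    by (simp add: L_coord i)
  show "trG S i j f ((g \<otimes>\<^bsub>grp L\<^esub> h) i) = (g \<otimes>\<^bsub>grp L\<^esub> h) j" if ij: "i \<in> I" "j \<in> I" "f \<in> Ar i j" for i j f
    using hom_mult[OF trG_hom[OF ij] G_coord[OF g(1) ij(1)] G_coord[OF g(2) ij(1)]] G.lim_tr[OF g(1) ij] G.lim_tr[OF g(2) ij]
    by (simp add: L_coord ij)
qed (simp add: lim_gspace_def)

lemma one_closed: "\<one>\<^bsub>grp L\<^esub> \<in> G.lim"
proof (rule G_limI)
  show "\<one>\<^bsub>grp L\<^esub> i \<in> carrier (grp (lvl S i))" if i: "i \<in> I" for i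
    using monoid.one_closed[OF group.is_monoid[OF lvl_group[OF i]]] by (simp add: L_coord i)
  show "trG S i j f (\<one>\<^bsub>grp L\<^esub> i) = \<one>\<^bsub>grp L\<^esub> j" if ij: "i \<in> I" "j \<in> I" "f \<in> Ar i j" for i j f
    using hom_one[OF trG_hom[OF ij] lvl_group[OF ij(1)] lvl_group[OF ij(2)]] by (simp add: L_coord ij)
qed (simp add: lim_gspace_def)

lemma group_L: "group (grp L)"
proof (rule groupI, unfold L_simps)
  fix g h k assume g: "g \<in> G.lim" and h: "h \<in> G.lim" and k: "k \<in> G.lim"
  show "g \<otimes>\<^bsub>grp L\<^esub> h \<in> G.lim" by (rule mult_closed[OF g h])
  show "g \<otimes>\<^bsub>grp L\<^esub> h \<otimes>\<^bsub>grp L\<^esub> k = g \<otimes>\<^bsub>grp L\<^esub> (h \<otimes>\<^bsub>grp L\<^esub> k)"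
  proof (rule G_eqI)
    show "(g \<otimes>\<^bsub>grp L\<^esub> h \<otimes>\<^bsub>grp L\<^esub> k) i = (g \<otimes>\<^bsub>grp L\<^esub> (h \<otimes>\<^bsub>grp L\<^esub> k)) i" if i: "i \<in> I" for i
      using monoid.m_assoc[OF group.is_monoid[OF lvl_group[OF i]] G_coord[OF g i] G_coord[OF h i] G_coord[OF k i]]
      by (simp add: L_coord i)
  qed (simp_all add: mult_closed g h k)
next
  show "\<one>\<^bsub>grp L\<^esub> \<in> G.lim" by (rule one_closed)
next
  fix g assume g: "g \<in> G.lim"
  show "\<one>\<^bsub>grp L\<^esub> \<otimes>\<^bsub>grp L\<^esub> g = g"
  proof (rule G_eqI)
    show "(\<one>\<^bsub>grp L\<^esub> \<otimes>\<^bsub>grp L\<^esub> g) i = g i" if i: "i \<in> I" for i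
      using monoid.l_one[OF group.is_monoid[OF lvl_group[OF i]] G_coord[OF g i]] by (simp add: L_coord i)
  qed (simp_all add: mult_closed one_closed g)
  define h where "h = (\<lambda>i\<in>I. inv\<^bsub>grp (lvl S i)\<^esub> (g i))"
  have h: "h \<in> G.lim"
  proof (rule G_limI)
    show "h i \<in> carrier (grp (lvl S i))" if i: "i \<in> I" for i
      using group.inv_closed[OF lvl_group[OF i] G_coord[OF g i]] i by (simp add: h_def)
    show "trG S i j f (h i) = h j" if ij: "i \<in> I" "j \<in> I" "f \<in> Ar i j" for i j f
    proof -
      interpret group_hom "grp (lvl S i)" "grp (lvl S j)" "trG S i j f"
        using lvl_group ij trG_hom[OF ij] by (simp add: group_hom_def group_hom_axioms_def)
      show ?thesis using hom_inv[OF G_coord[OF g ij(1)]] G.lim_tr[OF g ij] ij by (simp add: h_def)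
    qed
  qed (simp add: h_def)
  have "h \<otimes>\<^bsub>grp L\<^esub> g = \<one>\<^bsub>grp L\<^esub>"
  proof (rule G_eqI)
    show "(h \<otimes>\<^bsub>grp L\<^esub> g) i = \<one>\<^bsub>grp L\<^esub> i" if i: "i \<in> I" for i
      using group.l_inv[OF lvl_group[OF i] G_coord[OF g i]] by (simp add: L_coord i h_def)
  qed (simp_all add: mult_closed one_closed g h)
  then show "\<exists>h\<in>G.lim. h \<otimes>\<^bsub>grp L\<^esub> g = \<one>\<^bsub>grp L\<^esub>" using h by blast
qed

lemma mov_closed:
  assumes g: "g \<in> G.lim" and x: "x \<in> X.lim"
  shows "mov L g x \<in> X.lim"
proof (rule X_limI)
  show "mov L g x i \<in> base (lvl S i)" if i: "i \<in> I" for i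
    using group_action_closed[OF lvl_act[OF i] G_coord[OF g i] X.lim_coord[OF x i]] by (simp add: L_coord i x)
  show "trX S i j f (mov L g x i) = mov L g x j" if ij: "i \<in> I" "j \<in> I" "f \<in> Ar i j" for i j f
    using tr_equiv[OF ij G_coord[OF g ij(1)] X.lim_coord[OF x ij(1)]] X.lim_tr[OF x ij] G.lim_tr[OF g ij]
    by (simp add: L_coord ij x)
  show "mov L g x \<in> extensional I" using x by (simp add: lim_gspace_def lim_points_eq)
qed

lemma act_L: "group_action (grp L) (base L) (mov L)"
proof (rule group_actionI[OF group_L], unfold L_simps)
  show "mov L g \<in> extensional X.lim" for g by (simp add: lim_gspace_def lim_points_eq)
  show "mov L g x \<in> X.lim" if "g \<in> G.lim" "x \<in> X.lim" for g x using mov_closed that .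
  show "mov L \<one>\<^bsub>grp L\<^esub> x = x" if x: "x \<in> X.lim" for x
  proof (rule X_eqI)
    show "mov L \<one>\<^bsub>grp L\<^esub> x i = x i" if i: "i \<in> I" for i
      using group_action_one[OF lvl_act[OF i] X.lim_coord[OF x i]] by (simp add: L_coord i x)
  qed (simp_all add: mov_closed one_closed x)
  show "mov L (g \<otimes>\<^bsub>grp L\<^esub> h) x = mov L g (mov L h x)" if gh: "g \<in> G.lim" "h \<in> G.lim" and x: "x \<in> X.lim" for g h x
  proof (rule X_eqI)
    show "mov L (g \<otimes>\<^bsub>grp L\<^esub> h) x i = mov L g (mov L h x) i" if i: "i \<in> I" for i
      using group_action_mult[OF lvl_act[OF i] G_coord[OF gh(1) i] G_coord[OF gh(2) i] X.lim_coord[OF x i]]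
      by (simp add: L_coord i x mov_closed gh)
  qed (simp_all add: mov_closed mult_closed gh x)
qed

text \<open>Continuity into the limit is tested on components, and the component at \<open>i\<close>
  factors through the action at level \<open>i\<close>.\<close>

lemma mov_L_cont: "continuous_map (prod_topology (gtop L) (pts L)) (pts L) (\<lambda>(g, x). mov L g x)"
proof -
  let ?P = "prod_topology (gtop L) (pts L)"
  have tp: "topspace ?P = G.lim \<times> X.lim" by (simp add: L_simps)
  have ext: "X.lim \<subseteq> extensional I" by (auto simp: X.lim_def PiE_def)
  have "continuous_map ?P (pts (lvl S i)) (\<lambda>y. (case y of (g, x) \<Rightarrow> mov L g x) i)" if i: "i \<in> I" for i
  proof -
    have "continuous_map (gtop L) (gtop (lvl S i)) (\<lambda>g. g i)" "continuous_map (pts L) (pts (lvl S i)) (\<lambda>x. x i)"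
      using G.cont_coord[OF i] X.cont_coord[OF i] unfolding L_top .
    then have "continuous_map ?P (prod_topology (gtop (lvl S i)) (pts (lvl S i))) (\<lambda>(g, x). (g i, x i))"
      by (simp add: continuous_map_prod_top)
    from continuous_map_compose[OF this lvl_mov_cont[OF i]]
    show ?thesis
    proof (rule continuous_map_eq)
      fix y assume "y \<in> topspace ?P"
      then obtain g x where "y = (g, x)" "x \<in> X.lim" unfolding tp by blast
      then show "((\<lambda>(g, x). mov (lvl S i) g x) \<circ> (\<lambda>(g, x). (g i, x i))) y = (case y of (g, x) \<Rightarrow> mov L g x) i"
        using L_coord(3)[OF i] by simp
    qed
  qed
  moreover have "(\<lambda>(g, x). mov L g x) ` topspace ?P \<subseteq> extensional I"
    unfolding tp using mov_closed ext by auto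
  ultimately have "continuous_map ?P (product_topology (\<lambda>i. pts (lvl S i)) I) (\<lambda>(g, x). mov L g x)"
    unfolding continuous_map_componentwise by blast
  moreover have "(\<lambda>(g, x). mov L g x) \<in> topspace ?P \<rightarrow> X.lim"
    unfolding tp using mov_closed by auto
  ultimately show ?thesis
    unfolding L_top continuous_map_in_subtopology by blast
qed

section \<open>Projections and transitions as changes of space and group\<close>

lemma dc_proj:
  assumes i: "i \<in> I"
  shows "discrete_change (p i)"
proof (intro discrete_change.intro, unfold lim_proj_simps)
  show "(\<lambda>g. g i) \<in> hom (grp L) (grp (lvl S i))"
    by (rule homI) (simp_all add: L_simps L_coord G_coord i)
  show "(\<lambda>g. g i) ` carrier (grp L) = carrier (grp (lvl S i))"
  proof
    show "(\<lambda>g. g i) ` carrier (grp L) \<subseteq> carrier (grp (lvl S i))"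
      using G_coord[OF _ i] by (auto simp: L_simps)
    show "carrier (grp (lvl S i)) \<subseteq> (\<lambda>g. g i) ` carrier (grp L)"
    proof
      fix h assume "h \<in> carrier (grp (lvl S i))"
      then have "h \<in> topspace (gtop (lvl S i))" by (simp add: lvl_gtop i)
      \<comment> \<open>Here the compactness argument for projections is applied to the
        groups.\<close>
      then obtain g where "g \<in> G.lim" "g i = h" by (rule G.proj_surj[OF i])
      then show "h \<in> (\<lambda>g. g i) ` carrier (grp L)" by (auto simp: L_simps)
    qed
  qed
  show "continuous_map (pts L) (pts (lvl S i)) (\<lambda>x. x i)" using X.cont_coord[OF i] unfolding L_top .
  show "continuous_map (pts L) (pts L) (mov L g)" if g: "g \<in> carrier (grp L)" for g
  proof -
    have "continuous_map (pts L) (prod_topology (gtop L) (pts L)) (\<lambda>x. (g, x))"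
      using g by (intro continuous_map_pairedI) (simp_all add: L_simps)
    then show ?thesis using continuous_map_compose[OF _ mov_L_cont] by (fastforce simp: o_def)
  qed
  show "group_action (grp L) (base L) (mov L)" by (rule act_L)
  show "group_action (grp (lvl S i)) (base (lvl S i)) (mov (lvl S i))" by (rule lvl_act[OF i])
  show "pts (lvl S i) = discrete_topology (base (lvl S i))" by (rule lvl_disc[OF i])
  show "gtop (lvl S i) = discrete_topology (carrier (grp (lvl S i)))" by (rule lvl_gdisc[OF i])
qed (simp_all add: L_simps L_coord i)

lemma dc_trans:
  assumes ij: "i \<in> I" "j \<in> I" "f \<in> Ar i j"
  shows "discrete_change (tn i j f)"
proof (intro discrete_change.intro, unfold transition_simps)
  show "continuous_map (pts (lvl S i)) (pts (lvl S j)) (trX S i j f)"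
    by (subst lvl_disc[OF ij(1)]) (use trX_closed[OF ij] in auto)
  show "continuous_map (pts (lvl S i)) (pts (lvl S i)) (mov (lvl S i) g)" if "g \<in> carrier (grp (lvl S i))" for g
    by (subst lvl_disc[OF ij(1)]) (use group_action_closed[OF lvl_act[OF ij(1)] that] in auto)
  show "pts (lvl S j) = discrete_topology (base (lvl S j))" by (rule lvl_disc[OF ij(2)])
  show "gtop (lvl S j) = discrete_topology (carrier (grp (lvl S j)))" by (rule lvl_gdisc[OF ij(2)])
qed (simp_all add: ij lvl_act lvl_gtop trG_hom trG_surj tr_equiv)

lemma mem_fibre: "x \<in> pre (p i) {y} \<longleftrightarrow> x \<in> X.lim \<and> x i = y"
  by (simp add: mem_pre L_simps)

subsection \<open>Sheaves over the system and cocones\<close>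

lemma mem_pull_proj: "(x, d) \<in> tspace (pull (p i) D) \<longleftrightarrow> d \<in> tspace D \<and> x \<in> X.lim \<and> x i = prj D d"
  by (auto simp: tspace_pull L_simps)

lemma mem_pull_trans: "(x, d) \<in> tspace (pull (tn i j f) D) \<longleftrightarrow>
    d \<in> tspace D \<and> x \<in> base (lvl S i) \<and> trX S i j f x = prj D d"
  by (auto simp: tspace_pull)

lemma ds_sheaf: "\<lbrakk>is_dsheaf R S D; i \<in> I\<rbrakk> \<Longrightarrow> is_sheaf R (lvl S i) (dsh D i)"
  by (simp add: is_dsheaf_def)

lemma ds_str: "\<lbrakk>is_dsheaf R S D; i \<in> I; j \<in> I; f \<in> Ar i j\<rbrakk> \<Longrightarrow>
    str D i j f \<in> sheaf_hom R (lvl S i) (pull (tn i j f) (dsh D j)) (dsh D i)"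
  by (simp add: is_dsheaf_def)

lemma ds_str_closed:
  assumes "is_dsheaf R S D" "i \<in> I" "j \<in> I" "f \<in> Ar i j" "d \<in> tspace (dsh D j)" "x \<in> base (lvl S i)"
    "trX S i j f x = prj (dsh D j) d"
  shows "str D i j f (x, d) \<in> tspace (dsh D i)" "prj (dsh D i) (str D i j f (x, d)) = x"
  using hom_closed[OF ds_str[OF assms(1-4)], of "(x, d)"] hom_prj[OF ds_str[OF assms(1-4)], of "(x, d)"] assms
  by (simp_all add: mem_pull_trans)

lemma ds_id:
  assumes "is_dsheaf R S D" "i \<in> I" "d \<in> tspace (dsh D i)"
  shows "str D i i (Idn (idx S) i) (prj (dsh D i) d, d) = d"
proof -
  have "prj (dsh D i) d \<in> base (lvl S i)" using sheaf_prj[OF ds_sheaf[OF assms(1,2)] assms(3)] .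
  then have "(prj (dsh D i) d, d) \<in> tspace (pull (tn i i (Idn (idx S) i)) (dsh D i))"
    using assms trX_id by (simp add: mem_pull_trans)
  moreover have "\<forall>i\<in>I. \<forall>(x, d)\<in>tspace (pull (tn i i (Idn (idx S) i)) (dsh D i)). str D i i (Idn (idx S) i) (x, d) = d"
    using assms(1) unfolding is_dsheaf_def Let_def by (elim conjE)
  ultimately show ?thesis using assms(2) by fast
qed

lemma ds_comp:
  assumes "is_dsheaf R S D" "i \<in> I" "j \<in> I" "k \<in> I" "f \<in> Ar i j" "f' \<in> Ar j k"
    "d \<in> tspace (dsh D k)" "x \<in> base (lvl S i)" "trX S j k f' (trX S i j f x) = prj (dsh D k) d"
  shows "str D i k (Cmp (idx S) i j k f' f) (x, d) = str D i j f (x, str D j k f' (trX S i j f x, d))"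
proof -
  have "(x, d) \<in> tspace (pull (tn i k (Cmp (idx S) i j k f' f)) (dsh D k))"
    using assms tr_comp(2)[OF assms(2-6,8)] by (simp add: mem_pull_trans)
  moreover have "\<forall>i\<in>I. \<forall>j\<in>I. \<forall>k\<in>I. \<forall>f\<in>Ar i j. \<forall>f'\<in>Ar j k. \<forall>(x, d)\<in>tspace (pull (tn i k (Cmp (idx S) i j k f' f)) (dsh D k)).
      str D i k (Cmp (idx S) i j k f' f) (x, d) = str D i j f (x, str D j k f' (trX S i j f x, d))"
    using assms(1) unfolding is_dsheaf_def Let_def by (elim conjE)
  ultimately show ?thesis using assms(2-6) by fast
qed

text \<open>The profunctor \<open>H\<close> of the adjunction. Cocones are extensional in the index,
  so that those agreeing on all of \<open>I\<close> are equal, as the uniqueness statements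
  require.\<close>

definition cocones ::
  "('o, 'm, 'g, 'x, 'r, 'd) dsheaf \<Rightarrow> ('o \<Rightarrow> 'g, 'o \<Rightarrow> 'x, 'r, 'e) sheaf \<Rightarrow> ('o \<Rightarrow> ('o \<Rightarrow> 'x) \<times> 'd \<Rightarrow> 'e) set" where
  "cocones D E = {\<kappa> \<in> (\<Pi>\<^sub>E i\<in>I. sheaf_hom R L (pull (p i) (dsh D i)) E).
     \<forall>i\<in>I. \<forall>j\<in>I. \<forall>f\<in>Ar i j. compose (tspace (pull (p j) (dsh D j))) (\<kappa> i) (pull_trans S D i j f) = \<kappa> j}"

lemma pull_trans_apply:
  assumes ij: "i \<in> I" "j \<in> I" "f \<in> Ar i j" and d: "d \<in> tspace (dsh D j)" and x: "x \<in> X.lim" "x j = prj (dsh D j) d"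
  shows "pull_trans S D i j f (x, d) = (x, str D i j f (x i, d))"
proof -
  have "(x, d) \<in> tspace (pull (p j) (dsh D j))" using d x by (simp add: mem_pull_proj)
  moreover have "(x i, d) \<in> tspace (pull (tn i j f) (dsh D j))"
    using d x X.lim_coord[OF x(1) ij(1)] X.lim_tr[OF x(1) ij] by (simp add: mem_pull_trans)
  then have "(x, (x i, d)) \<in> tspace (pull (p i) (pull (tn i j f) (dsh D j)))"
    using x(1) by (simp add: mem_pull_proj)
  ultimately show ?thesis by (simp add: pull_trans_def compose_def pull_map_def)
qed

text \<open>Elementwise form of the cocone condition, in which the identification of iterated
  inverse images has disappeared: the structure map is simply applied at the component
  \<open>x i\<close>.\<close>

lemma cocones_iff:
  "\<kappa> \<in> cocones D E \<longleftrightarrow> \<kappa> \<in> (\<Pi>\<^sub>E i\<in>I. sheaf_hom R L (pull (p i) (dsh D i)) E) \<and>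
     (\<forall>i\<in>I. \<forall>j\<in>I. \<forall>f\<in>Ar i j. \<forall>d\<in>tspace (dsh D j). \<forall>x\<in>X.lim. x j = prj (dsh D j) d \<longrightarrow>
        \<kappa> i (x, str D i j f (x i, d)) = \<kappa> j (x, d))"
proof -
  have *: "compose (tspace (pull (p j) (dsh D j))) (\<kappa> i) (pull_trans S D i j f) = \<kappa> j \<longleftrightarrow>
      (\<forall>d\<in>tspace (dsh D j). \<forall>x\<in>X.lim. x j = prj (dsh D j) d \<longrightarrow> \<kappa> i (x, str D i j f (x i, d)) = \<kappa> j (x, d))"
    if \<kappa>: "\<kappa> \<in> (\<Pi>\<^sub>E i\<in>I. sheaf_hom R L (pull (p i) (dsh D i)) E)" and ij: "i \<in> I" "j \<in> I" "f \<in> Ar i j" for i j f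
  proof
    assume eq: "compose (tspace (pull (p j) (dsh D j))) (\<kappa> i) (pull_trans S D i j f) = \<kappa> j"
    show "\<forall>d\<in>tspace (dsh D j). \<forall>x\<in>X.lim. x j = prj (dsh D j) d \<longrightarrow> \<kappa> i (x, str D i j f (x i, d)) = \<kappa> j (x, d)"
    proof (intro ballI impI)
      fix d x assume dx: "d \<in> tspace (dsh D j)" "x \<in> X.lim" "x j = prj (dsh D j) d"
      then have "(x, d) \<in> tspace (pull (p j) (dsh D j))" by (simp add: mem_pull_proj)
      then show "\<kappa> i (x, str D i j f (x i, d)) = \<kappa> j (x, d)"
        using fun_cong[OF eq, of "(x, d)"] pull_trans_apply[OF ij dx] by (simp add: compose_def)
    qed
  next
    assume eq: "\<forall>d\<in>tspace (dsh D j). \<forall>x\<in>X.lim. x j = prj (dsh D j) d \<longrightarrow> \<kappa> i (x, str D i j f (x i, d)) = \<kappa> j (x, d)"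
    have "\<kappa> j \<in> sheaf_hom R L (pull (p j) (dsh D j)) E" using \<kappa> ij by blast
    then have "\<kappa> j \<in> extensional (tspace (pull (p j) (dsh D j)))" by (rule hom_ext)
    with compose_extensional show "compose (tspace (pull (p j) (dsh D j))) (\<kappa> i) (pull_trans S D i j f) = \<kappa> j"
    proof (rule extensionalityI)
      fix e assume e: "e \<in> tspace (pull (p j) (dsh D j))"
      obtain x d where [simp]: "e = (x, d)" by (cases e)
      have dx: "d \<in> tspace (dsh D j)" "x \<in> X.lim" "x j = prj (dsh D j) d" using e by (simp_all add: mem_pull_proj)
      then show "compose (tspace (pull (p j) (dsh D j))) (\<kappa> i) (pull_trans S D i j f) e = \<kappa> j e"
        using eq pull_trans_apply[OF ij dx] e by (simp add: compose_def)
    qed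
  qed
  show ?thesis unfolding cocones_def mem_Collect_eq by (intro conj_cong refl ball_cong *)
qed

lemma cocone_hom: "\<lbrakk>\<kappa> \<in> cocones D E; i \<in> I\<rbrakk> \<Longrightarrow> \<kappa> i \<in> sheaf_hom R L (pull (p i) (dsh D i)) E"
  by (auto simp: cocones_def)

lemma cocone_str:
  "\<lbrakk>\<kappa> \<in> cocones D E; i \<in> I; j \<in> I; f \<in> Ar i j; d \<in> tspace (dsh D j); x \<in> X.lim; x j = prj (dsh D j) d\<rbrakk>
    \<Longrightarrow> \<kappa> i (x, str D i j f (x i, d)) = \<kappa> j (x, d)"
  by (simp add: cocones_iff)

lemma cocone_eqI:
  assumes \<kappa>: "\<kappa> \<in> cocones D E" "\<kappa>' \<in> cocones D E"
    and eq: "\<And>i d x. \<lbrakk>i \<in> I; d \<in> tspace (dsh D i); x \<in> X.lim; x i = prj (dsh D i) d\<rbrakk> \<Longrightarrow> \<kappa> i (x, d) = \<kappa>' i (x, d)"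
  shows "\<kappa> = \<kappa>'"
proof (rule PiE_ext)
  show "\<kappa> \<in> (\<Pi>\<^sub>E i\<in>I. sheaf_hom R L (pull (p i) (dsh D i)) E)" "\<kappa>' \<in> (\<Pi>\<^sub>E i\<in>I. sheaf_hom R L (pull (p i) (dsh D i)) E)"
    using \<kappa> by (auto simp: cocones_def)
  show "\<kappa> i = \<kappa>' i" if i: "i \<in> I" for i
  proof (rule hom_eqI[OF cocone_hom[OF \<kappa>(1) i] cocone_hom[OF \<kappa>(2) i]])
    fix e assume "e \<in> tspace (pull (p i) (dsh D i))"
    then show "\<kappa> i e = \<kappa>' i e" using eq[OF i] by (cases e) (simp add: mem_pull_proj)
  qed
qed

lemma dsheaf_hom_iff:
  "u \<in> dsheaf_hom R S D D' \<longleftrightarrow> u \<in> (\<Pi>\<^sub>E i\<in>I. sheaf_hom R (lvl S i) (dsh D i) (dsh D' i)) \<and>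
     (\<forall>i\<in>I. \<forall>j\<in>I. \<forall>f\<in>Ar i j. \<forall>d\<in>tspace (dsh D j). \<forall>x\<in>base (lvl S i). trX S i j f x = prj (dsh D j) d \<longrightarrow>
        u i (str D i j f (x, d)) = str D' i j f (x, u j d))"
proof -
  have "compose (tspace (pull (tn i j f) (dsh D j))) (u i) (str D i j f) =
      compose (tspace (pull (tn i j f) (dsh D j))) (str D' i j f) (pull_map (tn i j f) (dsh D j) (u j)) \<longleftrightarrow>
      (\<forall>d\<in>tspace (dsh D j). \<forall>x\<in>base (lvl S i). trX S i j f x = prj (dsh D j) d \<longrightarrow>
        u i (str D i j f (x, d)) = str D' i j f (x, u j d))" (is "?a = ?b \<longleftrightarrow> ?r") for i j f
  proof
    assume eq: "?a = ?b"
    show ?r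
    proof (intro ballI impI)
      fix d x assume "d \<in> tspace (dsh D j)" "x \<in> base (lvl S i)" "trX S i j f x = prj (dsh D j) d"
      then have "(x, d) \<in> tspace (pull (tn i j f) (dsh D j))" by (simp add: mem_pull_trans)
      then show "u i (str D i j f (x, d)) = str D' i j f (x, u j d)"
        using fun_cong[OF eq, of "(x, d)"] by (simp add: compose_def pull_map_def)
    qed
  next
    assume eq: ?r
    from compose_extensional compose_extensional show "?a = ?b"
    proof (rule extensionalityI)
      fix e assume e: "e \<in> tspace (pull (tn i j f) (dsh D j))"
      obtain x d where [simp]: "e = (x, d)" by (cases e)
      show "?a e = ?b e" using eq e by (simp add: compose_def pull_map_def mem_pull_trans)
    qed
  qed
  then show ?thesis unfolding dsheaf_hom_def Let_def by auto
qed

lemma dsheaf_hom_hom: "\<lbrakk>u \<in> dsheaf_hom R S D D'; i \<in> I\<rbrakk> \<Longrightarrow> u i \<in> sheaf_hom R (lvl S i) (dsh D i) (dsh D' i)"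
  by (auto simp: dsheaf_hom_def)

lemma dsheaf_hom_str:
  "\<lbrakk>u \<in> dsheaf_hom R S D D'; i \<in> I; j \<in> I; f \<in> Ar i j; d \<in> tspace (dsh D j); x \<in> base (lvl S i);
    trX S i j f x = prj (dsh D j) d\<rbrakk> \<Longrightarrow> u i (str D i j f (x, d)) = str D' i j f (x, u j d)"
  by (simp add: dsheaf_hom_iff)

lemma dsheaf_hom_eqI:
  assumes u: "u \<in> dsheaf_hom R S D D'" "u' \<in> dsheaf_hom R S D D'"
    and eq: "\<And>i d. \<lbrakk>i \<in> I; d \<in> tspace (dsh D i)\<rbrakk> \<Longrightarrow> u i d = u' i d"
  shows "u = u'"
proof (rule PiE_ext)
  show "u \<in> (\<Pi>\<^sub>E i\<in>I. sheaf_hom R (lvl S i) (dsh D i) (dsh D' i))" "u' \<in> (\<Pi>\<^sub>E i\<in>I. sheaf_hom R (lvl S i) (dsh D i) (dsh D' i))"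
    using u by (auto simp: dsheaf_hom_def)
  show "u i = u' i" if i: "i \<in> I" for i
    by (rule hom_eqI[OF dsheaf_hom_hom[OF u(1) i] dsheaf_hom_hom[OF u(2) i]]) (use eq i in blast)
qed

lemma dsheaf_comp_apply: "\<lbrakk>i \<in> I; d \<in> tspace (dsh D i)\<rbrakk> \<Longrightarrow> dsheaf_comp S D v u i d = v i (u i d)"
  by (simp add: dsheaf_comp_def compose_def)

lemma dsheaf_comp_hom:
  assumes D: "is_dsheaf R S D" and u: "u \<in> dsheaf_hom R S D D'" and v: "v \<in> dsheaf_hom R S D' D''"
  shows "dsheaf_comp S D v u \<in> dsheaf_hom R S D D''"
  unfolding dsheaf_hom_iff
proof (intro conjI ballI impI)
  show "dsheaf_comp S D v u \<in> (\<Pi>\<^sub>E i\<in>I. sheaf_hom R (lvl S i) (dsh D i) (dsh D'' i))"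
    unfolding dsheaf_comp_def
    using compose_hom[OF sheaf_ops_closed[OF ds_sheaf[OF D]] dsheaf_hom_hom[OF u] dsheaf_hom_hom[OF v]] by auto
  fix i j f d x assume ij: "i \<in> I" "j \<in> I" "f \<in> Ar i j" and d: "d \<in> tspace (dsh D j)"
    and x: "x \<in> base (lvl S i)" "trX S i j f x = prj (dsh D j) d"
  note ud = hom_closed[OF dsheaf_hom_hom[OF u ij(2)] d] hom_prj[OF dsheaf_hom_hom[OF u ij(2)] d]
  show "dsheaf_comp S D v u i (str D i j f (x, d)) = str D'' i j f (x, dsheaf_comp S D v u j d)"
    using ds_str_closed[OF D ij d x] dsheaf_hom_str[OF u ij d x] dsheaf_hom_str[OF v ij ud(1) x(1)] ud(2) x(2)
    by (simp add: dsheaf_comp_apply ij d)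
qed

lemma dsheaf_id_hom:
  assumes D: "is_dsheaf R S D"
  shows "dsheaf_id S D \<in> dsheaf_hom R S D D"
  unfolding dsheaf_hom_iff
proof (intro conjI ballI impI)
  show "dsheaf_id S D \<in> (\<Pi>\<^sub>E i\<in>I. sheaf_hom R (lvl S i) (dsh D i) (dsh D i))"
    unfolding dsheaf_id_def using sheaf_id_hom[OF sheaf_ops_closed[OF ds_sheaf[OF D]]] by auto
qed (use ds_str_closed[OF D] in \<open>simp add: dsheaf_id_def sheaf_id_def\<close>)

lemma dsheaf_id_apply: "\<lbrakk>i \<in> I; d \<in> tspace (dsh D i)\<rbrakk> \<Longrightarrow> dsheaf_id S D i d = d"
  by (simp add: dsheaf_id_def sheaf_id_def)

lemma DSheaves_simps:
  "Obj (DSheaves R S) = {D. is_dsheaf R S D}" "Hom (DSheaves R S) = dsheaf_hom R S"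
  "Cmp (DSheaves R S) D D' D'' v u = dsheaf_comp S D v u" "Idn (DSheaves R S) = dsheaf_id S"
  by (simp_all add: DSheaves_def)

lemma Sheaves_simps:
  "Obj (Sheaves R B) = {E. is_sheaf R B E}" "Hom (Sheaves R B) = sheaf_hom R B"
  "Cmp (Sheaves R B) E E' E'' g f = compose (tspace E) g f" "Idn (Sheaves R B) = sheaf_id"
  by (simp_all add: Sheaves_def)

lemma category_DSheaves: "category (DSheaves R S)"
  unfolding category_def DSheaves_simps mem_Collect_eq
proof (intro conjI ballI, goal_cases)
  case (1 a) then show ?case by (simp add: dsheaf_id_hom)
next
  case (2 a b c f g) then show ?case by (simp add: dsheaf_comp_hom)
next
  case (3 a b f)
  then show ?case
    by (intro dsheaf_hom_eqI[OF dsheaf_comp_hom]) (auto simp: dsheaf_id_hom dsheaf_comp_apply dsheaf_id_apply)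
next
  case (4 a b f)
  then show ?case
    by (intro dsheaf_hom_eqI[OF dsheaf_comp_hom])
      (auto simp: dsheaf_id_hom dsheaf_comp_apply dsheaf_id_apply hom_closed[OF dsheaf_hom_hom])
next
  case (5 a b c d f g h)
  then show ?case
    by (intro dsheaf_hom_eqI[of _ a d] dsheaf_comp_hom) 
      (auto simp: dsheaf_comp_hom dsheaf_comp_apply hom_closed[OF dsheaf_hom_hom])
qed

section \<open>The two actions on cocones\<close>

definition post :: "('o, 'm, 'g, 'x, 'r, 'd) dsheaf \<Rightarrow> ('e \<Rightarrow> 'f) \<Rightarrow> ('o \<Rightarrow> ('o \<Rightarrow> 'x) \<times> 'd \<Rightarrow> 'e) \<Rightarrow>
    'o \<Rightarrow> ('o \<Rightarrow> 'x) \<times> 'd \<Rightarrow> 'f" where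
  "post D h \<kappa> = (\<lambda>i\<in>I. compose (tspace (pull (p i) (dsh D i))) h (\<kappa> i))"

definition prec :: "('o, 'm, 'g, 'x, 'r, 'd) dsheaf \<Rightarrow> ('o \<Rightarrow> ('o \<Rightarrow> 'x) \<times> 'c \<Rightarrow> 'e) \<Rightarrow> ('o \<Rightarrow> 'd \<Rightarrow> 'c) \<Rightarrow>
    'o \<Rightarrow> ('o \<Rightarrow> 'x) \<times> 'd \<Rightarrow> 'e" where
  "prec D \<kappa> u = (\<lambda>i\<in>I. compose (tspace (pull (p i) (dsh D i))) (\<kappa> i) (pull_map (p i) (dsh D i) (u i)))"

lemma post_apply: "\<lbrakk>i \<in> I; d \<in> tspace (dsh D i); x \<in> X.lim; x i = prj (dsh D i) d\<rbrakk> \<Longrightarrow> post D h \<kappa> i (x, d) = h (\<kappa> i (x, d))"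
  by (simp add: post_def compose_def mem_pull_proj)

lemma prec_apply: "\<lbrakk>i \<in> I; d \<in> tspace (dsh D i); x \<in> X.lim; x i = prj (dsh D i) d\<rbrakk> \<Longrightarrow> prec D \<kappa> u i (x, d) = \<kappa> i (x, u i d)"
  by (simp add: prec_def compose_def mem_pull_proj pull_map_def)

lemma pull_proj_ops:
  assumes D: "is_dsheaf R S D" and i: "i \<in> I"
  shows "ops_closed R L (pull (p i) (dsh D i))"
  using discrete_change.pull_ops_closed[OF dc_proj[OF i], unfolded lim_proj_simps, OF ds_sheaf[OF D i]] .

lemma lim_str_closed:
  assumes "is_dsheaf R S D" "i \<in> I" "j \<in> I" "f \<in> Ar i j" "d \<in> tspace (dsh D j)" "x \<in> X.lim" "x j = prj (dsh D j) d"
  shows "str D i j f (x i, d) \<in> tspace (dsh D i)" "prj (dsh D i) (str D i j f (x i, d)) = x i"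
  using ds_str_closed[OF assms(1-5) X.lim_coord[OF assms(6,2)]] X.lim_tr[OF assms(6,2-4)] assms(7) by simp_all

lemma post_cocone:
  assumes D: "is_dsheaf R S D" and \<kappa>: "\<kappa> \<in> cocones D E" and h: "h \<in> sheaf_hom R L E F"
  shows "post D h \<kappa> \<in> cocones D F"
  unfolding cocones_iff
proof (intro conjI ballI impI)
  show "post D h \<kappa> \<in> (\<Pi>\<^sub>E i\<in>I. sheaf_hom R L (pull (p i) (dsh D i)) F)"
    unfolding post_def using compose_hom[OF pull_proj_ops[OF D] cocone_hom[OF \<kappa>] h] by auto
qed (simp add: post_apply lim_str_closed[OF D] cocone_str[OF \<kappa>])

lemma prec_cocone:
  assumes D: "is_dsheaf R S D" and D': "is_dsheaf R S D'" and \<kappa>: "\<kappa> \<in> cocones D' E" and u: "u \<in> dsheaf_hom R S D D'"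
  shows "prec D \<kappa> u \<in> cocones D E"
  unfolding cocones_iff
proof (intro conjI ballI impI)
  have "pull_map (p i) (dsh D i) (u i) \<in> sheaf_hom R L (pull (p i) (dsh D i)) (pull (p i) (dsh D' i))" if i: "i \<in> I" for i
    using discrete_change.pull_map_hom[OF dc_proj[OF i], unfolded lim_proj_simps, OF ds_sheaf[OF D i] ds_sheaf[OF D' i] dsheaf_hom_hom[OF u i]] .
  then show "prec D \<kappa> u \<in> (\<Pi>\<^sub>E i\<in>I. sheaf_hom R L (pull (p i) (dsh D i)) E)"
    unfolding prec_def using compose_hom[OF pull_proj_ops[OF D] _ cocone_hom[OF \<kappa>]] by auto
  fix i j f d x assume ij: "i \<in> I" "j \<in> I" "f \<in> Ar i j" and d: "d \<in> tspace (dsh D j)"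
    and x: "x \<in> X.lim" "x j = prj (dsh D j) d"
  note ud = hom_closed[OF dsheaf_hom_hom[OF u ij(2)] d] hom_prj[OF dsheaf_hom_hom[OF u ij(2)] d]
  show "prec D \<kappa> u i (x, str D i j f (x i, d)) = prec D \<kappa> u j (x, d)"
    using lim_str_closed[OF D ij d x] dsheaf_hom_str[OF u ij d X.lim_coord[OF x(1) ij(1)]] X.lim_tr[OF x(1) ij] x d ij
      cocone_str[OF \<kappa> ij ud(1) x(1)] ud(2)
    by (simp add: prec_apply)
qed

end

context system
begin

subsection \<open>The right adjoint\<close>

text \<open>\<open>P\<close> is the system of direct images of \<open>E\<close> up to isomorphism:
  \<open>\<kappa>\<close> collects the evaluations of the single levels, and
  \<open>pmodel_universal\<close> shows that they form the universal cocone into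
  \<open>E\<close>.\<close>

definition pmodel :: "('o \<Rightarrow> 'g, 'o \<Rightarrow> 'x, 'r, 'e) sheaf \<Rightarrow> ('o, 'm, 'g, 'x, 'r, 'f) dsheaf \<Rightarrow>
    ('o \<Rightarrow> ('o \<Rightarrow> 'x) \<times> 'f \<Rightarrow> 'e) \<Rightarrow> bool" where
  "pmodel E P \<kappa> \<longleftrightarrow> is_dsheaf R S P \<and> \<kappa> \<in> cocones P E \<and>
     (\<forall>i\<in>I. section_model (p i) R E (dsh P i) (\<lambda>z x. \<kappa> i (x, z)))"

context
  fixes E :: "('o \<Rightarrow> 'g, 'o \<Rightarrow> 'x, 'r, 'e) sheaf" and F :: "('g, 'x, 'r, 'f) sheaf" and ev i
  assumes i: "i \<in> I" and sm: "section_model (p i) R E F ev"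
begin

lemmas sm_sheaf = section_model.is_sheaf[OF sm, unfolded lim_proj_simps]
lemmas sm_carrier = section_model.ev_carrier[OF sm, unfolded mem_fibre]
lemmas sm_eqI = section_model.ev_eqI[OF sm, unfolded mem_fibre]
lemmas sm_translateI = section_model.ev_eq_translateI[OF sm, unfolded mem_fibre lim_proj_simps L_simps]
lemmas sm_emov = section_model.emov[OF sm, unfolded lim_proj_simps L_simps Ball_def mem_fibre]
lemmas sm_add = section_model.add[OF sm, unfolded Ball_def mem_fibre]
lemmas sm_scal = section_model.scal[OF sm, unfolded Ball_def mem_fibre]
lemmas sm_surj = section_model.ev_surj[OF sm, unfolded lim_proj_simps Ball_def mem_fibre]

end

lemma subtopology_lvl: "i \<in> I \<Longrightarrow> subtopology (pts (lvl S i)) A = discrete_topology (base (lvl S i) \<inter> A)"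
  by (subst lvl_disc) simp_all

context
  fixes E :: "('o \<Rightarrow> 'g, 'o \<Rightarrow> 'x, 'r, 'e) sheaf" and P :: "('o, 'm, 'g, 'x, 'r, 'f) dsheaf"
    and ev :: "'o \<Rightarrow> 'f \<Rightarrow> ('o \<Rightarrow> 'x) \<Rightarrow> 'e"
  assumes sm: "\<And>i. i \<in> I \<Longrightarrow> section_model (p i) R E (dsh P i) (ev i)"
    and ext: "\<And>i j f. \<lbrakk>i \<in> I; j \<in> I; f \<in> Ar i j\<rbrakk> \<Longrightarrow> str P i j f \<in> extensional (tspace (pull (tn i j f) (dsh P j)))"
    and str: "\<And>i j f x z. \<lbrakk>i \<in> I; j \<in> I; f \<in> Ar i j; x \<in> base (lvl S i); z \<in> tspace (dsh P j);
        prj (dsh P j) z = trX S i j f x\<rbrakk> \<Longrightarrow> str P i j f (x, z) \<in> tspace (dsh P i) \<and>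
        prj (dsh P i) (str P i j f (x, z)) = x \<and>
        (\<forall>\<xi>\<in>X.lim. \<xi> i = x \<longrightarrow> ev i (str P i j f (x, z)) \<xi> = ev j z \<xi>)"
begin

private lemma sh: "i \<in> I \<Longrightarrow> is_sheaf R (lvl S i) (dsh P i)"
  using sm_sheaf sm by blast

private lemma str_hom:
  assumes ij: "i \<in> I" "j \<in> I" "f \<in> Ar i j"
  shows "str P i j f \<in> sheaf_hom R (lvl S i) (pull (tn i j f) (dsh P j)) (dsh P i)"
proof (rule discrete_change.pull_homI[OF dc_trans[OF ij], unfolded transition_simps mem_pre, OF sh[OF ij(2)] ext[OF ij]])
  fix d assume d: "d \<in> tspace (dsh P j)"
  show "continuous_map (subtopology (pts (lvl S i)) (pre (tn i j f) {prj (dsh P j) d})) (tot (dsh P i)) (\<lambda>x. str P i j f (x, d))"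
    unfolding subtopology_lvl[OF ij(1)] using str[OF ij _ d] by (auto simp: mem_pre)
next
  fix h x d assume h: "h \<in> carrier (grp (lvl S i))" and d: "d \<in> tspace (dsh P j)"
    and "x \<in> base (lvl S i) \<and> trX S i j f x \<in> {prj (dsh P j) d}"
  then have x: "x \<in> base (lvl S i)" "prj (dsh P j) d = trX S i j f x" by auto
  \<comment> \<open>The levels are compared through values in \<open>E\<close>, on which the limit
    group acts; hence the lift of \<open>h\<close>.\<close>
  obtain g where g: "g \<in> G.lim" "g i = h" using G.proj_surj[OF ij(1)] h lvl_gtop[OF ij(1)] by metis
  have gj: "trG S i j f h = g j" using G.lim_tr[OF g(1) ij] g(2) by simp
  note s = str[OF ij x(1) d x(2)]
  note gd = sm_emov[OF ij(2) sm[OF ij(2)] g(1) d]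
  note gs = sm_emov[OF ij(1) sm[OF ij(1)] g(1) conjunct1[OF s]]
  have hx: "mov (lvl S i) h x \<in> base (lvl S i)" using group_action_closed[OF lvl_act[OF ij(1)] h x(1)] .
  have e: "prj (dsh P j) (emov (dsh P j) (g j) d) = trX S i j f (mov (lvl S i) h x)"
    using gd x(2) tr_equiv[OF ij h x(1)] gj by simp
  note hs = str[OF ij hx conjunct1[OF gd] e]
  show "str P i j f (mov (lvl S i) h x, emov (dsh P j) (trG S i j f h) d) = emov (dsh P i) h (str P i j f (x, d))"
    unfolding gj
  proof (rule sm_translateI[OF ij(1) sm[OF ij(1)] _ _ x(1) g(1)])
    show "str P i j f (mov (lvl S i) h x, emov (dsh P j) (g j) d) \<in> tspace (dsh P i)" using hs by blast
    show "emov (dsh P i) h (str P i j f (x, d)) \<in> tspace (dsh P i)" using gs g(2) by simp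
    show "prj (dsh P i) (str P i j f (mov (lvl S i) h x, emov (dsh P j) (g j) d)) = mov (lvl S i) (g i) x"
      using hs g(2) by simp
    show "prj (dsh P i) (emov (dsh P i) h (str P i j f (x, d))) = mov (lvl S i) (g i) x" using gs s g(2) by simp
    fix \<xi> assume \<xi>: "\<xi> \<in> X.lim \<and> \<xi> i = x"
    have 1: "mov L g \<xi> \<in> X.lim" "mov L g \<xi> i = mov (lvl S i) h x"
      using mov_closed[OF g(1)] \<xi> L_coord(3)[OF ij(1)] g(2) by auto
    have 2: "\<xi> j = prj (dsh P j) d" using X.lim_tr[OF _ ij, of \<xi>] \<xi> x(2) by simp
    have "ev i (str P i j f (mov (lvl S i) h x, emov (dsh P j) (g j) d)) (mov L g \<xi>) = ev j (emov (dsh P j) (g j) d) (mov L g \<xi>)"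
      using hs 1 by blast
    also have "\<dots> = emov E g (ev j d \<xi>)" using gd \<xi> 2 by blast
    also have "\<dots> = emov E g (ev i (str P i j f (x, d)) \<xi>)" using s \<xi> by simp
    also have "\<dots> = ev i (emov (dsh P i) h (str P i j f (x, d))) (mov L g \<xi>)" using gs s \<xi> g(2) by simp
    finally show "ev i (str P i j f (mov (lvl S i) h x, emov (dsh P j) (g j) d)) (mov L g \<xi>) =
      ev i (emov (dsh P i) h (str P i j f (x, d))) (mov L g \<xi>)" .
  qed
next
  fix x d assume "d \<in> tspace (dsh P j)" "x \<in> base (lvl S i) \<and> trX S i j f x \<in> {prj (dsh P j) d}"
  then show "prj (dsh P i) (str P i j f (x, d)) = x" using str[OF ij] by simp
next
  fix x d d' assume d: "d \<in> tspace (dsh P j)" "d' \<in> tspace (dsh P j)" "prj (dsh P j) d = prj (dsh P j) d'"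
    and "x \<in> base (lvl S i) \<and> trX S i j f x \<in> {prj (dsh P j) d'}"
  then have x: "x \<in> base (lvl S i)" "prj (dsh P j) d = trX S i j f x" "prj (dsh P j) d' = trX S i j f x" by auto
  note s = str[OF ij x(1) d(1) x(2)] and s' = str[OF ij x(1) d(2) x(3)]
  note dd = sm_add[OF ij(2) sm[OF ij(2)] d]
  have e: "prj (dsh P j) (esum (dsh P j) d d') = trX S i j f x" using dd x(3) by simp
  note sdd = str[OF ij x(1) conjunct1[OF dd] e]
  have pe: "prj (dsh P i) (str P i j f (x, d)) = prj (dsh P i) (str P i j f (x, d'))" using s s' by simp
  note ss = sm_add[OF ij(1) sm[OF ij(1)] conjunct1[OF s] conjunct1[OF s'] pe]
  show "str P i j f (x, esum (dsh P j) d d') = esum (dsh P i) (str P i j f (x, d)) (str P i j f (x, d'))"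
  proof (rule sm_eqI[OF ij(1) sm[OF ij(1)] conjunct1[OF sdd] conjunct1[OF ss]])
    show "prj (dsh P i) (str P i j f (x, esum (dsh P j) d d')) =
        prj (dsh P i) (esum (dsh P i) (str P i j f (x, d)) (str P i j f (x, d')))"
      using sdd ss s' by simp
    fix \<xi> assume "\<xi> \<in> X.lim \<and> \<xi> i = prj (dsh P i) (esum (dsh P i) (str P i j f (x, d)) (str P i j f (x, d')))"
    then have \<xi>: "\<xi> \<in> X.lim" "\<xi> i = x" using ss s' by auto
    have 2: "\<xi> j = prj (dsh P j) d'" using X.lim_tr[OF \<xi>(1) ij] \<xi> x(3) by simp
    show "ev i (str P i j f (x, esum (dsh P j) d d')) \<xi> = ev i (esum (dsh P i) (str P i j f (x, d)) (str P i j f (x, d'))) \<xi>"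
      using sdd ss dd s s' \<xi> 2 by simp
  qed
next
  fix r x d assume r: "r \<in> carrier R" and d: "d \<in> tspace (dsh P j)"
    and "x \<in> base (lvl S i) \<and> trX S i j f x \<in> {prj (dsh P j) d}"
  then have x: "x \<in> base (lvl S i)" "prj (dsh P j) d = trX S i j f x" by auto
  note s = str[OF ij x(1) d x(2)]
  note dd = sm_scal[OF ij(2) sm[OF ij(2)] r d]
  have e: "prj (dsh P j) (escal (dsh P j) r d) = trX S i j f x" using dd x(2) by simp
  note sdd = str[OF ij x(1) conjunct1[OF dd] e]
  note ss = sm_scal[OF ij(1) sm[OF ij(1)] r conjunct1[OF s]]
  show "str P i j f (x, escal (dsh P j) r d) = escal (dsh P i) r (str P i j f (x, d))"
  proof (rule sm_eqI[OF ij(1) sm[OF ij(1)] conjunct1[OF sdd] conjunct1[OF ss]])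
    show "prj (dsh P i) (str P i j f (x, escal (dsh P j) r d)) = prj (dsh P i) (escal (dsh P i) r (str P i j f (x, d)))"
      using sdd ss s by simp
    fix \<xi> assume "\<xi> \<in> X.lim \<and> \<xi> i = prj (dsh P i) (escal (dsh P i) r (str P i j f (x, d)))"
    then have \<xi>: "\<xi> \<in> X.lim" "\<xi> i = x" using ss s by auto
    have 2: "\<xi> j = prj (dsh P j) d" using X.lim_tr[OF \<xi>(1) ij] \<xi> x(2) by simp
    show "ev i (str P i j f (x, escal (dsh P j) r d)) \<xi> = ev i (escal (dsh P i) r (str P i j f (x, d))) \<xi>"
      using sdd ss dd s \<xi> 2 by simp
  qed
qed

private lemma str_eqI:
  assumes i: "i \<in> I" and z: "z \<in> tspace (dsh P i)" "z' \<in> tspace (dsh P i)" "prj (dsh P i) z = x" "prj (dsh P i) z' = x"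
    and ev: "\<And>\<xi>. \<lbrakk>\<xi> \<in> X.lim; \<xi> i = x\<rbrakk> \<Longrightarrow> ev i z \<xi> = ev i z' \<xi>"
  shows "z = z'"
  by (rule sm_eqI[OF i sm[OF i] z(1,2)]) (use z ev in auto)

private lemma is_ds: "is_dsheaf R S P"
  unfolding is_dsheaf_def Let_def
proof (intro conjI ballI, goal_cases)
  case (1 i) then show ?case by (rule sh)
next
  case (2 i j f) then show ?case by (rule str_hom)
next
  case (3 i e)
  obtain x d where [simp]: "e = (x, d)" by (cases e)
  have x: "x \<in> base (lvl S i)" "d \<in> tspace (dsh P i)" "prj (dsh P i) d = trX S i i (Idn (idx S) i) x"
    using 3(2) by (simp_all add: mem_pull_trans)
  have f: "Idn (idx S) i \<in> Ar i i" using category_id[OF cofiltered_category[OF cof] 3(1)] .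
  note s = str[OF 3(1,1) f x(1,2,3)]
  have "str P i i (Idn (idx S) i) (x, d) = d"
    by (rule str_eqI[OF 3(1), of _ _ x]) (use s x trX_id[OF 3(1)] in auto)
  then show ?case by simp
next
  case (4 i j k f f' e)
  note I = 4(1-3) and A = 4(4,5)
  obtain x d where [simp]: "e = (x, d)" by (cases e)
  have x: "x \<in> base (lvl S i)" "d \<in> tspace (dsh P k)" "prj (dsh P k) d = trX S i k (Cmp (idx S) i j k f' f) x"
    using 4(6) by (simp_all add: mem_pull_trans)
  have f: "Cmp (idx S) i j k f' f \<in> Ar i k" using category_comp[OF cofiltered_category[OF cof] I A] .
  have x': "prj (dsh P k) d = trX S j k f' (trX S i j f x)" using x(3) tr_comp(2)[OF I A x(1)] by simp
  note jx = trX_closed[OF I(1,2) A(1) x(1)]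
  note s = str[OF I(1,3) f x(1,2,3)]
  note s1 = str[OF I(2,3) A(2) jx x(2) x']
  note s2 = str[OF I(1,2) A(1) x(1) conjunct1[OF s1] conjunct1[OF conjunct2[OF s1]]]
  have "str P i k (Cmp (idx S) i j k f' f) (x, d) = str P i j f (x, str P j k f' (trX S i j f x, d))"
  proof (rule str_eqI[OF I(1), of _ _ x])
    fix \<xi> assume \<xi>: "\<xi> \<in> X.lim" "\<xi> i = x"
    have "\<xi> j = trX S i j f x" using X.lim_tr[OF \<xi>(1) I(1,2) A(1)] \<xi> by simp
    then show "ev i (str P i k (Cmp (idx S) i j k f' f) (x, d)) \<xi> = ev i (str P i j f (x, str P j k f' (trX S i j f x, d))) \<xi>"
      using s s1 s2 \<xi> by simp
  qed (use s s2 in auto)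
  then show ?case by simp
qed

text \<open>The assumption on \<open>str\<close> says that structure maps leave the underlying
  section unchanged and only restrict it to a smaller fibre. Equivariance, linearity and the
  composition law then hold because they hold for values.\<close>

lemma pmodelI: "pmodel E P (\<lambda>i\<in>I. restrict (\<lambda>(x, z). ev i z x) (tspace (pull (p i) (dsh P i))))"
  unfolding pmodel_def
proof (intro conjI is_ds ballI)
  let ?\<kappa> = "\<lambda>i\<in>I. restrict (\<lambda>(x, z). ev i z x) (tspace (pull (p i) (dsh P i)))"
  have \<kappa>: "?\<kappa> i (x, z) = ev i z x" if "i \<in> I" "z \<in> tspace (dsh P i)" "x \<in> X.lim" "x i = prj (dsh P i) z" for i x z
    using that by (simp add: mem_pull_proj)
  have hom: "?\<kappa> i \<in> sheaf_hom R L (pull (p i) (dsh P i)) E" if i: "i \<in> I" for i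
  proof (rule discrete_change.pull_homI[OF dc_proj[OF i], unfolded lim_proj_simps mem_fibre, OF sh[OF i]])
    show "?\<kappa> i \<in> extensional (tspace (pull (p i) (dsh P i)))" using i by simp
    note m = sm[OF i]
    fix d assume d: "d \<in> tspace (dsh P i)"
    show "continuous_map (subtopology (pts L) (pre (p i) {prj (dsh P i) d})) (tot E) (\<lambda>x. ?\<kappa> i (x, d))"
    proof (rule continuous_map_eq)
      show "continuous_map (subtopology (pts L) (pre (p i) {prj (dsh P i) d})) (tot E) (ev i d)"
        using inv_on_cont[OF section_model.ev_inv_on[OF m d]] by simp
      fix x assume "x \<in> topspace (subtopology (pts L) (pre (p i) {prj (dsh P i) d}))"
      then show "ev i d x = ?\<kappa> i (x, d)" using \<kappa>[OF i d, of x] by (auto simp: L_simps mem_fibre)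
    qed
    fix x
    show "prj E (?\<kappa> i (x, d)) = x" if "x \<in> X.lim \<and> x i = prj (dsh P i) d"
      using \<kappa>[OF i d] sm_carrier[OF i m d that] that by simp
    show "?\<kappa> i (mov L g x, emov (dsh P i) (g i) d) = emov E g (?\<kappa> i (x, d))"
      if g: "g \<in> carrier (grp L)" and x: "x \<in> X.lim \<and> x i = prj (dsh P i) d" for g
    proof -
      have g': "g \<in> G.lim" using g by (simp add: L_simps)
      note gd = sm_emov[OF i m g' d]
      have "mov L g x \<in> X.lim" "mov L g x i = prj (dsh P i) (emov (dsh P i) (g i) d)"
        using mov_closed[OF g'] x gd L_coord(3)[OF i] by auto
      then show ?thesis using \<kappa>[OF i conjunct1[OF gd]] \<kappa>[OF i d, of x] gd x by simp
    qed
    show "?\<kappa> i (x, esum (dsh P i) d d') = esum E (?\<kappa> i (x, d)) (?\<kappa> i (x, d'))"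
      if d': "d' \<in> tspace (dsh P i)" "prj (dsh P i) d = prj (dsh P i) d'" and x: "x \<in> X.lim \<and> x i = prj (dsh P i) d'" for d'
      using sm_add[OF i m d d'] \<kappa>[OF i, of "esum (dsh P i) d d'" x] \<kappa>[OF i d, of x] \<kappa>[OF i d'(1), of x] x d' by simp
    show "?\<kappa> i (x, escal (dsh P i) r d) = escal E r (?\<kappa> i (x, d))"
      if r: "r \<in> carrier R" and x: "x \<in> X.lim \<and> x i = prj (dsh P i) d" for r
      using sm_scal[OF i m r d] \<kappa>[OF i, of "escal (dsh P i) r d" x] \<kappa>[OF i d, of x] x by simp
  qed
  show "?\<kappa> \<in> cocones P E"
    unfolding cocones_iff
  proof (intro conjI ballI impI)
    show "?\<kappa> \<in> (\<Pi>\<^sub>E i\<in>I. sheaf_hom R L (pull (p i) (dsh P i)) E)" using hom by auto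
    fix i j f d x assume ij: "i \<in> I" "j \<in> I" "f \<in> Ar i j" and d: "d \<in> tspace (dsh P j)"
      and x: "x \<in> X.lim" "x j = prj (dsh P j) d"
    have "prj (dsh P j) d = trX S i j f (x i)" using X.lim_tr[OF x(1) ij] x(2) by simp
    note s = str[OF ij X.lim_coord[OF x(1) ij(1)] d this]
    show "?\<kappa> i (x, str P i j f (x i, d)) = ?\<kappa> j (x, d)"
      using \<kappa>[OF ij(1) conjunct1[OF s] x(1)] \<kappa>[OF ij(2) d x] s x(1) by simp
  qed
  show "section_model (p i) R E (dsh P i) (\<lambda>z x. ?\<kappa> i (x, z))" if i: "i \<in> I" for i
    by (rule section_model.model_cong[OF sm[OF i]]) (use \<kappa>[OF i] in \<open>simp add: mem_fibre\<close>)
qed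

end

text \<open>Level by level this is the adjunction between inverse and direct image. Compatibility
  with the structure maps is tested at limit points \<xi> over \<open>x\<close>, where both sides
  have the value \<open>l j (\<xi>, d)\<close>.\<close>

lemma pmodel_universal:
  fixes D :: "('o, 'm, 'g, 'x, 'r, 'd) dsheaf"
  assumes P: "pmodel E P \<kappa>" and D: "is_dsheaf R S D" and l: "l \<in> cocones D E"
  shows "\<exists>!u. u \<in> dsheaf_hom R S D P \<and> prec D \<kappa> u = l"
proof -
  have ds: "is_dsheaf R S P" and \<kappa>: "\<kappa> \<in> cocones P E"
    and sm: "\<And>i. i \<in> I \<Longrightarrow> section_model (p i) R E (dsh P i) (\<lambda>z x. \<kappa> i (x, z))"
    using P by (auto simp: pmodel_def)
  have "\<forall>i\<in>I. \<exists>u. u \<in> sheaf_hom R (lvl S i) (dsh D i) (dsh P i) \<and>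
      (\<forall>d\<in>tspace (dsh D i). \<forall>x\<in>X.lim. x i = prj (dsh D i) d \<longrightarrow> \<kappa> i (x, u d) = l i (x, d))"
  proof
    fix i assume i: "i \<in> I"
    obtain u where "u \<in> sheaf_hom R (lvl S i) (dsh D i) (dsh P i)"
      "\<And>d x. \<lbrakk>d \<in> tspace (dsh D i); x \<in> pre (p i) {prj (dsh D i) d}\<rbrakk> \<Longrightarrow> \<kappa> i (x, u d) = l i (x, d)"
      using section_model.mate_exists[OF sm[OF i], unfolded lim_proj_simps, OF ds_sheaf[OF D i] cocone_hom[OF l i]] by blast
    then show "\<exists>u. u \<in> sheaf_hom R (lvl S i) (dsh D i) (dsh P i) \<and>
      (\<forall>d\<in>tspace (dsh D i). \<forall>x\<in>X.lim. x i = prj (dsh D i) d \<longrightarrow> \<kappa> i (x, u d) = l i (x, d))"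
      by (intro exI[of _ u]) (simp add: mem_fibre)
  qed
  from bchoice[OF this] obtain w where w: "\<forall>i\<in>I. w i \<in> sheaf_hom R (lvl S i) (dsh D i) (dsh P i) \<and>
      (\<forall>d\<in>tspace (dsh D i). \<forall>x\<in>X.lim. x i = prj (dsh D i) d \<longrightarrow> \<kappa> i (x, w i d) = l i (x, d))" ..
  define u where "u = restrict w I"
  have u_hom: "u i \<in> sheaf_hom R (lvl S i) (dsh D i) (dsh P i)" if "i \<in> I" for i
    using w that by (simp add: u_def)
  have u: "\<kappa> i (x, u i d) = l i (x, d)" if "i \<in> I" "d \<in> tspace (dsh D i)" "x \<in> X.lim" "x i = prj (dsh D i) d" for i d x
    using w that by (simp add: u_def)
  have hom: "u \<in> dsheaf_hom R S D P"
    unfolding dsheaf_hom_iff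
  proof (intro conjI ballI impI)
    show "u \<in> (\<Pi>\<^sub>E i\<in>I. sheaf_hom R (lvl S i) (dsh D i) (dsh P i))"
      using w by (simp add: u_def)
    fix i j f d x assume ij: "i \<in> I" "j \<in> I" "f \<in> Ar i j" and d: "d \<in> tspace (dsh D j)"
      and x: "x \<in> base (lvl S i)" "trX S i j f x = prj (dsh D j) d"
    note sd = ds_str_closed[OF D ij d x]
    note usd = hom_closed[OF u_hom[OF ij(1)] sd(1)] hom_prj[OF u_hom[OF ij(1)] sd(1)]
    note ud = hom_closed[OF u_hom[OF ij(2)] d] hom_prj[OF u_hom[OF ij(2)] d]
    have x': "trX S i j f x = prj (dsh P j) (u j d)" using x(2) ud(2) by simp
    note sud = ds_str_closed[OF ds ij ud(1) x(1) x']
    show "u i (str D i j f (x, d)) = str P i j f (x, u j d)"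
    proof (rule sm_eqI[OF ij(1) sm[OF ij(1)] usd(1) sud(1)])
      show "prj (dsh P i) (u i (str D i j f (x, d))) = prj (dsh P i) (str P i j f (x, u j d))"
        using usd(2) sd(2) sud(2) by simp
      fix \<xi> assume "\<xi> \<in> X.lim \<and> \<xi> i = prj (dsh P i) (str P i j f (x, u j d))"
      then have \<xi>: "\<xi> \<in> X.lim" "\<xi> i = x" using sud(2) by auto
      have \<xi>j: "\<xi> j = prj (dsh D j) d" using X.lim_tr[OF \<xi>(1) ij] \<xi>(2) x(2) by simp
      have "\<kappa> i (\<xi>, u i (str D i j f (x, d))) = l i (\<xi>, str D i j f (\<xi> i, d))"
        using u[OF ij(1) sd(1) \<xi>(1)] \<xi>(2) sd(2) by simp
      also have "\<dots> = l j (\<xi>, d)" using cocone_str[OF l ij d \<xi>(1) \<xi>j] .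
      also have "\<dots> = \<kappa> j (\<xi>, u j d)" using u[OF ij(2) d \<xi>(1) \<xi>j] by simp
      also have "\<dots> = \<kappa> i (\<xi>, str P i j f (x, u j d))"
        using cocone_str[OF \<kappa> ij ud(1) \<xi>(1)] ud(2) \<xi>j \<xi>(2) by simp
      finally show "\<kappa> i (\<xi>, u i (str D i j f (x, d))) = \<kappa> i (\<xi>, str P i j f (x, u j d))" .
    qed
  qed
  show ?thesis
  proof (rule ex1I[of _ u], intro conjI hom)
    show "prec D \<kappa> u = l"
      by (rule cocone_eqI[OF prec_cocone[OF D ds \<kappa> hom] l]) (simp add: prec_apply u)
    fix v assume v: "v \<in> dsheaf_hom R S D P \<and> prec D \<kappa> v = l"
    show "v = u"
    proof (rule dsheaf_hom_eqI[OF conjunct1[OF v] hom])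
      fix i d assume i: "i \<in> I" and d: "d \<in> tspace (dsh D i)"
      have vh: "v i \<in> sheaf_hom R (lvl S i) (dsh D i) (dsh P i)" using dsheaf_hom_hom v i by blast
      note c = hom_closed[OF vh d] hom_prj[OF vh d] hom_closed[OF u_hom[OF i] d] hom_prj[OF u_hom[OF i] d]
      show "v i d = u i d"
      proof (rule sm_eqI[OF i sm[OF i] c(1,3)])
        show "prj (dsh P i) (v i d) = prj (dsh P i) (u i d)" using c by simp
        fix x assume "x \<in> X.lim \<and> x i = prj (dsh P i) (u i d)"
        then have x: "x \<in> X.lim" "x i = prj (dsh D i) d" using c by auto
        show "\<kappa> i (x, v i d) = \<kappa> i (x, u i d)"
          using prec_apply[OF i d x, of \<kappa> v] u[OF i d x] conjunct2[OF v] by simp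
      qed
    qed
  qed
qed

section \<open>The germ sheaves as a model, and copies of models\<close>

lemma push_model_proj:
  assumes "is_sheaf R L E" "i \<in> I"
  shows "section_model (p i) R E (push (p i) E) germ_val"
  using discrete_change.push_model[OF dc_proj[OF assms(2)], unfolded lim_proj_simps, OF assms(1) ring] .

text \<open>\<open>push_trans\<close> turns a germ into the germ of a section whose values are again
  germs, and \<open>adjoint_left\<close> evaluates the outer one; what remains is the same section
  of \<open>E\<close> on a smaller fibre.\<close>

lemma p_bullet_str:
  assumes E: "is_sheaf R L E" and ij: "i \<in> I" "j \<in> I" "f \<in> Ar i j" and x: "x \<in> base (lvl S i)"
    and z: "z \<in> tspace (push (p j) E)" "prj (push (p j) E) z = trX S i j f x"
  shows "str (p_bullet S E) i j f (x, z) \<in> tspace (push (p i) E) \<and>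
    prj (push (p i) E) (str (p_bullet S E) i j f (x, z)) = x \<and>
    (\<forall>\<xi>\<in>X.lim. \<xi> i = x \<longrightarrow> germ_val (str (p_bullet S E) i j f (x, z)) \<xi> = germ_val z \<xi>)"
proof -
  interpret pi: discrete_change "p i" by (rule dc_proj[OF ij(1)])
  interpret pj: discrete_change "p j" by (rule dc_proj[OF ij(2)])
  interpret T: discrete_change "tn i j f" by (rule dc_trans[OF ij])
  have Ei: "is_sheaf R (src (p i)) E" and Ej: "is_sheaf R (src (p j)) E" using E by simp_all
  note sm = push_model_proj[OF E ij(1)]
  note sh = sm_sheaf[OF ij(1) sm]
  have shT: "is_sheaf R (src (tn i j f)) (push (p i) E)" using sh by simp
  obtain V s where V: "germ_rep z = (V, s)" "fst z \<in> V" "V \<subseteq> base (tgt (p j))" "inv_on (p j) E V s" "germ_val z = s"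
    using pj.push_rep[OF Ej z(1)] by metis
  have y: "fst z = trX S i j f x" using z(2) by (simp add: push_def)
  define W where "W = pre (tn i j f) V"
  have W: "W \<subseteq> base (lvl S i)" "x \<in> W" using V(2) x y by (auto simp: W_def mem_pre)
  \<comment> \<open>The projections commute with the transition map, so \<open>V\<close> and its
    preimage at level \<open>i\<close> have the same preimage in the limit.\<close>
  have pre_W: "pre (p i) W = pre (p j) V"
    using X.lim_tr[OF _ ij] X.lim_coord[OF _ ij(1)] by (auto simp: W_def mem_pre L_simps)
  have s: "inv_on (p i) E W s"
  proof (rule inv_onI, unfold pre_W)
    show "continuous_map (subtopology (pts (src (p i))) (pre (p j) V)) (tot E) s"
      using inv_on_cont[OF V(4)] by simp
    show "prj E (s \<xi>) = \<xi>" if "\<xi> \<in> pre (p j) V" for \<xi> using inv_on_prj[OF V(4) that] .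
    fix n \<xi> assume n: "n \<in> carrier (grp (src (p i)))" "grp_map (p i) n = \<one>\<^bsub>grp (tgt (p i))\<^esub>" and \<xi>: "\<xi> \<in> pre (p j) V"
    \<comment> \<open>The kernel of the projection to \<open>G_i\<close> is contained in that of the
      projection to \<open>G_j\<close>.\<close>
    have "n j = \<one>\<^bsub>grp (lvl S j)\<^esub>"
      using G.lim_tr[OF _ ij, of n] n T.grp_map_one by (simp add: L_simps)
    then show "s (mov (src (p i)) n \<xi>) = emov E n (s \<xi>)"
      using inv_on_mov[OF V(4) _ _ \<xi>, of n] n by simp
  qed
  \<comment> \<open>The section of the direct image at level \<open>i\<close> that corresponds to
    \<open>s\<close>: at each point the germ of \<open>s\<close> itself.\<close>
  define \<sigma> where "\<sigma> x' = germ (p i) E x' W s" for x'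
  have \<sigma>: "\<sigma> x' \<in> tspace (push (p i) E)" "prj (push (p i) E) (\<sigma> x') = x'"
    "\<And>\<xi>. \<lbrakk>\<xi> \<in> X.lim; \<xi> i = x'\<rbrakk> \<Longrightarrow> germ_val (\<sigma> x') \<xi> = s \<xi>" if "x' \<in> W" for x'
    using pi.germ_push[OF Ei that _ s] W(1) unfolding \<sigma>_def by (simp_all add: mem_fibre)
  have inv: "inv_on (tn i j f) (push (p i) E) V \<sigma>"
  proof (rule inv_onI, unfold transition_simps W_def[symmetric])
    show "continuous_map (subtopology (pts (lvl S i)) W) (tot (push (p i) E)) \<sigma>"
      unfolding subtopology_lvl[OF ij(1)] using \<sigma>(1) by auto
    show "prj (push (p i) E) (\<sigma> x') = x'" if "x' \<in> W" for x' using \<sigma>(2)[OF that] .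
    fix n x' assume n: "n \<in> carrier (grp (lvl S i))" "trG S i j f n = \<one>\<^bsub>grp (lvl S j)\<^esub>" and x': "x' \<in> W"
    \<comment> \<open>An element of the kernel of the transition lifts to a limit element that is
      trivial at \<open>j\<close>, under which \<open>s\<close> is invariant.\<close>
    obtain g where g: "g \<in> G.lim" "g i = n" using G.proj_surj[OF ij(1)] n(1) lvl_gtop[OF ij(1)] by metis
    have gj: "g j = \<one>\<^bsub>grp (lvl S j)\<^esub>" using G.lim_tr[OF g(1) ij] g(2) n(2) by simp
    have nx: "mov (lvl S i) n x' \<in> W"
      using T.mov_kernel_pre[unfolded transition_simps, OF n] x' by (simp add: W_def)
    have x'b: "x' \<in> base (lvl S i)" using x' W(1) by blast
    note gs = sm_emov[OF ij(1) sm g(1) \<sigma>(1)[OF x']]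
    show "\<sigma> (mov (lvl S i) n x') = emov (push (p i) E) n (\<sigma> x')"
    proof (rule sm_translateI[OF ij(1) sm \<sigma>(1)[OF nx] _ x'b g(1)])
      show "emov (push (p i) E) n (\<sigma> x') \<in> tspace (push (p i) E)" using gs g(2) by simp
      show "prj (push (p i) E) (\<sigma> (mov (lvl S i) n x')) = mov (lvl S i) (g i) x'" using \<sigma>(2)[OF nx] g(2) by simp
      show "prj (push (p i) E) (emov (push (p i) E) n (\<sigma> x')) = mov (lvl S i) (g i) x'"
        using gs \<sigma>(2)[OF x'] g(2) by simp
      fix \<xi> assume \<xi>: "\<xi> \<in> X.lim \<and> \<xi> i = x'"
      have "mov L g \<xi> \<in> X.lim" "mov L g \<xi> i = mov (lvl S i) n x'"
        using mov_closed[OF g(1)] \<xi> L_coord(3)[OF ij(1)] g(2) by auto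
      then have "germ_val (\<sigma> (mov (lvl S i) n x')) (mov L g \<xi>) = s (mov L g \<xi>)" using \<sigma>(3)[OF nx] by simp
      also have "\<dots> = emov E g (s \<xi>)"
      proof -
        have "\<xi> \<in> pre (p j) V" using \<xi> x' unfolding pre_W[symmetric] by (simp add: mem_pre L_simps)
        then show ?thesis using inv_on_mov[OF V(4), of g \<xi>] g(1) gj by (simp add: L_simps)
      qed
      also have "\<dots> = germ_val (emov (push (p i) E) n (\<sigma> x')) (mov L g \<xi>)"
        using gs \<sigma>(2,3)[OF x'] \<xi> g(2) by simp
      finally show "germ_val (\<sigma> (mov (lvl S i) n x')) (mov L g \<xi>) = germ_val (emov (push (p i) E) n (\<sigma> x')) (mov L g \<xi>)" .
    qed
  qed
  have fV: "fst z \<in> V" "V \<subseteq> base (tgt (tn i j f))" and fb: "fst z \<in> base (tgt (tn i j f))" using V(2,3) by auto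
  have "push_trans S i j f E z = germ (tn i j f) (push (p i) E) (fst z) V (\<lambda>x\<in>W. \<sigma> x)"
    using z(1) V(1) by (simp add: push_trans_def W_def \<sigma>_def Let_def)
  also have "\<dots> = germ (tn i j f) (push (p i) E) (fst z) V \<sigma>"
    by (rule T.germ_cong[OF shT]) (use fV fb in \<open>auto simp: W_def mem_pre\<close>)
  finally have pt: "push_trans S i j f E z = germ (tn i j f) (push (p i) E) (fst z) V \<sigma>" .
  have "(x, z) \<in> tspace (pull (tn i j f) (push (p j) E))" using z x by (simp add: mem_pull_trans)
  then have "str (p_bullet S E) i j f (x, z) = germ_val (push_trans S i j f E z) x"
    by (simp add: p_bullet_def adjoint_left_def germ_val_def)
  also have "\<dots> = \<sigma> x"
    unfolding pt by (rule T.germ_push(3)[OF shT fV inv]) (use x y in \<open>simp add: mem_pre\<close>)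
  finally show ?thesis using \<sigma>[OF W(2)] V(5) by simp
qed

lemma p_bullet_model:
  assumes E: "is_sheaf R L E"
  shows "pmodel E (p_bullet S E) (\<lambda>i\<in>I. restrict (\<lambda>(x, z). germ_val z x) (tspace (pull (p i) (push (p i) E))))"
proof -
  have d: "dsh (p_bullet S E) i = push (p i) E" for i by (simp add: p_bullet_def)
  have "pmodel E (p_bullet S E) (\<lambda>i\<in>I. restrict (\<lambda>(x, z). germ_val z x) (tspace (pull (p i) (dsh (p_bullet S E) i))))"
    by (rule pmodelI) (simp_all add: d push_model_proj[OF E] p_bullet_str[OF E],
      simp add: p_bullet_def adjoint_left_def)
  then show ?thesis by (simp add: d)
qed

text \<open>Sheaves and structure maps are both conjugated by \<open>c\<close>; as the values are
  unchanged, \<open>pmodelI\<close> applies again.\<close>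

lemma pmodel_copy:
  fixes c :: "'o \<Rightarrow> 'f \<Rightarrow> 'h"
  assumes P: "pmodel E P \<kappa>" and c: "\<And>i. i \<in> I \<Longrightarrow> inj_on (c i) (tspace (dsh P i))"
  shows "\<exists>(P' :: ('o, 'm, 'g, 'x, 'r, 'h) dsheaf) \<kappa>'. pmodel E P' \<kappa>'"
proof -
  have ds: "is_dsheaf R S P" and \<kappa>: "\<kappa> \<in> cocones P E"
    and sm: "\<And>i. i \<in> I \<Longrightarrow> section_model (p i) R E (dsh P i) (\<lambda>z x. \<kappa> i (x, z))"
    using P by (auto simp: pmodel_def)
  let ?F = "\<lambda>i. copy_sheaf (c i) (dsh P i)" and ?d = "\<lambda>i. inv_into (tspace (dsh P i)) (c i)"
  define P' where "P' = \<lparr>dsh = ?F,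
    str = (\<lambda>i j f. restrict (\<lambda>(x, z). c i (str P i j f (x, ?d j z))) (tspace (pull (tn i j f) (?F j))))\<rparr>"
  have t: "tspace (?F i) = c i ` tspace (dsh P i)" "prj (?F i) z = prj (dsh P i) (?d i z)" for i z
    by (simp_all add: copy_sheaf_def Let_def)
  have P': "dsh P' i = ?F i" for i by (simp add: P'_def)
  have "pmodel E P' (\<lambda>i\<in>I. restrict (\<lambda>(x, z). \<kappa> i (x, ?d i z)) (tspace (pull (p i) (dsh P' i))))"
  proof (rule pmodelI)
    show "section_model (p i) R E (dsh P' i) (\<lambda>z x. \<kappa> i (x, ?d i z))" if i: "i \<in> I" for i
      unfolding P' using section_model.copy_model[OF sm[OF i] c[OF i]] .
    show "str P' i j f \<in> extensional (tspace (pull (tn i j f) (dsh P' j)))" for i j f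
      by (simp add: P'_def)
    fix i j f x z assume ij: "i \<in> I" "j \<in> I" "f \<in> Ar i j" and x: "x \<in> base (lvl S i)"
      and z: "z \<in> tspace (dsh P' j)" "prj (dsh P' j) z = trX S i j f x"
    obtain w where w: "w \<in> tspace (dsh P j)" "z = c j w" using z(1) unfolding P' t by blast
    have dw: "?d j (c j w) = w" using c[OF ij(2)] w(1) by simp
    have pw: "trX S i j f x = prj (dsh P j) w" using z(2) unfolding P' t w(2) dw by simp
    note s = ds_str_closed[OF ds ij w(1) x pw]
    have "(x, z) \<in> tspace (pull (tn i j f) (?F j))"
      using x z unfolding P' by (simp add: mem_pull_trans)
    then have e: "str P' i j f (x, z) = c i (str P i j f (x, w))"
      using dw w(2) by (simp add: P'_def)
    have di: "?d i (c i (str P i j f (x, w))) = str P i j f (x, w)" using c[OF ij(1)] s(1) by simp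
    show "str P' i j f (x, z) \<in> tspace (dsh P' i) \<and> prj (dsh P' i) (str P' i j f (x, z)) = x \<and>
        (\<forall>\<xi>\<in>X.lim. \<xi> i = x \<longrightarrow> \<kappa> i (\<xi>, ?d i (str P' i j f (x, z))) = \<kappa> j (\<xi>, ?d j z))"
    proof (intro conjI ballI impI)
      show "str P' i j f (x, z) \<in> tspace (dsh P' i)" "prj (dsh P' i) (str P' i j f (x, z)) = x"
        unfolding P' t e di using s by simp_all
      fix \<xi> assume \<xi>: "\<xi> \<in> X.lim" "\<xi> i = x"
      have "\<xi> j = prj (dsh P j) w" using X.lim_tr[OF \<xi>(1) ij] \<xi>(2) pw by simp
      then show "\<kappa> i (\<xi>, ?d i (str P' i j f (x, z))) = \<kappa> j (\<xi>, ?d j z)"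
        unfolding e di unfolding w(2) dw using cocone_str[OF \<kappa> ij w(1) \<xi>(1)] \<xi>(2) by simp
    qed
  qed
  then show ?thesis by blast
qed

end

subsection \<open>The colimit\<close>

text \<open>\<open>J\<close> encodes a limit point and an equivalence class as an element of the
  target type. Its injectivity is added in \<open>colimit\<close>, since the set of pairs it
  concerns has to be defined beforehand.\<close>

locale colimit_data = system R S
  for R :: "('r, 's) ring_scheme" and S :: "('o, 'm, 'g, 'x) diagram" +
  fixes D :: "('o, 'm, 'g, 'x, 'r, 'e) dsheaf" and J :: "('o \<Rightarrow> 'x) \<times> ('o \<times> 'e) set \<Rightarrow> 'u"
  assumes D: "is_dsheaf R S D"
begin

definition stk :: "'o \<Rightarrow> ('o \<Rightarrow> 'x) \<Rightarrow> 'e set" where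
  "stk i \<xi> = {d \<in> tspace (dsh D i). i \<in> I \<and> \<xi> \<in> X.lim \<and> prj (dsh D i) d = \<xi> i}"

text \<open>Transport of a stalk element at \<xi> along an arrow \<open>k \<rightarrow> i\<close>.
  It runs from level \<open>i\<close> to level \<open>k\<close>, so refinement goes against the
  arrows.\<close>

definition mv :: "'o \<Rightarrow> 'o \<Rightarrow> 'm \<Rightarrow> ('o \<Rightarrow> 'x) \<Rightarrow> 'e \<Rightarrow> 'e" where
  "mv k i f \<xi> d = str D k i f (\<xi> k, d)"

text \<open>The filtered colimit relation on the stalk at \<xi>, with \<open>k\<close> as the common
  level to which both elements are transported.\<close>

definition rel :: "('o \<Rightarrow> 'x) \<Rightarrow> 'o \<Rightarrow> 'e \<Rightarrow> 'o \<Rightarrow> 'e \<Rightarrow> bool" where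
  "rel \<xi> i d j e \<longleftrightarrow> (\<exists>k\<in>I. \<exists>f\<in>Ar k i. \<exists>g\<in>Ar k j. mv k i f \<xi> d = mv k j g \<xi> e)"

definition cls :: "('o \<Rightarrow> 'x) \<Rightarrow> 'o \<Rightarrow> 'e \<Rightarrow> ('o \<times> 'e) set" where
  "cls \<xi> i d = {(j, e). e \<in> stk j \<xi> \<and> rel \<xi> i d j e}"

definition leg :: "'o \<Rightarrow> ('o \<Rightarrow> 'x) \<Rightarrow> 'e \<Rightarrow> 'u" where
  "leg i \<xi> d = J (\<xi>, cls \<xi> i d)"

definition cls_pairs :: "(('o \<Rightarrow> 'x) \<times> ('o \<times> 'e) set) set" where
  "cls_pairs = {(\<xi>, cls \<xi> i d) |\<xi> i d. d \<in> stk i \<xi>}"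

lemma stkD: "d \<in> stk i \<xi> \<Longrightarrow> d \<in> tspace (dsh D i)" "d \<in> stk i \<xi> \<Longrightarrow> i \<in> I"
  "d \<in> stk i \<xi> \<Longrightarrow> \<xi> \<in> X.lim" "d \<in> stk i \<xi> \<Longrightarrow> prj (dsh D i) d = \<xi> i"
  by (simp_all add: stk_def)

lemma stkI: "\<lbrakk>i \<in> I; \<xi> \<in> X.lim; d \<in> tspace (dsh D i); prj (dsh D i) d = \<xi> i\<rbrakk> \<Longrightarrow> d \<in> stk i \<xi>"
  by (simp add: stk_def)

lemma mv_stk: "\<lbrakk>d \<in> stk i \<xi>; k \<in> I; f \<in> Ar k i\<rbrakk> \<Longrightarrow> mv k i f \<xi> d \<in> stk k \<xi>"
  using lim_str_closed[OF D, of k i f d \<xi>] by (simp add: stk_def mv_def)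

lemma mv_comp:
  assumes d: "d \<in> stk i \<xi>" and k: "k \<in> I" "l \<in> I" and f: "f \<in> Ar k i" and g: "g \<in> Ar l k"
  shows "mv l i (Cmp (idx S) l k i f g) \<xi> d = mv l k g \<xi> (mv k i f \<xi> d)"
proof -
  note dd = stkD[OF d]
  have 1: "trX S l k g (\<xi> l) = \<xi> k" "trX S k i f (\<xi> k) = \<xi> i"
    using X.lim_tr[OF dd(3) k(2,1) g] X.lim_tr[OF dd(3) k(1) dd(2) f] by auto
  show ?thesis
    using ds_comp[OF D k(2,1) dd(2) g f dd(1) X.lim_coord[OF dd(3) k(2)]] 1 dd(4) by (simp add: mv_def)
qed

lemma mv_id: "d \<in> stk i \<xi> \<Longrightarrow> mv i i (Idn (idx S) i) \<xi> d = d"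
  using ds_id[OF D, of i d] by (simp add: stk_def mv_def)

lemma cat: "category (idx S)"
  using cofiltered_category[OF cof] .

lemma rel_mv:
  assumes d: "d \<in> stk i \<xi>" and k: "k \<in> I" "f \<in> Ar k i"
  shows "rel \<xi> k (mv k i f \<xi> d) i d"
  unfolding rel_def
  using k category_id[OF cat k(1)] mv_id[OF mv_stk[OF d k]] by metis

lemma rel_refl: "d \<in> stk i \<xi> \<Longrightarrow> rel \<xi> i d i d"
  using stkD(2) category_id[OF cat] unfolding rel_def by blast

lemma rel_sym: "rel \<xi> i d j e \<Longrightarrow> rel \<xi> j e i d"
  unfolding rel_def by metis

text \<open>The two common levels both map to \<open>j\<close>; completing these arrows to a
  commutative square gives a level where the two transports of \<open>e\<close> coincide.\<close>

lemma rel_trans: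
  assumes d: "d \<in> stk i \<xi>" "e \<in> stk j \<xi>" "c \<in> stk l \<xi>" and r: "rel \<xi> i d j e" "rel \<xi> j e l c"
  shows "rel \<xi> i d l c"
proof -
  note io = stkD(2)[OF d(1)] stkD(2)[OF d(2)] stkD(2)[OF d(3)]
  obtain k f g where k: "k \<in> I" "f \<in> Ar k i" "g \<in> Ar k j" "mv k i f \<xi> d = mv k j g \<xi> e"
    using r(1) by (auto simp: rel_def)
  obtain k' f' g' where k': "k' \<in> I" "f' \<in> Ar k' j" "g' \<in> Ar k' l" "mv k' j f' \<xi> e = mv k' l g' \<xi> c"
    using r(2) by (auto simp: rel_def)
  obtain m u v where m: "m \<in> I" "u \<in> Ar m k" "v \<in> Ar m k'"
    "Cmp (idx S) m k j g u = Cmp (idx S) m k' j f' v"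
    using cofiltered_square[OF cof k(1) k'(1) io(2) k(3) k'(2)] .
  have "mv m i (Cmp (idx S) m k i f u) \<xi> d = mv m k u \<xi> (mv k j g \<xi> e)"
    using mv_comp[OF d(1) k(1) m(1) k(2) m(2)] k(4) by simp
  also have "\<dots> = mv m k' v \<xi> (mv k' j f' \<xi> e)"
    using mv_comp[OF d(2) k(1) m(1) k(3) m(2)] mv_comp[OF d(2) k'(1) m(1) k'(2) m(3)] m(4) by simp
  also have "\<dots> = mv m l (Cmp (idx S) m k' l g' v) \<xi> c"
    using mv_comp[OF d(3) k'(1) m(1) k'(3) m(3)] k'(4) by simp
  finally show ?thesis
    unfolding rel_def
    using m(1) category_comp[OF cat m(1) k(1) io(1) m(2) k(2)] category_comp[OF cat m(1) k'(1) io(3) m(3) k'(3)]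
    by blast
qed

lemma cls_eq_iff:
  assumes d: "d \<in> stk i \<xi>" "e \<in> stk j \<xi>"
  shows "cls \<xi> i d = cls \<xi> j e \<longleftrightarrow> rel \<xi> i d j e"
proof
  assume "cls \<xi> i d = cls \<xi> j e"
  moreover have "(j, e) \<in> cls \<xi> j e" using d rel_refl by (simp add: cls_def)
  ultimately have "(j, e) \<in> cls \<xi> i d" by simp
  then show "rel \<xi> i d j e" by (simp add: cls_def)
next
  assume r: "rel \<xi> i d j e"
  have "rel \<xi> i d l c \<longleftrightarrow> rel \<xi> j e l c" if c: "c \<in> stk l \<xi>" for l c
    using rel_trans[OF d(2,1) c rel_sym[OF r]] rel_trans[OF d c r] by blast
  then show "cls \<xi> i d = cls \<xi> j e" unfolding cls_def by blast
qed

end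

locale colimit = colimit_data R S D J
  for R :: "('r, 's) ring_scheme" and S :: "('o, 'm, 'g, 'x) diagram"
    and D :: "('o, 'm, 'g, 'x, 'r, 'e) dsheaf" and J :: "('o \<Rightarrow> 'x) \<times> ('o \<times> 'e) set \<Rightarrow> 'u" +
  assumes inj: "inj_on J cls_pairs"
begin

lemma leg_eq_iff:
  assumes d: "d \<in> stk i \<xi>" "e \<in> stk j \<xi>'"
  shows "leg i \<xi> d = leg j \<xi>' e \<longleftrightarrow> \<xi> = \<xi>' \<and> rel \<xi> i d j e"
proof -
  have "(\<xi>, cls \<xi> i d) \<in> cls_pairs" "(\<xi>', cls \<xi>' j e) \<in> cls_pairs"
    using d by (auto simp: cls_pairs_def)
  then have "leg i \<xi> d = leg j \<xi>' e \<longleftrightarrow> \<xi> = \<xi>' \<and> cls \<xi> i d = cls \<xi>' j e"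
    unfolding leg_def using inj by (auto dest: inj_onD)
  moreover have "cls \<xi> i d = cls \<xi> j e \<longleftrightarrow> rel \<xi> i d j e" if "\<xi> = \<xi>'"
    using cls_eq_iff[OF d(1)] d(2) that by simp
  ultimately show ?thesis by blast
qed

lemma leg_mv: "\<lbrakk>d \<in> stk i \<xi>; k \<in> I; f \<in> Ar k i\<rbrakk> \<Longrightarrow> leg k \<xi> (mv k i f \<xi> d) = leg i \<xi> d"
  using leg_eq_iff[OF mv_stk] rel_mv by simp

text \<open>The relation allows two different arrows to level \<open>i\<close>; equalizing them
  makes a single arrow suffice.\<close>

lemma leg_eq_sameD:
  assumes d: "d \<in> stk i \<xi>" "e \<in> stk i \<xi>" and eq: "leg i \<xi> d = leg i \<xi> e"
  obtains k f where "k \<in> I" "f \<in> Ar k i" "mv k i f \<xi> d = mv k i f \<xi> e"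
proof -
  have i: "i \<in> I" using stkD(2)[OF d(1)] .
  obtain k f g where k: "k \<in> I" "f \<in> Ar k i" "g \<in> Ar k i" "mv k i f \<xi> d = mv k i g \<xi> e"
    using leg_eq_iff[OF d] eq by (auto simp: rel_def)
  obtain m h where m: "m \<in> I" "h \<in> Ar m k" "Cmp (idx S) m k i f h = Cmp (idx S) m k i g h"
    using cofiltered_equalize[OF cof k(1) i k(2,3)] .
  have "mv m i (Cmp (idx S) m k i f h) \<xi> d = mv m i (Cmp (idx S) m k i f h) \<xi> e"
    using mv_comp[OF d(1) k(1) m(1) k(2) m(2)] mv_comp[OF d(2) k(1) m(1) k(3) m(2)] k(4) m(3) by simp
  then show thesis using that[OF m(1) category_comp[OF cat m(1) k(1) i m(2) k(2)]] by blast
qed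

text \<open>Well-definedness of the sum needs both identifications along the same pair of arrows.
  The first identification fixes the arrows, and the second is then reached by refining their common
  source once more.\<close>

lemma leg_eq_pairD:
  assumes d: "d \<in> stk i \<xi>" "e \<in> stk i \<xi>" and d': "d' \<in> stk j \<xi>" "e' \<in> stk j \<xi>"
    and eq: "leg i \<xi> d = leg j \<xi> d'" "leg i \<xi> e = leg j \<xi> e'"
  obtains k f g where "k \<in> I" "f \<in> Ar k i" "g \<in> Ar k j"
    "mv k i f \<xi> d = mv k j g \<xi> d'" "mv k i f \<xi> e = mv k j g \<xi> e'"
proof -
  have i: "i \<in> I" and j: "j \<in> I" using stkD(2) d d' by auto
  obtain k f g where k: "k \<in> I" "f \<in> Ar k i" "g \<in> Ar k j" "mv k i f \<xi> d = mv k j g \<xi> d'"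
    using leg_eq_iff[OF d(1) d'(1)] eq by (auto simp: rel_def)
  note c1 = mv_stk[OF d(2) k(1,2)] and c2 = mv_stk[OF d'(2) k(1,3)]
  have "leg k \<xi> (mv k i f \<xi> e) = leg k \<xi> (mv k j g \<xi> e')"
    using leg_mv[OF d(2) k(1,2)] leg_mv[OF d'(2) k(1,3)] eq(2) by simp
  then obtain m h where m: "m \<in> I" "h \<in> Ar m k" "mv m k h \<xi> (mv k i f \<xi> e) = mv m k h \<xi> (mv k j g \<xi> e')"
    using leg_eq_sameD[OF c1 c2] by blast
  show thesis
  proof (rule that[OF m(1)])
    show "Cmp (idx S) m k i f h \<in> Ar m i" "Cmp (idx S) m k j g h \<in> Ar m j"
      using category_comp[OF cat m(1) k(1) i m(2) k(2)] category_comp[OF cat m(1) k(1) j m(2) k(3)] .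
    show "mv m i (Cmp (idx S) m k i f h) \<xi> d = mv m j (Cmp (idx S) m k j g h) \<xi> d'"
      "mv m i (Cmp (idx S) m k i f h) \<xi> e = mv m j (Cmp (idx S) m k j g h) \<xi> e'"
      using mv_comp[OF d(1) k(1) m(1) k(2) m(2)] mv_comp[OF d(2) k(1) m(1) k(2) m(2)]
        mv_comp[OF d'(1) k(1) m(1) k(3) m(2)] mv_comp[OF d'(2) k(1) m(1) k(3) m(2)] k(4) m(3) by simp_all
  qed
qed

lemma common2:
  assumes d: "d \<in> stk i \<xi>" "e \<in> stk j \<xi>"
  obtains k d' e' where "d' \<in> stk k \<xi>" "e' \<in> stk k \<xi>" "leg i \<xi> d = leg k \<xi> d'" "leg j \<xi> e = leg k \<xi> e'"
proof -
  obtain k f g where k: "k \<in> I" "f \<in> Ar k i" "g \<in> Ar k j"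
    using cofiltered_two[OF cof stkD(2)[OF d(1)] stkD(2)[OF d(2)]] .
  show thesis
    using that[OF mv_stk[OF d(1) k(1,2)] mv_stk[OF d(2) k(1,3)]] leg_mv[OF d(1) k(1,2)] leg_mv[OF d(2) k(1,3)] by simp
qed

lemma common3:
  assumes d: "d \<in> stk i \<xi>" "e \<in> stk j \<xi>" "c \<in> stk l \<xi>"
  obtains k d' e' c' where "d' \<in> stk k \<xi>" "e' \<in> stk k \<xi>" "c' \<in> stk k \<xi>"
    "leg i \<xi> d = leg k \<xi> d'" "leg j \<xi> e = leg k \<xi> e'" "leg l \<xi> c = leg k \<xi> c'"
proof -
  obtain k d' e' where k: "d' \<in> stk k \<xi>" "e' \<in> stk k \<xi>" "leg i \<xi> d = leg k \<xi> d'" "leg j \<xi> e = leg k \<xi> e'"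
    using common2[OF d(1,2)] .
  obtain m f g where m: "m \<in> I" "f \<in> Ar m k" "g \<in> Ar m l"
    using cofiltered_two[OF cof stkD(2)[OF k(1)] stkD(2)[OF d(3)]] .
  show thesis
    using that[OF mv_stk[OF k(1) m(1,2)] mv_stk[OF k(2) m(1,2)] mv_stk[OF d(3) m(1,3)]]
      leg_mv[OF k(1) m(1,2)] leg_mv[OF k(2) m(1,2)] leg_mv[OF d(3) m(1,3)] k by simp
qed

lemma lvl_sheaf: "d \<in> stk i \<xi> \<Longrightarrow> is_sheaf R (lvl S i) (dsh D i)"
  using ds_sheaf[OF D] stkD(2) by blast

lemma add_stk:
  assumes d: "d \<in> stk i \<xi>" "e \<in> stk i \<xi>"
  shows "esum (dsh D i) d e \<in> stk i \<xi>"
  using sheaf_add[OF lvl_sheaf[OF d(1)], of d e] d by (simp add: stk_def)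

lemma scal_stk:
  assumes d: "d \<in> stk i \<xi>" and r: "r \<in> carrier R"
  shows "escal (dsh D i) r d \<in> stk i \<xi>"
  using sheaf_scal[OF lvl_sheaf[OF d(1)] r, of d] d by (simp add: stk_def)

lemma mov_stk:
  assumes d: "d \<in> stk i \<xi>" and g: "g \<in> G.lim"
  shows "emov (dsh D i) (g i) d \<in> stk i (mov L g \<xi>)"
  using sheaf_mov_closed[OF lvl_sheaf[OF d] G_coord[OF g stkD(2)[OF d]] stkD(1)[OF d]]
    sheaf_prj_mov[OF lvl_sheaf[OF d] G_coord[OF g stkD(2)[OF d]] stkD(1)[OF d]]
    L_coord(3)[OF stkD(2)[OF d] stkD(3)[OF d]] stkD[OF d] mov_closed[OF g stkD(3)[OF d]]
  by (intro stkI) auto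

lemma zero_stk:
  assumes "i \<in> I" "\<xi> \<in> X.lim"
  shows "ezero (dsh D i) (\<xi> i) \<in> stk i \<xi>"
  using sheaf_zero[OF ds_sheaf[OF D assms(1)] X.lim_coord[OF assms(2,1)]] assms by (simp add: stk_def)

context
  fixes k i f
  assumes ki: "k \<in> I" "i \<in> I" "f \<in> Ar k i"
begin

private lemma pre_tn:
  assumes d: "d \<in> stk i \<xi>"
  shows "\<xi> k \<in> pre (tn k i f) {prj (dsh D i) d}"
  using stkD[OF d] X.lim_tr[OF stkD(3)[OF d] ki] X.lim_coord[OF stkD(3)[OF d] ki(1)] by (simp add: mem_pre)

private lemma st: "is_sheaf R (tgt (tn k i f)) (dsh D i)"
  "str D k i f \<in> sheaf_hom R (src (tn k i f)) (pull (tn k i f) (dsh D i)) (dsh D k)"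
  using ds_sheaf[OF D ki(2)] ds_str[OF D ki] by simp_all

lemma mv_add:
  assumes d: "d \<in> stk i \<xi>" "e \<in> stk i \<xi>"
  shows "mv k i f \<xi> (esum (dsh D i) d e) = esum (dsh D k) (mv k i f \<xi> d) (mv k i f \<xi> e)"
  using discrete_change.pull_hom_add[OF dc_trans[OF ki] st stkD(1)[OF d(1)] stkD(1)[OF d(2)] _ pre_tn[OF d(2)]]
    stkD(4)[OF d(1)] stkD(4)[OF d(2)] by (simp add: mv_def)

lemma mv_scal:
  assumes d: "d \<in> stk i \<xi>" and r: "r \<in> carrier R"
  shows "mv k i f \<xi> (escal (dsh D i) r d) = escal (dsh D k) r (mv k i f \<xi> d)"
  using discrete_change.pull_hom_scal[OF dc_trans[OF ki] st r stkD(1)[OF d] pre_tn[OF d]] by (simp add: mv_def)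

lemma mv_mov:
  assumes d: "d \<in> stk i \<xi>" and g: "g \<in> G.lim"
  shows "mv k i f (mov L g \<xi>) (emov (dsh D i) (g i) d) = emov (dsh D k) (g k) (mv k i f \<xi> d)"
  using discrete_change.pull_hom_mov[OF dc_trans[OF ki] st _ stkD(1)[OF d] pre_tn[OF d], of "g k"]
    G_coord[OF g ki(1)] G.lim_tr[OF g ki] L_coord(3)[OF ki(1) stkD(3)[OF d]] by (simp add: mv_def)

end

section \<open>The colimit as a set with operations\<close>

definition pt :: "'u \<Rightarrow> 'o \<Rightarrow> 'x" where
  "pt z = (SOME \<xi>. \<exists>i d. d \<in> stk i \<xi> \<and> z = leg i \<xi> d)"

lemma pt_leg: "d \<in> stk i \<xi> \<Longrightarrow> pt (leg i \<xi> d) = \<xi>"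
proof -
  assume d: "d \<in> stk i \<xi>"
  then have "\<exists>j e. e \<in> stk j (pt (leg i \<xi> d)) \<and> leg i \<xi> d = leg j (pt (leg i \<xi> d)) e"
    unfolding pt_def by (intro someI_ex[of "\<lambda>\<xi>'. \<exists>j e. e \<in> stk j \<xi>' \<and> leg i \<xi> d = leg j \<xi>' e"]) blast
  then show ?thesis using leg_eq_iff[OF d] by metis
qed

definition Kset :: "'u set" where
  "Kset = {leg i \<xi> d |i \<xi> d. d \<in> stk i \<xi>}"

text \<open>The final topology for the basic sections \<open>\<xi> \<mapsto> leg i \<xi> d\<close>
  on the fibres where they are defined.\<close>

definition Kopen :: "'u set \<Rightarrow> bool" where
  "Kopen U \<longleftrightarrow> U \<subseteq> Kset \<and> (\<forall>i\<in>I. \<forall>d\<in>tspace (dsh D i). openin (pts L) {\<xi>. d \<in> stk i \<xi> \<and> leg i \<xi> d \<in> U})"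

text \<open>The sum is formed at a common level of representatives; \<open>common2\<close> supplies
  one and \<open>leg_add_cong\<close> removes the dependence on it.\<close>

definition Ksum :: "'u \<Rightarrow> 'u \<Rightarrow> 'u" where
  "Ksum z z' = (SOME w. \<exists>i \<xi> d e. d \<in> stk i \<xi> \<and> e \<in> stk i \<xi> \<and> z = leg i \<xi> d \<and> z' = leg i \<xi> e \<and>
     w = leg i \<xi> (esum (dsh D i) d e))"

definition Kscal :: "'r \<Rightarrow> 'u \<Rightarrow> 'u" where
  "Kscal r z = (SOME w. \<exists>i \<xi> d. d \<in> stk i \<xi> \<and> z = leg i \<xi> d \<and> w = leg i \<xi> (escal (dsh D i) r d))"

definition Kmov :: "('o \<Rightarrow> 'g) \<Rightarrow> 'u \<Rightarrow> 'u" where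
  "Kmov g = restrict (\<lambda>z. SOME w. \<exists>i \<xi> d. d \<in> stk i \<xi> \<and> z = leg i \<xi> d \<and>
     w = leg i (mov L g \<xi>) (emov (dsh D i) (g i) d)) Kset"

definition Kzero :: "('o \<Rightarrow> 'x) \<Rightarrow> 'u" where
  "Kzero \<xi> = (let i = SOME i. i \<in> I in leg i \<xi> (ezero (dsh D i) (\<xi> i)))"

definition K :: "('o \<Rightarrow> 'g, 'o \<Rightarrow> 'x, 'r, 'u) sheaf" where
  "K = \<lparr>tot = topology Kopen, prj = pt, emov = Kmov, ezero = Kzero, esum = Ksum, escal = Kscal\<rparr>"

lemma leg_add_cong:
  assumes d: "d \<in> stk i \<xi>" "e \<in> stk i \<xi>" and d': "d' \<in> stk j \<xi>" "e' \<in> stk j \<xi>"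
    and eq: "leg i \<xi> d = leg j \<xi> d'" "leg i \<xi> e = leg j \<xi> e'"
  shows "leg i \<xi> (esum (dsh D i) d e) = leg j \<xi> (esum (dsh D j) d' e')"
proof -
  obtain k f g where k: "k \<in> I" "f \<in> Ar k i" "g \<in> Ar k j"
    "mv k i f \<xi> d = mv k j g \<xi> d'" "mv k i f \<xi> e = mv k j g \<xi> e'"
    using leg_eq_pairD[OF d d' eq] .
  then show ?thesis
    using leg_mv[OF add_stk[OF d] k(1,2)] leg_mv[OF add_stk[OF d'] k(1,3)]
      mv_add[OF k(1) stkD(2)[OF d(1)] k(2) d] mv_add[OF k(1) stkD(2)[OF d'(1)] k(3) d'] by simp
qed

lemma leg_relD:
  assumes d: "d \<in> stk i \<xi>" "d' \<in> stk j \<xi>" and eq: "leg i \<xi> d = leg j \<xi> d'"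
  obtains k f g where "k \<in> I" "f \<in> Ar k i" "g \<in> Ar k j" "mv k i f \<xi> d = mv k j g \<xi> d'"
  using leg_eq_iff[OF d] eq by (auto simp: rel_def)

lemma Ksum_leg:
  assumes d: "d \<in> stk i \<xi>" "e \<in> stk i \<xi>"
  shows "Ksum (leg i \<xi> d) (leg i \<xi> e) = leg i \<xi> (esum (dsh D i) d e)"
proof -
  let ?P = "\<lambda>w. \<exists>j \<xi>' d' e'. d' \<in> stk j \<xi>' \<and> e' \<in> stk j \<xi>' \<and> leg i \<xi> d = leg j \<xi>' d' \<and> leg i \<xi> e = leg j \<xi>' e' \<and>
     w = leg j \<xi>' (esum (dsh D j) d' e')"
  have "?P (leg i \<xi> (esum (dsh D i) d e))" using d by blast
  then have "?P (Ksum (leg i \<xi> d) (leg i \<xi> e))" unfolding Ksum_def by (rule someI)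
  then obtain j \<xi>' d' e' where j: "d' \<in> stk j \<xi>'" "e' \<in> stk j \<xi>'" "leg i \<xi> d = leg j \<xi>' d'" "leg i \<xi> e = leg j \<xi>' e'"
    "Ksum (leg i \<xi> d) (leg i \<xi> e) = leg j \<xi>' (esum (dsh D j) d' e')" by blast
  have "\<xi>' = \<xi>" using leg_eq_iff[OF d(1) j(1)] j(3) by simp
  then show ?thesis using leg_add_cong[OF d, of d' j e'] j by simp
qed

lemma Kscal_leg:
  assumes d: "d \<in> stk i \<xi>" and r: "r \<in> carrier R"
  shows "Kscal r (leg i \<xi> d) = leg i \<xi> (escal (dsh D i) r d)"
proof -
  let ?P = "\<lambda>w. \<exists>j \<xi>' d'. d' \<in> stk j \<xi>' \<and> leg i \<xi> d = leg j \<xi>' d' \<and> w = leg j \<xi>' (escal (dsh D j) r d')"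
  have "?P (leg i \<xi> (escal (dsh D i) r d))" using d by blast
  then have "?P (Kscal r (leg i \<xi> d))" unfolding Kscal_def by (rule someI)
  then obtain j \<xi>' d' where j: "d' \<in> stk j \<xi>'" "leg i \<xi> d = leg j \<xi>' d'"
    "Kscal r (leg i \<xi> d) = leg j \<xi>' (escal (dsh D j) r d')" by blast
  have [simp]: "\<xi>' = \<xi>" using leg_eq_iff[OF d(1) j(1)] j(2) by simp
  obtain k f g where k: "k \<in> I" "f \<in> Ar k i" "g \<in> Ar k j" "mv k i f \<xi> d = mv k j g \<xi> d'"
    using leg_relD[OF d, of d' j] j by auto
  have d': "d' \<in> stk j \<xi>" using j(1) by simp
  show ?thesis
    using leg_mv[OF scal_stk[OF d r] k(1,2)] leg_mv[OF scal_stk[OF d' r] k(1,3)] j(3) k(4)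
      mv_scal[OF k(1) stkD(2)[OF d] k(2) d r] mv_scal[OF k(1) stkD(2)[OF d'] k(3) d' r] by simp
qed

lemma leg_Kset: "d \<in> stk i \<xi> \<Longrightarrow> leg i \<xi> d \<in> Kset"
  by (auto simp: Kset_def)

lemma Kmov_leg:
  assumes d: "d \<in> stk i \<xi>" and h: "h \<in> G.lim"
  shows "Kmov h (leg i \<xi> d) = leg i (mov L h \<xi>) (emov (dsh D i) (h i) d)"
proof -
  let ?P = "\<lambda>w. \<exists>j \<xi>' d'. d' \<in> stk j \<xi>' \<and> leg i \<xi> d = leg j \<xi>' d' \<and> w = leg j (mov L h \<xi>') (emov (dsh D j) (h j) d')"
  have "?P (leg i (mov L h \<xi>) (emov (dsh D i) (h i) d))" using d by blast
  then have "?P (SOME w. ?P w)" by (rule someI)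
  then have "?P (Kmov h (leg i \<xi> d))" using leg_Kset[OF d] by (simp add: Kmov_def)
  then obtain j \<xi>' d' where j: "d' \<in> stk j \<xi>'" "leg i \<xi> d = leg j \<xi>' d'"
    "Kmov h (leg i \<xi> d) = leg j (mov L h \<xi>') (emov (dsh D j) (h j) d')" by blast
  have [simp]: "\<xi>' = \<xi>" using leg_eq_iff[OF d(1) j(1)] j(2) by simp
  obtain k f g where k: "k \<in> I" "f \<in> Ar k i" "g \<in> Ar k j" "mv k i f \<xi> d = mv k j g \<xi> d'"
    using leg_relD[OF d, of d' j] j by auto
  have d': "d' \<in> stk j \<xi>" using j(1) by simp
  show ?thesis
    using leg_mv[OF mov_stk[OF d h] k(1,2)] leg_mv[OF mov_stk[OF d' h] k(1,3)] j(3) k(4)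
      mv_mov[OF k(1) stkD(2)[OF d] k(2) d h] mv_mov[OF k(1) stkD(2)[OF d'] k(3) d' h] by simp
qed

lemma mv_zero:
  assumes ki: "k \<in> I" "i \<in> I" "f \<in> Ar k i" and x: "\<xi> \<in> X.lim"
  shows "mv k i f \<xi> (ezero (dsh D i) (\<xi> i)) = ezero (dsh D k) (\<xi> k)"
proof -
  note z = zero_stk[OF ki(2) x] and zk = mv_stk[OF zero_stk[OF ki(2) x] ki(1,3)]
  have ab: "abelian_group (stalk (dsh D j) (\<xi> j))" if "j \<in> I" for j
    using left_module_abelian_group[OF sheaf_module[OF ds_sheaf[OF D that] X.lim_coord[OF x that]]] .
  have "esum (dsh D i) (ezero (dsh D i) (\<xi> i)) (ezero (dsh D i) (\<xi> i)) = ezero (dsh D i) (\<xi> i)"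
    using abelian_groupE(5)[OF ab[OF ki(2)], of "ezero (dsh D i) (\<xi> i)"] z by (simp add: stk_def)
  then have "esum (dsh D k) (mv k i f \<xi> (ezero (dsh D i) (\<xi> i))) (mv k i f \<xi> (ezero (dsh D i) (\<xi> i))) =
      mv k i f \<xi> (ezero (dsh D i) (\<xi> i))"
    using mv_add[OF ki z z] by simp
  then show ?thesis
    using abelian_group_idem_zero[OF ab[OF ki(1)], of "mv k i f \<xi> (ezero (dsh D i) (\<xi> i))"] zk
    by (simp add: stk_def)
qed

lemma Kzero_eq:
  assumes i: "i \<in> I" and x: "\<xi> \<in> X.lim"
  shows "Kzero \<xi> = leg i \<xi> (ezero (dsh D i) (\<xi> i))"
proof -
  define j where "j = (SOME i. i \<in> I)"
  have j: "j \<in> I" using someI[of "\<lambda>i. i \<in> I" i] i by (simp add: j_def)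
  obtain k f g where k: "k \<in> I" "f \<in> Ar k i" "g \<in> Ar k j" using cofiltered_two[OF cof i j] .
  have "leg j \<xi> (ezero (dsh D j) (\<xi> j)) = leg i \<xi> (ezero (dsh D i) (\<xi> i))"
    using leg_mv[OF zero_stk[OF j x] k(1,3)] leg_mv[OF zero_stk[OF i x] k(1,2)]
      mv_zero[OF k(1) j k(3) x] mv_zero[OF k(1) i k(2) x] by simp
  then show ?thesis by (simp add: Kzero_def j_def[symmetric] Let_def)
qed

section \<open>Topology of the colimit\<close>

lemma istopology_K: "istopology Kopen"
  unfolding istopology_def
proof (intro conjI allI impI)
  fix U V assume U: "Kopen U" and V: "Kopen V"
  have "{\<xi>. d \<in> stk i \<xi> \<and> leg i \<xi> d \<in> U \<inter> V} = {\<xi>. d \<in> stk i \<xi> \<and> leg i \<xi> d \<in> U} \<inter> {\<xi>. d \<in> stk i \<xi> \<and> leg i \<xi> d \<in> V}"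
    for d i by blast
  then show "Kopen (U \<inter> V)" using U V unfolding Kopen_def by (auto intro: openin_Int)
next
  fix \<U> assume U: "\<forall>U\<in>\<U>. Kopen U"
  have "{\<xi>. d \<in> stk i \<xi> \<and> leg i \<xi> d \<in> \<Union> \<U>} = (\<Union>U\<in>\<U>. {\<xi>. d \<in> stk i \<xi> \<and> leg i \<xi> d \<in> U})" for d i by blast
  then show "Kopen (\<Union> \<U>)" using U unfolding Kopen_def by (auto intro!: openin_Union)
qed

lemma openin_K: "openin (tot K) = Kopen"
  using istopology_K by (simp add: K_def topology_inverse')

lemma fibre_open: "i \<in> I \<Longrightarrow> openin (pts L) {\<xi>. d \<in> tspace (dsh D i) \<and> d \<in> stk i \<xi>}"
proof -
  assume i: "i \<in> I"
  show ?thesis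
  proof (cases "d \<in> tspace (dsh D i)")
    case True
    then have "{\<xi>. d \<in> tspace (dsh D i) \<and> d \<in> stk i \<xi>} = {\<xi> \<in> X.lim. \<xi> i = prj (dsh D i) d}"
      using i by (auto simp: stk_def)
    then show ?thesis using X.openin_fibre[OF i] unfolding L_top by simp
  qed simp
qed

lemma Kopen_Kset: "Kopen Kset"
  unfolding Kopen_def
proof (intro conjI ballI order.refl)
  fix i d assume i: "i \<in> I" "d \<in> tspace (dsh D i)"
  have "{\<xi>. d \<in> stk i \<xi> \<and> leg i \<xi> d \<in> Kset} = {\<xi>. d \<in> tspace (dsh D i) \<and> d \<in> stk i \<xi>}"
    using leg_Kset i by blast
  then show "openin (pts L) {\<xi>. d \<in> stk i \<xi> \<and> leg i \<xi> d \<in> Kset}" using fibre_open[OF i(1)] by simp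
qed

lemma tspace_K: "tspace K = Kset"
  using Kopen_Kset unfolding topspace_def openin_K by (auto simp: Kopen_def)

lemma K_simps: "prj K = pt" "emov K = Kmov" "ezero K = Kzero" "esum K = Ksum" "escal K = Kscal"
  by (simp_all add: K_def)

lemma Kset_cases:
  assumes "z \<in> Kset"
  obtains i d where "d \<in> stk i (pt z)" "z = leg i (pt z) d"
proof -
  obtain i \<xi> d where d: "d \<in> stk i \<xi>" "z = leg i \<xi> d" using assms by (auto simp: Kset_def)
  then show thesis using that[of d i] pt_leg[OF d(1)] by simp
qed

lemma pre_stk: "\<lbrakk>i \<in> I; d \<in> tspace (dsh D i)\<rbrakk> \<Longrightarrow> pre (p i) {prj (dsh D i) d} = {\<xi>. d \<in> stk i \<xi>}"
  by (auto simp: stk_def mem_fibre)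

text \<open>Universal property of the final topology: continuity is tested on basic
  sections.\<close>

lemma K_continuousI:
  assumes c: "\<And>i d. \<lbrakk>i \<in> I; d \<in> tspace (dsh D i)\<rbrakk> \<Longrightarrow>
    continuous_map (subtopology (pts L) {\<xi>. d \<in> stk i \<xi>}) T (\<lambda>\<xi>. h (leg i \<xi> d))"
  shows "continuous_map (tot K) T h"
  unfolding continuous_map_def
proof (intro conjI allI impI)
  have t: "topspace (subtopology (pts L) {\<xi>. d \<in> stk i \<xi>}) = {\<xi>. d \<in> stk i \<xi>}" for i d
    by (auto simp: L_simps stk_def)
  show "h \<in> tspace K \<rightarrow> topspace T"
    unfolding tspace_K
  proof
    fix z assume "z \<in> Kset"
    then obtain i d where d: "d \<in> stk i (pt z)" "z = leg i (pt z) d" by (rule Kset_cases)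
    then show "h z \<in> topspace T"
      using continuous_map_image_subset_topspace[OF c[OF stkD(2,1)[OF d(1)]], unfolded t] d by (metis image_subset_iff mem_Collect_eq)
  qed
  fix U assume U: "openin T U"
  show "openin (tot K) {z \<in> tspace K. h z \<in> U}"
    unfolding openin_K Kopen_def tspace_K
  proof (intro conjI ballI)
    fix i d assume i: "i \<in> I" "d \<in> tspace (dsh D i)"
    have o: "openin (pts L) {\<xi>. d \<in> stk i \<xi>}" using fibre_open[OF i(1), of d] i(2) by simp
    have "openin (subtopology (pts L) {\<xi>. d \<in> stk i \<xi>}) {\<xi> \<in> {\<xi>. d \<in> stk i \<xi>}. h (leg i \<xi> d) \<in> U}"
      using openin_continuous_map_preimage[OF c[OF i] U] unfolding t .
    then have "openin (pts L) {\<xi> \<in> {\<xi>. d \<in> stk i \<xi>}. h (leg i \<xi> d) \<in> U}" using openin_trans_full[OF _ o] by blast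
    moreover have "{\<xi> \<in> {\<xi>. d \<in> stk i \<xi>}. h (leg i \<xi> d) \<in> U} = {\<xi>. d \<in> stk i \<xi> \<and> leg i \<xi> d \<in> {z \<in> Kset. h z \<in> U}}"
      using leg_Kset by blast
    ultimately show "openin (pts L) {\<xi>. d \<in> stk i \<xi> \<and> leg i \<xi> d \<in> {z \<in> Kset. h z \<in> U}}" by simp
  qed auto
qed

lemma leg_cont:
  assumes i: "i \<in> I" "d \<in> tspace (dsh D i)"
  shows "continuous_map (subtopology (pts L) {\<xi>. d \<in> stk i \<xi>}) (tot K) (\<lambda>\<xi>. leg i \<xi> d)"
  unfolding continuous_map_def
proof (intro conjI allI impI)
  have t: "topspace (subtopology (pts L) {\<xi>. d \<in> stk i \<xi>}) = {\<xi>. d \<in> stk i \<xi>}"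
    by (auto simp: L_simps stk_def)
  show "(\<lambda>\<xi>. leg i \<xi> d) \<in> topspace (subtopology (pts L) {\<xi>. d \<in> stk i \<xi>}) \<rightarrow> tspace K"
    unfolding t tspace_K using leg_Kset by blast
  fix U assume "openin (tot K) U"
  then have "openin (pts L) {\<xi>. d \<in> stk i \<xi> \<and> leg i \<xi> d \<in> U}" using i by (simp add: openin_K Kopen_def)
  then show "openin (subtopology (pts L) {\<xi>. d \<in> stk i \<xi>}) {\<xi> \<in> topspace (subtopology (pts L) {\<xi>. d \<in> stk i \<xi>}). leg i \<xi> d \<in> U}"
    unfolding t openin_subtopology by (intro exI[of _ "{\<xi>. d \<in> stk i \<xi> \<and> leg i \<xi> d \<in> U}"]) auto
qed

definition Bas :: "'o \<Rightarrow> 'e \<Rightarrow> 'u set" where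
  "Bas i d = {leg i \<xi> d |\<xi>. d \<in> stk i \<xi>}"

text \<open>If two basic sections meet over \<xi>, the representatives agree at a level
  \<open>k\<close>, and transport to \<open>k\<close> depends on \<xi> only through
  \<open>\<xi> k\<close>. They therefore agree over the whole open fibre of
  \<open>\<xi> k\<close>.\<close>

lemma openin_Bas:
  assumes i: "i \<in> I" "d \<in> tspace (dsh D i)"
  shows "openin (tot K) (Bas i d)"
  unfolding openin_K Kopen_def
proof (intro conjI ballI)
  show "Bas i d \<subseteq> Kset" using leg_Kset by (auto simp: Bas_def)
  fix j e assume j: "j \<in> I" "e \<in> tspace (dsh D j)"
  show "openin (pts L) {\<xi>. e \<in> stk j \<xi> \<and> leg j \<xi> e \<in> Bas i d}"
  proof (subst openin_subopen, intro ballI)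
    fix \<xi> assume "\<xi> \<in> {\<xi>. e \<in> stk j \<xi> \<and> leg j \<xi> e \<in> Bas i d}"
    then obtain \<xi>' where e: "e \<in> stk j \<xi>" "leg j \<xi> e = leg i \<xi>' d" "d \<in> stk i \<xi>'" by (auto simp: Bas_def)
    have "\<xi>' = \<xi>" using leg_eq_iff[OF e(1,3)] e(2) by simp
    then have d: "d \<in> stk i \<xi>" "leg j \<xi> e = leg i \<xi> d" using e by simp_all
    obtain k f g where k: "k \<in> I" "f \<in> Ar k j" "g \<in> Ar k i" "mv k j f \<xi> e = mv k i g \<xi> d"
      using leg_relD[OF e(1) d] .
    let ?W = "{\<xi>' \<in> X.lim. \<xi>' k = \<xi> k}"
    have "e \<in> stk j \<xi>' \<and> leg j \<xi>' e \<in> Bas i d" if x': "\<xi>' \<in> ?W" for \<xi>'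
    proof -
      have "\<xi>' j = \<xi> j" "\<xi>' i = \<xi> i"
        using X.lim_tr[OF _ k(1) j(1) k(2)] X.lim_tr[OF _ k(1) i(1) k(3)] x' stkD(3)[OF e(1)]
        by (metis (mono_tags, lifting) mem_Collect_eq)+
      then have s: "e \<in> stk j \<xi>'" "d \<in> stk i \<xi>'" using e(1) d(1) x' by (auto simp: stk_def)
      have "mv k j f \<xi>' e = mv k i g \<xi>' d" using k(4) x' by (simp add: mv_def)
      then have "leg j \<xi>' e = leg i \<xi>' d"
        using leg_mv[OF s(1) k(1,2)] leg_mv[OF s(2) k(1,3)] by simp
      then show ?thesis using s by (auto simp: Bas_def)
    qed
    moreover have "openin (pts L) ?W" using X.openin_fibre[OF k(1)] unfolding L_top .
    ultimately show "\<exists>W. openin (pts L) W \<and> \<xi> \<in> W \<and> W \<subseteq> {\<xi>. e \<in> stk j \<xi> \<and> leg j \<xi> e \<in> Bas i d}"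
      using stkD(3)[OF e(1)] by (intro exI[of _ ?W]) auto
  qed
qed

lemma BasD: "z \<in> Bas i d \<Longrightarrow> d \<in> stk i (pt z) \<and> z = leg i (pt z) d"
  using pt_leg by (auto simp: Bas_def)

lemma leg_Bas: "d \<in> stk i \<xi> \<Longrightarrow> leg i \<xi> d \<in> Bas i d"
  by (auto simp: Bas_def)

lemma pt_cont: "continuous_map (tot K) (pts L) pt"
proof (rule K_continuousI)
  fix i d
  show "continuous_map (subtopology (pts L) {\<xi>. d \<in> stk i \<xi>}) (pts L) (\<lambda>\<xi>. pt (leg i \<xi> d))"
  proof (rule continuous_map_eq[of _ _ "\<lambda>\<xi>. \<xi>"])
    show "continuous_map (subtopology (pts L) {\<xi>. d \<in> stk i \<xi>}) (pts L) (\<lambda>\<xi>. \<xi>)"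
      by (simp add: continuous_map_from_subtopology)
  qed (simp add: pt_leg)
qed

text \<open>\<open>pt\<close> is injective on each \<open>Bas i d\<close>, and it maps an open set
  onto the union of the open sets by which its openness is defined.\<close>

lemma K_local_homeomorphism: "local_homeomorphism (tot K) (pts L) pt"
proof (rule local_homeomorphismI[OF pt_cont])
  fix U assume U: "openin (tot K) U"
  then have "U \<subseteq> Kset" by (simp add: openin_K Kopen_def)
  have "pt ` U = (\<Union>(i, d)\<in>{(i, d). i \<in> I \<and> d \<in> tspace (dsh D i)}. {\<xi>. d \<in> stk i \<xi> \<and> leg i \<xi> d \<in> U})" (is "_ = ?V")
  proof
    show "pt ` U \<subseteq> ?V"
    proof
      fix \<xi> assume "\<xi> \<in> pt ` U"
      then obtain z where z: "z \<in> U" "\<xi> = pt z" by blast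
      then obtain i d where d: "d \<in> stk i (pt z)" "z = leg i (pt z) d" using \<open>U \<subseteq> Kset\<close> Kset_cases by blast
      have "(i, d) \<in> {(i, d). i \<in> I \<and> d \<in> tspace (dsh D i)}" using stkD(1,2)[OF d(1)] by simp
      moreover have "\<xi> \<in> {\<xi>. d \<in> stk i \<xi> \<and> leg i \<xi> d \<in> U}" using d z by simp
      ultimately show "\<xi> \<in> ?V" by blast
    qed
    show "?V \<subseteq> pt ` U"
    proof
      fix \<xi> assume "\<xi> \<in> ?V"
      then obtain i d where d: "d \<in> stk i \<xi>" "leg i \<xi> d \<in> U" by blast
      then show "\<xi> \<in> pt ` U" using pt_leg[OF d(1)] by (metis image_eqI)
    qed
  qed
  moreover have "openin (pts L) ?V"
    using U by (intro openin_Union) (auto simp: openin_K Kopen_def)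
  ultimately show "openin (pts L) (pt ` U)" by simp
next
  fix z assume "z \<in> tspace K"
  then obtain i d where d: "d \<in> stk i (pt z)" "z = leg i (pt z) d" using Kset_cases tspace_K by metis
  have "z \<in> Bas i d" using leg_Bas[OF d(1)] d(2) by simp
  moreover have "inj_on pt (Bas i d)"
    by (rule inj_onI) (metis BasD)
  ultimately show "\<exists>U. openin (tot K) U \<and> z \<in> U \<and> inj_on pt U"
    using openin_Bas stkD(1,2)[OF d(1)] by blast
qed

section \<open>Action and module structure of the colimit\<close>

lemma K_action: "group_action (grp L) (tspace K) (emov K)"
proof (rule group_actionI[OF group_L], unfold L_simps tspace_K K_simps)
  show "Kmov g \<in> extensional Kset" for g by (simp add: Kmov_def)
  show "Kmov g z \<in> Kset" if g: "g \<in> G.lim" and z: "z \<in> Kset" for g z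
    using z by (rule Kset_cases) (metis Kmov_leg[OF _ g] leg_Kset mov_stk[OF _ g])
  show "Kmov \<one>\<^bsub>grp L\<^esub> z = z" if z: "z \<in> Kset" for z
  proof -
    obtain i d where d: "d \<in> stk i (pt z)" "z = leg i (pt z) d" using z by (rule Kset_cases)
    have "mov L \<one>\<^bsub>grp L\<^esub> (pt z) = pt z"
      using group_action_one[OF act_L] stkD(3)[OF d(1)] by (simp add: L_simps)
    moreover have "emov (dsh D i) (\<one>\<^bsub>grp L\<^esub> i) d = d"
      using group_action_one[OF sheaf_act[OF lvl_sheaf[OF d(1)]] stkD(1)[OF d(1)]] L_coord(2)[OF stkD(2)[OF d(1)]] by simp
    ultimately show ?thesis using Kmov_leg[OF d(1) one_closed] d(2) by simp
  qed
  show "Kmov (g \<otimes>\<^bsub>grp L\<^esub> h) z = Kmov g (Kmov h z)" if g: "g \<in> G.lim" and h: "h \<in> G.lim" and z: "z \<in> Kset" for g h z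
  proof -
    obtain i d where d: "d \<in> stk i (pt z)" "z = leg i (pt z) d" using z by (rule Kset_cases)
    have "mov L (g \<otimes>\<^bsub>grp L\<^esub> h) (pt z) = mov L g (mov L h (pt z))"
      using group_action_mult[OF act_L] stkD(3)[OF d(1)] g h by (simp add: L_simps)
    moreover have "emov (dsh D i) ((g \<otimes>\<^bsub>grp L\<^esub> h) i) d = emov (dsh D i) (g i) (emov (dsh D i) (h i) d)"
      using group_action_mult[OF sheaf_act[OF lvl_sheaf[OF d(1)]] G_coord[OF g] G_coord[OF h] stkD(1)[OF d(1)]]
        L_coord(1) stkD(2)[OF d(1)] by simp
    ultimately show ?thesis
      using Kmov_leg[OF d(1) mult_closed[OF g h]] Kmov_leg[OF d(1) h] Kmov_leg[OF mov_stk[OF d(1) h] g] d(2) by simp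
  qed
qed

text \<open>Near \<open>(g, z)\<close> the component at \<open>i\<close> of the group element is
  constant, so there the action is the basic section of one fixed element \<open>e\<close> composed
  with the action on the base.\<close>

lemma K_mov_cont: "continuous_map (prod_topology (gtop L) (tot K)) (tot K) (\<lambda>(g, z). emov K g z)"
proof (rule continuous_map_local)
  let ?P = "prod_topology (gtop L) (tot K)"
  fix x assume "x \<in> topspace ?P"
  then obtain g z where x: "x = (g, z)" "g \<in> G.lim" "z \<in> Kset" by (auto simp: L_simps tspace_K)
  obtain i d where d: "d \<in> stk i (pt z)" "z = leg i (pt z) d" using x(3) by (rule Kset_cases)
  note io = stkD(1,2)[OF d(1)]
  let ?N = "{h \<in> G.lim. h i = g i}"
  let ?U = "?N \<times> Bas i d"
  have "openin (gtop L) ?N" using G.openin_fibre[OF io(2)] unfolding L_top .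
  then have U: "openin ?P ?U" using openin_Bas[OF io(2,1)] by (simp add: openin_prod_Times_iff)
  have tU: "topspace (subtopology ?P ?U) = ?U" using openin_subset[OF U] by auto
  define e where "e = emov (dsh D i) (g i) d"
  have e: "e \<in> tspace (dsh D i)" using stkD(1)[OF mov_stk[OF d(1) x(2)]] by (simp add: e_def)
  have es: "e \<in> stk i (mov L h (pt w))" "emov K h w = leg i (mov L h (pt w)) e" if "(h, w) \<in> ?U" for h w
  proof -
    have h: "h \<in> G.lim" "h i = g i" and w: "d \<in> stk i (pt w)" "w = leg i (pt w) d" using that BasD by auto
    show "e \<in> stk i (mov L h (pt w))" using mov_stk[OF w(1) h(1)] h(2) by (simp add: e_def)
    show "emov K h w = leg i (mov L h (pt w)) e" using Kmov_leg[OF w(1) h(1)] w(2) h(2) by (simp add: K_simps e_def)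
  qed
  have "continuous_map (prod_topology (gtop L) (tot K)) (prod_topology (gtop L) (pts L)) (\<lambda>(h, w). (h, pt w))"
    using pt_cont by (simp add: continuous_map_prod_top)
  from continuous_map_compose[OF this mov_L_cont]
  have "continuous_map ?P (pts L) (\<lambda>(h, w). mov L h (pt w))" by (simp add: o_def case_prod_unfold)
  then have "continuous_map (subtopology ?P ?U) (subtopology (pts L) {\<xi>. e \<in> stk i \<xi>}) (\<lambda>(h, w). mov L h (pt w))"
    unfolding continuous_map_in_subtopology tU using es(1) by (auto simp: continuous_map_from_subtopology)
  from continuous_map_compose[OF this leg_cont[OF io(2) e]]
  have "continuous_map (subtopology ?P ?U) (tot K) (\<lambda>(g, z). emov K g z)"
  proof (rule continuous_map_eq)
    fix y assume "y \<in> topspace (subtopology ?P ?U)"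
    then obtain h w where y: "y = (h, w)" "(h, w) \<in> ?U" unfolding tU by blast
    show "((\<lambda>\<xi>. leg i \<xi> e) \<circ> (\<lambda>(h, w). mov L h (pt w))) y = (case y of (g, z) \<Rightarrow> emov K g z)"
      using es(2)[OF y(2)] y(1) by simp
  qed
  moreover have "x \<in> ?U" using x d leg_Bas[OF d(1)] by simp
  ultimately show "\<exists>U. openin ?P U \<and> x \<in> U \<and> continuous_map (subtopology ?P U) (tot K) (\<lambda>(g, z). emov K g z)"
    using U by blast
qed

lemma stalk_K_cases:
  assumes "z \<in> carrier (stalk K \<xi>)"
  obtains i d where "d \<in> stk i \<xi>" "z = leg i \<xi> d"
proof -
  have z: "z \<in> Kset" "pt z = \<xi>" using assms by (simp_all add: tspace_K K_simps)
  obtain i d where "d \<in> stk i (pt z)" "z = leg i (pt z) d" using z(1) by (rule Kset_cases)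
  then show thesis using that unfolding z(2) by blast
qed

lemma leg_stalk: "d \<in> stk i \<xi> \<Longrightarrow> leg i \<xi> d \<in> carrier (stalk K \<xi>)"
  using leg_Kset pt_leg by (simp add: tspace_K K_simps)

lemma lvl_module: "d \<in> stk i \<xi> \<Longrightarrow> left_module R (stalk (dsh D i) (\<xi> i))"
  using sheaf_module[OF lvl_sheaf] stkD X.lim_coord by blast

lemma stk_carrier: "d \<in> stk i \<xi> \<Longrightarrow> d \<in> carrier (stalk (dsh D i) (\<xi> i))"
  by (simp add: stk_def)

lemma stalk_K_simps: "zero (stalk K \<xi>) = Kzero \<xi>" "add (stalk K \<xi>) = Ksum" "smult (stalk K \<xi>) = Kscal"
  by (simp_all add: K_simps)

text \<open>Two or three classes have representatives at a common level, where the group laws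
  hold.\<close>

lemma K_abelian:
  assumes x: "\<xi> \<in> X.lim"
  shows "abelian_group (stalk K \<xi>)"
proof (rule abelian_groupI, unfold stalk_K_simps)
  note ab = left_module_abelian_group[OF lvl_module]
  obtain i0 where i0: "i0 \<in> I" using cof by (auto simp: cofiltered_def)
  show "Kzero \<xi> \<in> carrier (stalk K \<xi>)" using Kzero_eq[OF i0 x] leg_stalk[OF zero_stk[OF i0 x]] by simp
  fix z1 assume z1: "z1 \<in> carrier (stalk K \<xi>)"
  obtain i d where d: "d \<in> stk i \<xi>" "z1 = leg i \<xi> d" using z1 by (rule stalk_K_cases)
  note i = stkD(2)[OF d(1)]
  note z = zero_stk[OF i x] and zi = Kzero_eq[OF i x]
  show "Ksum (Kzero \<xi>) z1 = z1"
    using Ksum_leg[OF z d(1)] zi d(2) abelian_groupE(5)[OF ab[OF d(1)] stk_carrier[OF d(1)]] by simp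
  obtain n where n: "n \<in> stk i \<xi>" "esum (dsh D i) n d = ezero (dsh D i) (\<xi> i)"
    using abelian_groupE(6)[OF ab[OF d(1)] stk_carrier[OF d(1)]] i x by (auto simp: stk_def)
  show "\<exists>y\<in>carrier (stalk K \<xi>). Ksum y z1 = Kzero \<xi>"
    using Ksum_leg[OF n(1) d(1)] n(2) zi d(2) leg_stalk[OF n(1)] by (intro bexI[of _ "leg i \<xi> n"]) simp_all
  fix z2 assume z2: "z2 \<in> carrier (stalk K \<xi>)"
  obtain j e where e: "e \<in> stk j \<xi>" "z2 = leg j \<xi> e" using z2 by (rule stalk_K_cases)
  obtain k d' e' where k: "d' \<in> stk k \<xi>" "e' \<in> stk k \<xi>" "z1 = leg k \<xi> d'" "z2 = leg k \<xi> e'"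
    using common2[OF d(1) e(1)] d(2) e(2) by metis
  show "Ksum z1 z2 \<in> carrier (stalk K \<xi>)"
    using Ksum_leg[OF k(1,2)] k leg_stalk[OF add_stk[OF k(1,2)]] by simp
  show "Ksum z1 z2 = Ksum z2 z1"
    using Ksum_leg[OF k(1,2)] Ksum_leg[OF k(2,1)] k(3,4)
      abelian_groupE(4)[OF ab[OF k(1)] stk_carrier[OF k(1)] stk_carrier[OF k(2)]] by simp
  fix z3 assume z3: "z3 \<in> carrier (stalk K \<xi>)"
  obtain l c where c: "c \<in> stk l \<xi>" "z3 = leg l \<xi> c" using z3 by (rule stalk_K_cases)
  obtain m a1 a2 a3 where m: "a1 \<in> stk m \<xi>" "a2 \<in> stk m \<xi>" "a3 \<in> stk m \<xi>"
    "z1 = leg m \<xi> a1" "z2 = leg m \<xi> a2" "z3 = leg m \<xi> a3"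
    using common3[OF d(1) e(1) c(1)] d(2) e(2) c(2) by metis
  show "Ksum (Ksum z1 z2) z3 = Ksum z1 (Ksum z2 z3)"
    using Ksum_leg[OF m(1,2)] Ksum_leg[OF m(2,3)] Ksum_leg[OF add_stk[OF m(1,2)] m(3)]
      Ksum_leg[OF m(1) add_stk[OF m(2,3)]] m(4-6)
      abelian_groupE(3)[OF ab[OF m(1)] stk_carrier[OF m(1)] stk_carrier[OF m(2)] stk_carrier[OF m(3)]] by simp
qed

lemma K_module:
  assumes x: "\<xi> \<in> X.lim"
  shows "left_module R (stalk K \<xi>)"
proof (rule left_module.intro[OF ring K_abelian[OF x]], intro left_module_axioms.intro, unfold stalk_K_simps)
  interpret R: ring R by (rule ring)
  fix z assume z: "z \<in> carrier (stalk K \<xi>)"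
  obtain i d where d: "d \<in> stk i \<xi>" "z = leg i \<xi> d" using z by (rule stalk_K_cases)
  note M = lvl_module[OF d(1)] and dc = stk_carrier[OF d(1)]
  show "Kscal \<one>\<^bsub>R\<^esub> z = z"
    using Kscal_leg[OF d(1) R.one_closed] d(2) left_module.smult_one[OF M dc] by simp
  fix r assume r: "r \<in> carrier R"
  show "Kscal r z \<in> carrier (stalk K \<xi>)"
    using Kscal_leg[OF d(1) r] d(2) leg_stalk[OF scal_stk[OF d(1) r]] by simp
  { fix r' assume r': "r' \<in> carrier R"
    show "Kscal (r \<oplus>\<^bsub>R\<^esub> r') z = Ksum (Kscal r z) (Kscal r' z)"
      using Kscal_leg[OF d(1) r] Kscal_leg[OF d(1) r'] Kscal_leg[OF d(1) R.a_closed[OF r r']]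
        Ksum_leg[OF scal_stk[OF d(1) r] scal_stk[OF d(1) r']] d(2) left_module.smult_l_distr[OF M r r' dc] by simp
    show "Kscal (r \<otimes>\<^bsub>R\<^esub> r') z = Kscal r (Kscal r' z)"
      using Kscal_leg[OF scal_stk[OF d(1) r'] r] Kscal_leg[OF d(1) r'] Kscal_leg[OF d(1) R.m_closed[OF r r']]
        d(2) left_module.smult_assoc1[OF M r r' dc] by simp }
  fix w assume w: "w \<in> carrier (stalk K \<xi>)"
  obtain j e where e: "e \<in> stk j \<xi>" "w = leg j \<xi> e" using w by (rule stalk_K_cases)
  obtain k d' e' where k: "d' \<in> stk k \<xi>" "e' \<in> stk k \<xi>" "z = leg k \<xi> d'" "w = leg k \<xi> e'"
    using common2[OF d(1) e(1)] d(2) e(2) by metis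
  show "Kscal r (Ksum z w) = Ksum (Kscal r z) (Kscal r w)"
    using Ksum_leg[OF k(1,2)] Kscal_leg[OF k(1) r] Kscal_leg[OF k(2) r] Kscal_leg[OF add_stk[OF k(1,2)] r]
      Ksum_leg[OF scal_stk[OF k(1) r] scal_stk[OF k(2) r]] k(3,4)
      left_module.smult_r_distr[OF lvl_module[OF k(1)] r stk_carrier[OF k(1)] stk_carrier[OF k(2)]] by simp
qed

lemma sub_stk:
  assumes d: "d \<in> stk i \<xi>" "e \<in> stk i \<xi>"
  shows "d \<ominus>\<^bsub>stalk (dsh D i) (\<xi> i)\<^esub> e \<in> stk i \<xi>"
proof -
  interpret A: abelian_group "stalk (dsh D i) (\<xi> i)"
    by (rule left_module_abelian_group[OF lvl_module[OF d(1)]])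
  show ?thesis
    using A.minus_closed[OF stk_carrier[OF d(1)] stk_carrier[OF d(2)]] stkD(2,3)[OF d(1)] by (simp add: stk_def)
qed

text \<open>The difference in the stalk of \<open>K\<close> is characterised by adding the
  subtrahend back, and that sum is computed at level \<open>i\<close>.\<close>

lemma leg_sub:
  assumes d: "d \<in> stk i \<xi>" "e \<in> stk i \<xi>"
  shows "leg i \<xi> d \<ominus>\<^bsub>stalk K \<xi>\<^esub> leg i \<xi> e = leg i \<xi> (d \<ominus>\<^bsub>stalk (dsh D i) (\<xi> i)\<^esub> e)"
proof -
  interpret A: abelian_group "stalk (dsh D i) (\<xi> i)"
    by (rule left_module_abelian_group[OF lvl_module[OF d(1)]])
  interpret B: abelian_group "stalk K \<xi>" by (rule K_abelian[OF stkD(3)[OF d(1)]])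
  let ?s = "d \<ominus>\<^bsub>stalk (dsh D i) (\<xi> i)\<^esub> e"
  note c = stk_carrier[OF d(1)] stk_carrier[OF d(2)]
  have "?s \<oplus>\<^bsub>stalk (dsh D i) (\<xi> i)\<^esub> e = d"
    unfolding a_minus_def using c A.a_assoc A.l_neg A.r_zero A.a_inv_closed by metis
  then have "leg i \<xi> ?s \<oplus>\<^bsub>stalk K \<xi>\<^esub> leg i \<xi> e = leg i \<xi> d"
    using Ksum_leg[OF sub_stk[OF d] d(2)] by (simp add: K_simps)
  moreover note l = leg_stalk[OF sub_stk[OF d]] leg_stalk[OF d(2)]
  ultimately have "leg i \<xi> d \<ominus>\<^bsub>stalk K \<xi>\<^esub> leg i \<xi> e =
      leg i \<xi> ?s \<oplus>\<^bsub>stalk K \<xi>\<^esub> leg i \<xi> e \<ominus>\<^bsub>stalk K \<xi>\<^esub> leg i \<xi> e" by simp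
  also have "\<dots> = leg i \<xi> ?s"
    unfolding a_minus_def[of "stalk K \<xi>"]
    using B.a_assoc[OF l B.a_inv_closed[OF l(2)]] B.r_neg[OF l(2)] B.r_zero[OF l(1)] by simp
  finally show ?thesis .
qed

text \<open>Near \<open>(z, w)\<close> both arguments run through basic sections of elements
  \<open>a\<close> and \<open>b\<close> of one level, and their difference is the basic section of
  \<open>s\<close>. The stalk in which \<open>s\<close> is formed does not vary, because membership
  in \<open>Bas k a\<close> fixes the component at \<open>k\<close>.\<close>

lemma K_sub_cont: "continuous_map (subtopology (prod_topology (tot K) (tot K)) {(a, b). prj K a = prj K b}) (tot K)
       (\<lambda>(a, b). a \<ominus>\<^bsub>stalk K (prj K a)\<^esub> b)"
proof (rule continuous_map_local)
  let ?Q = "prod_topology (tot K) (tot K)"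
  let ?P = "subtopology ?Q {(a, b). prj K a = prj K b}"
  fix y assume "y \<in> topspace ?P"
  then obtain z w where y: "y = (z, w)" "z \<in> Kset" "w \<in> Kset" "pt z = pt w" by (auto simp: tspace_K K_simps)
  obtain i d where d: "d \<in> stk i (pt z)" "z = leg i (pt z) d" using y(2) by (rule Kset_cases)
  obtain j e where e: "e \<in> stk j (pt w)" "w = leg j (pt w) e" using y(3) by (rule Kset_cases)
  have e': "e \<in> stk j (pt z)" "w = leg j (pt z) e" using e y(4) by simp_all
  obtain k a b where k: "a \<in> stk k (pt z)" "b \<in> stk k (pt z)" "z = leg k (pt z) a" "w = leg k (pt z) b"
    using common2[OF d(1) e'(1)] d(2) e'(2) by metis
  note ko = stkD(2)[OF k(1)] and ka = stkD(1)[OF k(1)] and kb = stkD(1)[OF k(2)]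
  let ?U = "(Bas k a \<times> Bas k b) \<inter> {(a, b). prj K a = prj K b}"
  have "openin ?Q (Bas k a \<times> Bas k b)"
    using openin_Bas[OF ko ka] openin_Bas[OF ko kb] by (simp add: openin_prod_Times_iff)
  then have U: "openin ?P ?U" by (auto simp: openin_subtopology)
  have tU: "topspace (subtopology ?P ?U) = ?U" using openin_subset[OF U] by auto
  define s where "s = a \<ominus>\<^bsub>stalk (dsh D k) (pt z k)\<^esub> b"
  have s: "s \<in> tspace (dsh D k)" using stkD(1)[OF sub_stk[OF k(1,2)]] by (simp add: s_def)
  have val: "s \<in> stk k (pt u)" "u \<ominus>\<^bsub>stalk K (prj K u)\<^esub> v = leg k (pt u) s" if "(u, v) \<in> ?U" for u v
  proof -
    have "u \<in> Bas k a" "v \<in> Bas k b" "pt u = pt v" using that by (auto simp: K_simps)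
    then have uv: "a \<in> stk k (pt u)" "u = leg k (pt u) a" "b \<in> stk k (pt u)" "v = leg k (pt u) b"
      using BasD by metis+
    have "pt u k = pt z k" using stkD(4)[OF uv(1)] stkD(4)[OF k(1)] by simp
    then show "s \<in> stk k (pt u)" "u \<ominus>\<^bsub>stalk K (prj K u)\<^esub> v = leg k (pt u) s"
      using sub_stk[OF uv(1,3)] leg_sub[OF uv(1,3)] uv(2,4) by (simp_all add: s_def K_simps)
  qed
  have "continuous_map (subtopology ?P ?U) (pts L) (\<lambda>x. pt (fst x))"
    using continuous_map_compose[OF continuous_map_fst pt_cont]
    by (auto simp: o_def intro!: continuous_map_from_subtopology)
  then have "continuous_map (subtopology ?P ?U) (subtopology (pts L) {\<xi>. s \<in> stk k \<xi>}) (\<lambda>x. pt (fst x))"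
    unfolding continuous_map_in_subtopology tU using val(1) by auto
  from continuous_map_compose[OF this leg_cont[OF ko s]]
  have "continuous_map (subtopology ?P ?U) (tot K) (\<lambda>(a, b). a \<ominus>\<^bsub>stalk K (prj K a)\<^esub> b)"
  proof (rule continuous_map_eq)
    fix x assume "x \<in> topspace (subtopology ?P ?U)"
    then obtain u v where x: "x = (u, v)" "(u, v) \<in> ?U" unfolding tU by blast
    show "((\<lambda>\<xi>. leg k \<xi> s) \<circ> (\<lambda>x. pt (fst x))) x = (case x of (a, b) \<Rightarrow> a \<ominus>\<^bsub>stalk K (prj K a)\<^esub> b)"
      using val(2)[OF x(2)] x(1) by simp
  qed
  moreover have "y \<in> ?U"
    using leg_Bas[OF k(1)] leg_Bas[OF k(2)] y(1,4) unfolding k(3,4)[symmetric] by (simp add: K_simps)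
  ultimately show "\<exists>U. openin ?P U \<and> y \<in> U \<and> continuous_map (subtopology ?P U) (tot K) (\<lambda>(a, b). a \<ominus>\<^bsub>stalk K (prj K a)\<^esub> b)"
    using U by blast
qed

lemma K_scal_cont:
  assumes r: "r \<in> carrier R"
  shows "continuous_map (tot K) (tot K) (escal K r)"
proof (rule K_continuousI)
  fix i d assume i: "i \<in> I" "d \<in> tspace (dsh D i)"
  let ?e = "escal (dsh D i) r d"
  have e: "?e \<in> tspace (dsh D i)" "prj (dsh D i) ?e = prj (dsh D i) d" using sheaf_scal[OF ds_sheaf[OF D i(1)] r i(2)] by auto
  then have eq: "{\<xi>. ?e \<in> stk i \<xi>} = {\<xi>. d \<in> stk i \<xi>}" using i by (auto simp: stk_def)
  show "continuous_map (subtopology (pts L) {\<xi>. d \<in> stk i \<xi>}) (tot K) (\<lambda>\<xi>. escal K r (leg i \<xi> d))"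
    using leg_cont[OF i(1) e(1)] unfolding eq
    by (rule continuous_map_eq) (simp add: K_simps Kscal_leg[OF _ r])
qed

lemma pt_Kmov: "\<lbrakk>g \<in> G.lim; z \<in> Kset\<rbrakk> \<Longrightarrow> pt (Kmov g z) = mov L g (pt z)"
  by (erule Kset_cases) (metis Kmov_leg mov_stk pt_leg)

lemma K_linear:
  assumes g: "g \<in> G.lim" and x: "\<xi> \<in> X.lim"
  shows "left_linear R (stalk K \<xi>) (stalk K (mov L g \<xi>)) (emov K g)"
  unfolding left_linear_def
proof (intro conjI ballI funcsetI, unfold stalk_K_simps K_simps(2))
  fix z assume z: "z \<in> carrier (stalk K \<xi>)"
  obtain i d where d: "d \<in> stk i \<xi>" "z = leg i \<xi> d" using z by (rule stalk_K_cases)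
  show "Kmov g z \<in> carrier (stalk K (mov L g \<xi>))"
    using Kmov_leg[OF d(1) g] d(2) leg_stalk[OF mov_stk[OF d(1) g]] by simp
  show "Kmov g (Kscal r z) = Kscal r (Kmov g z)" if r: "r \<in> carrier R" for r
    using Kscal_leg[OF d(1) r] Kmov_leg[OF d(1) g] Kmov_leg[OF scal_stk[OF d(1) r] g] Kscal_leg[OF mov_stk[OF d(1) g] r] d(2)
      sheaf_mov_scal[OF lvl_sheaf[OF d(1)] G_coord[OF g stkD(2)[OF d(1)]] r stkD(1)[OF d(1)]] by simp
  fix w assume w: "w \<in> carrier (stalk K \<xi>)"
  obtain j e where e: "e \<in> stk j \<xi>" "w = leg j \<xi> e" using w by (rule stalk_K_cases)
  obtain k d' e' where k: "d' \<in> stk k \<xi>" "e' \<in> stk k \<xi>" "z = leg k \<xi> d'" "w = leg k \<xi> e'"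
    using common2[OF d(1) e(1)] d(2) e(2) by metis
  have pe: "prj (dsh D k) d' = prj (dsh D k) e'" using stkD(4)[OF k(1)] stkD(4)[OF k(2)] by simp
  show "Kmov g (Ksum z w) = Ksum (Kmov g z) (Kmov g w)"
    using Ksum_leg[OF k(1,2)] Kmov_leg[OF k(1) g] Kmov_leg[OF k(2) g] Kmov_leg[OF add_stk[OF k(1,2)] g]
      Ksum_leg[OF mov_stk[OF k(1) g] mov_stk[OF k(2) g]] k(3,4)
      sheaf_mov_add[OF lvl_sheaf[OF k(1)] G_coord[OF g stkD(2)[OF k(1)]] stkD(1)[OF k(1)] stkD(1)[OF k(2)] pe] by simp
qed

lemma K_sheaf: "is_sheaf R L K"
  unfolding is_sheaf_def continuous_action_def
proof (intro conjI ballI K_action K_mov_cont K_sub_cont)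
  show "local_homeomorphism (tot K) (pts L) (prj K)" using K_local_homeomorphism by (simp add: K_simps)
  show "prj K (emov K g z) = mov L g (prj K z)" if "g \<in> carrier (grp L)" "z \<in> tspace K" for g z
    using pt_Kmov that by (simp add: K_simps tspace_K L_simps)
  show "left_module R (stalk K \<xi>)" if "\<xi> \<in> base L" for \<xi> using K_module that by (simp add: L_simps)
  show "continuous_map (tot K) (tot K) (escal K r)" if "r \<in> carrier R" for r using K_scal_cont that .
  show "left_linear R (stalk K \<xi>) (stalk K (mov L g \<xi>)) (emov K g)" if "g \<in> carrier (grp L)" "\<xi> \<in> base L" for g \<xi>
    using K_linear that by (simp add: L_simps)
qed

section \<open>The colimit cocone and its universal property\<close>

definition legs :: "'o \<Rightarrow> ('o \<Rightarrow> 'x) \<times> 'e \<Rightarrow> 'u" where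
  "legs = (\<lambda>i\<in>I. restrict (\<lambda>(\<xi>, d). leg i \<xi> d) (tspace (pull (p i) (dsh D i))))"

lemma legs_apply: "d \<in> stk i \<xi> \<Longrightarrow> legs i (\<xi>, d) = leg i \<xi> d"
  using stkD[of d i \<xi>] by (simp add: legs_def mem_pull_proj)

lemma legs_cocone: "legs \<in> cocones D K"
  unfolding cocones_iff
proof (intro conjI ballI impI)
  have "legs i \<in> sheaf_hom R L (pull (p i) (dsh D i)) K" if i: "i \<in> I" for i
  proof (rule discrete_change.pull_homI[OF dc_proj[OF i], unfolded lim_proj_simps mem_fibre, OF ds_sheaf[OF D i]])
    show "legs i \<in> extensional (tspace (pull (p i) (dsh D i)))" using i by (simp add: legs_def)
    fix d assume d: "d \<in> tspace (dsh D i)"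
    show "continuous_map (subtopology (pts L) (pre (p i) {prj (dsh D i) d})) (tot K) (\<lambda>x. legs i (x, d))"
      unfolding pre_stk[OF i d] using leg_cont[OF i d] by (rule continuous_map_eq) (simp add: legs_apply)
    fix x
    { assume "x \<in> X.lim \<and> x i = prj (dsh D i) d"
      then have "d \<in> stk i x" using i d by (simp add: stk_def) } note s = this
    show "prj K (legs i (x, d)) = x" if "x \<in> X.lim \<and> x i = prj (dsh D i) d"
      using legs_apply[OF s[OF that]] pt_leg[OF s[OF that]] by (simp add: K_simps)
    show "legs i (mov L g x, emov (dsh D i) (g i) d) = emov K g (legs i (x, d))"
      if g: "g \<in> carrier (grp L)" and x: "x \<in> X.lim \<and> x i = prj (dsh D i) d" for g
    proof -
      have g': "g \<in> G.lim" using g by (simp add: L_simps)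
      show ?thesis
        using legs_apply[OF s[OF x]] legs_apply[OF mov_stk[OF s[OF x] g']] Kmov_leg[OF s[OF x] g'] by (simp add: K_simps)
    qed
    show "legs i (x, escal (dsh D i) r d) = escal K r (legs i (x, d))"
      if r: "r \<in> carrier R" and x: "x \<in> X.lim \<and> x i = prj (dsh D i) d" for r
      using legs_apply[OF s[OF x]] legs_apply[OF scal_stk[OF s[OF x] r]] Kscal_leg[OF s[OF x] r] by (simp add: K_simps)
    show "legs i (x, esum (dsh D i) d d') = esum K (legs i (x, d)) (legs i (x, d'))"
      if d': "d' \<in> tspace (dsh D i)" "prj (dsh D i) d = prj (dsh D i) d'" and x: "x \<in> X.lim \<and> x i = prj (dsh D i) d'" for d'
    proof -
      have s': "d \<in> stk i x" "d' \<in> stk i x" using i d d' x by (auto simp: stk_def)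
      show ?thesis
        using legs_apply[OF s'(1)] legs_apply[OF s'(2)] legs_apply[OF add_stk[OF s']] Ksum_leg[OF s'] by (simp add: K_simps)
    qed
  qed
  then show "legs \<in> (\<Pi>\<^sub>E i\<in>I. sheaf_hom R L (pull (p i) (dsh D i)) K)" by (auto simp: legs_def)
  fix i j f d x assume ij: "i \<in> I" "j \<in> I" "f \<in> Ar i j" and d: "d \<in> tspace (dsh D j)" and x: "x \<in> X.lim" "x j = prj (dsh D j) d"
  have s: "d \<in> stk j x" using ij d x by (simp add: stk_def)
  show "legs i (x, str D i j f (x i, d)) = legs j (x, d)"
    using legs_apply[OF s] legs_apply[OF mv_stk[OF s ij(1,3)]] leg_mv[OF s ij(1,3)] by (simp add: mv_def)
qed

text \<open>A cocone takes equal values on related representatives, so it factors through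
  \<open>leg\<close>. The total space of \<open>E\<close> may lie in a type other than that of
  \<open>K\<close>.\<close>

lemma K_universal:
  fixes E :: "('o \<Rightarrow> 'g, 'o \<Rightarrow> 'x, 'r, 'v) sheaf"
  assumes E: "is_sheaf R L E" and k: "\<kappa> \<in> cocones D E"
  shows "\<exists>!h. h \<in> sheaf_hom R L K E \<and> post D h legs = \<kappa>"
proof -
  have wd: "\<kappa> i (\<xi>, d) = \<kappa> j (\<xi>, e)" if d: "d \<in> stk i \<xi>" "e \<in> stk j \<xi>" and eq: "leg i \<xi> d = leg j \<xi> e" for i j \<xi> d e
  proof -
    obtain l f g where l: "l \<in> I" "f \<in> Ar l i" "g \<in> Ar l j" "mv l i f \<xi> d = mv l j g \<xi> e"
      using leg_relD[OF d eq] .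
    show ?thesis
      using cocone_str[OF k l(1) stkD(2)[OF d(1)] l(2) stkD(1,3)[OF d(1)]] stkD(4)[OF d(1)]
        cocone_str[OF k l(1) stkD(2)[OF d(2)] l(3) stkD(1,3)[OF d(2)]] stkD(4)[OF d(2)] l(4) by (simp add: mv_def)
  qed
  define P where "P z w \<longleftrightarrow> (\<exists>i \<xi> d. d \<in> stk i \<xi> \<and> z = leg i \<xi> d \<and> w = \<kappa> i (\<xi>, d))" for z w
  define h where "h = restrict (\<lambda>z. SOME w. P z w) Kset"
  have h: "h (leg i \<xi> d) = \<kappa> i (\<xi>, d)" if d: "d \<in> stk i \<xi>" for i \<xi> d
  proof -
    have "P (leg i \<xi> d) (\<kappa> i (\<xi>, d))" using d by (auto simp: P_def)
    then have "P (leg i \<xi> d) (SOME w. P (leg i \<xi> d) w)" by (rule someI)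
    then have "P (leg i \<xi> d) (h (leg i \<xi> d))" using leg_Kset[OF d] by (simp add: h_def)
    then obtain j \<xi>' e where j: "e \<in> stk j \<xi>'" "leg i \<xi> d = leg j \<xi>' e" "h (leg i \<xi> d) = \<kappa> j (\<xi>', e)" by (auto simp: P_def)
    have "\<xi>' = \<xi>" using leg_eq_iff[OF d j(1)] j(2) by simp
    then show ?thesis using wd[OF d, of e j] j by simp
  qed
  have pr: "\<xi> \<in> pre (p i) {prj (dsh D i) d}" if "d \<in> stk i \<xi>" for i \<xi> d using stkD[OF that] by (simp add: mem_fibre)
  have "h \<in> sheaf_hom R L K E"
  proof (rule sheaf_homI, unfold tspace_K K_simps)
    show "h \<in> extensional Kset" by (simp add: h_def)
    show "continuous_map (tot K) (tot E) h"
    proof (rule K_continuousI)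
      fix i d assume i: "i \<in> I" "d \<in> tspace (dsh D i)"
      show "continuous_map (subtopology (pts L) {\<xi>. d \<in> stk i \<xi>}) (tot E) (\<lambda>\<xi>. h (leg i \<xi> d))"
        using discrete_change.pull_hom_cont[OF dc_proj[OF i(1)], unfolded lim_proj_simps, OF ds_sheaf[OF D i(1)] cocone_hom[OF k i(1)] i(2)]
        unfolding pre_stk[OF i] by (rule continuous_map_eq) (simp add: h)
    qed
    fix z assume z: "z \<in> Kset"
    obtain i d where d: "d \<in> stk i (pt z)" "z = leg i (pt z) d" using z by (rule Kset_cases)
    note di = dc_proj[OF stkD(2)[OF d(1)]] and sh = lvl_sheaf[OF d(1)] and ck = cocone_hom[OF k stkD(2)[OF d(1)]]
    note d1 = stkD(1)[OF d(1)] and dp = pr[OF d(1)]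
    have hz: "h z = \<kappa> i (pt z, d)" using h[OF d(1)] d(2) by simp
    show "prj E (h z) = pt z"
      unfolding hz using discrete_change.pull_hom_prj[OF di, unfolded lim_proj_simps, OF sh ck d1 dp] .
    show "h (Kmov g z) = emov E g (h z)" if g: "g \<in> carrier (grp L)" for g
    proof -
      have g': "g \<in> G.lim" using g by (simp add: L_simps)
      have "Kmov g z = leg i (mov L g (pt z)) (emov (dsh D i) (g i) d)" using Kmov_leg[OF d(1) g'] d(2) by simp
      then show ?thesis
        using h[OF mov_stk[OF d(1) g']] discrete_change.pull_hom_mov[OF di, unfolded lim_proj_simps, OF sh ck g d1 dp] hz by simp
    qed
    show "h (Kscal r z) = escal E r (h z)" if r: "r \<in> carrier R" for r
    proof -
      have "Kscal r z = leg i (pt z) (escal (dsh D i) r d)" using Kscal_leg[OF d(1) r] d(2) by simp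
      then show ?thesis
        using h[OF scal_stk[OF d(1) r]] discrete_change.pull_hom_scal[OF di, unfolded lim_proj_simps, OF sh ck r d1 dp] hz by simp
    qed
    fix w assume w: "w \<in> Kset" and zw: "pt z = pt w"
    obtain j e where e: "e \<in> stk j (pt w)" "w = leg j (pt w) e" using w by (rule Kset_cases)
    have e': "e \<in> stk j (pt z)" "w = leg j (pt z) e" using e zw by simp_all
    obtain l a b where l: "a \<in> stk l (pt z)" "b \<in> stk l (pt z)" "z = leg l (pt z) a" "w = leg l (pt z) b"
      using common2[OF d(1) e'(1)] d(2) e'(2) by metis
    have pe: "prj (dsh D l) a = prj (dsh D l) b" using stkD(4)[OF l(1)] stkD(4)[OF l(2)] by simp
    have "Ksum z w = leg l (pt z) (esum (dsh D l) a b)" using Ksum_leg[OF l(1,2)] l(3,4) by simp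
    moreover have "h z = \<kappa> l (pt z, a)" "h w = \<kappa> l (pt z, b)" using h[OF l(1)] h[OF l(2)] l(3,4) by simp_all
    ultimately show "h (Ksum z w) = esum E (h z) (h w)"
      using h[OF add_stk[OF l(1,2)]] discrete_change.pull_hom_add[OF dc_proj[OF stkD(2)[OF l(1)]], unfolded lim_proj_simps,
        OF lvl_sheaf[OF l(1)] cocone_hom[OF k stkD(2)[OF l(1)]] stkD(1)[OF l(1)] stkD(1)[OF l(2)] pe pr[OF l(2)]] by simp
  qed
  note hh = this
  have eq: "post D f legs i (\<xi>, d) = f (leg i \<xi> d)" if d: "d \<in> stk i \<xi>" for f :: "'u \<Rightarrow> 'v" and i \<xi> d
    using post_apply[OF stkD(2,1,3)[OF d], of f legs] stkD(4)[OF d] legs_apply[OF d] by simp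
  show ?thesis
  proof (rule ex1I[of _ h], intro conjI hh)
    show "post D h legs = \<kappa>"
      by (rule cocone_eqI[OF post_cocone[OF D legs_cocone hh] k]) (use eq h stkI in simp)
    fix f assume f: "f \<in> sheaf_hom R L K E \<and> post D f legs = \<kappa>"
    show "f = h"
    proof (rule hom_eqI[OF conjunct1[OF f] hh])
      fix z assume "z \<in> tspace K"
      then obtain i d where d: "d \<in> stk i (pt z)" "z = leg i (pt z) d" using Kset_cases tspace_K by metis
      show "f z = h z" using eq[OF d(1), of f] f h[OF d(1)] d(2) by simp
    qed
  qed
qed

end

context system
begin

subsection \<open>Local structure of equivariant sheaves on the limit\<close>

text \<open>The agreement locus is open and contains \<open>x\<close>, hence contains the fibre of
  \<open>x\<close> at some level; passing to a level above this one and above \<open>i\<close>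
  provides the arrow to \<open>i\<close>.\<close>

lemma sections_agree:
  assumes E: "is_sheaf R L E" and i: "i \<in> I"
    and s: "continuous_map (subtopology (pts L) (pre (p i) {y})) (tot E) s"
    and t: "continuous_map (subtopology (pts L) (pre (p i) {y})) (tot E) t"
    and p: "\<And>x. \<lbrakk>x \<in> X.lim; x i = y\<rbrakk> \<Longrightarrow> prj E (s x) = prj E (t x)"
    and x: "x \<in> X.lim" "x i = y" and eq: "s x = t x"
  obtains k f where "k \<in> I" "f \<in> Ar k i" "\<And>x'. \<lbrakk>x' \<in> X.lim; x' k = x k\<rbrakk> \<Longrightarrow> s x' = t x'"
proof -
  let ?T = "subtopology (pts L) (pre (p i) {y})"
  have tT: "topspace ?T = {x \<in> X.lim. x i = y}" by (auto simp: L_simps mem_fibre)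
  have "openin ?T {x \<in> topspace ?T. s x = t x}"
    by (rule openin_equalizer[OF sheaf_lh[OF E] s t]) (unfold tT, use p in blast)
  moreover have "openin (pts L) (pre (p i) {y})"
    using discrete_change.openin_pre[OF dc_proj[OF i], of "{y}"] by simp
  ultimately have "openin (pts L) {x \<in> topspace ?T. s x = t x}" using openin_trans_full by blast
  then have "openin X.limtop {x \<in> topspace ?T. s x = t x}" unfolding L_top .
  moreover have "x \<in> {x \<in> topspace ?T. s x = t x}" unfolding tT using x eq by blast
  ultimately obtain l where l: "l \<in> I" "{x' \<in> X.lim. x' l = x l} \<subseteq> {x \<in> topspace ?T. s x = t x}"
    by (rule X.neighbourhood_fibre)
  obtain k f g where k: "k \<in> I" "f \<in> Ar k i" "g \<in> Ar k l" using cofiltered_two[OF cof i l(1)] .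
  show thesis
  proof (rule that[OF k(1,2)])
    fix x' assume x': "x' \<in> X.lim" "x' k = x k"
    then have "x' l = x l" using X.lim_tr[OF x'(1) k(1) l(1) k(3)] X.lim_tr[OF x(1) k(1) l(1) k(3)] by simp
    then show "s x' = t x'" using l(2) x'(1) by blast
  qed
qed

text \<open>The maps \<open>(g, x) \<mapsto> s (g x)\<close> and \<open>(g, x) \<mapsto> g (s x)\<close> lift the same map to the base, so they
  agree near \<open>(1, x\<^sub>0)\<close>, where a basic neighbourhood is a product of fibres over a single level.\<close>

lemma invariant_section:
  assumes E: "is_sheaf R L E" and e: "e \<in> tspace E"
  obtains i s where "i \<in> I" "inv_on (p i) E {prj E e i} s" "s (prj E e) = e"
proof -
  define x where "x = prj E e"
  have x: "x \<in> X.lim" using sheaf_prj[OF E e] by (simp add: x_def L_simps)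
  obtain U s where U: "openin (pts L) U" "x \<in> U" "continuous_map (subtopology (pts L) U) (tot E) s"
    "\<And>x. x \<in> U \<Longrightarrow> prj E (s x) = x" "s x = e"
    using local_section[OF sheaf_lh[OF E] e] unfolding x_def by metis
  obtain j where j: "j \<in> I" "{x' \<in> X.lim. x' j = x j} \<subseteq> U"
    using U(1,2) unfolding L_top by (rule X.neighbourhood_fibre)
  define N where "N = {x' \<in> X.lim. x' j = x j}"
  \<comment> \<open>Elements trivial at level \<open>j\<close> preserve the fibre \<open>N\<close>,
    on which \<open>s\<close> is defined, so both maps to be compared live on
    \<open>H \<times> N\<close>.\<close>
  define H where "H = {g \<in> G.lim. g j = \<one>\<^bsub>grp L\<^esub> j}"
  let ?P = "prod_topology (gtop L) (pts L)"
  let ?T = "subtopology ?P (H \<times> N)"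
  have oN: "openin (pts L) N" and oH: "openin (gtop L) H"
    using X.openin_fibre[OF j(1)] G.openin_fibre[OF j(1)] unfolding L_top N_def H_def .
  have oHN: "openin ?P (H \<times> N)" using oN oH by (simp add: openin_prod_Times_iff)
  have tT: "topspace ?T = H \<times> N" using openin_subset[OF oHN] by auto
  have sN: "continuous_map (subtopology (pts L) N) (tot E) s"
    using continuous_map_from_subtopology_mono[OF U(3) j(2)] unfolding N_def .
  have stN: "topspace (subtopology (pts L) N) = N" by (auto simp: L_simps N_def)
  have s_closed: "s x' \<in> tspace E" "prj E (s x') = x'" if "x' \<in> N" for x'
    using continuous_map_image_subset_topspace[OF sN] that U(4) j(2)[folded N_def] unfolding stN by blast+
  have mN: "mov L g x' \<in> N" if g: "g \<in> H" and x': "x' \<in> N" for g x'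
    using mov_closed[of g x'] g x' L_coord(2,3)[OF j(1)] group_action_one[OF lvl_act[OF j(1)] X.lim_coord[OF x j(1)]]
    by (simp add: N_def H_def)
  have "continuous_map ?T (pts L) (\<lambda>(g, x). mov L g x)"
    using mov_L_cont by (rule continuous_map_from_subtopology)
  then have "continuous_map ?T (subtopology (pts L) N) (\<lambda>(g, x). mov L g x)"
    unfolding continuous_map_in_subtopology tT using mN by auto
  from continuous_map_compose[OF this sN]
  have c1: "continuous_map ?T (tot E) (\<lambda>(g, x). s (mov L g x))" by (simp add: o_def case_prod_unfold)
  have "continuous_map ?T (pts L) snd"
    by (rule continuous_map_from_subtopology) (rule continuous_map_snd)
  then have "continuous_map ?T (subtopology (pts L) N) snd"
    unfolding continuous_map_in_subtopology tT by auto
  from continuous_map_compose[OF this sN] have "continuous_map ?T (tot E) (\<lambda>y. s (snd y))" by (simp add: o_def)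
  moreover have "continuous_map ?T (gtop L) fst"
    by (rule continuous_map_from_subtopology) (rule continuous_map_fst)
  ultimately have "continuous_map ?T (tot E) (\<lambda>y. emov E (fst y) (s (snd y)))"
    by (rule sheaf_mov_cont[OF E])
  then have c2: "continuous_map ?T (tot E) (\<lambda>(g, x). emov E g (s x))" by (simp add: case_prod_unfold)
  let ?O = "{y \<in> topspace ?T. (case y of (g, x) \<Rightarrow> s (mov L g x)) = (case y of (g, x) \<Rightarrow> emov E g (s x))}"
  have "openin ?T ?O"
  proof (rule openin_equalizer[OF sheaf_lh[OF E] c1 c2])
    fix y assume "y \<in> topspace ?T"
    then obtain g x' where y: "y = (g, x')" "g \<in> H" "x' \<in> N" unfolding tT by blast
    have "g \<in> carrier (grp L)" using y(2) by (simp add: L_simps H_def)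
    then show "prj E (case y of (g, x) \<Rightarrow> s (mov L g x)) = prj E (case y of (g, x) \<Rightarrow> emov E g (s x))"
      using s_closed(2)[OF mN[OF y(2,3)]] sheaf_prj_mov[OF E _ s_closed(1)[OF y(3)]] s_closed(2)[OF y(3)] y(1) by simp
  qed
  then have O: "openin ?P ?O" using openin_trans_full[OF _ oHN] by blast
  have mem: "(\<one>\<^bsub>grp L\<^esub>, x) \<in> ?O"
  proof -
    have "s (mov L \<one>\<^bsub>grp L\<^esub> x) = emov E \<one>\<^bsub>grp L\<^esub> (s x)"
      using group_action_one[OF act_L, of x] group_action_one[OF sheaf_act[OF E], of "s x"] x e U(5) by (simp add: L_simps)
    then show ?thesis unfolding tT using one_closed x by (simp add: N_def H_def)
  qed
  obtain A B where AB: "openin (gtop L) A" "openin (pts L) B" "\<one>\<^bsub>grp L\<^esub> \<in> A" "x \<in> B" "A \<times> B \<subseteq> ?O"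
    using O[unfolded openin_prod_topology_alt, rule_format, OF mem] by (elim exE conjE) (rule that)
  obtain k where k: "k \<in> I" "{g \<in> G.lim. g k = \<one>\<^bsub>grp L\<^esub> k} \<subseteq> A"
    using AB(1,3) unfolding L_top by (rule G.neighbourhood_fibre)
  obtain l where l: "l \<in> I" "{x' \<in> X.lim. x' l = x l} \<subseteq> B"
    using AB(2,4) unfolding L_top by (rule X.neighbourhood_fibre)
  obtain m a b where m: "m \<in> I" "a \<in> Ar m k" "b \<in> Ar m l" using cofiltered_two[OF cof k(1) l(1)] .
  \<comment> \<open>Level \<open>i\<close> lies over \<open>k\<close>, \<open>l\<close> and
    \<open>j\<close>: the kernel at \<open>i\<close> is then inside \<open>A\<close>, and the fibre
    of \<open>x i\<close> is inside both \<open>B\<close> and \<open>N\<close>.\<close>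
  obtain i c d where i: "i \<in> I" "c \<in> Ar i m" "d \<in> Ar i j" using cofiltered_two[OF cof m(1) j(1)] .
  have "inv_on (p i) E {x i} s"
  proof (rule inv_onI, unfold lim_proj_simps mem_fibre)
    have eqd: "x' m = x m \<and> x' j = x j" if x': "x' \<in> X.lim \<and> x' i = x i" for x'
      using x' X.lim_tr[OF _ i(1) m(1) i(2), of x'] X.lim_tr[OF x i(1) m(1) i(2)]
        X.lim_tr[OF _ i(1) j(1) i(3), of x'] X.lim_tr[OF x i(1) j(1) i(3)] by simp
    then have eqB: "x' l = x l \<and> x' \<in> N" if x': "x' \<in> X.lim \<and> x' i = x i" for x'
      unfolding N_def
      using x' eqd[OF x'] X.lim_tr[OF _ m(1) l(1) m(3), of x'] X.lim_tr[OF x m(1) l(1) m(3)] by simp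
    have sub: "pre (p i) {x i} \<subseteq> N" using eqB by (auto simp: mem_fibre)
    show "continuous_map (subtopology (pts L) (pre (p i) {x i})) (tot E) s"
      using continuous_map_from_subtopology_mono[OF sN sub] .
    show "prj E (s x') = x'" if "x' \<in> X.lim \<and> x' i = x i" for x' using s_closed(2) eqB[OF that] by blast
    fix g x' assume g: "g \<in> carrier (grp L)" "g i = \<one>\<^bsub>grp (lvl S i)\<^esub>" and x': "x' \<in> X.lim \<and> x' i = x i"
    have gl: "g \<in> G.lim" using g by (simp add: L_simps)
    have gi: "g i = \<one>\<^bsub>grp L\<^esub> i" using g(2) L_coord(2)[OF i(1)] by simp
    have gm: "g m = \<one>\<^bsub>grp L\<^esub> m"
      using G.lim_tr[OF gl i(1) m(1) i(2)] G.lim_tr[OF one_closed i(1) m(1) i(2)] gi by simp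
    have "g k = \<one>\<^bsub>grp L\<^esub> k"
      using G.lim_tr[OF gl m(1) k(1) m(2)] G.lim_tr[OF one_closed m(1) k(1) m(2)] gm by simp
    then have "g \<in> A" using k(2) gl by blast
    moreover have "x' \<in> B" using l(2) eqB[OF x'] x' by blast
    ultimately have "(g, x') \<in> A \<times> B" by simp
    then have "(g, x') \<in> ?O" by (rule subsetD[OF AB(5)])
    then show "s (mov L g x') = emov E g (s x')" by simp
  qed
  then show thesis using that[OF i(1)] U(5) unfolding x_def by blast
qed

text \<open>The inverses are taken level by level; they respect the structure maps because
  \<open>u\<close> does and each \<open>u i\<close> is injective.\<close>

lemma dsheaf_bijective_iso:
  assumes D: "is_dsheaf R S D" and D': "is_dsheaf R S D'" and u: "u \<in> dsheaf_hom R S D D'"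
    and bij: "\<And>i. i \<in> I \<Longrightarrow> bij_betw (u i) (tspace (dsh D i)) (tspace (dsh D' i))"
  shows "dsheaf_iso R S D D' u"
proof -
  have "\<forall>i\<in>I. \<exists>v. v \<in> sheaf_hom R (lvl S i) (dsh D' i) (dsh D i) \<and>
      compose (tspace (dsh D i)) v (u i) = sheaf_id (dsh D i) \<and> compose (tspace (dsh D' i)) (u i) v = sheaf_id (dsh D' i)"
    using bijective_hom_iso[OF ds_sheaf[OF D] ds_sheaf[OF D'] dsheaf_hom_hom[OF u] bij] unfolding sheaf_iso_def by blast
  from bchoice[OF this] obtain w where w: "\<forall>i\<in>I. w i \<in> sheaf_hom R (lvl S i) (dsh D' i) (dsh D i) \<and>
      compose (tspace (dsh D i)) (w i) (u i) = sheaf_id (dsh D i) \<and> compose (tspace (dsh D' i)) (u i) (w i) = sheaf_id (dsh D' i)" ..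
  define v where "v = restrict w I"
  have v: "v i \<in> sheaf_hom R (lvl S i) (dsh D' i) (dsh D i)"
    "compose (tspace (dsh D i)) (v i) (u i) = sheaf_id (dsh D i)" "compose (tspace (dsh D' i)) (u i) (v i) = sheaf_id (dsh D' i)"
    if "i \<in> I" for i using w that by (simp_all add: v_def)
  have uv: "u i (v i d) = d" if "i \<in> I" "d \<in> tspace (dsh D' i)" for i d
    using fun_cong[OF v(3)[OF that(1)], of d] that by (simp add: compose_def sheaf_id_def)
  have inj: "a = b" if "i \<in> I" "a \<in> tspace (dsh D i)" "b \<in> tspace (dsh D i)" "u i a = u i b" for i a b
    using bij[OF that(1)] that(2-4) by (auto simp: bij_betw_def dest: inj_onD)
  have "v \<in> dsheaf_hom R S D' D"
    unfolding dsheaf_hom_iff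
  proof (intro conjI ballI impI)
    show "v \<in> (\<Pi>\<^sub>E i\<in>I. sheaf_hom R (lvl S i) (dsh D' i) (dsh D i))" using w by (simp add: v_def)
    fix i j f d x assume ij: "i \<in> I" "j \<in> I" "f \<in> Ar i j" and d: "d \<in> tspace (dsh D' j)"
      and x: "x \<in> base (lvl S i)" "trX S i j f x = prj (dsh D' j) d"
    note sd = ds_str_closed[OF D' ij d x]
    note vd = hom_closed[OF v(1)[OF ij(2)] d] hom_prj[OF v(1)[OF ij(2)] d]
    have x': "trX S i j f x = prj (dsh D j) (v j d)" using x(2) vd(2) by simp
    note svd = ds_str_closed[OF D ij vd(1) x(1) x']
    show "v i (str D' i j f (x, d)) = str D i j f (x, v j d)"
    proof (rule inj[OF ij(1) hom_closed[OF v(1)[OF ij(1)] sd(1)] svd(1)])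
      show "u i (v i (str D' i j f (x, d))) = u i (str D i j f (x, v j d))"
        using uv[OF ij(1) sd(1)] uv[OF ij(2) d] dsheaf_hom_str[OF u ij vd(1) x(1) x'] by simp
    qed
  qed
  moreover have "dsheaf_comp S D v u = dsheaf_id S D" "dsheaf_comp S D' u v = dsheaf_id S D'"
    unfolding dsheaf_comp_def dsheaf_id_def using v(2,3) by (auto intro: restrict_ext)
  ultimately show ?thesis unfolding dsheaf_iso_def using u by blast
qed

subsection \<open>The unit and the counit\<close>

text \<open>Two properties of a filtered colimit that drive the bijectivity arguments: every element
  comes from some level, and elements of one level that become equal in the colimit do so at a level
  above it. The construction of \<open>K\<close> stays hidden behind them.\<close>

definition is_ccolim :: "('o, 'm, 'g, 'x, 'r, 'd) dsheaf \<Rightarrow> ('o \<Rightarrow> 'g, 'o \<Rightarrow> 'x, 'r, 'e) sheaf \<Rightarrow>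
    ('o \<Rightarrow> ('o \<Rightarrow> 'x) \<times> 'd \<Rightarrow> 'e) \<Rightarrow> bool" where
  "is_ccolim D K \<iota> \<longleftrightarrow> is_sheaf R L K \<and> \<iota> \<in> cocones D K \<and>
     (\<forall>z\<in>tspace K. \<exists>i\<in>I. \<exists>d\<in>tspace (dsh D i). prj (dsh D i) d = prj K z i \<and> z = \<iota> i (prj K z, d)) \<and>
     (\<forall>i\<in>I. \<forall>d\<in>tspace (dsh D i). \<forall>e\<in>tspace (dsh D i). \<forall>x\<in>X.lim.
        prj (dsh D i) d = x i \<and> prj (dsh D i) e = x i \<and> \<iota> i (x, d) = \<iota> i (x, e) \<longrightarrow>
        (\<exists>k\<in>I. \<exists>f\<in>Ar k i. str D k i f (x k, d) = str D k i f (x k, e)))"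

context
  fixes D :: "('o, 'm, 'g, 'x, 'r, 'd) dsheaf" and K :: "('o \<Rightarrow> 'g, 'o \<Rightarrow> 'x, 'r, 'e) sheaf" and \<iota>
  assumes D: "is_dsheaf R S D" and c: "is_ccolim D K \<iota>"
begin

lemma cc_sheaf: "is_sheaf R L K" and cc_cocone: "\<iota> \<in> cocones D K"
  using c by (simp_all add: is_ccolim_def)

lemma cc_surj:
  assumes "z \<in> tspace K"
  obtains i d where "i \<in> I" "d \<in> tspace (dsh D i)" "prj (dsh D i) d = prj K z i" "z = \<iota> i (prj K z, d)"
  using c assms unfolding is_ccolim_def by blast

lemma cc_eqD:
  assumes "i \<in> I" "d \<in> tspace (dsh D i)" "e \<in> tspace (dsh D i)" "x \<in> X.lim"
    "prj (dsh D i) d = x i" "prj (dsh D i) e = x i" "\<iota> i (x, d) = \<iota> i (x, e)"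
  obtains k f where "k \<in> I" "f \<in> Ar k i" "str D k i f (x k, d) = str D k i f (x k, e)"
  using c assms unfolding is_ccolim_def by blast

lemma cc_cont:
  assumes "i \<in> I" "d \<in> tspace (dsh D i)"
  shows "continuous_map (subtopology (pts L) (pre (p i) {prj (dsh D i) d})) (tot K) (\<lambda>x. \<iota> i (x, d))"
  using discrete_change.pull_hom_cont[OF dc_proj[OF assms(1)], unfolded lim_proj_simps,
    OF ds_sheaf[OF D assms(1)] cocone_hom[OF cc_cocone assms(1)] assms(2)] .

lemma cc_prj:
  assumes "i \<in> I" "d \<in> tspace (dsh D i)" "x \<in> X.lim" "x i = prj (dsh D i) d"
  shows "\<iota> i (x, d) \<in> tspace K" "prj K (\<iota> i (x, d)) = x"
  using hom_closed[OF cocone_hom[OF cc_cocone assms(1)], of "(x, d)"]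
    hom_prj[OF cocone_hom[OF cc_cocone assms(1)], of "(x, d)"] assms by (simp_all add: mem_pull_proj)

end

text \<open>Injectivity: two sections with the same value at \<open>x\<close> agree on a smaller
  fibre, so the structure map to that level already identifies them. Surjectivity is
  \<open>invariant_section\<close>, whose section is represented at its level because
  \<open>P\<close> models the direct images.\<close>

lemma counit_bij:
  assumes P: "pmodel E P \<kappa>" and c: "is_ccolim P K \<iota>" and E: "is_sheaf R L E"
    and h: "h \<in> sheaf_hom R L K E" and eq: "post P h \<iota> = \<kappa>"
  shows "bij_betw h (tspace K) (tspace E)"
proof -
  have ds: "is_dsheaf R S P" and \<kappa>: "\<kappa> \<in> cocones P E"
    and sm: "\<And>i. i \<in> I \<Longrightarrow> section_model (p i) R E (dsh P i) (\<lambda>z x. \<kappa> i (x, z))"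
    using P by (auto simp: pmodel_def)
  have hi: "h (\<iota> i (x, d)) = \<kappa> i (x, d)" if "i \<in> I" "d \<in> tspace (dsh P i)" "x \<in> X.lim" "x i = prj (dsh P i) d" for i x d
    using post_apply[OF that, of h \<iota>] eq by simp
  have inj: "\<iota> i (x, a) = \<iota> i (x, b)"
    if i: "i \<in> I" and a: "a \<in> tspace (dsh P i)" "b \<in> tspace (dsh P i)" and x: "x \<in> X.lim"
      and p: "prj (dsh P i) a = x i" "prj (dsh P i) b = x i" and e: "\<kappa> i (x, a) = \<kappa> i (x, b)" for i x a b
  proof -
    have ca: "continuous_map (subtopology (pts L) (pre (p i) {x i})) (tot E) (\<lambda>x. \<kappa> i (x, a))"
      and cb: "continuous_map (subtopology (pts L) (pre (p i) {x i})) (tot E) (\<lambda>x. \<kappa> i (x, b))"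
      using inv_on_cont[OF section_model.ev_inv_on[OF sm[OF i] a(1)]] inv_on_cont[OF section_model.ev_inv_on[OF sm[OF i] a(2)]]
      unfolding p by simp_all
    have pe: "prj E (\<kappa> i (x', a)) = prj E (\<kappa> i (x', b))" if "x' \<in> X.lim" "x' i = x i" for x'
      using sm_carrier[OF i sm[OF i] a(1), of x'] sm_carrier[OF i sm[OF i] a(2), of x'] p that by simp
    obtain k f where k: "k \<in> I" "f \<in> Ar k i"
      and ag: "\<And>x'. \<lbrakk>x' \<in> X.lim; x' k = x k\<rbrakk> \<Longrightarrow> \<kappa> i (x', a) = \<kappa> i (x', b)"
      using sections_agree[OF E i ca cb pe x refl e] by blast
    note sa = lim_str_closed[OF ds k(1) i k(2) a(1) x p(1)[symmetric]]
    note sb = lim_str_closed[OF ds k(1) i k(2) a(2) x p(2)[symmetric]]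
    \<comment> \<open>Both elements represent restrictions to the fibre of \<open>x k\<close>, where
      the sections agree.\<close>
    have "str P k i f (x k, a) = str P k i f (x k, b)"
    proof (rule sm_eqI[OF k(1) sm[OF k(1)] sa(1) sb(1)])
      show "prj (dsh P k) (str P k i f (x k, a)) = prj (dsh P k) (str P k i f (x k, b))" using sa sb by simp
      fix x' assume "x' \<in> X.lim \<and> x' k = prj (dsh P k) (str P k i f (x k, b))"
      then have x': "x' \<in> X.lim" "x' k = x k" using sb by auto
      have "x' i = x i" using X.lim_tr[OF x'(1) k(1) i k(2)] X.lim_tr[OF x k(1) i k(2)] x'(2) by simp
      then show "\<kappa> k (x', str P k i f (x k, a)) = \<kappa> k (x', str P k i f (x k, b))"
        using cocone_str[OF \<kappa> k(1) i k(2) a(1) x'(1)] cocone_str[OF \<kappa> k(1) i k(2) a(2) x'(1)] p ag[OF x'] x'(2) by simp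
    qed
    then show ?thesis
      using cocone_str[OF cc_cocone[OF ds c] k(1) i k(2) a(1) x] cocone_str[OF cc_cocone[OF ds c] k(1) i k(2) a(2) x] p by simp
  qed
  have "z = w" if z: "z \<in> tspace K" and w: "w \<in> tspace K" and hzw: "h z = h w" for z w
  proof -
    define x where "x = prj K z"
    have xw: "prj K w = x" using hom_prj[OF h z] hom_prj[OF h w] hzw by (simp add: x_def)
    have x: "x \<in> X.lim" using sheaf_prj[OF cc_sheaf[OF ds c] z] by (simp add: x_def L_simps)
    obtain i a where a: "i \<in> I" "a \<in> tspace (dsh P i)" "prj (dsh P i) a = x i" "z = \<iota> i (x, a)"
      using cc_surj[OF ds c z] unfolding x_def .
    obtain j b where b: "j \<in> I" "b \<in> tspace (dsh P j)" "prj (dsh P j) b = x j" "w = \<iota> j (x, b)"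
      using cc_surj[OF ds c w] unfolding xw .
    obtain k f g where k: "k \<in> I" "f \<in> Ar k i" "g \<in> Ar k j" using cofiltered_two[OF cof a(1) b(1)] .
    note sa = lim_str_closed[OF ds k(1) a(1) k(2) a(2) x a(3)[symmetric]]
    note sb = lim_str_closed[OF ds k(1) b(1) k(3) b(2) x b(3)[symmetric]]
    have za: "z = \<iota> k (x, str P k i f (x k, a))"
      using cocone_str[OF cc_cocone[OF ds c] k(1) a(1) k(2) a(2) x a(3)[symmetric]] a(4) by simp
    have wb: "w = \<iota> k (x, str P k j g (x k, b))"
      using cocone_str[OF cc_cocone[OF ds c] k(1) b(1) k(3) b(2) x b(3)[symmetric]] b(4) by simp
    have "\<kappa> k (x, str P k i f (x k, a)) = \<kappa> k (x, str P k j g (x k, b))"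
      using hi[OF k(1) sa(1) x sa(2)[symmetric]] hi[OF k(1) sb(1) x sb(2)[symmetric]] hzw unfolding za[symmetric] wb[symmetric] by simp
    then show "z = w" unfolding za wb by (rule inj[OF k(1) sa(1) sb(1) x sa(2) sb(2)])
  qed
  moreover have "e \<in> h ` tspace K" if e: "e \<in> tspace E" for e
  proof -
    obtain i s where i: "i \<in> I" "inv_on (p i) E {prj E e i} s" "s (prj E e) = e" using invariant_section[OF E e] .
    have x: "prj E e \<in> X.lim" using sheaf_prj[OF E e] by (simp add: L_simps)
    obtain z where z: "z \<in> tspace (dsh P i)" "prj (dsh P i) z = prj E e i" "\<forall>x. x \<in> X.lim \<and> x i = prj E e i \<longrightarrow> \<kappa> i (x, z) = s x"
      using sm_surj[OF i(1) sm[OF i(1)] X.lim_coord[OF x i(1)] i(2)] by blast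
    have "h (\<iota> i (prj E e, z)) = e" using hi[OF i(1) z(1) x z(2)[symmetric]] z(3) x i(3) by simp
    then show ?thesis using cc_prj(1)[OF ds c i(1) z(1) x z(2)[symmetric]] by (metis image_eqI)
  qed
  ultimately show ?thesis
    unfolding bij_betw_def using hom_closed[OF h] by (auto intro: inj_onI)
qed

section \<open>Adjoint structure maps of direct images\<close>

lemma adjoint_right_trans:
  assumes D: "is_dsheaf R S D" and ij: "i \<in> I" "j \<in> I" "f \<in> Ar i j"
  shows "adjoint_right (tn i j f) (dsh D j) (dsh D i) (str D i j f) \<in>
      sheaf_hom R (lvl S j) (dsh D j) (push (tn i j f) (dsh D i))"
    "\<And>d x. \<lbrakk>d \<in> tspace (dsh D j); x \<in> base (lvl S i); trX S i j f x = prj (dsh D j) d\<rbrakk> \<Longrightarrow>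
      germ_val (adjoint_right (tn i j f) (dsh D j) (dsh D i) (str D i j f) d) x = str D i j f (x, d)"
  using discrete_change.adjoint_right[OF dc_trans[OF ij], unfolded transition_simps, OF ds_sheaf[OF D ij(1)] ring
      ds_sheaf[OF D ij(2)] ds_str[OF D ij]] by (simp_all add: mem_pre)

lemma push_model_trans:
  assumes D: "is_dsheaf R S D" and ij: "i \<in> I" "j \<in> I" "f \<in> Ar i j"
  shows "section_model (tn i j f) R (dsh D i) (push (tn i j f) (dsh D i)) germ_val"
  using discrete_change.push_model[OF dc_trans[OF ij], unfolded transition_simps, OF ds_sheaf[OF D ij(1)] ring] .

text \<open>This is the equality \<open>(p_j)_* E = (\<phi>_ij)_* (p_i)_* E\<close> in terms of
  models: an invariant family of sections over the fibres of \<open>X \<rightarrow> X_i\<close>,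
  indexed by the points of \<open>X_i\<close> over \<open>y\<close>, is one invariant section over
  the fibre of \<open>X \<rightarrow> X_j\<close> at \<open>y\<close>.\<close>

lemma pmodel_adjoint_isos:
  assumes P: "pmodel E P \<kappa>"
  shows "adjoint_structure_isos R S P"
  unfolding adjoint_structure_isos_def
proof (intro ballI)
  fix i j f assume ij: "i \<in> I" "j \<in> I" "f \<in> Ar i j"
  have ds: "is_dsheaf R S P" and \<kappa>: "\<kappa> \<in> cocones P E"
    and sm: "\<And>i. i \<in> I \<Longrightarrow> section_model (p i) R E (dsh P i) (\<lambda>z x. \<kappa> i (x, z))"
    using P by (auto simp: pmodel_def)
  let ?F = "push (tn i j f) (dsh P i)"
  let ?a = "adjoint_right (tn i j f) (dsh P j) (dsh P i) (str P i j f)"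
  note ah = adjoint_right_trans(1)[OF ds ij] and av = adjoint_right_trans(2)[OF ds ij]
  note pm = push_model_trans[OF ds ij]
  note pm_eqI = section_model.ev_eqI[OF pm]
  have Fs: "is_sheaf R (lvl S j) ?F" using section_model.is_sheaf[OF pm] by simp
  have "d = d'" if d: "d \<in> tspace (dsh P j)" "d' \<in> tspace (dsh P j)" and eq: "?a d = ?a d'" for d d'
  proof (rule sm_eqI[OF ij(2) sm[OF ij(2)] d])
    show pe: "prj (dsh P j) d = prj (dsh P j) d'" using hom_prj[OF ah d(1)] hom_prj[OF ah d(2)] eq by simp
    fix x assume "x \<in> X.lim \<and> x j = prj (dsh P j) d'"
    then have x: "x \<in> X.lim" "x j = prj (dsh P j) d'" by auto
    have xi: "x i \<in> base (lvl S i)" "trX S i j f (x i) = prj (dsh P j) d'"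
      using X.lim_coord[OF x(1) ij(1)] X.lim_tr[OF x(1) ij] x(2) by simp_all
    have "str P i j f (x i, d) = str P i j f (x i, d')"
      using av[OF d(1) xi(1)] av[OF d(2) xi] xi(2) pe eq by simp
    then show "\<kappa> j (x, d) = \<kappa> j (x, d')"
      using cocone_str[OF \<kappa> ij d(1) x(1)] cocone_str[OF \<kappa> ij d(2) x] x(2) pe by simp
  qed
  moreover have "w \<in> ?a ` tspace (dsh P j)" if w: "w \<in> tspace ?F" for w
  proof -
    define y where "y = prj ?F w"
    define t where "t = germ_val w"
    have y: "y \<in> base (lvl S j)" using sheaf_prj[OF Fs w] by (simp add: y_def)
    have t: "inv_on (tn i j f) (dsh P i) {y} t" using section_model.ev_inv_on[OF pm w] by (simp add: y_def t_def)
    have t_closed: "t x \<in> tspace (dsh P i)" "prj (dsh P i) (t x) = x" if "x \<in> base (lvl S i)" "trX S i j f x = y" for x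
      using inv_on_closed[OF t, of x] inv_on_prj[OF t, of x] that by (simp_all add: mem_pre)
    have over: "x i \<in> base (lvl S i)" "trX S i j f (x i) = y" if "x \<in> X.lim" "x j = y" for x
      using X.lim_coord[OF that(1) ij(1)] X.lim_tr[OF that(1) ij] that(2) by simp_all
    \<comment> \<open>The glued section: over each point of level \<open>i\<close> it is the section
      represented by the value of \<open>t\<close> there.\<close>
    define s where "s x = \<kappa> i (x, t (x i))" for x
    have "inv_on (p j) E {y} s"
    proof (rule inv_onI, unfold lim_proj_simps mem_fibre)
      let ?T = "subtopology (pts L) (pre (p j) {y})"
      have tT: "topspace ?T = {x \<in> X.lim. x j = y}" by (auto simp: L_simps mem_fibre)
      show "continuous_map ?T (tot E) s"
      proof (rule continuous_map_local)
        fix x assume "x \<in> topspace ?T"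
        then have x: "x \<in> X.lim" "x j = y" unfolding tT by auto
        note tx = t_closed[OF over[OF x]]
        have sub: "pre (p i) {x i} \<subseteq> pre (p j) {y}"
        proof
          fix x' assume "x' \<in> pre (p i) {x i}"
          then have "x' \<in> X.lim" "x' i = x i" by (simp_all add: mem_fibre)
          then show "x' \<in> pre (p j) {y}" using X.lim_tr[OF _ ij, of x'] X.lim_tr[OF x(1) ij] x(2) by (simp add: mem_fibre)
        qed
        have "openin (pts L) (pre (p i) {x i})" using discrete_change.openin_pre[OF dc_proj[OF ij(1)], of "{x i}"] by simp
        then have o: "openin ?T (pre (p i) {x i})" using sub by (auto simp: openin_subtopology)
        \<comment> \<open>On the open fibre of \<open>x i\<close> the element
          \<open>t (x' i)\<close> is constant, so continuity of \<open>s\<close> reduces to that of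
          one represented section.\<close>
        have "continuous_map (subtopology (pts L) (pre (p i) {x i})) (tot E) (\<lambda>x'. \<kappa> i (x', t (x i)))"
          using inv_on_cont[OF section_model.ev_inv_on[OF sm[OF ij(1)] tx(1)]] unfolding tx(2) by simp
        then have "continuous_map (subtopology (pts L) (pre (p i) {x i})) (tot E) s"
          by (rule continuous_map_eq) (auto simp: s_def mem_fibre)
        moreover have "subtopology ?T (pre (p i) {x i}) = subtopology (pts L) (pre (p i) {x i})"
          using sub by (simp add: subtopology_subtopology Int_absorb1)
        ultimately have "continuous_map (subtopology ?T (pre (p i) {x i})) (tot E) s" by simp
        moreover have "x \<in> pre (p i) {x i}" using x by (simp add: mem_fibre)
        ultimately show "\<exists>U. openin ?T U \<and> x \<in> U \<and> continuous_map (subtopology ?T U) (tot E) s"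
          using o by blast
      qed
      fix x assume "x \<in> X.lim \<and> x j = y"
      then have x: "x \<in> X.lim" "x j = y" by auto
      note tx = t_closed[OF over[OF x]]
      show "prj E (s x) = x"
        using sm_carrier[OF ij(1) sm[OF ij(1)] tx(1), of x] tx(2) x(1) by (simp add: s_def)
      fix g assume g: "g \<in> carrier (grp L)" "g j = \<one>\<^bsub>grp (lvl S j)\<^esub>"
      have g': "g \<in> G.lim" using g by (simp add: L_simps)
      \<comment> \<open>As \<open>g\<close> is trivial at \<open>j\<close>, its component
        \<open>g i\<close> lies in the kernel of the transition, under which \<open>t\<close> is
        invariant.\<close>
      have "t (mov (lvl S i) (g i) (x i)) = emov (dsh P i) (g i) (t (x i))"
        using inv_on_mov[OF t, of "g i" "x i"] G_coord[OF g' ij(1)] G.lim_tr[OF g' ij] g(2) over[OF x] by (simp add: mem_pre)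
      then show "s (mov L g x) = emov E g (s x)"
        using sm_emov[OF ij(1) sm[OF ij(1)] g' tx(1)] tx(2) x(1) L_coord(3)[OF ij(1) x(1)] by (simp add: s_def)
    qed
    then obtain z where z: "z \<in> tspace (dsh P j)" "prj (dsh P j) z = y" "\<forall>x. x \<in> X.lim \<and> x j = y \<longrightarrow> \<kappa> j (x, z) = s x"
      using sm_surj[OF ij(2) sm[OF ij(2)] y] by blast
    have "?a z = w"
    proof (rule pm_eqI[OF hom_closed[OF ah z(1)] w])
      show "prj ?F (?a z) = prj ?F w" using hom_prj[OF ah z(1)] z(2) by (simp add: y_def)
      fix x assume "x \<in> pre (tn i j f) {prj ?F w}"
      then have x: "x \<in> base (lvl S i)" "trX S i j f x = y" by (simp_all add: mem_pre y_def)
      have xz: "trX S i j f x = prj (dsh P j) z" using x(2) z(2) by simp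
      note sz = ds_str_closed[OF ds ij z(1) x(1) xz]
      have "str P i j f (x, z) = t x"
      proof (rule sm_eqI[OF ij(1) sm[OF ij(1)] sz(1) t_closed(1)[OF x]])
        show "prj (dsh P i) (str P i j f (x, z)) = prj (dsh P i) (t x)" using sz(2) t_closed(2)[OF x] by simp
        fix \<xi> assume "\<xi> \<in> X.lim \<and> \<xi> i = prj (dsh P i) (t x)"
        then have \<xi>: "\<xi> \<in> X.lim" "\<xi> i = x" using t_closed(2)[OF x] by auto
        have \<xi>j: "\<xi> j = y" using X.lim_tr[OF \<xi>(1) ij] \<xi>(2) x(2) by simp
        show "\<kappa> i (\<xi>, str P i j f (x, z)) = \<kappa> i (\<xi>, t x)"
          using cocone_str[OF \<kappa> ij z(1) \<xi>(1)] \<xi>j z(2,3) \<xi> by (simp add: s_def)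
      qed
      then show "germ_val (?a z) x = germ_val w x" using av[OF z(1) x(1) xz] by (simp add: t_def)
    qed
    then show ?thesis using z(1) by blast
  qed
  ultimately have "bij_betw ?a (tspace (dsh P j)) (tspace ?F)"
    unfolding bij_betw_def using hom_closed[OF ah] by (auto intro: inj_onI)
  then show "sheaf_iso R (lvl S j) (dsh P j) ?F ?a"
    by (rule bijective_hom_iso[OF ds_sheaf[OF ds ij(2)] Fs ah])
qed

section \<open>The unit on systems whose adjoint structure maps are isomorphisms\<close>

context
  fixes D :: "('o, 'm, 'g, 'x, 'r, 'd) dsheaf" and K :: "('o \<Rightarrow> 'g, 'o \<Rightarrow> 'x, 'r, 'e) sheaf" and \<iota>
  assumes D: "is_dsheaf R S D" and c: "is_ccolim D K \<iota>" and adj: "adjoint_structure_isos R S D"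
begin

private lemma adj_bij:
  assumes ij: "i \<in> I" "j \<in> I" "f \<in> Ar i j"
  shows "bij_betw (adjoint_right (tn i j f) (dsh D j) (dsh D i) (str D i j f)) (tspace (dsh D j))
    (tspace (push (tn i j f) (dsh D i)))"
  using adj ij unfolding adjoint_structure_isos_def by (blast intro: sheaf_iso_bij)

text \<open>Each limit point over \<open>y\<close> sees \<open>d\<close> and \<open>d'\<close>
  identified at a level of its own; \<open>uniform_level\<close> gives one level \<open>i\<close> at
  which this holds on the whole fibre over \<open>y\<close>. There the adjoint structure map takes
  \<open>d\<close> and \<open>d'\<close> to germs with the same values, and it is injective by
  assumption.\<close>

lemma leg_injective:
  assumes j: "j \<in> I" and d: "d \<in> tspace (dsh D j)" "d' \<in> tspace (dsh D j)" "prj (dsh D j) d = y" "prj (dsh D j) d' = y"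
    and eq: "\<And>x. \<lbrakk>x \<in> X.lim; x j = y\<rbrakk> \<Longrightarrow> \<iota> j (x, d) = \<iota> j (x, d')"
  shows "d = d'"
proof -
  obtain i f where i: "i \<in> I" "f \<in> Ar i j"
    and e: "\<And>x. \<lbrakk>x \<in> base (lvl S i); trX S i j f x = y\<rbrakk> \<Longrightarrow> str D i j f (x, d) = str D i j f (x, d')"
  proof (rule X.uniform_level[OF j, of y "\<lambda>i f x. str D i j f (x, d) = str D i j f (x, d')"])
    fix x assume x: "x \<in> X.lim" "x j = y"
    obtain k f where "k \<in> I" "f \<in> Ar k j" "str D k j f (x k, d) = str D k j f (x k, d')"
      using cc_eqD[OF D c j d(1,2) x(1) _ _ eq[OF x]] d x by auto
    then show "\<exists>i\<in>I. \<exists>f\<in>Ar i j. str D i j f (x i, d) = str D i j f (x i, d')" by blast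
  next
    fix i f k g x
    assume *: "i \<in> I" "k \<in> I" "f \<in> Ar i j" "g \<in> Ar k i" "x \<in> base (lvl S k)" "trX S i j f (trX S k i g x) = y"
      "str D i j f (trX S k i g x, d) = str D i j f (trX S k i g x, d')"
    show "str D k j (Cmp (idx S) k i j f g) (x, d) = str D k j (Cmp (idx S) k i j f g) (x, d')"
      using ds_comp[OF D *(2,1) j *(4,3) d(1) *(5)] ds_comp[OF D *(2,1) j *(4,3) d(2) *(5)] *(6,7) d by simp
  qed blast
  note ij = i(1) j i(2)
  note ah = adjoint_right_trans(1)[OF D ij] and av = adjoint_right_trans(2)[OF D ij]
  have "adjoint_right (tn i j f) (dsh D j) (dsh D i) (str D i j f) d = adjoint_right (tn i j f) (dsh D j) (dsh D i) (str D i j f) d'"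
  proof (rule section_model.ev_eqI[OF push_model_trans[OF D ij] hom_closed[OF ah d(1)] hom_closed[OF ah d(2)]])
    show "prj (push (tn i j f) (dsh D i)) (adjoint_right (tn i j f) (dsh D j) (dsh D i) (str D i j f) d) =
      prj (push (tn i j f) (dsh D i)) (adjoint_right (tn i j f) (dsh D j) (dsh D i) (str D i j f) d')"
      using hom_prj[OF ah d(1)] hom_prj[OF ah d(2)] d by simp
    fix x assume "x \<in> pre (tn i j f) {prj (push (tn i j f) (dsh D i)) (adjoint_right (tn i j f) (dsh D j) (dsh D i) (str D i j f) d')}"
    then have x: "x \<in> base (lvl S i)" "trX S i j f x = y" using hom_prj[OF ah d(2)] d(4) by (simp_all add: mem_pre)
    show "germ_val (adjoint_right (tn i j f) (dsh D j) (dsh D i) (str D i j f) d) x =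
        germ_val (adjoint_right (tn i j f) (dsh D j) (dsh D i) (str D i j f) d') x"
      using av[OF d(1) x(1)] av[OF d(2) x(1)] x(2) d e[OF x] by simp
  qed
  then show ?thesis using adj_bij[OF ij] d(1,2) by (auto simp: bij_betw_def dest: inj_onD)
qed

text \<open>By compactness the local representatives of an invariant section of the colimit come from a
  single level \<open>i\<close>; there they form an invariant section, which the isomorphism descends to \<open>D j\<close>.\<close>

lemma leg_surjective:
  assumes j: "j \<in> I" and y: "y \<in> base (lvl S j)" and s: "inv_on (p j) K {y} s"
  obtains d where "d \<in> tspace (dsh D j)" "prj (dsh D j) d = y" "\<And>x. \<lbrakk>x \<in> X.lim; x j = y\<rbrakk> \<Longrightarrow> \<iota> j (x, d) = s x"
proof -
  note \<iota> = cc_cocone[OF D c]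
  let ?P = "\<lambda>i f x. \<exists>d. d \<in> tspace (dsh D i) \<and> prj (dsh D i) d = x \<and> (\<forall>\<xi>\<in>X.lim. \<xi> i = x \<longrightarrow> s \<xi> = \<iota> i (\<xi>, d))"
  obtain i f where i: "i \<in> I" "f \<in> Ar i j"
    and e: "\<And>x. \<lbrakk>x \<in> base (lvl S i); trX S i j f x = y\<rbrakk> \<Longrightarrow> ?P i f x"
  proof (rule X.uniform_level[OF j, of y ?P])
    fix x assume x: "x \<in> X.lim" "x j = y"
    then have xp: "x \<in> pre (p j) {y}" by (simp add: mem_fibre)
    note sx = inv_on_closed[OF s xp] and ps = inv_on_prj[OF s xp]
    obtain i0 d0 where d0: "i0 \<in> I" "d0 \<in> tspace (dsh D i0)" "prj (dsh D i0) d0 = x i0" "s x = \<iota> i0 (x, d0)"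
      using cc_surj[OF D c sx] unfolding ps .
    \<comment> \<open>The level at which \<open>s x\<close> is represented may have no arrow to
      \<open>j\<close>, so it is refined to one that has.\<close>
    obtain i1 g h where i1: "i1 \<in> I" "g \<in> Ar i1 i0" "h \<in> Ar i1 j" using cofiltered_two[OF cof d0(1) j] .
    define d1 where "d1 = str D i1 i0 g (x i1, d0)"
    have d1: "d1 \<in> tspace (dsh D i1)" "prj (dsh D i1) d1 = x i1"
      using lim_str_closed[OF D i1(1) d0(1) i1(2) d0(2) x(1) d0(3)[symmetric]] by (simp_all add: d1_def)
    have sx1: "s x = \<iota> i1 (x, d1)"
      using cocone_str[OF \<iota> i1(1) d0(1) i1(2) d0(2) x(1) d0(3)[symmetric]] d0(4) by (simp add: d1_def)
    have sub: "pre (p i1) {x i1} \<subseteq> pre (p j) {y}"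
    proof
      fix x' assume "x' \<in> pre (p i1) {x i1}"
      then have "x' \<in> X.lim" "x' i1 = x i1" by (simp_all add: mem_fibre)
      then show "x' \<in> pre (p j) {y}"
        using X.lim_tr[OF _ i1(1) j i1(3), of x'] X.lim_tr[OF x(1) i1(1) j i1(3)] x(2) by (simp add: mem_fibre)
    qed
    have cs: "continuous_map (subtopology (pts L) (pre (p i1) {x i1})) (tot K) s"
      using continuous_map_from_subtopology_mono[OF inv_on_cont[OF s] sub] by simp
    have ci: "continuous_map (subtopology (pts L) (pre (p i1) {x i1})) (tot K) (\<lambda>x. \<iota> i1 (x, d1))"
      using cc_cont[OF D c i1(1) d1(1)] unfolding d1(2) .
    have pe: "prj K (s x') = prj K (\<iota> i1 (x', d1))" if x': "x' \<in> X.lim" "x' i1 = x i1" for x'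
    proof -
      have "x' \<in> pre (p j) {y}" using sub x' by (auto simp: mem_fibre)
      then show ?thesis using inv_on_prj[OF s] cc_prj(2)[OF D c i1(1) d1(1) x'(1)] x'(2) d1(2) by simp
    qed
    \<comment> \<open>Having the same value at \<open>x\<close>, the section \<open>s\<close> and
      the basic section of \<open>d1\<close> agree on a smaller fibre.\<close>
    obtain k f where k: "k \<in> I" "f \<in> Ar k i1" and ag: "\<And>x'. \<lbrakk>x' \<in> X.lim; x' k = x k\<rbrakk> \<Longrightarrow> s x' = \<iota> i1 (x', d1)"
      using sections_agree[OF cc_sheaf[OF D c] i1(1) cs ci pe x(1) refl sx1] by blast
    have "?P k (Cmp (idx S) k i1 j h f) (x k)"
    proof (intro exI conjI ballI impI)
      show "str D k i1 f (x k, d1) \<in> tspace (dsh D k)" "prj (dsh D k) (str D k i1 f (x k, d1)) = x k"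
        using lim_str_closed[OF D k(1) i1(1) k(2) d1(1) x(1) d1(2)[symmetric]] .
      fix \<xi> assume \<xi>: "\<xi> \<in> X.lim" "\<xi> k = x k"
      have "\<xi> i1 = prj (dsh D i1) d1" using X.lim_tr[OF \<xi>(1) k(1) i1(1) k(2)] X.lim_tr[OF x(1) k(1) i1(1) k(2)] \<xi>(2) d1(2) by simp
      then show "s \<xi> = \<iota> k (\<xi>, str D k i1 f (x k, d1))"
        using cocone_str[OF \<iota> k(1) i1(1) k(2) d1(1) \<xi>(1)] ag[OF \<xi>] \<xi>(2) by simp
    qed
    then show "\<exists>i\<in>I. \<exists>f\<in>Ar i j. ?P i f (x i)"
      using k(1) category_comp[OF cofiltered_category[OF cof] k(1) i1(1) j k(2) i1(3)] by blast
  next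
    fix i f k g x
    assume *: "i \<in> I" "k \<in> I" "f \<in> Ar i j" "g \<in> Ar k i" "x \<in> base (lvl S k)" "trX S i j f (trX S k i g x) = y"
      "?P i f (trX S k i g x)"
    then obtain d where d: "d \<in> tspace (dsh D i)" "prj (dsh D i) d = trX S k i g x"
      "\<And>\<xi>. \<lbrakk>\<xi> \<in> X.lim; \<xi> i = trX S k i g x\<rbrakk> \<Longrightarrow> s \<xi> = \<iota> i (\<xi>, d)" by blast
    show "?P k (Cmp (idx S) k i j f g) x"
    proof (intro exI conjI ballI impI)
      show "str D k i g (x, d) \<in> tspace (dsh D k)" "prj (dsh D k) (str D k i g (x, d)) = x"
        using ds_str_closed[OF D *(2,1,4) d(1) *(5) d(2)[symmetric]] .
      fix \<xi> assume \<xi>: "\<xi> \<in> X.lim" "\<xi> k = x"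
      have "\<xi> i = trX S k i g x" using X.lim_tr[OF \<xi>(1) *(2,1,4)] \<xi>(2) by simp
      then show "s \<xi> = \<iota> k (\<xi>, str D k i g (x, d))"
        using d(3)[OF \<xi>(1)] cocone_str[OF \<iota> *(2,1,4) d(1) \<xi>(1)] d(2) \<xi>(2) by simp
    qed
  qed blast
  note ij = i(1) j i(2)
  have "\<forall>x\<in>{x \<in> base (lvl S i). trX S i j f x = y}. ?P i f x" using e by blast
  \<comment> \<open>One representative is chosen at each point of level \<open>i\<close> over
    \<open>y\<close>. Over a discrete space continuity is automatic, whereas invariance under the
    kernel has to be proved.\<close>
  from bchoice[OF this] obtain t where t': "\<forall>x\<in>{x \<in> base (lvl S i). trX S i j f x = y}.
      t x \<in> tspace (dsh D i) \<and> prj (dsh D i) (t x) = x \<and> (\<forall>\<xi>\<in>X.lim. \<xi> i = x \<longrightarrow> s \<xi> = \<iota> i (\<xi>, t x))" ..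
  have t: "t x \<in> tspace (dsh D i)" "prj (dsh D i) (t x) = x" "\<And>\<xi>. \<lbrakk>\<xi> \<in> X.lim; \<xi> i = x\<rbrakk> \<Longrightarrow> s \<xi> = \<iota> i (\<xi>, t x)"
    if "x \<in> base (lvl S i)" "trX S i j f x = y" for x using t' that by blast+
  have inv: "inv_on (tn i j f) (dsh D i) {y} t"
  proof (rule inv_onI, unfold transition_simps mem_pre singleton_iff)
    show "continuous_map (subtopology (pts (lvl S i)) (pre (tn i j f) {y})) (tot (dsh D i)) t"
      unfolding subtopology_lvl[OF i(1)] using t(1) by (auto simp: mem_pre)
    show "prj (dsh D i) (t x) = x" if "x \<in> base (lvl S i) \<and> trX S i j f x = y" for x using t(2) that by blast
    fix n x assume n: "n \<in> carrier (grp (lvl S i))" "trG S i j f n = \<one>\<^bsub>grp (lvl S j)\<^esub>"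
      and "x \<in> base (lvl S i) \<and> trX S i j f x = y"
    then have x: "x \<in> base (lvl S i)" "trX S i j f x = y" by auto
    obtain g where g: "g \<in> G.lim" "g i = n" using G.proj_surj[OF i(1)] n(1) lvl_gtop[OF i(1)] by metis
    have gj: "g j = \<one>\<^bsub>grp (lvl S j)\<^esub>" using G.lim_tr[OF g(1) ij] g(2) n(2) by simp
    have nx: "mov (lvl S i) n x \<in> base (lvl S i)" "trX S i j f (mov (lvl S i) n x) = y"
      using group_action_closed[OF lvl_act[OF i(1)] n(1) x(1)] tr_equiv[OF ij n(1) x(1)] n(2) x(2)
        group_action_one[OF lvl_act[OF j] y] by simp_all
    note sh = ds_sheaf[OF D i(1)]
    show "t (mov (lvl S i) n x) = emov (dsh D i) n (t x)"
    \<comment> \<open>The two sides are known to agree in the colimit. Injectivity of the legs,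
      applied at level \<open>i\<close>, brings the equation back to \<open>dsh D i\<close>.\<close>
    proof (rule leg_injective[OF i(1) t(1)[OF nx] sheaf_mov_closed[OF sh n(1) t(1)[OF x]] t(2)[OF nx]])
      show "prj (dsh D i) (emov (dsh D i) n (t x)) = mov (lvl S i) n x"
        using sheaf_prj_mov[OF sh n(1) t(1)[OF x]] t(2)[OF x] by simp
      fix \<xi> assume \<xi>: "\<xi> \<in> X.lim" "\<xi> i = mov (lvl S i) n x"
      have "\<xi> \<in> pre (p i) {mov (tgt (p i)) (grp_map (p i) g) x}" using \<xi> g(2) by (simp add: mem_fibre)
      then obtain \<xi>' where "\<xi>' \<in> pre (p i) {x}" "\<xi> = mov L g \<xi>'"
        using discrete_change.pre_mov_inv[OF dc_proj[OF i(1)], of g x \<xi>] g(1) x(1) by (auto simp: L_simps)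
      then have \<xi>': "\<xi>' \<in> X.lim" "\<xi>' i = x" "\<xi> = mov L g \<xi>'" by (auto simp: mem_fibre)
      have \<xi>'j: "\<xi>' \<in> pre (p j) {y}" using X.lim_tr[OF \<xi>'(1) ij] \<xi>' x(2) by (simp add: mem_fibre)
      have "\<iota> i (\<xi>, t (mov (lvl S i) n x)) = s (mov L g \<xi>')" using t(3)[OF nx \<xi>] \<xi>'(3) by simp
      also have "\<dots> = emov K g (s \<xi>')"
        using inv_on_mov[OF s, of g \<xi>'] g(1) gj \<xi>'j by (simp add: L_simps)
      also have "\<dots> = emov K g (\<iota> i (\<xi>', t x))" using t(3)[OF x \<xi>'(1,2)] by simp
      also have "\<dots> = \<iota> i (mov L g \<xi>', emov (dsh D i) (g i) (t x))"
        using discrete_change.pull_hom_mov[OF dc_proj[OF i(1)], unfolded lim_proj_simps mem_fibre L_simps,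
          OF sh cocone_hom[OF \<iota> i(1)] g(1) t(1)[OF x], of \<xi>'] \<xi>' t(2)[OF x] by simp
      finally show "\<iota> i (\<xi>, t (mov (lvl S i) n x)) = \<iota> i (\<xi>, emov (dsh D i) n (t x))" using \<xi>'(3) g(2) by simp
    qed
  qed
  note ah = adjoint_right_trans(1)[OF D ij] and av = adjoint_right_trans(2)[OF D ij]
  obtain w where w: "w \<in> tspace (push (tn i j f) (dsh D i))" "prj (push (tn i j f) (dsh D i)) w = y"
    "\<forall>x\<in>pre (tn i j f) {y}. germ_val w x = t x"
    using section_model.ev_surj[OF push_model_trans[OF D ij], unfolded transition_simps, OF y inv] by blast
  then obtain d where d: "d \<in> tspace (dsh D j)" "w = adjoint_right (tn i j f) (dsh D j) (dsh D i) (str D i j f) d"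
    using adj_bij[OF ij] by (auto simp: bij_betw_def)
  have pd: "prj (dsh D j) d = y" using hom_prj[OF ah d(1)] d(2) w(2) by simp
  show thesis
  proof (rule that[OF d(1) pd])
    fix x assume x: "x \<in> X.lim" "x j = y"
    have xi: "x i \<in> base (lvl S i)" "trX S i j f (x i) = y"
      using X.lim_coord[OF x(1) i(1)] X.lim_tr[OF x(1) ij] x(2) by simp_all
    have "str D i j f (x i, d) = t (x i)"
      using av[OF d(1) xi(1)] xi pd d(2) w(3) by (simp add: mem_pre)
    then show "\<iota> j (x, d) = s x"
      using cocone_str[OF \<iota> ij d(1) x(1)] x(2) pd t(3)[OF xi x(1) refl] by simp
  qed
qed

text \<open>The equation \<open>prec D \<kappa> u = \<iota>\<close> says that \<open>u j d\<close>
  represents the section \<open>x \<mapsto> \<iota> j (x, d)\<close>, so the two preceding lemmas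
  become injectivity and surjectivity of \<open>u j\<close>.\<close>

lemma unit_bij:
  assumes P: "pmodel K P \<kappa>" and u: "u \<in> dsheaf_hom R S D P" and eq: "prec D \<kappa> u = \<iota>" and j: "j \<in> I"
  shows "bij_betw (u j) (tspace (dsh D j)) (tspace (dsh P j))"
proof -
  have ds: "is_dsheaf R S P" and \<kappa>: "\<kappa> \<in> cocones P K"
    and sm: "section_model (p j) R K (dsh P j) (\<lambda>z x. \<kappa> j (x, z))"
    using P j by (auto simp: pmodel_def)
  note uh = dsheaf_hom_hom[OF u j]
  have ku: "\<kappa> j (x, u j d) = \<iota> j (x, d)" if "d \<in> tspace (dsh D j)" "x \<in> X.lim" "x j = prj (dsh D j) d" for x d
    using prec_apply[OF j that, of \<kappa> u] eq by simp
  have "d = d'" if d: "d \<in> tspace (dsh D j)" "d' \<in> tspace (dsh D j)" "u j d = u j d'" for d d'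
  proof (rule leg_injective[OF j d(1,2)])
    show pe: "prj (dsh D j) d = prj (dsh D j) d'" using hom_prj[OF uh d(1)] hom_prj[OF uh d(2)] d(3) by simp
    show "\<iota> j (x, d) = \<iota> j (x, d')" if "x \<in> X.lim" "x j = prj (dsh D j) d'" for x
      using ku[OF d(1) that(1)] ku[OF d(2) that] that(2) pe d(3) by simp
  qed simp
  moreover have "z \<in> u j ` tspace (dsh D j)" if z: "z \<in> tspace (dsh P j)" for z
  proof -
    obtain d where d: "d \<in> tspace (dsh D j)" "prj (dsh D j) d = prj (dsh P j) z"
      "\<And>x. \<lbrakk>x \<in> X.lim; x j = prj (dsh P j) z\<rbrakk> \<Longrightarrow> \<iota> j (x, d) = \<kappa> j (x, z)"
      using leg_surjective[OF j sheaf_prj[OF ds_sheaf[OF ds j] z] section_model.ev_inv_on[OF sm z]] by blast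
    have "u j d = z"
    proof (rule sm_eqI[OF j sm hom_closed[OF uh d(1)] z])
      show "prj (dsh P j) (u j d) = prj (dsh P j) z" using hom_prj[OF uh d(1)] d(2) by simp
      show "\<kappa> j (x, u j d) = \<kappa> j (x, z)" if "x \<in> X.lim \<and> x j = prj (dsh P j) z" for x
        using ku[OF d(1)] d(2,3) that by simp
    qed
    then show ?thesis using d(1) by blast
  qed
  ultimately show ?thesis
    unfolding bij_betw_def using hom_closed[OF uh] by (auto intro: inj_onI)
qed

end

end

section \<open>The adjunction\<close>

lemma ex1_eqI: "\<lbrakk>\<exists>!x. P x; P a; P b\<rbrakk> \<Longrightarrow> a = b"
  by blast

lemma (in colimit) is_ccolim_K: "is_ccolim D K legs"
  unfolding is_ccolim_def
proof (intro conjI ballI impI K_sheaf legs_cocone)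
  fix z assume "z \<in> tspace K"
  then have "z \<in> Kset" by (simp add: tspace_K)
  then obtain i d where d: "d \<in> stk i (pt z)" "z = leg i (pt z) d" by (rule Kset_cases)
  show "\<exists>i\<in>I. \<exists>d\<in>tspace (dsh D i). prj (dsh D i) d = prj K z i \<and> z = legs i (prj K z, d)"
  proof (intro bexI conjI)
    show "prj (dsh D i) d = prj K z i" using stkD(4)[OF d(1)] by (simp add: K_simps)
    show "z = legs i (prj K z, d)" unfolding K_simps legs_apply[OF d(1)] by (rule d(2))
  qed (use stkD(1,2)[OF d(1)] in auto)
next
  fix i d e x assume i: "i \<in> I" and de: "d \<in> tspace (dsh D i)" "e \<in> tspace (dsh D i)" and x: "x \<in> X.lim"
    and *: "prj (dsh D i) d = x i \<and> prj (dsh D i) e = x i \<and> legs i (x, d) = legs i (x, e)"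
  have s: "d \<in> stk i x" "e \<in> stk i x" using i de x * by (simp_all add: stk_def)
  have "leg i x d = leg i x e" using * legs_apply[OF s(1)] legs_apply[OF s(2)] by simp
  then obtain k f where "k \<in> I" "f \<in> Ar k i" "mv k i f x d = mv k i f x e" by (rule leg_eq_sameD[OF s])
  then show "\<exists>k\<in>I. \<exists>f\<in>Ar k i. str D k i f (x k, d) = str D k i f (x k, e)" by (auto simp: mv_def)
qed

context system
begin

section \<open>Functoriality of cocones\<close>

lemma prec_comp:
  assumes D: "is_dsheaf R S D" and D': "is_dsheaf R S D'" and D'': "is_dsheaf R S D''"
    and u: "u \<in> dsheaf_hom R S D D'" and v: "v \<in> dsheaf_hom R S D' D''" and \<kappa>: "\<kappa> \<in> cocones D'' E"
  shows "prec D \<kappa> (dsheaf_comp S D v u) = prec D (prec D' \<kappa> v) u"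
proof (rule cocone_eqI[OF prec_cocone[OF D D'' \<kappa> dsheaf_comp_hom[OF D u v]]
    prec_cocone[OF D D' prec_cocone[OF D' D'' \<kappa> v] u]])
  fix i d x assume *: "i \<in> I" "d \<in> tspace (dsh D i)" "x \<in> X.lim" "x i = prj (dsh D i) d"
  note ud = hom_closed[OF dsheaf_hom_hom[OF u *(1)] *(2)] hom_prj[OF dsheaf_hom_hom[OF u *(1)] *(2)]
  show "prec D \<kappa> (dsheaf_comp S D v u) i (x, d) = prec D (prec D' \<kappa> v) u i (x, d)"
    using ud * dsheaf_comp_apply[OF *(1,2), of v u] by (simp add: prec_apply)
qed

lemma prec_id:
  assumes D: "is_dsheaf R S D" and \<kappa>: "\<kappa> \<in> cocones D E"
  shows "prec D \<kappa> (dsheaf_id S D) = \<kappa>"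
  by (rule cocone_eqI[OF prec_cocone[OF D D \<kappa> dsheaf_id_hom[OF D]] \<kappa>]) (simp add: prec_apply dsheaf_id_apply)

lemma post_comp:
  assumes D: "is_dsheaf R S D" and \<kappa>: "\<kappa> \<in> cocones D E" and h: "h \<in> sheaf_hom R L E F" "h' \<in> sheaf_hom R L F F'"
    and E: "is_sheaf R L E"
  shows "post D (compose (tspace E) h' h) \<kappa> = post D h' (post D h \<kappa>)"
proof (rule cocone_eqI[OF post_cocone[OF D \<kappa> compose_hom[OF sheaf_ops_closed[OF E] h]]
    post_cocone[OF D post_cocone[OF D \<kappa> h(1)] h(2)]])
  fix i d x assume *: "i \<in> I" "d \<in> tspace (dsh D i)" "x \<in> X.lim" "x i = prj (dsh D i) d"
  have "\<kappa> i (x, d) \<in> tspace E" using hom_closed[OF cocone_hom[OF \<kappa> *(1)], of "(x, d)"] * by (simp add: mem_pull_proj)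
  then show "post D (compose (tspace E) h' h) \<kappa> i (x, d) = post D h' (post D h \<kappa>) i (x, d)"
    using * by (simp add: post_apply compose_def)
qed

lemma post_id:
  assumes D: "is_dsheaf R S D" and \<kappa>: "\<kappa> \<in> cocones D E" and E: "is_sheaf R L E"
  shows "post D (sheaf_id E) \<kappa> = \<kappa>"
proof (rule cocone_eqI[OF post_cocone[OF D \<kappa> sheaf_id_hom[OF sheaf_ops_closed[OF E]]] \<kappa>])
  fix i d x assume *: "i \<in> I" "d \<in> tspace (dsh D i)" "x \<in> X.lim" "x i = prj (dsh D i) d"
  have "\<kappa> i (x, d) \<in> tspace E" using hom_closed[OF cocone_hom[OF \<kappa> *(1)], of "(x, d)"] * by (simp add: mem_pull_proj)
  then show "post D (sheaf_id E) \<kappa> i (x, d) = \<kappa> i (x, d)" using * by (simp add: post_apply sheaf_id_def)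
qed

lemma post_prec:
  assumes D: "is_dsheaf R S D" and D': "is_dsheaf R S D'" and u: "u \<in> dsheaf_hom R S D D'"
    and h: "h \<in> sheaf_hom R L E F" and \<kappa>: "\<kappa> \<in> cocones D' E"
  shows "post D h (prec D \<kappa> u) = prec D (post D' h \<kappa>) u"
proof (rule cocone_eqI[OF post_cocone[OF D prec_cocone[OF D D' \<kappa> u] h] prec_cocone[OF D D' post_cocone[OF D' \<kappa> h] u]])
  fix i d x assume *: "i \<in> I" "d \<in> tspace (dsh D i)" "x \<in> X.lim" "x i = prj (dsh D i) d"
  note ud = hom_closed[OF dsheaf_hom_hom[OF u *(1)] *(2)] hom_prj[OF dsheaf_hom_hom[OF u *(1)] *(2)]
  show "post D h (prec D \<kappa> u) i (x, d) = prec D (post D' h \<kappa>) u i (x, d)"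
    using * ud by (simp add: post_apply prec_apply)
qed

section \<open>Colimits and direct images inside the universe\<close>

lemma colimit_exists:
  fixes D :: "('o, 'm, 'g, 'x, 'r, 'u) dsheaf" and U :: "('o \<times> ('o \<Rightarrow> 'x)) \<times> (('o \<Rightarrow> 'x) \<Rightarrow> 'u) \<Rightarrow> 'u"
  assumes D: "is_dsheaf R S D" and U: "inj U"
  shows "\<exists>(K :: ('o \<Rightarrow> 'g, 'o \<Rightarrow> 'x, 'r, 'u) sheaf) \<iota>. is_ccolim D K \<iota> \<and>
    (\<forall>(E :: ('o \<Rightarrow> 'g, 'o \<Rightarrow> 'x, 'r, 'u) sheaf) \<kappa>. is_sheaf R L E \<longrightarrow> \<kappa> \<in> cocones D E \<longrightarrow>
      (\<exists>!h. h \<in> sheaf_hom R L K E \<and> post D h \<iota> = \<kappa>))"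
proof -
  \<comment> \<open>A class is encoded by a chosen member: related elements have the same class, so
    the member and the limit point recover it. The function slot of the code holds the constant
    function at the stalk element.\<close>
  define J where "J = (\<lambda>(x :: 'o \<Rightarrow> 'x, c :: ('o \<times> 'u) set). let r = SOME r. r \<in> c in U ((fst r, x), \<lambda>_. snd r))"
  interpret C: colimit_data R S D J by unfold_locales (rule D)
  have "inj_on J C.cls_pairs"
  proof (rule inj_onI)
    fix a b assume "a \<in> C.cls_pairs" "b \<in> C.cls_pairs" and eq: "J a = J b"
    then obtain x i d y j e where a: "a = (x, C.cls x i d)" "d \<in> C.stk i x" and b: "b = (y, C.cls y j e)" "e \<in> C.stk j y"
      by (auto simp: C.cls_pairs_def)
    define r where "r = (SOME r. r \<in> C.cls x i d)"
    define r' where "r' = (SOME r. r \<in> C.cls y j e)"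
    have "(i, d) \<in> C.cls x i d" "(j, e) \<in> C.cls y j e"
      using a(2) b(2) C.rel_refl by (simp_all add: C.cls_def)
    from someI[of "\<lambda>r. r \<in> C.cls x i d", OF this(1)] someI[of "\<lambda>r. r \<in> C.cls y j e", OF this(2)]
    have r: "r \<in> C.cls x i d" "r' \<in> C.cls y j e" unfolding r_def r'_def .
    have "((fst r, x), \<lambda>_ :: 'o \<Rightarrow> 'x. snd r) = ((fst r', y), \<lambda>_. snd r')"
      using eq U unfolding a(1) b(1) J_def Let_def case_prod_conv r_def[symmetric] r'_def[symmetric] by (rule injD[rotated])
    then have xy: "x = y" "r = r'" by (auto simp: fun_eq_iff prod_eq_iff)
    obtain l c where lc: "r = (l, c)" by (cases r)
    have "c \<in> C.stk l x" "C.rel x i d l c" "C.rel y j e l c"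
      using r xy unfolding lc by (auto simp: C.cls_def)
    then have "C.cls x i d = C.cls x l c" "C.cls y j e = C.cls x l c"
      using C.cls_eq_iff a(2) b(2) xy(1) by auto
    then show "a = b" using a(1) b(1) xy(1) by simp
  qed
  then interpret colimit R S D J by unfold_locales
  show ?thesis using is_ccolim_K K_universal by blast
qed

lemma pmodel_exists:
  fixes E :: "('o \<Rightarrow> 'g, 'o \<Rightarrow> 'x, 'r, 'u) sheaf" and U :: "('o \<times> ('o \<Rightarrow> 'x)) \<times> (('o \<Rightarrow> 'x) \<Rightarrow> 'u) \<Rightarrow> 'u"
  assumes E: "is_sheaf R L E" and U: "inj U"
  shows "\<exists>(P :: ('o, 'm, 'g, 'x, 'r, 'u) dsheaf) \<kappa>. pmodel E P \<kappa>"
proof (rule pmodel_copy[OF p_bullet_model[OF E]])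
  fix i assume i: "i \<in> I"
  \<comment> \<open>A germ is determined by its base point and its values on the fibre. The base
    point is stored as a constant function, and the index slot of the code is filled
    arbitrarily.\<close>
  let ?c = "\<lambda>z :: ('o \<Rightarrow> 'x, 'x, 'u) germ. U ((undefined, \<lambda>_. fst z), germ_val z)"
  show "inj_on ?c (tspace (dsh (p_bullet S E) i))"
  proof (rule inj_onI)
    fix z z' assume z: "z \<in> tspace (dsh (p_bullet S E) i)" "z' \<in> tspace (dsh (p_bullet S E) i)" and c: "?c z = ?c z'"
    from injD[OF U c] have eq: "fst z = fst z'" "germ_val z = germ_val z'"
      by (simp_all add: fun_eq_iff)
    show "z = z'"
      by (rule section_model.ev_eqI[OF push_model_proj[OF E i]]) (use z eq in \<open>simp_all add: p_bullet_def push_def\<close>)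
  qed
qed

text \<open>\<open>\<kappa>\<close> and \<open>l\<close> are the evaluation cocones of the germ
  systems. The universal property provides a morphism \<open>w\<close> with the required equation,
  and evaluating germs shows that the explicit formula of \<open>push_map\<close> computes it; the
  morphism laws of the formula thus come from \<open>w\<close>.\<close>

lemma p_bullet_map:
  assumes E: "is_sheaf R L E" and F: "is_sheaf R L F" and h: "h \<in> sheaf_hom R L E F"
    and \<kappa>: "\<kappa> = (\<lambda>i\<in>I. restrict (\<lambda>(x, z). germ_val z x) (tspace (pull (p i) (push (p i) E))))"
    and l: "l = (\<lambda>i\<in>I. restrict (\<lambda>(x, z). germ_val z x) (tspace (pull (p i) (push (p i) F))))"
  shows "p_bullet_map S E F h \<in> dsheaf_hom R S (p_bullet S E) (p_bullet S F)"
    "prec (p_bullet S E) l (p_bullet_map S E F h) = post (p_bullet S E) h \<kappa>"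
proof -
  have "pmodel E (p_bullet S E) \<kappa>" and mF: "pmodel F (p_bullet S F) l"
    using p_bullet_model[OF E] p_bullet_model[OF F] \<kappa> l by simp_all
  then have dE: "is_dsheaf R S (p_bullet S E)" and cE: "\<kappa> \<in> cocones (p_bullet S E) E"
    by (simp_all add: pmodel_def)
  have d: "dsh (p_bullet S E) i = push (p i) E" "dsh (p_bullet S F) i = push (p i) F" for i by (simp_all add: p_bullet_def)
  obtain w where w: "w \<in> dsheaf_hom R S (p_bullet S E) (p_bullet S F)" "prec (p_bullet S E) l w = post (p_bullet S E) h \<kappa>"
    using pmodel_universal[OF mF dE post_cocone[OF dE cE h]] by blast
  have "p_bullet_map S E F h = w"
  proof (rule extensionalityI)
    show "p_bullet_map S E F h \<in> extensional I" by (simp add: p_bullet_map_def)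
    show "w \<in> extensional I" using w(1) by (auto simp: dsheaf_hom_def PiE_def)
    fix i assume i: "i \<in> I"
    interpret pi: discrete_change "p i" by (rule dc_proj[OF i])
    have Ei: "is_sheaf R (src (p i)) E" and Fi: "is_sheaf R (src (p i)) F" using E F by simp_all
    have wh: "w i \<in> sheaf_hom R (lvl S i) (push (p i) E) (push (p i) F)" using dsheaf_hom_hom[OF w(1) i] by (simp add: d)
    have "push_map (p i) E F h = w i"
    proof (rule extensionalityI)
      show "push_map (p i) E F h \<in> extensional (tspace (push (p i) E))" by (simp add: push_map_def)
      show "w i \<in> extensional (tspace (push (p i) E))" using hom_ext[OF wh] .
      fix z assume z: "z \<in> tspace (push (p i) E)"
      obtain V s where V: "germ_rep z = (V, s)" "fst z \<in> V" "V \<subseteq> base (tgt (p i))" "inv_on (p i) E V s" "germ_val z = s"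
        using pi.push_rep[OF Ei z] by metis
      note pz = hom_prj[OF wh z]
      have hs: "inv_on (p i) F V (\<lambda>x. h (s x))"
      proof (rule inv_onI)
        show "continuous_map (subtopology (pts (src (p i))) (pre (p i) V)) (tot F) (\<lambda>x. h (s x))"
          using continuous_map_compose[OF inv_on_cont[OF V(4)] hom_cont[OF h]] by (simp add: o_def)
        show "prj F (h (s x)) = x" if "x \<in> pre (p i) V" for x
          using hom_prj[OF h inv_on_closed[OF V(4) that]] inv_on_prj[OF V(4) that] by simp
        show "h (s (mov (src (p i)) n x)) = emov F n (h (s x))"
          if "n \<in> carrier (grp (src (p i)))" "grp_map (p i) n = \<one>\<^bsub>grp (tgt (p i))\<^esub>" "x \<in> pre (p i) V" for n x
          using inv_on_mov[OF V(4) that] hom_mov[OF h _ inv_on_closed[OF V(4) that(3)], of n] that(1) by simp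
      qed
      have yb: "fst z \<in> base (tgt (p i))" using V(2,3) by blast
      have "push_map (p i) E F h z = germ (p i) F (fst z) V (restrict (\<lambda>x. h (s x)) (pre (p i) V))"
        using z V(1) by (simp add: push_map_def)
      also have "\<dots> = germ (p i) F (fst z) V (\<lambda>x. h (s x))"
        by (rule pi.germ_cong[OF Fi V(2,2) yb]) (use V(2) in \<open>simp add: mem_pre\<close>)
      finally have e: "push_map (p i) E F h z = germ (p i) F (fst z) V (\<lambda>x. h (s x))" .
      note gp = pi.germ_push[OF Fi V(2,3) hs]
      show "push_map (p i) E F h z = w i z"
        unfolding e
      proof (rule pi.push_eqI[OF Fi gp(1) hom_closed[OF wh z]])
        have pf: "prj (push (p i) E) z = fst z" by (simp add: push_def)
        show "prj (push (p i) F) (germ (p i) F (fst z) V (\<lambda>x. h (s x))) = prj (push (p i) F) (w i z)"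
          using gp(2) pz pf by simp
        fix x assume "x \<in> pre (p i) {prj (push (p i) F) (w i z)}"
        then have x: "x \<in> pre (p i) {fst z}" using pz pf by simp
        then have x': "x \<in> X.lim" "x i = fst z" by (simp_all add: mem_fibre)
        have "(x, z) \<in> tspace (pull (p i) (push (p i) E))" "(x, w i z) \<in> tspace (pull (p i) (push (p i) F))"
          using z x' pf pz hom_closed[OF wh z] by (simp_all add: mem_pull_proj)
        moreover have "l i (x, w i z) = h (\<kappa> i (x, z))"
          using prec_apply[of i z "p_bullet S E" x l w] post_apply[of i z "p_bullet S E" x h \<kappa>] i z x' pf w(2) by (simp add: d)
        ultimately have "germ_val (w i z) x = h (germ_val z x)" using i by (simp add: \<kappa> l)
        then show "germ_val (germ (p i) F (fst z) V (\<lambda>x. h (s x))) x = germ_val (w i z) x"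
          using gp(3)[OF x] V(5) by simp
      qed
    qed
    then show "p_bullet_map S E F h i = w i" using i by (simp add: p_bullet_map_def)
  qed
  then show "p_bullet_map S E F h \<in> dsheaf_hom R S (p_bullet S E) (p_bullet S F)"
    "prec (p_bullet S E) l (p_bullet_map S E F h) = post (p_bullet S E) h \<kappa>" using w by simp_all
qed

text \<open>The families in \<open>sheaf_cocone\<close> are arbitrary outside the index set, those
  in \<open>cocones\<close> are extensional; restriction mediates between them.\<close>

lemma sheaf_cocone_iff:
  assumes K: "is_sheaf R L K"
  shows "sheaf_cocone R L (idx S) (\<lambda>i. pull (p i) (dsh D i)) (pull_trans S D) K \<kappa> \<longleftrightarrow> restrict \<kappa> I \<in> cocones D K"
  unfolding sheaf_cocone_def cocones_def using K by (auto simp: PiE_iff)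

section \<open>Assembling the adjunction and the equivalence\<close>

lemma iso_in_Sheaves: "sheaf_iso R L E F h \<Longrightarrow> iso_in (Sheaves R L) E F h"
  by (simp add: sheaf_iso_def iso_in_def Sheaves_simps)

lemma iso_in_DSheaves: "dsheaf_iso R S D D' u \<Longrightarrow> iso_in (DSheaves R S) D D' u"
  by (simp add: dsheaf_iso_def iso_in_def DSheaves_simps)

theorem colim_p_bullet_adjunction:
  fixes U :: "('o \<times> ('o \<Rightarrow> 'x)) \<times> (('o \<Rightarrow> 'x) \<Rightarrow> 'u) \<Rightarrow> 'u"
  assumes U: "inj U"
  shows "\<exists>(L' :: (('o, 'm, 'g, 'x, 'r, 'u) dsheaf, 'o \<Rightarrow> 'u \<Rightarrow> 'u,
                 ('o \<Rightarrow> 'g, 'o \<Rightarrow> 'x, 'r, 'u) sheaf, 'u \<Rightarrow> 'u) fctr) Q \<eta> \<epsilon> \<iota> \<theta>.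
    adjunction (DSheaves R S) (Sheaves R L) L' Q \<eta> \<epsilon> \<and>
    is_colim_functor R S L' \<iota> \<and>
    is_p_bullet_functor R S Q \<theta> \<and>
    (\<forall>E\<in>Obj (Sheaves R L). iso_in (Sheaves R L) (onObj L' (onObj Q E)) E (\<epsilon> E)) \<and>
    adjoint_equivalence
      (full_subcategory (DSheaves R S) (adjoint_structure_isos R S)) (Sheaves R L) L' Q \<eta> \<epsilon>"
proof -
  have "\<forall>D\<in>{D :: ('o, 'm, 'g, 'x, 'r, 'u) dsheaf. is_dsheaf R S D}. \<exists>(q :: ('o \<Rightarrow> 'g, 'o \<Rightarrow> 'x, 'r, 'u) sheaf \<times> ('o \<Rightarrow> ('o \<Rightarrow> 'x) \<times> 'u \<Rightarrow> 'u)).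
    is_ccolim D (fst q) (snd q) \<and>
    (\<forall>(E :: ('o \<Rightarrow> 'g, 'o \<Rightarrow> 'x, 'r, 'u) sheaf) \<kappa>. is_sheaf R L E \<longrightarrow> \<kappa> \<in> cocones D E \<longrightarrow>
      (\<exists>!h. h \<in> sheaf_hom R L (fst q) E \<and> post D h (snd q) = \<kappa>))"
    using colimit_exists[OF _ U] by (simp add: split_paired_Ex)
  from bchoice[OF this] obtain q :: "('o, 'm, 'g, 'x, 'r, 'u) dsheaf \<Rightarrow>
    ('o \<Rightarrow> 'g, 'o \<Rightarrow> 'x, 'r, 'u) sheaf \<times> ('o \<Rightarrow> ('o \<Rightarrow> 'x) \<times> 'u \<Rightarrow> 'u)" where q: "\<And>D :: ('o, 'm, 'g, 'x, 'r, 'u) dsheaf. is_dsheaf R S D \<Longrightarrow>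
    is_ccolim D (fst (q D)) (snd (q D)) \<and>
    (\<forall>(E :: ('o \<Rightarrow> 'g, 'o \<Rightarrow> 'x, 'r, 'u) sheaf) \<kappa>. is_sheaf R L E \<longrightarrow> \<kappa> \<in> cocones D E \<longrightarrow>
      (\<exists>!h. h \<in> sheaf_hom R L (fst (q D)) E \<and> post D h (snd (q D)) = \<kappa>))" by blast
  define L0 where "L0 D = fst (q D)" for D
  define r where "r D = snd (q D)" for D
  have cc: "is_ccolim D (L0 D) (r D)" if "is_dsheaf R S D" for D using q[OF that] by (simp add: L0_def r_def)
  have r_univ: "\<exists>!h. h \<in> sheaf_hom R L (L0 D) E \<and> post D h (r D) = \<kappa>"
    if "is_dsheaf R S D" "is_sheaf R L E" "\<kappa> \<in> cocones D E"
    for D and E :: "('o \<Rightarrow> 'g, 'o \<Rightarrow> 'x, 'r, 'u) sheaf" and \<kappa>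
    using q[OF that(1)] that(2,3) by (simp add: L0_def r_def)
  have "\<forall>E\<in>{E :: ('o \<Rightarrow> 'g, 'o \<Rightarrow> 'x, 'r, 'u) sheaf. is_sheaf R L E}. \<exists>P :: ('o, 'm, 'g, 'x, 'r, 'u) dsheaf \<times> _.
      pmodel E (fst P) (snd P)"
    using pmodel_exists[OF _ U] by (simp add: split_paired_Ex)
  from bchoice[OF this] obtain P :: "('o \<Rightarrow> 'g, 'o \<Rightarrow> 'x, 'r, 'u) sheaf \<Rightarrow> ('o, 'm, 'g, 'x, 'r, 'u) dsheaf \<times> _"
    where P: "\<And>E. is_sheaf R L E \<Longrightarrow> pmodel E (fst (P E)) (snd (P E))" by blast
  define Q0 where "Q0 E = fst (P E)" for E
  define s where "s E = snd (P E)" for E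
  have pm: "pmodel E (Q0 E) (s E)" if "is_sheaf R L E" for E using P[OF that] by (simp add: Q0_def s_def)
  have Q0: "is_dsheaf R S (Q0 E)" and s: "s E \<in> cocones (Q0 E) E" if "is_sheaf R L E" for E
    using pm[OF that] by (simp_all add: pmodel_def)
  have L0: "is_sheaf R L (L0 D)" and r: "r D \<in> cocones D (L0 D)" if "is_dsheaf R S D" for D
    using cc_sheaf[OF that cc[OF that]] cc_cocone[OF that cc[OF that]] .
  \<comment> \<open>By \<open>r_univ\<close> the colimit represents cocones out of a fixed system,
    and by \<open>pmodel_universal\<close> the direct images represent cocones into a fixed
    sheaf.\<close>
  interpret B: birepresentable "DSheaves R S" "Sheaves R L" cocones post prec L0 Q0 r s
  proof (intro birepresentable.intro category_DSheaves category_Sheaves, unfold DSheaves_simps Sheaves_simps mem_Collect_eq, goal_cases)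
    case 1 then show ?case using post_cocone by blast
  next
    case 2 then show ?case using post_comp by blast
  next
    case 3 then show ?case using post_id by blast
  next
    case 4 then show ?case using prec_cocone by blast
  next
    case 5 then show ?case using prec_comp by blast
  next
    case 6 then show ?case using prec_id by blast
  next
    case 7 then show ?case using post_prec by blast
  next
    case 8 then show ?case by (rule L0)
  next
    case 9 then show ?case by (rule Q0)
  next
    case 10 then show ?case by (rule r)
  next
    case 11 then show ?case by (rule s)
  next
    case 12 then show ?case by (rule r_univ)
  next
    case 13 then show ?case using pmodel_universal[OF pm] by blast
  qed
  note adj = B.adjunction
  have eps: "iso_in (Sheaves R L) (L0 (Q0 E)) E (B.\<epsilon> E)" if E: "is_sheaf R L E" for E
  proof -
    have e: "B.\<epsilon> E \<in> sheaf_hom R L (L0 (Q0 E)) E" "post (Q0 E) (B.\<epsilon> E) (r (Q0 E)) = s E"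
      using B.eps[of E] E by (simp_all add: Sheaves_simps)
    show ?thesis
      using iso_in_Sheaves[OF bijective_hom_iso[OF L0[OF Q0[OF E]] E e(1) counit_bij[OF pm[OF E] cc[OF Q0[OF E]] E e]]] .
  qed
  have eta: "iso_in (DSheaves R S) D (Q0 (L0 D)) (B.\<eta> D)" if D: "is_dsheaf R S D" and a: "adjoint_structure_isos R S D" for D
  proof -
    have e: "B.\<eta> D \<in> dsheaf_hom R S D (Q0 (L0 D))" "prec D (s (L0 D)) (B.\<eta> D) = r D"
      using B.eta[of D] D by (simp_all add: DSheaves_simps)
    show ?thesis
      using iso_in_DSheaves[OF dsheaf_bijective_iso[OF D Q0[OF L0[OF D]] e(1) unit_bij[OF D cc[OF D] a pm[OF L0[OF D]] e]]] .
  qed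
  \<comment> \<open>Direct images lie in the full subcategory, which is what lets the adjunction
    restrict to it.\<close>
  have adj_isos: "adjoint_structure_isos R S (Q0 E)" if "is_sheaf R L E" for E
    using pmodel_adjoint_isos[OF pm[OF that]] .
  have equivalence: "adjoint_equivalence (full_subcategory (DSheaves R S) (adjoint_structure_isos R S)) (Sheaves R L)
      B.L B.Q B.\<eta> B.\<epsilon>"
    unfolding adjoint_equivalence_def
  proof (intro conjI ballI)
    show "adjunction (full_subcategory (DSheaves R S) (adjoint_structure_isos R S)) (Sheaves R L) B.L B.Q B.\<eta> B.\<epsilon>"
      by (rule adjunction_full_subcategory[OF adj]) (simp add: B.onObj Sheaves_simps adj_isos)
    show "iso_in (full_subcategory (DSheaves R S) (adjoint_structure_isos R S)) D (onObj B.Q (onObj B.L D)) (B.\<eta> D)"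
      if "D \<in> Obj (full_subcategory (DSheaves R S) (adjoint_structure_isos R S))" for D
      using eta[of D] that unfolding iso_in_def full_subcategory_simps DSheaves_simps B.onObj by simp
    show "iso_in (Sheaves R L) (onObj B.L (onObj B.Q E)) E (B.\<epsilon> E)" if "E \<in> Obj (Sheaves R L)" for E
      using eps that by (simp add: B.onObj Sheaves_simps)
  qed
  have colim: "is_colim_functor R S B.L r"
    unfolding is_colim_functor_def Let_def DSheaves_simps mem_Collect_eq B.onObj
  proof (intro conjI ballI)
    fix D :: "('o, 'm, 'g, 'x, 'r, 'u) dsheaf" assume "D \<in> Collect (is_dsheaf R S)"
    then have D: "is_dsheaf R S D" by simp
    have rr: "restrict (r D) I = r D" using r[OF D] by (auto simp: cocones_def PiE_def extensional_restrict)
    show "sheaf_colimit R L (idx S) (\<lambda>i. pull (p i) (dsh D i)) (pull_trans S D) (L0 D) (r D)"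
      unfolding sheaf_colimit_def
    proof (intro conjI allI impI)
      show "sheaf_cocone R L (idx S) (\<lambda>i. pull (p i) (dsh D i)) (pull_trans S D) (L0 D) (r D)"
        using r[OF D] unfolding sheaf_cocone_iff[OF L0[OF D], of D] rr .
      fix K' :: "('o \<Rightarrow> 'g, 'o \<Rightarrow> 'x, 'r, 'u) sheaf" and \<kappa>
      assume k: "sheaf_cocone R L (idx S) (\<lambda>i. pull (p i) (dsh D i)) (pull_trans S D) K' \<kappa>"
      then have K': "is_sheaf R L K'" by (simp add: sheaf_cocone_def)
      have "restrict \<kappa> I \<in> cocones D K'" using k unfolding sheaf_cocone_iff[OF K', of D] .
      from r_univ[OF D K' this]
      have "\<exists>!h. h \<in> sheaf_hom R L (L0 D) K' \<and> post D h (r D) = restrict \<kappa> I" .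
      moreover have "post D h (r D) = restrict \<kappa> I \<longleftrightarrow>
          (\<forall>i\<in>I. compose (tspace (pull (p i) (dsh D i))) h (r D i) = \<kappa> i)" for h
        by (auto simp: post_def fun_eq_iff restrict_def)
      ultimately show "\<exists>!h. h \<in> sheaf_hom R L (L0 D) K' \<and>
          (\<forall>i\<in>I. compose (tspace (pull (p i) (dsh D i))) h (r D i) = \<kappa> i)" by simp
    qed
    fix D' :: "('o, 'm, 'g, 'x, 'r, 'u) dsheaf" and u i assume "D' \<in> Collect (is_dsheaf R S)" and u: "u \<in> dsheaf_hom R S D D'" and i: "i \<in> I"
    then have D': "is_dsheaf R S D'" by simp
    have "post D (onHom B.L D D' u) (r D) = prec D (r D') u"
      using B.L_hom[of D D' u] D D' u by (simp add: DSheaves_simps)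
    from fun_cong[OF this, of i]
    show "compose (tspace (pull (p i) (dsh D i))) (onHom B.L D D' u) (r D i) =
        compose (tspace (pull (p i) (dsh D i))) (r D' i) (pull_map (p i) (dsh D i) (u i))"
      using i by (simp add: post_def prec_def)
  qed
  define l :: "('o \<Rightarrow> 'g, 'o \<Rightarrow> 'x, 'r, 'u) sheaf \<Rightarrow> _" where
    "l E = (\<lambda>i\<in>I. restrict (\<lambda>(x, z). germ_val z x) (tspace (pull (p i) (push (p i) E))))" for E
  have pb: "pmodel E (p_bullet S E) (l E)" if "is_sheaf R L E" for E using p_bullet_model[OF that] by (simp add: l_def)
  have pbd: "is_dsheaf R S (p_bullet S E)" and pbc: "l E \<in> cocones (p_bullet S E) E"
    if "is_sheaf R L E" for E :: "('o \<Rightarrow> 'g, 'o \<Rightarrow> 'x, 'r, 'u) sheaf"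
    using pb[OF that] by (simp_all add: pmodel_def)
  \<comment> \<open>The unique comparison between two models of the same direct images: the copy in
    the universe and the germ sheaves.\<close>
  define \<theta> where "\<theta> E = (THE u. u \<in> dsheaf_hom R S (Q0 E) (p_bullet S E) \<and> prec (Q0 E) (l E) u = s E)" for E
  have \<theta>: "\<theta> E \<in> dsheaf_hom R S (Q0 E) (p_bullet S E)" "prec (Q0 E) (l E) (\<theta> E) = s E" if E: "is_sheaf R L E" for E
    using theI'[OF pmodel_universal[OF pb[OF E] Q0[OF E] s[OF E]]] by (simp_all add: \<theta>_def)
  have "is_p_bullet_functor R S B.Q \<theta>"
    unfolding is_p_bullet_functor_def Sheaves_simps B.onObj
  proof (intro conjI ballI)
    fix E :: "('o \<Rightarrow> 'g, 'o \<Rightarrow> 'x, 'r, 'u) sheaf" assume "E \<in> Collect (is_sheaf R L)"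
    then have E: "is_sheaf R L E" by simp
    show "is_dsheaf R S (p_bullet S E)" by (rule pbd[OF E])
    obtain v where v: "v \<in> dsheaf_hom R S (p_bullet S E) (Q0 E)" "prec (p_bullet S E) (s E) v = l E"
      using pmodel_universal[OF pm[OF E] pbd[OF E] pbc[OF E]] by blast
    \<comment> \<open>The composite and the identity satisfy the same universal equation and hence
      coincide: models of one sheaf are uniquely isomorphic.\<close>
    have 1: "dsheaf_comp S (Q0 E) v (\<theta> E) = dsheaf_id S (Q0 E)"
    proof (rule ex1_eqI)
      show "\<exists>!u. u \<in> dsheaf_hom R S (Q0 E) (Q0 E) \<and> prec (Q0 E) (s E) u = s E"
        using pmodel_universal[OF pm[OF E] Q0[OF E] s[OF E]] .
      show "dsheaf_comp S (Q0 E) v (\<theta> E) \<in> dsheaf_hom R S (Q0 E) (Q0 E) \<and> prec (Q0 E) (s E) (dsheaf_comp S (Q0 E) v (\<theta> E)) = s E"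
        using dsheaf_comp_hom[OF Q0[OF E] \<theta>(1)[OF E] v(1)] prec_comp[OF Q0[OF E] pbd[OF E] Q0[OF E] \<theta>(1)[OF E] v(1) s[OF E]]
          v(2) \<theta>(2)[OF E] by simp
      show "dsheaf_id S (Q0 E) \<in> dsheaf_hom R S (Q0 E) (Q0 E) \<and> prec (Q0 E) (s E) (dsheaf_id S (Q0 E)) = s E"
        using dsheaf_id_hom[OF Q0[OF E]] prec_id[OF Q0[OF E] s[OF E]] by simp
    qed
    have 2: "dsheaf_comp S (p_bullet S E) (\<theta> E) v = dsheaf_id S (p_bullet S E)"
    proof (rule ex1_eqI)
      show "\<exists>!u. u \<in> dsheaf_hom R S (p_bullet S E) (p_bullet S E) \<and> prec (p_bullet S E) (l E) u = l E"
        using pmodel_universal[OF pb[OF E] pbd[OF E] pbc[OF E]] .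
      show "dsheaf_comp S (p_bullet S E) (\<theta> E) v \<in> dsheaf_hom R S (p_bullet S E) (p_bullet S E) \<and>
          prec (p_bullet S E) (l E) (dsheaf_comp S (p_bullet S E) (\<theta> E) v) = l E"
        using dsheaf_comp_hom[OF pbd[OF E] v(1) \<theta>(1)[OF E]]
          prec_comp[OF pbd[OF E] Q0[OF E] pbd[OF E] v(1) \<theta>(1)[OF E] pbc[OF E]] v(2) \<theta>(2)[OF E] by simp
      show "dsheaf_id S (p_bullet S E) \<in> dsheaf_hom R S (p_bullet S E) (p_bullet S E) \<and>
          prec (p_bullet S E) (l E) (dsheaf_id S (p_bullet S E)) = l E"
        using dsheaf_id_hom[OF pbd[OF E]] prec_id[OF pbd[OF E] pbc[OF E]] by simp
    qed
    show "dsheaf_iso R S (Q0 E) (p_bullet S E) (\<theta> E)"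
      unfolding dsheaf_iso_def using \<theta>(1)[OF E] v(1) 1 2 by blast
    fix F :: "('o \<Rightarrow> 'g, 'o \<Rightarrow> 'x, 'r, 'u) sheaf" and f assume "F \<in> Collect (is_sheaf R L)" and f: "f \<in> sheaf_hom R L E F"
    then have F: "is_sheaf R L F" by simp
    note pbm = p_bullet_map[OF E F f l_def l_def]
    have Qf: "onHom B.Q E F f \<in> dsheaf_hom R S (Q0 E) (Q0 F)" "prec (Q0 E) (s F) (onHom B.Q E F f) = post (Q0 E) f (s E)"
      using B.Q_hom[of E F f] E F f by (simp_all add: DSheaves_simps Sheaves_simps)
    \<comment> \<open>Naturality of the comparison, again by uniqueness: precomposing
      \<open>l F\<close> with either composite gives \<open>post (Q0 E) f (s E)\<close>.\<close>
    show "dsheaf_comp S (Q0 E) (p_bullet_map S E F f) (\<theta> E) = dsheaf_comp S (Q0 E) (\<theta> F) (onHom B.Q E F f)"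
    proof (rule ex1_eqI)
      show "\<exists>!u. u \<in> dsheaf_hom R S (Q0 E) (p_bullet S F) \<and> prec (Q0 E) (l F) u = post (Q0 E) f (s E)"
        using pmodel_universal[OF pb[OF F] Q0[OF E] post_cocone[OF Q0[OF E] s[OF E] f]] .
      show "dsheaf_comp S (Q0 E) (p_bullet_map S E F f) (\<theta> E) \<in> dsheaf_hom R S (Q0 E) (p_bullet S F) \<and>
          prec (Q0 E) (l F) (dsheaf_comp S (Q0 E) (p_bullet_map S E F f) (\<theta> E)) = post (Q0 E) f (s E)"
        using dsheaf_comp_hom[OF Q0[OF E] \<theta>(1)[OF E] pbm(1)] pbm(2) \<theta>(2)[OF E]
          prec_comp[OF Q0[OF E] pbd[OF E] pbd[OF F] \<theta>(1)[OF E] pbm(1) pbc[OF F]]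
          post_prec[OF Q0[OF E] pbd[OF E] \<theta>(1)[OF E] f pbc[OF E]] by simp
      show "dsheaf_comp S (Q0 E) (\<theta> F) (onHom B.Q E F f) \<in> dsheaf_hom R S (Q0 E) (p_bullet S F) \<and>
          prec (Q0 E) (l F) (dsheaf_comp S (Q0 E) (\<theta> F) (onHom B.Q E F f)) = post (Q0 E) f (s E)"
        using dsheaf_comp_hom[OF Q0[OF E] Qf(1) \<theta>(1)[OF F]] \<theta>(2)[OF F] Qf(2)
          prec_comp[OF Q0[OF E] Q0[OF F] pbd[OF F] Qf(1) \<theta>(1)[OF F] pbc[OF F]] by simp
    qed
  qed
  then show ?thesis
    using adj colim equivalence eps by (intro exI[of _ B.L] exI[of _ B.Q] exI[of _ B.\<eta>] exI[of _ B.\<epsilon>] exI[of _ r] exI[of _ \<theta>])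
      (simp add: B.onObj Sheaves_simps)
qed

end

theorem theorem11p6:
  fixes R :: "('r, 's) ring_scheme"
    and S :: "('o, 'm, 'g, 'x) diagram"
  assumes "ring R"
    and "cofiltered (idx S)"
    and "\<And>i. i \<in> Obj (idx S) \<Longrightarrow> finite_discrete_gspace (lvl S i)"
    and "surjective_equivariant_diagram S"
    and "universe_for S TYPE('u)"
  shows "\<exists>(L :: (('o, 'm, 'g, 'x, 'r, 'u) dsheaf, 'o \<Rightarrow> 'u \<Rightarrow> 'u,
                 ('o \<Rightarrow> 'g, 'o \<Rightarrow> 'x, 'r, 'u) sheaf, 'u \<Rightarrow> 'u) fctr) Q \<eta> \<epsilon> \<iota> \<theta>.
    adjunction (DSheaves R S) (Sheaves R (lim_gspace S)) L Q \<eta> \<epsilon> \<and>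
    is_colim_functor R S L \<iota> \<and>
    is_p_bullet_functor R S Q \<theta> \<and>
    (\<forall>E\<in>Obj (Sheaves R (lim_gspace S)).
       iso_in (Sheaves R (lim_gspace S)) (onObj L (onObj Q E)) E (\<epsilon> E)) \<and>
    adjoint_equivalence
      (full_subcategory (DSheaves R S) (adjoint_structure_isos R S)) (Sheaves R (lim_gspace S))
      L Q \<eta> \<epsilon>"
proof -
  interpret system R S
    using assms(1-4) by (intro system.intro)
  obtain U :: "('o \<times> ('o \<Rightarrow> 'x)) \<times> (('o \<Rightarrow> 'x) \<Rightarrow> 'u) \<Rightarrow> 'u" where "inj U"
    using assms(5) unfolding universe_for_def lepoll_def by blast
  then show ?thesis by (rule colim_p_bullet_adjunction)
qed

end
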